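(* Let $\|\cdot\|$ be an admissible norm on $\mathbb{R}^3$ and let $f:M\to(\mathbb{R}^3,\|\cdot\|)$ be a topologically closed immersed surface whose Minkowski Gaussian curvature is null (identically zero). Then $M$ is a cylinder or a plane.
   Context: A norm $\|\cdot\|$ on $\mathbb{R}^3$ is admissible if its unit sphere $\partial B=\{x\in\mathbb{R}^3:\|x\|=1\}$ has strictly positive Gaussian curvature in the usual Euclidean geometry of $\mathbb{R}^3$. A non-zero vector $v$ is Birkhoff orthogonal to a plane $P$ (through the origin), written $v\dashv_B P$, if $\|v+tw\|\ge\|v\|$ for all $t\in\mathbb{R}$, $w\in P$. Surfaces are smooth and orientable, immersions are smooth, and $M$ is identified with its image in $\mathbb{R}^3$, $T_pM$ being regarded as a plane in $\mathbb{R}^3$. The Birkhoff-Gauss map $\eta:M\to\partial B$ is a globally defined smooth map with $\eta(p)\dashv_B T_pM$ for all $p$ (one of the two choices is fixed). Since $T_{\eta(p)}\partial B$ is parallel to $T_pM$, $d\eta_p$ is an endomorphism of $T_pM$; the Minkowski Gaussian curvature is $K(p)=\det(d\eta_p)$. The immersed surface $M$ is topologically closed if it is closed in the topology of $\mathbb{R}^3$ derived from the norm (equivalently, the usual Euclidean topology). A cylinder is an immersed surface $M$ such that for each point $p\in M$ there is a unique line $r(p)\subseteq M$ through $p$, and if $p\ne q$, then the lines $r(p)$ and $r(q)$ are parallel or coincident.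
   Formalization: The surface is assumed connected; "topologically closed" means the immersion is a closed map (for embedded surfaces: M is a closed set); lines in M are lines of the immersed surface, not of its image. Without this, disconnected or self-intersecting surfaces are counterexamples. *)

theory Defs
  imports "HOL-Analysis.Analysis"
begin

section \<open>Smooth surfaces and immersions\<close>

text \<open>The definition of \<open>C\<^sup>k\<close> is meant for open \<open>S\<close>; the directional derivatives
  \<open>x \<mapsto> Df(x) v\<close>, for all fixed \<open>v\<close>, play the role of the partial derivatives.\<close>

fun Ck_on :: "nat \<Rightarrow> 'a::euclidean_space set \<Rightarrow> ('a \<Rightarrow> 'b::real_normed_vector) \<Rightarrow> bool" where
  "Ck_on 0 S f \<longleftrightarrow> continuous_on S f"
| "Ck_on (Suc k) S f \<longleftrightarrow> (\<forall>x\<in>S. f differentiable (at x)) \<and>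
     (\<forall>v. Ck_on k S (\<lambda>x. frechet_derivative f (at x) v))"

definition smooth_on :: "'a::euclidean_space set \<Rightarrow> ('a \<Rightarrow> 'b::real_normed_vector) \<Rightarrow> bool" where
  "smooth_on S f \<longleftrightarrow> (\<forall>k. Ck_on k S f)"

text \<open>A surface is a subset \<open>M\<close> of a Hausdorff second countable space together with an atlas \<open>A\<close>
  of local parametrizations (inverse charts) \<open>(V, \<psi>)\<close>, each a homeomorphism of an open set \<open>V\<close> of
  the plane onto a relatively open subset of \<open>M\<close>. The atlas need not be maximal.\<close>

type_synonym 'm atlas = "((real^2) set \<times> (real^2 \<Rightarrow> 'm)) set"

definition smooth_surface :: "'m::{t2_space,second_countable_topology} set \<Rightarrow> 'm atlas \<Rightarrow> bool" where
  "smooth_surface M A \<longleftrightarrow>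
     (\<forall>(V, \<psi>)\<in>A. open V \<and> openin (top_of_set M) (\<psi> ` V) \<and> (\<exists>g. homeomorphism V (\<psi> ` V) \<psi> g)) \<and>
     M = (\<Union>(V, \<psi>)\<in>A. \<psi> ` V) \<and>
     (\<forall>(V, \<psi>)\<in>A. \<forall>(V', \<psi>')\<in>A.
        smooth_on (V \<inter> \<psi> -` (\<psi>' ` V')) (inv_into V' \<psi>' \<circ> \<psi>))"

definition smooth_map :: "'m atlas \<Rightarrow> ('m \<Rightarrow> real^3) \<Rightarrow> bool" where
  "smooth_map A f \<longleftrightarrow> (\<forall>(V, \<psi>)\<in>A. smooth_on V (f \<circ> \<psi>))"

definition immersion :: "'m atlas \<Rightarrow> ('m \<Rightarrow> real^3) \<Rightarrow> bool" where
  "immersion A f \<longleftrightarrow> smooth_map A f \<and>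
     (\<forall>(V, \<psi>)\<in>A. \<forall>x\<in>V. inj (frechet_derivative (f \<circ> \<psi>) (at x)))"

text \<open>The tangent plane \<open>T\<^sub>pM\<close>, regarded as a plane through the origin of \<open>\<real>\<^sup>3\<close>.\<close>

definition tangent_plane :: "'m atlas \<Rightarrow> ('m \<Rightarrow> real^3) \<Rightarrow> 'm \<Rightarrow> (real^3) set" where
  "tangent_plane A f p =
     {frechet_derivative (f \<circ> \<psi>) (at x) u | V \<psi> x u. (V, \<psi>) \<in> A \<and> x \<in> V \<and> \<psi> x = p}"

text \<open>The differential at \<open>p\<close> of a map \<open>\<nu>\<close> defined on \<open>M\<close>, as a map on \<open>T\<^sub>pM \<subseteq> \<real>\<^sup>3\<close>: a vector
  \<open>w = D(f \<circ> \<psi>) u\<close> tangent to \<open>M\<close> is sent to \<open>D(\<nu> \<circ> \<psi>) u\<close>. By the chain rule and injectivity of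
  \<open>D(f \<circ> \<psi>)\<close> the result does not depend on \<open>\<psi>\<close>. The value is meaningful for \<open>w \<in> T\<^sub>pM\<close> only.\<close>

definition surface_differential ::
    "'m atlas \<Rightarrow> ('m \<Rightarrow> real^3) \<Rightarrow> ('m \<Rightarrow> real^3) \<Rightarrow> 'm \<Rightarrow> real^3 \<Rightarrow> real^3" where
  "surface_differential A f \<nu> p w =
     (THE z. \<exists>V \<psi> x u. (V, \<psi>) \<in> A \<and> x \<in> V \<and> \<psi> x = p \<and>
        w = frechet_derivative (f \<circ> \<psi>) (at x) u \<and>
        z = frechet_derivative (\<nu> \<circ> \<psi>) (at x) u)"

text \<open>The determinant of an endomorphism \<open>L\<close> of a plane \<open>T\<close>: the determinant of the matrix \<open>C\<close>
  of \<open>L\<close> in a basis of \<open>T\<close>, the basis being given by an isomorphism \<open>B\<close> from \<open>\<real>\<^sup>2\<close> to \<open>T\<close>.\<close>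

definition plane_det :: "(real^3) set \<Rightarrow> (real^3 \<Rightarrow> real^3) \<Rightarrow> real" where
  "plane_det T L =
     (THE d. \<exists>(B :: real^2 \<Rightarrow> real^3) (C :: real^2^2). linear B \<and> inj B \<and> range B = T \<and>
        (\<forall>x. L (B x) = B (C *v x)) \<and> d = det C)"

lemma plane_det_eq:
  fixes B :: "real^2 \<Rightarrow> real^3" and C :: "real^2^2"
  assumes B: "linear B" "inj B" and C: "\<And>x. L (B x) = B (C *v x)"
  shows "plane_det (range B) L = det C"
  unfolding plane_det_def
proof (rule the_equality)
  show "\<exists>(B' :: real^2 \<Rightarrow> real^3) (C' :: real^2^2). linear B' \<and> inj B' \<and> range B' = range B \<and>
        (\<forall>x. L (B' x) = B' (C' *v x)) \<and> det C = det C'"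
    using assms by blast
next
  fix d
  assume "\<exists>(B' :: real^2 \<Rightarrow> real^3) (C' :: real^2^2). linear B' \<and> inj B' \<and> range B' = range B \<and>
        (\<forall>x. L (B' x) = B' (C' *v x)) \<and> d = det C'"
  then obtain B' :: "real^2 \<Rightarrow> real^3" and C' :: "real^2^2" where
    B': "linear B'" "inj B'" "range B' = range B" and C': "\<And>x. L (B' x) = B' (C' *v x)"
    and d: "d = det C'" by blast
  obtain g where g: "linear g" "g \<circ> B = id"
    using linear_injective_left_inverse[OF B] by blast
  have gB: "g (B x) = x" for x using g(2) by (metis comp_apply id_apply)
  have Bg: "B (g (B' x)) = B' x" for x
    by (metis B'(3) gB rangeE rangeI)
  define P where "P = matrix (g \<circ> B')"
  have lin: "linear (g \<circ> B')" using B'(1) g(1) by (rule linear_compose)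
  have P: "P *v x = g (B' x)" for x
    unfolding P_def using matrix_vector_mul(2)[OF lin] by (metis comp_apply)
  have injP: "inj (g \<circ> B')"
    by (rule injI) (metis comp_apply Bg B'(2) injD)
  have "P *v (C' *v x) = C *v (P *v x)" for x
    by (metis P C' C Bg gB)
  then have "P ** C' = C ** P"
    by (simp add: matrix_eq matrix_vector_mul_assoc)
  then have "det P * det C' = det C * det P" by (metis det_mul)
  moreover have "det P \<noteq> 0"
    unfolding P_def using injP det_nz_iff_inj[OF lin] by blast
  ultimately show "d = det C" using d by simp
qed

section \<open>Admissible norms and the Birkhoff-Gauss map\<close>

definition is_norm :: "(real^3 \<Rightarrow> real) \<Rightarrow> bool" where
  "is_norm N \<longleftrightarrow> (\<forall>x. 0 \<le> N x) \<and> (\<forall>x. N x = 0 \<longleftrightarrow> x = 0) \<and>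
     (\<forall>c x. N (c *\<^sub>R x) = \<bar>c\<bar> * N x) \<and> (\<forall>x y. N (x + y) \<le> N x + N y)"

definition unit_sphere :: "(real^3 \<Rightarrow> real) \<Rightarrow> (real^3) set" where
  "unit_sphere N = {x. N x = 1}"

text \<open>The Euclidean Gaussian curvature of a surface is the determinant of the differential of a
  Euclidean unit normal field \<open>n\<close>; it is independent of the choice of the sign of \<open>n\<close>.\<close>

definition euclidean_gauss_map ::
    "'m set \<Rightarrow> 'm atlas \<Rightarrow> ('m \<Rightarrow> real^3) \<Rightarrow> ('m \<Rightarrow> real^3) \<Rightarrow> bool" where
  "euclidean_gauss_map M A f n \<longleftrightarrow> smooth_map A n \<and>
     (\<forall>p\<in>M. norm (n p) = 1 \<and> (\<forall>w\<in>tangent_plane A f p. n p \<bullet> w = 0))"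

text \<open>That the Gaussian curvature of the unit sphere makes sense includes that the sphere is a
  smooth surface of \<open>\<real>\<^sup>3\<close>, i.e. has an atlas (with its subspace topology) making the inclusion
  an immersion. The smooth structure so obtained is unique.\<close>

definition admissible_norm :: "(real^3 \<Rightarrow> real) \<Rightarrow> bool" where
  "admissible_norm N \<longleftrightarrow> is_norm N \<and>
     (\<exists>A n. smooth_surface (unit_sphere N) A \<and> immersion A (\<lambda>x. x) \<and>
        euclidean_gauss_map (unit_sphere N) A (\<lambda>x. x) n \<and>
        (\<forall>p\<in>unit_sphere N.
           plane_det (tangent_plane A (\<lambda>x. x) p) (surface_differential A (\<lambda>x. x) n p) > 0))"

definition birkhoff_orthogonal :: "(real^3 \<Rightarrow> real) \<Rightarrow> real^3 \<Rightarrow> (real^3) set \<Rightarrow> bool" where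
  "birkhoff_orthogonal N v P \<longleftrightarrow> v \<noteq> 0 \<and> (\<forall>t. \<forall>w\<in>P. N (v + t *\<^sub>R w) \<ge> N v)"

text \<open>Since the unit sphere is an embedded surface, smoothness of \<open>\<eta>\<close> as a map into the sphere is
  smoothness as a map into \<open>\<real>\<^sup>3\<close>. The vector \<open>\<eta> p\<close> is transversal to \<open>T\<^sub>pM\<close>, so the existence of
  a global \<open>\<eta>\<close> entails that \<open>M\<close> is orientable.\<close>

definition birkhoff_gauss_map ::
    "(real^3 \<Rightarrow> real) \<Rightarrow> 'm set \<Rightarrow> 'm atlas \<Rightarrow> ('m \<Rightarrow> real^3) \<Rightarrow> ('m \<Rightarrow> real^3) \<Rightarrow> bool" where
  "birkhoff_gauss_map N M A f \<eta> \<longleftrightarrow> smooth_map A \<eta> \<and>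
     (\<forall>p\<in>M. \<eta> p \<in> unit_sphere N \<and> birkhoff_orthogonal N (\<eta> p) (tangent_plane A f p))"

definition minkowski_gauss_curvature ::
    "'m atlas \<Rightarrow> ('m \<Rightarrow> real^3) \<Rightarrow> ('m \<Rightarrow> real^3) \<Rightarrow> 'm \<Rightarrow> real" where
  "minkowski_gauss_curvature A f \<eta> p =
     plane_det (tangent_plane A f p) (surface_differential A f \<eta> p)"

section \<open>Closed immersed surfaces, cylinders and planes\<close>

text \<open>\<open>M\<close> is identified with its image, so that the closed subsets of \<open>M\<close>, and \<open>M\<close> itself, are
  to be closed in \<open>\<real>\<^sup>3\<close>: the map \<open>f\<close> is a closed map. For surfaces without self-intersections,
  embedded in \<open>\<real>\<^sup>3\<close>, this says just that the image is a closed set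
  (see \<open>topologically_closed_embedding\<close> below).

  For an immersion that is not an embedding, closedness of the set \<open>f ` M\<close> alone would say nothing
  about \<open>M\<close> near its ends, because an end of one sheet can be hidden inside another sheet. Take the
  six planes \<open>x, y, z \<in> {0, 1}\<close> in Euclidean space, cover them by open half planes, and
  join these half planes to one another by smooth bent strips of the form (plane curve)
  \<open>\<times>\<close> (open unit interval) whose two edges run inside two of the parallel planes. This gives a
  connected orientable immersed flat surface with closed image which is neither a cylinder nor
  a plane.\<close>

definition topologically_closed :: "'m::topological_space set \<Rightarrow> ('m \<Rightarrow> real^3) \<Rightarrow> bool" where
  "topologically_closed M f \<longleftrightarrow> closed_map (top_of_set M) euclidean f"

lemma topologically_closed_imp_closed_image:
  assumes "topologically_closed M f"
  shows "closed (f ` M)"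
  using assms unfolding topologically_closed_def closed_map_def by auto

lemma topologically_closed_embedding:
  assumes "homeomorphism M (f ` M) f g"
  shows "topologically_closed M f \<longleftrightarrow> closed (f ` M)"
proof
  assume cl: "closed (f ` M)"
  show "topologically_closed M f"
    unfolding topologically_closed_def closed_map_def
  proof (intro allI impI)
    fix U assume U: "closedin (top_of_set M) U"
    then have "closedin (top_of_set (f ` M)) (f ` U)"
      using homeomorphism_imp_closed_map[OF assms] by blast
    then show "closedin euclidean (f ` U)"
      using cl by (simp add: closedin_closed_trans)
  qed
qed (rule topologically_closed_imp_closed_image)

text \<open>A straight line contained in the immersed surface: a subset \<open>L\<close> of \<open>M\<close> that \<open>f\<close> identifies
  with a line of \<open>\<real>\<^sup>3\<close>. For a surface \<open>M \<subseteq> \<real>\<^sup>3\<close> with \<open>f\<close> the inclusion these are the lines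
  \<open>L \<subseteq> M\<close>. Lines in the image set that are pieced together from several sheets are not lines in
  the surface.\<close>

definition line_in_surface :: "'m::topological_space set \<Rightarrow> ('m \<Rightarrow> real^3) \<Rightarrow> 'm set \<Rightarrow> bool" where
  "line_in_surface M f L \<longleftrightarrow> L \<subseteq> M \<and> affine (f ` L) \<and> aff_dim (f ` L) = 1 \<and>
     (\<exists>g. homeomorphism L (f ` L) f g)"

text \<open>Coincident lines are parallel in the sense of \<^const>\<open>affine_parallel\<close>.\<close>

definition is_cylinder :: "'m::topological_space set \<Rightarrow> ('m \<Rightarrow> real^3) \<Rightarrow> bool" where
  "is_cylinder M f \<longleftrightarrow>
     (\<exists>r. (\<forall>p\<in>M. line_in_surface M f (r p) \<and> p \<in> r p \<and>
             (\<forall>L. line_in_surface M f L \<and> p \<in> L \<longrightarrow> L = r p)) \<and>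
          (\<forall>p\<in>M. \<forall>q\<in>M. p \<noteq> q \<longrightarrow> affine_parallel (f ` r p) (f ` r q)))"

definition is_plane :: "'m set \<Rightarrow> ('m \<Rightarrow> real^3) \<Rightarrow> bool" where
  "is_plane M f \<longleftrightarrow> affine (f ` M) \<and> aff_dim (f ` M) = 2"

end

theory Submission
  imports Defs
begin

text \<open>The Minkowski curvature is reduced to the Euclidean one. Birkhoff orthogonality of \<open>\<eta> p\<close> to
  the tangent plane at \<open>p\<close> says that this plane is parallel to the tangent plane of the unit sphere
  at \<open>\<eta> p\<close>. If \<open>\<nu>\<close> is the Euclidean normal of the unit sphere, then \<open>n = \<nu> \<circ> \<eta>\<close> is therefore a
  Euclidean unit normal of the surface. As \<open>\<nu>\<close> is differentiable, the differential of \<open>n\<close> vanishes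
  wherever that of \<open>\<eta>\<close> does, so where the determinant of \<open>d\<eta>\<close> is zero the Gauss map \<open>n\<close> has rank
  at most one: the surface is flat in the Euclidean sense (\<open>flat_chart_of_birkhoff_gauss_map\<close>).
  It remains to prove the classical theorem that a complete flat surface is a cylinder or a plane.
  Completeness enters as properness of the immersion: a sequence of points whose images converge
  has a convergent subsequence (\<open>closed_map_proper_sequences\<close>).
  
  Let \<open>W\<close> be the set of the points where \<open>dn \<noteq> 0\<close>. Near such a point \<open>n\<close> is a function \<open>\<nu>0\<close> of one real
  parameter \<open>s\<close>, the tangent planes form a family \<open>y \<bullet> \<nu>0 s = \<kappa>0 s\<close>, and differentiation in \<open>s\<close>
  gives a second equation \<open>y \<bullet> \<nu>1 s = \<kappa>1 s\<close>, so that \<open>s\<close> is constant along straight segments.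
  Differentiating once more gives an identity that passes to limits and shows that \<open>dn\<close> cannot
  die out along such a segment; with properness, the segment extends to a complete line in \<open>W\<close>
  (\<open>W_line\<close>). The lines pass to the closure \<open>C\<close> of \<open>W\<close>. There they are unique, because neighbouring
  lines carry different values of \<open>n\<close> and hence cannot cross (\<open>C_line_unique\<close>). Off \<open>C\<close> the surface
  is locally planar.
  
  The lines are all parallel. First, on \<open>C\<close> the direction of the line has derivative zero
  (\<open>ruling_variation\<close>): the first-order displacement between two neighbouring lines is an affine
  function of the position on the line; it is tangent to the surface, which has the same tangent
  plane along the whole line, and it has no zero transversally to the line, since the lines do not
  cross. An affine function on the real line without zeros is constant. Second, a line can be
  translated through a planar piece: were the translate stopped by \<open>C\<close>, a second line would cross
  the first one in the plane (\<open>planar_fan\<close>). A continuation argument along curves, which is needed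
  because the curve may meet the boundary of \<open>C\<close> in a complicated set, then shows that the direction
  is constant (\<open>ruling_direction_near\<close>). Finally, if some point lies on a further line of the
  surface, the two directions sweep out a plane, which is open and closed in the surface
  (\<open>plane_of_crossing_lines\<close>); otherwise the parallel lines are the unique ones.
  
  The surface may have self-intersections. All statements about lines are hence made in the surface and
  not in space: a segment is a curve in the surface that the immersion maps affinely.\<close>


section \<open>Properly immersed surfaces and flat segments\<close>

text \<open>\<open>G\<close> parametrises a neighbourhood of \<open>p\<close> by the projection \<open>P\<close> along the normal direction \<open>\<nu>\<close>. With
  a Lipschitz bound in place of derivatives, the arguments about lines below need
  continuity only.\<close>

definition graph_chart ::
    "'m::topological_space set \<Rightarrow> ('m \<Rightarrow> real^3) \<Rightarrow> 'm \<Rightarrow> real^3 \<Rightarrow> (real^3 \<Rightarrow> real^2) \<Rightarrow> real \<Rightarrow> (real^2 \<Rightarrow> 'm) \<Rightarrow> real \<Rightarrow> bool" where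
  "graph_chart M f p \<nu> P r G K \<longleftrightarrow>
     linear P \<and> (\<forall>y. P y = 0 \<longleftrightarrow> (\<exists>c. y = c *\<^sub>R \<nu>)) \<and> 0 < r \<and>
     openin (top_of_set M) (G ` ball (P (f p)) r) \<and> G (P (f p)) = p \<and>
     continuous_on (ball (P (f p)) r) G \<and> (\<forall>z\<in>ball (P (f p)) r. P (f (G z)) = z) \<and>
     (\<forall>z\<in>ball (P (f p)) r. \<forall>z'\<in>ball (P (f p)) r. norm (f (G z) - f (G z')) \<le> K * norm (z - z'))"

lemma closedin_agreement:
  fixes g h :: "'a::topological_space \<Rightarrow> 'b::t2_space"
  assumes "continuous_on S g" "continuous_on S h"
  shows "closedin (top_of_set S) {t\<in>S. g t = h t}"
proof -
  have "closedin (top_of_set S) (S \<inter> (\<lambda>t. (g t, h t)) -` {y. \<exists>x. y = (x, x)})"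
    by (intro continuous_closedin_preimage continuous_on_Pair assms closed_diagonal)
  moreover have "S \<inter> (\<lambda>t. (g t, h t)) -` {y. \<exists>x. y = (x, x)} = {t\<in>S. g t = h t}" by auto
  ultimately show ?thesis by simp
qed

lemma eventually_in_openin:
  assumes "openin (top_of_set M) U" "p \<in> U" "\<And>i. X i \<in> M" "X \<longlonglongrightarrow> p"
  shows "\<forall>\<^sub>F i in sequentially. X i \<in> U"
proof -
  obtain T where T: "open T" "U = M \<inter> T" using assms(1) by (auto simp: openin_open)
  then have "\<forall>\<^sub>F i in sequentially. X i \<in> T"
    using assms(2,4) topological_tendstoD by fastforce
  then show ?thesis by eventually_elim (use T assms(3) in auto)
qed

text \<open>The field \<open>n\<close> is a unit normal: the last assumption is tangency of the plane orthogonal to \<open>n p\<close> in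
  first order, expressed without reference to derivatives.\<close>

locale proper_surface =
  fixes M :: "'m::{t2_space,second_countable_topology} set"
    and f n :: "'m \<Rightarrow> real^3"
  assumes continuous_f: "continuous_on M f"
    and continuous_n: "continuous_on M n"
    and norm_n: "p \<in> M \<Longrightarrow> norm (n p) = 1"
    and proper: "(\<And>i::nat. X i \<in> M) \<Longrightarrow> (\<lambda>i. f (X i)) \<longlonglongrightarrow> y \<Longrightarrow>
        \<exists>l\<in>M. \<exists>r. strict_mono r \<and> (X \<circ> r) \<longlonglongrightarrow> l"
    and local_graph: "p \<in> M \<Longrightarrow> \<exists>P r G K. graph_chart M f p (n p) P r G K"
    and tangency: "p \<in> M \<Longrightarrow> 0 < \<epsilon> \<Longrightarrow> \<exists>U. openin (top_of_set M) U \<and> p \<in> U \<and>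
        (\<forall>y\<in>U. \<bar>n p \<bullet> (f y - f p)\<bar> \<le> \<epsilon> * norm (f y - f p))"
begin

lemma f_tendsto:
  assumes "\<And>i. X i \<in> M" "p \<in> M" "X \<longlonglongrightarrow> p" shows "(\<lambda>i. f (X i)) \<longlonglongrightarrow> f p"
  using continuous_on_tendsto_compose[OF continuous_f assms(3,2)] assms(1) by simp

lemma n_tendsto:
  assumes "\<And>i. X i \<in> M" "p \<in> M" "X \<longlonglongrightarrow> p" shows "(\<lambda>i. n (X i)) \<longlonglongrightarrow> n p"
  using continuous_on_tendsto_compose[OF continuous_n assms(3,2)] assms(1) by simp

lemma graph_chartD:
  assumes "graph_chart M f p (n p) P r G K"
  shows "linear P" "0 < r" "openin (top_of_set M) (G ` ball (P (f p)) r)"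
    "p \<in> G ` ball (P (f p)) r" "G (P (f p)) = p"
    "continuous_on (ball (P (f p)) r) G" "\<And>z. z \<in> ball (P (f p)) r \<Longrightarrow> P (f (G z)) = z"
    "\<And>z. z \<in> ball (P (f p)) r \<Longrightarrow> G z \<in> M"
    "\<And>y. y \<in> G ` ball (P (f p)) r \<Longrightarrow> G (P (f y)) = y"
    "\<And>y. y \<in> G ` ball (P (f p)) r \<Longrightarrow> P (f y) \<in> ball (P (f p)) r"
    "\<And>c. P (c *\<^sub>R n p) = 0" "\<And>y. P y = 0 \<Longrightarrow> \<exists>c. y = c *\<^sub>R n p"
    "\<And>z z'. z \<in> ball (P (f p)) r \<Longrightarrow> z' \<in> ball (P (f p)) r \<Longrightarrow>
       norm (f (G z) - f (G z')) \<le> K * norm (z - z')"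
proof -
  note * = assms[unfolded graph_chart_def]
  show "linear P" "0 < r" and o: "openin (top_of_set M) (G ` ball (P (f p)) r)"
    "G (P (f p)) = p"
    "continuous_on (ball (P (f p)) r) G"
    "\<And>c. P (c *\<^sub>R n p) = 0" "\<And>y. P y = 0 \<Longrightarrow> \<exists>c. y = c *\<^sub>R n p"
     and z: "\<And>z. z \<in> ball (P (f p)) r \<Longrightarrow> P (f (G z)) = z"
    using * by blast+
  show "p \<in> G ` ball (P (f p)) r" using * by (metis centre_in_ball image_eqI)
  show "\<And>z. z \<in> ball (P (f p)) r \<Longrightarrow> G z \<in> M" using o by (meson image_subset_iff openin_imp_subset)
  show "\<And>y. y \<in> G ` ball (P (f p)) r \<Longrightarrow> G (P (f y)) = y" using z by auto
  show "\<And>y. y \<in> G ` ball (P (f p)) r \<Longrightarrow> P (f y) \<in> ball (P (f p)) r" using z by auto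
  show "\<And>z z'. z \<in> ball (P (f p)) r \<Longrightarrow> z' \<in> ball (P (f p)) r \<Longrightarrow>
       norm (f (G z) - f (G z')) \<le> K * norm (z - z')" using * by blast
qed

text \<open>The points of a connected set on which a curve agrees with the local graph over its own projection
  form an open and closed subset; so a curve that starts on a sheet and whose projection stays in the
  disc stays on that sheet, even if other sheets of the surface pass over the disc.\<close>

lemma graph_chart_lift:
  assumes gc: "graph_chart M f p (n p) P r G K"
    and "connected S" and cg: "continuous_on S g" and gM: "g ` S \<subseteq> M"
    and ball: "\<And>t. t \<in> S \<Longrightarrow> P (f (g t)) \<in> ball (P (f p)) r"
    and t0: "t0 \<in> S" "g t0 \<in> G ` ball (P (f p)) r" and t: "t \<in> S"
  shows "g t = G (P (f (g t)))"
proof -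
  note gc' = graph_chartD[OF gc]
  let ?B = "ball (P (f p)) r"
  have lP: "continuous_on UNIV P" using gc'(1) by (simp add: linear_continuous_on linear_linear)
  have c: "continuous_on S (\<lambda>t. P (f (g t)))"
    by (rule continuous_on_compose2[OF lP continuous_on_compose2[OF continuous_f cg gM]]) auto
  have c': "continuous_on S (\<lambda>t. G (P (f (g t))))"
    by (rule continuous_on_compose2[OF gc'(6) c]) (use ball in auto)
  have cl: "closedin (top_of_set S) {t\<in>S. g t = G (P (f (g t)))}"
    by (rule closedin_agreement[OF cg c'])
  have "openin (top_of_set S) (S \<inter> g -` (G ` ?B))"
    by (rule continuous_openin_preimage[OF cg _ gc'(3)]) (use gM in auto)
  moreover have "S \<inter> g -` (G ` ?B) = {t\<in>S. g t = G (P (f (g t)))}"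
  proof (intro equalityI subsetI)
    fix t assume "t \<in> S \<inter> g -` (G ` ?B)"
    then show "t \<in> {t\<in>S. g t = G (P (f (g t)))}" using gc'(9)[of "g t"] by simp
  next
    fix t assume "t \<in> {t\<in>S. g t = G (P (f (g t)))}"
    then have t: "t \<in> S" "G (P (f (g t))) = g t" by simp_all
    then have "G (P (f (g t))) \<in> G ` ?B" using ball by blast
    then show "t \<in> S \<inter> g -` (G ` ?B)" using t by simp
  qed
  ultimately have op: "openin (top_of_set S) {t\<in>S. g t = G (P (f (g t)))}" by simp
  have "t0 \<in> {t\<in>S. g t = G (P (f (g t)))}" using t0(1) gc'(9)[OF t0(2)] by simp
  moreover have "{t\<in>S. g t = G (P (f (g t)))} = {} \<or> {t\<in>S. g t = G (P (f (g t)))} = S"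
    using \<open>connected S\<close>[unfolded connected_clopen] op cl by meson
  ultimately show ?thesis using t by blast
qed

text \<open>Near \<open>p\<close> the surface is a graph over its tangent plane. Lines whose images cross, at least when
  viewed along the normal, are shown to meet in the surface in this way.\<close>

lemma locally_injective_mod_normal:
  assumes p: "p \<in> M" and X: "\<And>i. X i \<in> M" "X \<longlonglongrightarrow> p" and Y: "\<And>i. Y i \<in> M" "Y \<longlonglongrightarrow> p"
  shows "\<forall>\<^sub>F i in sequentially. (\<exists>c. f (X i) - f (Y i) = c *\<^sub>R n p) \<longrightarrow> X i = Y i"
proof -
  obtain P r G K where "graph_chart M f p (n p) P r G K" using local_graph[OF p] by blast
  note gc = graph_chartD[OF this]
  have "\<forall>\<^sub>F i in sequentially. X i \<in> G ` ball (P (f p)) r"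
    by (rule eventually_in_openin[OF gc(3,4) X])
  moreover have "\<forall>\<^sub>F i in sequentially. Y i \<in> G ` ball (P (f p)) r"
    by (rule eventually_in_openin[OF gc(3,4) Y])
  ultimately show ?thesis
  proof eventually_elim
    case (elim i)
    show ?case
    proof
      assume "\<exists>c. f (X i) - f (Y i) = c *\<^sub>R n p"
      then obtain c where "f (X i) - f (Y i) = c *\<^sub>R n p" ..
      then have "P (f (X i) - f (Y i)) = 0" by (metis gc(11))
      then have "P (f (X i)) = P (f (Y i))" by (simp add: linear_diff[OF gc(1)])
      then show "X i = Y i" by (metis gc(9) elim(1,2))
    qed
  qed
qed

lemma lift_unique:
  fixes g h :: "'a::topological_space \<Rightarrow> 'm"
  assumes S: "connected S" and g: "continuous_on S g" "g ` S \<subseteq> M"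
    and h: "continuous_on S h" "h ` S \<subseteq> M"
    and eq: "\<And>t. t \<in> S \<Longrightarrow> f (g t) = f (h t)" and t0: "t0 \<in> S" "g t0 = h t0" and t: "t \<in> S"
  shows "g t = h t"
proof -
  let ?A = "{t\<in>S. g t = h t}"
  have cl: "closedin (top_of_set S) ?A" by (rule closedin_agreement[OF g(1) h(1)])
  have op: "openin (top_of_set S) ?A"
  proof (subst openin_subopen, intro ballI)
    fix s assume s: "s \<in> ?A"
    then have "g s \<in> M" using g(2) by auto
    then obtain P r G K where gcc: "graph_chart M f (g s) (n (g s)) P r G K"
      using local_graph by metis
    note gc = graph_chartD[OF gcc]
    let ?U = "G ` ball (P (f (g s))) r"
    let ?T = "(S \<inter> g -` ?U) \<inter> (S \<inter> h -` ?U)"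
    have gS: "g \<in> S \<rightarrow> M" "h \<in> S \<rightarrow> M" using g(2) h(2) by auto
    have "openin (top_of_set S) ?T"
      by (rule openin_Int[OF continuous_openin_preimage[OF g(1) gS(1) gc(3)]
            continuous_openin_preimage[OF h(1) gS(2) gc(3)]])
    moreover have "s \<in> ?T" using s gc(4) by simp
    moreover have "?T \<subseteq> ?A"
    proof
      fix u assume u: "u \<in> ?T"
      then have "g u \<in> ?U" "h u \<in> ?U" "u \<in> S" by auto
      then have "G (P (f (g u))) = g u" "G (P (f (h u))) = h u" using gc(9) by blast+
      then have "g u = h u" using eq[OF \<open>u \<in> S\<close>] by metis
      then show "u \<in> ?A" using \<open>u \<in> S\<close> by blast
    qed
    ultimately show "\<exists>T. openin (top_of_set S) T \<and> s \<in> T \<and> T \<subseteq> ?A" by blast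
  qed
  have "?A = {} \<or> ?A = S" using S[unfolded connected_clopen] cl op by meson
  moreover have "t0 \<in> ?A" using t0 by simp
  ultimately show ?thesis using t by blast
qed

text \<open>A curve in the surface over the segment from \<open>f x\<close> to \<open>f x + w\<close>, along which the normal is
  constant. Constancy of \<open>n\<close> is what distinguishes rulings from arbitrary straight segments.\<close>

definition nlift :: "(real \<Rightarrow> 'm) \<Rightarrow> 'm \<Rightarrow> real^3 \<Rightarrow> bool" where
  "nlift g x w \<longleftrightarrow> continuous_on {0..1} g \<and> g 0 = x \<and>
     (\<forall>t\<in>{0..1}. g t \<in> M \<and> f (g t) = f x + t *\<^sub>R w \<and> n (g t) = n x)"

definition nseg :: "'m \<Rightarrow> real^3 \<Rightarrow> bool" where
  "nseg x w \<longleftrightarrow> (\<exists>g. nlift g x w)"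

text \<open>The endpoint of the segment in direction \<open>w\<close>, the analogue of the exponential map; it is
  meaningful if \<open>nseg x w\<close> holds. Since lifts are unique, the choice is immaterial.\<close>

definition ex :: "'m \<Rightarrow> real^3 \<Rightarrow> 'm" where
  "ex x w = (SOME g. nlift g x w) 1"

text \<open>Lifts of a segment from a given starting point are unique by \<open>lift_unique\<close>.\<close>

lemma nlift_ex:
  assumes "nlift g x w" shows "nseg x w" "ex x w = g 1"
proof -
  show "nseg x w" using assms nseg_def by blast
  define h where "h = (SOME g. nlift g x w)"
  have h: "nlift h x w" unfolding h_def using assms by (rule someI[of "\<lambda>g. nlift g x w"])
  have "h 1 = g 1"
    by (rule lift_unique[of "{0..1::real}" h g 0]) (use h assms in \<open>auto simp: nlift_def\<close>)
  then show "ex x w = g 1" by (simp add: ex_def h_def)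
qed

lemma curve_ex:
  assumes g: "continuous_on {a..b} g"
    and gM: "\<And>t. t \<in> {a..b} \<Longrightarrow> g t \<in> M"
    and fg: "\<And>t. t \<in> {a..b} \<Longrightarrow> f (g t) = c + t *\<^sub>R w"
    and ng: "\<And>t. t \<in> {a..b} \<Longrightarrow> n (g t) = \<nu>"
    and st: "s \<in> {a..b}" "t \<in> {a..b}"
  shows "nseg (g s) ((t - s) *\<^sub>R w)" "ex (g s) ((t - s) *\<^sub>R w) = g t"
proof -
  have in_ab: "s + u * (t - s) \<in> {a..b}" if "u \<in> {0..1}" for u
  proof -
    have "s + u * (t - s) = (1 - u) *\<^sub>R s + u *\<^sub>R t" by (simp add: algebra_simps)
    then show ?thesis using convexD_alt[OF convex_real_interval(5)[of a b] st, of u] that by auto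
  qed
  have "nlift (\<lambda>u. g (s + u * (t - s))) (g s) ((t - s) *\<^sub>R w)"
    unfolding nlift_def
  proof (intro conjI ballI)
    show "continuous_on {0..1} (\<lambda>u. g (s + u * (t - s)))"
      by (rule continuous_on_compose2[OF g]) (use in_ab in \<open>auto intro!: continuous_intros\<close>)
  qed (use in_ab st gM fg ng in \<open>auto simp: algebra_simps\<close>)
  from nlift_ex[OF this] show "nseg (g s) ((t - s) *\<^sub>R w)" "ex (g s) ((t - s) *\<^sub>R w) = g t" by auto
qed

lemma nseg_curve:
  assumes "nseg x w"
  shows "continuous_on {0..1} (\<lambda>t. ex x (t *\<^sub>R w))"
    "\<And>t. t \<in> {0..1} \<Longrightarrow> ex x (t *\<^sub>R w) \<in> M"
    "\<And>t. t \<in> {0..1} \<Longrightarrow> f (ex x (t *\<^sub>R w)) = f x + t *\<^sub>R w"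
    "\<And>t. t \<in> {0..1} \<Longrightarrow> n (ex x (t *\<^sub>R w)) = n x"
    "\<And>t. t \<in> {0..1} \<Longrightarrow> nseg x (t *\<^sub>R w)"
proof -
  obtain g where g: "nlift g x w" using assms nseg_def by blast
  then have g': "continuous_on {0..1} g" "g 0 = x" "\<And>t. t \<in> {0..1} \<Longrightarrow> g t \<in> M"
    "\<And>t. t \<in> {0..1} \<Longrightarrow> f (g t) = f x + t *\<^sub>R w" "\<And>t. t \<in> {0..1} \<Longrightarrow> n (g t) = n x"
    unfolding nlift_def by auto
  have e: "nseg x (t *\<^sub>R w)" "ex x (t *\<^sub>R w) = g t" if "t \<in> {0..1}" for t
    using curve_ex[OF g'(1,3,4,5), of 0 t] that g'(2) by auto
  show "continuous_on {0..1} (\<lambda>t. ex x (t *\<^sub>R w))"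
    using g'(1) by (rule continuous_on_eq) (use e in auto)
  show "\<And>t. t \<in> {0..1} \<Longrightarrow> ex x (t *\<^sub>R w) \<in> M"
    "\<And>t. t \<in> {0..1} \<Longrightarrow> f (ex x (t *\<^sub>R w)) = f x + t *\<^sub>R w"
    "\<And>t. t \<in> {0..1} \<Longrightarrow> n (ex x (t *\<^sub>R w)) = n x"
    "\<And>t. t \<in> {0..1} \<Longrightarrow> nseg x (t *\<^sub>R w)"
    using e g' by auto
qed

lemma nseg_ex:
  assumes "nseg x w" shows "ex x w \<in> M" "f (ex x w) = f x + w" "n (ex x w) = n x"
  using nseg_curve(2-4)[OF assms, of 1] by auto

lemma nseg_0: assumes "x \<in> M" shows "nseg x 0" "ex x 0 = x"
  using nlift_ex[of "\<lambda>_. x" x 0] assms by (auto simp: nlift_def)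

lemma nseg_in_M: "nseg x w \<Longrightarrow> x \<in> M"
  using nlift_def nseg_def by fastforce

lemma nseg_sub:
  assumes "nseg x (b *\<^sub>R w)" "0 \<le> a" "a \<le> b" shows "nseg x (a *\<^sub>R w)"
proof (cases "b = 0")
  case True then show ?thesis using assms by auto
next
  case False
  then show ?thesis using nseg_curve(5)[OF assms(1), of "a / b"] assms by auto
qed

lemma nseg_append:
  assumes 1: "nseg x (a *\<^sub>R w)" and 2: "nseg (ex x (a *\<^sub>R w)) (b *\<^sub>R w)" and ab: "0 \<le> a" "0 \<le> b"
  shows "nseg x ((a + b) *\<^sub>R w)" "ex x ((a + b) *\<^sub>R w) = ex (ex x (a *\<^sub>R w)) (b *\<^sub>R w)"
proof -
  have sc: "continuous_on {0..c} (\<lambda>t. ex y (t *\<^sub>R w))" if "nseg y (c *\<^sub>R w)" "0 \<le> c" for y c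
  proof (cases "c = 0")
    case True then show ?thesis by simp
  next
    case False
    have "continuous_on {0..c} (\<lambda>t. ex y ((t / c) *\<^sub>R (c *\<^sub>R w)))"
      by (rule continuous_on_compose2[OF nseg_curve(1)[OF that(1)]])
        (use False that in \<open>auto intro!: continuous_intros simp: field_simps\<close>)
    then show ?thesis using False by simp
  qed
  define g where "g t = (if t \<le> a then ex x (t *\<^sub>R w) else ex (ex x (a *\<^sub>R w)) ((t - a) *\<^sub>R w))" for t
  have s1: "nseg x (t *\<^sub>R w)" if "0 \<le> t" "t \<le> a" for t using nseg_sub[OF 1] that by auto
  have s2: "nseg (ex x (a *\<^sub>R w)) ((t - a) *\<^sub>R w)" if "a \<le> t" "t \<le> a + b" for t
    using nseg_sub[OF 2] that by auto
  have gM: "g t \<in> M \<and> f (g t) = f x + t *\<^sub>R w \<and> n (g t) = n x" if "t \<in> {0..a+b}" for t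
  proof (cases "t \<le> a")
    case True
    then show ?thesis using nseg_ex[OF s1, of t] that by (simp add: g_def)
  next
    case False
    then show ?thesis using nseg_ex[OF s2, of t] nseg_ex[OF 1] that
      by (simp add: g_def scaleR_diff_left)
  qed
  have "continuous_on ({0..a} \<union> {a..a+b}) g"
    unfolding g_def
  proof (rule continuous_on_cases)
    show "continuous_on {0..a} (\<lambda>t. ex x (t *\<^sub>R w))" by (rule sc[OF 1 ab(1)])
    show "continuous_on {a..a + b} (\<lambda>t. ex (ex x (a *\<^sub>R w)) ((t - a) *\<^sub>R w))"
      by (rule continuous_on_compose2[OF sc[OF 2 ab(2)]]) (auto intro!: continuous_intros)
    show "\<forall>t. t \<in> {0..a} \<and> \<not> t \<le> a \<or> t \<in> {a..a + b} \<and> t \<le> a \<longrightarrow>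
        ex x (t *\<^sub>R w) = ex (ex x (a *\<^sub>R w)) ((t - a) *\<^sub>R w)"
      using nseg_0(2)[OF nseg_ex(1)[OF 1]] by auto
  qed auto
  moreover have "{0..a} \<union> {a..a+b} = {0..a+b}" using ab by auto
  ultimately have cg: "continuous_on {0..a+b} g" by simp
  have g0: "g 0 = x" using ab nseg_0[OF nseg_in_M[OF 1]] by (simp add: g_def)
  have gab: "g (a + b) = ex (ex x (a *\<^sub>R w)) (b *\<^sub>R w)"
    using ab nseg_0(2)[OF nseg_ex(1)[OF 1]] by (auto simp: g_def)
  have z: "0 \<in> {0..a+b}" "a + b \<in> {0..a+b}" using ab by auto
  show "nseg x ((a + b) *\<^sub>R w)" "ex x ((a + b) *\<^sub>R w) = ex (ex x (a *\<^sub>R w)) (b *\<^sub>R w)"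
    using curve_ex[OF cg gM[THEN conjunct1] gM[THEN conjunct2, THEN conjunct1] gM[THEN conjunct2, THEN conjunct2] z] unfolding g0 gab by simp_all
qed

lemma nseg_reverse:
  assumes "nseg x w" shows "nseg (ex x w) (- w)" "ex (ex x w) (- w) = x"
proof -
  have z: "1 \<in> {0..1::real}" "0 \<in> {0..1::real}" by auto
  show "nseg (ex x w) (- w)" "ex (ex x w) (- w) = x"
    using curve_ex[OF nseg_curve(1-4)[OF assms] z] nseg_0[OF nseg_in_M[OF assms]] by simp_all
qed

end

section \<open>Planes and frames in Euclidean space\<close>

unbundle cross3_syntax

text \<open>Cramer's rule for the vectors \<open>a\<close>, \<open>b\<close>, \<open>c\<close> of space, with determinants written as triple
  products. It yields the coordinate formulas for planes below.\<close>

lemma cramer3: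
  fixes a b c y :: "real^3"
  shows "(a \<bullet> (c \<times> b)) *\<^sub>R y =
    (y \<bullet> (c \<times> b)) *\<^sub>R a - (y \<bullet> (c \<times> a)) *\<^sub>R b - (y \<bullet> (a \<times> b)) *\<^sub>R c"
  by (simp add: vec_eq_iff forall_3 cross3_def inner_vec_def sum_3 algebra_simps)

lemma triple_in_plane:
  fixes \<nu> a b y :: "real^3"
  assumes "norm \<nu> = 1" "\<nu> \<bullet> a = 0" "\<nu> \<bullet> b = 0" "\<nu> \<bullet> y = 0"
  shows "y \<bullet> (a \<times> b) = 0"
proof -
  have "\<nu> \<times> (a \<times> b) = 0" using assms by (simp add: Lagrange)
  then have "a \<times> b \<in> span {\<nu>}" using assms(1)
    by (metis cross_eq_0 collinear_lemma norm_zero span_base span_mul span_zero insertI1 zero_neq_one)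
  then obtain c where "a \<times> b = c *\<^sub>R \<nu>" by (auto simp: span_singleton)
  then show ?thesis using assms(4) by (simp add: inner_commute)
qed

text \<open>In the plane orthogonal to \<open>\<nu>\<close>, the expression \<open>a \<bullet> (\<nu> \<times> b)\<close> is the area form.\<close>

lemma plane_coords:
  fixes \<nu> a b y :: "real^3"
  assumes "norm \<nu> = 1" "\<nu> \<bullet> a = 0" "\<nu> \<bullet> b = 0" "\<nu> \<bullet> y = 0" and ne: "a \<bullet> (\<nu> \<times> b) \<noteq> 0"
  shows "y = (y \<bullet> (\<nu> \<times> b) / (a \<bullet> (\<nu> \<times> b))) *\<^sub>R a - (y \<bullet> (\<nu> \<times> a) / (a \<bullet> (\<nu> \<times> b))) *\<^sub>R b"
proof -
  have "(a \<bullet> (\<nu> \<times> b)) *\<^sub>R y = (y \<bullet> (\<nu> \<times> b)) *\<^sub>R a - (y \<bullet> (\<nu> \<times> a)) *\<^sub>R b"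
    using cramer3[of a \<nu> b y] triple_in_plane[OF assms(1-4)] by simp
  then have "(1 / (a \<bullet> (\<nu> \<times> b))) *\<^sub>R ((a \<bullet> (\<nu> \<times> b)) *\<^sub>R y) =
      (1 / (a \<bullet> (\<nu> \<times> b))) *\<^sub>R ((y \<bullet> (\<nu> \<times> b)) *\<^sub>R a - (y \<bullet> (\<nu> \<times> a)) *\<^sub>R b)" by simp
  then show ?thesis using ne by (simp add: scaleR_diff_right)
qed

lemma inner_cross_swap: "a \<bullet> (\<nu> \<times> b) = - (b \<bullet> (\<nu> \<times> a))" for a b \<nu> :: "real^3"
  by (simp add: cross3_def inner_vec_def sum_3 algebra_simps)

lemma inner_cross_self: "a \<bullet> (\<nu> \<times> a) = 0" "\<nu> \<bullet> (\<nu> \<times> a) = 0" for a \<nu> :: "real^3"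
  by (simp_all add: cross3_def inner_vec_def sum_3 algebra_simps)

lemma frame_expansion:
  fixes \<nu> a y :: "real^3"
  assumes "norm \<nu> = 1" "\<nu> \<bullet> a = 0" "a \<noteq> 0"
  shows "y = (y \<bullet> a / (a \<bullet> a)) *\<^sub>R a + (y \<bullet> (\<nu> \<times> a) / (a \<bullet> a)) *\<^sub>R (\<nu> \<times> a) + (y \<bullet> \<nu>) *\<^sub>R \<nu>"
proof -
  have n1: "\<nu> \<bullet> \<nu> = 1" using assms(1) by (simp add: dot_square_norm)
  have 1: "(\<nu> \<times> a) \<bullet> (\<nu> \<times> a) = a \<bullet> a"
    using norm_cross[of \<nu> a] assms by (simp add: power2_norm_eq_inner)
  have 2: "a \<times> (\<nu> \<times> a) = (a \<bullet> a) *\<^sub>R \<nu>" "\<nu> \<times> (\<nu> \<times> a) = - a"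
    using assms n1 by (simp_all add: Lagrange inner_commute)
  have "(a \<bullet> a) *\<^sub>R y = (y \<bullet> a) *\<^sub>R a + (y \<bullet> (\<nu> \<times> a)) *\<^sub>R (\<nu> \<times> a) + (y \<bullet> ((a \<bullet> a) *\<^sub>R \<nu>)) *\<^sub>R \<nu>"
    using arg_cong[OF cramer3[of a \<nu> "\<nu> \<times> a" y], of uminus] unfolding 2 by (simp add: algebra_simps)
  then have "(1 / (a \<bullet> a)) *\<^sub>R ((a \<bullet> a) *\<^sub>R y) =
     (1 / (a \<bullet> a)) *\<^sub>R ((y \<bullet> a) *\<^sub>R a + (y \<bullet> (\<nu> \<times> a)) *\<^sub>R (\<nu> \<times> a) + (y \<bullet> ((a \<bullet> a) *\<^sub>R \<nu>)) *\<^sub>R \<nu>)" by simp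
  then show ?thesis using assms(3) by (simp add: scaleR_add_right)
qed

lemma parallel_in_plane:
  fixes \<nu> a b :: "real^3"
  assumes "norm \<nu> = 1" "\<nu> \<bullet> a = 0" "\<nu> \<bullet> b = 0" "a \<noteq> 0" "b \<bullet> (\<nu> \<times> a) = 0"
  shows "\<exists>c. b = c *\<^sub>R a"
proof -
  have "b = (b \<bullet> a / (a \<bullet> a)) *\<^sub>R a"
    using frame_expansion[OF assms(1,2,4), of b] assms(3,5) by (simp add: inner_commute)
  then show ?thesis by blast
qed

section \<open>Limits of flat segments\<close>

context proper_surface
begin

text \<open>Local step for the convergence of segments: near a parameter \<open>\<tau>\<close>, properness provides a
  cluster point of the points at \<open>\<tau>\<close>, and a graph chart there contains all but finitely many of the
  curves as soon as they converge at a single parameter.\<close>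

lemma ex_limit_chart:
  assumes X: "\<And>i::nat. X i \<in> M" "X \<longlonglongrightarrow> x" "x \<in> M" and w: "w \<longlonglongrightarrow> v"
    and seg: "\<And>i. nseg (X i) (w i)" and \<tau>: "\<tau> \<in> {0..1}"
  shows "\<exists>T h. openin (top_of_set {0..1}) T \<and> \<tau> \<in> T \<and> continuous_on T h \<and> h ` T \<subseteq> M \<and>
    (\<forall>\<tau>1\<in>T. \<forall>l1\<in>M. (\<lambda>i. ex (X i) (\<tau>1 *\<^sub>R w i)) \<longlonglongrightarrow> l1 \<longrightarrow>
       (\<forall>t\<in>T. (\<lambda>i. ex (X i) (t *\<^sub>R w i)) \<longlonglongrightarrow> h t))"
proof -
  define g where "g i t = ex (X i) (t *\<^sub>R w i)" for i t
  have g: "continuous_on {0..1} (g i)" "\<And>t. t \<in> {0..1} \<Longrightarrow> g i t \<in> M"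
    "\<And>t. t \<in> {0..1} \<Longrightarrow> f (g i t) = f (X i) + t *\<^sub>R w i" for i
    using nseg_curve(1-3)[OF seg[of i]] unfolding g_def by auto
  have fX: "(\<lambda>i. f (X i)) \<longlonglongrightarrow> f x" by (rule f_tendsto[OF X(1,3,2)])
  have lim: "(\<lambda>i. f (X i) + t *\<^sub>R w i) \<longlonglongrightarrow> f x + t *\<^sub>R v" for t
    by (intro tendsto_intros fX w)
  have "(\<lambda>i. f (g i \<tau>)) \<longlonglongrightarrow> f x + \<tau> *\<^sub>R v" using lim[of \<tau>] g(3)[OF \<tau>] by simp
  from proper[OF g(2)[OF \<tau>] this]
  obtain l r where l: "l \<in> M" and r: "strict_mono r" "((\<lambda>i. g i \<tau>) \<circ> r) \<longlonglongrightarrow> l" by blast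
  have "(\<lambda>k. f (g (r k) \<tau>)) \<longlonglongrightarrow> f l"
    using f_tendsto[of "\<lambda>k. g (r k) \<tau>" l] g(2)[OF \<tau>] l r(2) by (simp add: o_def)
  moreover have "(\<lambda>k. f (g (r k) \<tau>)) \<longlonglongrightarrow> f x + \<tau> *\<^sub>R v"
    using LIMSEQ_subseq_LIMSEQ[OF lim[of \<tau>] r(1)] g(3)[OF \<tau>] by (simp add: o_def)
  ultimately have fl: "f l = f x + \<tau> *\<^sub>R v" by (rule LIMSEQ_unique)
  obtain P \<rho> G K where gcc: "graph_chart M f l (n l) P \<rho> G K" using local_graph[OF l] by metis
  note gc = graph_chartD[OF gcc]
  have Pl: "linear P" by (rule gc(1))
  have blP: "bounded_linear P" using Pl linear_conv_bounded_linear by blast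
  obtain B where B: "0 < B" "\<And>y. norm (P y) \<le> B * norm y"
    using linear_bounded_pos[OF Pl] by blast
  define \<epsilon> where "\<epsilon> = \<rho> / (2 * B * (norm v + 1))"
  have nv: "0 < norm v + 1" using norm_ge_zero[of v] by linarith
  have \<epsilon>: "0 < \<epsilon>" using B(1) gc(2) nv by (simp add: \<epsilon>_def)
  define z where "z t = P (f x + t *\<^sub>R v)" for t
  have z1: "dist (P (f l)) (z t) < \<rho> / 2" if "\<bar>t - \<tau>\<bar> < \<epsilon>" for t
  proof -
    have "dist (P (f l)) (z t) = norm (P ((\<tau> - t) *\<^sub>R v))"
      unfolding dist_norm z_def fl linear_diff[OF Pl, symmetric] by (simp add: scaleR_diff_left)
    also have "\<dots> \<le> B * (\<bar>t - \<tau>\<bar> * norm v)" using B(2)[of "(\<tau> - t) *\<^sub>R v"] by (simp add: abs_minus_commute)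
    also have "\<dots> \<le> B * (\<bar>t - \<tau>\<bar> * (norm v + 1))" using B(1) by (simp add: mult_left_mono)
    also have "\<dots> < B * (\<epsilon> * (norm v + 1))" using B(1) nv that by simp
    also have "\<dots> = \<rho> / 2" using B(1) nv by (simp add: \<epsilon>_def)
    finally show ?thesis .
  qed
  have "(\<lambda>i. B * (norm (f (X i) - f x) + norm (w i - v))) \<longlonglongrightarrow> B * (norm (f x - f x) + norm (v - v))"
    by (intro tendsto_intros fX w)
  then have ev: "\<forall>\<^sub>F i in sequentially. B * (norm (f (X i) - f x) + norm (w i - v)) < \<rho> / 2"
    using gc(2) by (intro order_tendstoD(2)[where a = "\<rho>/2"]) auto
  have z2: "dist (z t) (P (f (X i) + t *\<^sub>R w i)) < \<rho> / 2"
    if "B * (norm (f (X i) - f x) + norm (w i - v)) < \<rho> / 2" "t \<in> {0..1}" for i t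
  proof -
    have "dist (z t) (P (f (X i) + t *\<^sub>R w i)) = norm (P ((f (X i) - f x) + t *\<^sub>R (w i - v)))"
      unfolding dist_norm z_def linear_diff[OF Pl, symmetric]
      by (subst norm_minus_cancel[symmetric], subst linear_neg[OF Pl, symmetric]) (simp add: algebra_simps)
    also have "\<dots> \<le> B * norm ((f (X i) - f x) + t *\<^sub>R (w i - v))" by (rule B(2))
    also have "\<dots> \<le> B * (norm (f (X i) - f x) + norm (w i - v))"
    proof (rule mult_left_mono)
      have "norm ((f (X i) - f x) + t *\<^sub>R (w i - v)) \<le> norm (f (X i) - f x) + t * norm (w i - v)"
        using norm_triangle_ineq[of "f (X i) - f x" "t *\<^sub>R (w i - v)"] that(2) by simp
      also have "t * norm (w i - v) \<le> norm (w i - v)"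
        using that(2) by (simp add: mult_left_le_one_le)
      finally show "norm ((f (X i) - f x) + t *\<^sub>R (w i - v)) \<le> norm (f (X i) - f x) + norm (w i - v)"
        by simp
    qed (use B(1) in simp)
    finally show ?thesis using that(1) by simp
  qed
  define T where "T = {0..1} \<inter> ball \<tau> \<epsilon>"
  have T1: "t \<in> {0..1}" "\<bar>t - \<tau>\<bar> < \<epsilon>" if "t \<in> T" for t
    using that by (auto simp: T_def dist_real_def abs_minus_commute)
  have zT: "z t \<in> ball (P (f l)) \<rho>" if "t \<in> T" for t
    using z1[of t] T1[OF that] gc(2) by simp
  have PT: "P (f (g i t)) \<in> ball (P (f l)) \<rho>"
    if "B * (norm (f (X i) - f x) + norm (w i - v)) < \<rho> / 2" "t \<in> T" for i t
    using z2[OF that(1) T1(1)[OF that(2)]] z1[OF T1(2)[OF that(2)]] g(3)[OF T1(1)[OF that(2)], of i]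
      dist_triangle_less_add[of "P (f l)" "z t" "\<rho>/2" "P (f (X i) + t *\<^sub>R w i)" "\<rho>/2"]
    by (simp add: dist_commute)
  have key: "g i t = G (P (f (X i) + t *\<^sub>R w i))"
    if "B * (norm (f (X i) - f x) + norm (w i - v)) < \<rho> / 2" "t1 \<in> T" "g i t1 \<in> G ` ball (P (f l)) \<rho>" "t \<in> T"
    for i t t1
  proof -
    have "connected T" unfolding T_def by (intro convex_connected convex_Int convex_ball convex_real_interval)
    moreover have "continuous_on T (g i)" using g(1) by (rule continuous_on_subset) (auto simp: T_def)
    moreover have "g i ` T \<subseteq> M" using g(2) T1(1) by auto
    ultimately have "g i t = G (P (f (g i t)))"
      using graph_chart_lift[OF gcc, of T "g i" t1 t] PT[OF that(1)] that by blast
    then show ?thesis using g(3)[OF T1(1)[OF that(4)]] by metis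
  qed
  have GT: "(\<lambda>i. G (P (f (X i) + t *\<^sub>R w i))) \<longlonglongrightarrow> G (z t)" if "t \<in> T" for t
  proof -
    have "isCont G (z t)"
      using gc(6) zT[OF that] by (meson continuous_on_eq_continuous_at open_ball)
    moreover have "(\<lambda>i. P (f (X i) + t *\<^sub>R w i)) \<longlonglongrightarrow> z t"
      unfolding z_def by (rule bounded_linear.tendsto[OF blP lim])
    ultimately show ?thesis by (rule isCont_tendsto_compose)
  qed
  have cz: "continuous_on T z"
    unfolding z_def
    by (rule continuous_on_compose2[OF linear_continuous_on[OF blP, of UNIV]]) (auto intro!: continuous_intros)
  have "continuous_on T (\<lambda>t. G (z t))"
    by (rule continuous_on_compose2[OF gc(6) cz]) (use zT in auto)
  moreover have "(\<lambda>t. G (z t)) ` T \<subseteq> M" using zT gc(8) by auto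
  moreover have "openin (top_of_set {0..1}) T" unfolding T_def by (simp add: openin_open_Int)
  moreover have \<tau>T: "\<tau> \<in> T" using \<tau> \<epsilon> by (simp add: T_def)
  moreover have "(\<lambda>i. g i t) \<longlonglongrightarrow> G (z t)" if t1: "t1 \<in> T" and l1: "l1 \<in> M" "(\<lambda>i. g i t1) \<longlonglongrightarrow> l1"
    and t: "t \<in> T" for t1 l1 t
  proof -
    have sub: "\<forall>\<^sub>F k in sequentially. Q (r k)" if "\<forall>\<^sub>F i in sequentially. Q i" for Q
      using eventually_subseq[OF r(1) that] .
    have "\<forall>\<^sub>F k in sequentially. g (r k) \<tau> \<in> G ` ball (P (f l)) \<rho>"
      by (rule eventually_in_openin[OF gc(3,4)]) (use g(2)[OF \<tau>] r(2) in \<open>auto simp: o_def\<close>)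
    with sub[OF ev] have tr: "\<forall>\<^sub>F k in sequentially. g (r k) t1 = G (P (f (X (r k)) + t1 *\<^sub>R w (r k)))"
      by eventually_elim (rule key[OF _ \<tau>T _ t1])
    have "(\<lambda>k. g (r k) t1) \<longlonglongrightarrow> l1" using LIMSEQ_subseq_LIMSEQ[OF l1(2) r(1)] by (simp add: o_def)
    from Lim_transform_eventually[OF this tr]
    have "(\<lambda>k. G (P (f (X (r k)) + t1 *\<^sub>R w (r k)))) \<longlonglongrightarrow> l1" .
    moreover have "(\<lambda>k. G (P (f (X (r k)) + t1 *\<^sub>R w (r k)))) \<longlonglongrightarrow> G (z t1)"
      using LIMSEQ_subseq_LIMSEQ[OF GT[OF t1] r(1)] by (simp add: o_def)
    ultimately have "l1 = G (z t1)" by (rule LIMSEQ_unique)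
    then have "l1 \<in> G ` ball (P (f l)) \<rho>" using zT[OF t1] by blast
    then have "\<forall>\<^sub>F i in sequentially. g i t1 \<in> G ` ball (P (f l)) \<rho>"
      by (rule eventually_in_openin[OF gc(3)]) (use g(2) T1(1)[OF t1] l1 in auto)
    with ev have "\<forall>\<^sub>F i in sequentially. G (P (f (X i) + t *\<^sub>R w i)) = g i t"
      by eventually_elim (metis key t1 t)
    then show ?thesis by (rule Lim_transform_eventually[OF GT[OF t]])
  qed
  ultimately show ?thesis unfolding g_def[symmetric]
    by (intro exI[of _ T] exI[of _ "\<lambda>t. G (z t)"] conjI ballI impI)
qed

text \<open>Segments depend continuously on initial point and direction, and limits of segments are segments;
  this is where properness of the immersion is used. The set of parameters where the curves
  converge is open and closed by the local step, and contains \<open>0\<close>.\<close>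

theorem ex_limit:
  assumes X: "\<And>i::nat. X i \<in> M" "X \<longlonglongrightarrow> x" "x \<in> M" and w: "w \<longlonglongrightarrow> v"
    and seg: "\<And>i. nseg (X i) (w i)"
  shows "nseg x v" "(\<lambda>i. ex (X i) (w i)) \<longlonglongrightarrow> ex x v"
proof -
  define g where "g i t = ex (X i) (t *\<^sub>R w i)" for i t
  have g: "\<And>t. t \<in> {0..1} \<Longrightarrow> g i t \<in> M" "\<And>t. t \<in> {0..1} \<Longrightarrow> f (g i t) = f (X i) + t *\<^sub>R w i"
    "\<And>t. t \<in> {0..1} \<Longrightarrow> n (g i t) = n (X i)" for i
    using nseg_curve(2-4)[OF seg[of i]] unfolding g_def by auto
  have g0: "g i 0 = X i" for i using nseg_0(2)[OF X(1)] by (simp add: g_def)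
  define \<Phi> where "\<Phi> \<tau> T h \<longleftrightarrow> openin (top_of_set {0..1}) T \<and> \<tau> \<in> T \<and> continuous_on T h \<and> h ` T \<subseteq> M \<and>
    (\<forall>\<tau>1\<in>T. \<forall>l1\<in>M. (\<lambda>i. g i \<tau>1) \<longlonglongrightarrow> l1 \<longrightarrow> (\<forall>t\<in>T. (\<lambda>i. g i t) \<longlonglongrightarrow> h t))"
    for \<tau> :: real and T :: "real set" and h
  have "\<exists>T h. \<Phi> \<tau> T h" if "\<tau> \<in> {0..1}" for \<tau>
    unfolding g_def \<Phi>_def by (rule ex_limit_chart[OF X w seg that])
  then obtain T h where \<Phi>: "\<And>\<tau>. \<tau> \<in> {0..1} \<Longrightarrow> \<Phi> \<tau> (T \<tau>) (h \<tau>)" by metis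
  have Th: "openin (top_of_set {0..1}) (T \<tau>)" "\<tau> \<in> T \<tau>" "continuous_on (T \<tau>) (h \<tau>)" "h \<tau> ` T \<tau> \<subseteq> M"
    "\<And>t1 l1 t. t1 \<in> T \<tau> \<Longrightarrow> l1 \<in> M \<Longrightarrow> (\<lambda>i. g i t1) \<longlonglongrightarrow> l1 \<Longrightarrow> t \<in> T \<tau> \<Longrightarrow>
       (\<lambda>i. g i t) \<longlonglongrightarrow> h \<tau> t"
    if "\<tau> \<in> {0..1}" for \<tau>
    using \<Phi>[OF that] unfolding \<Phi>_def by blast+
  have conv: "\<exists>l\<in>M. (\<lambda>i. g i t) \<longlonglongrightarrow> l" if t: "t \<in> {0..1}" for t
  proof (rule connected_induction_simple[of "{0..1::real}" 0 t "\<lambda>t. \<exists>l\<in>M. (\<lambda>i. g i t) \<longlonglongrightarrow> l"])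
    show "\<exists>l\<in>M. (\<lambda>i. g i 0) \<longlonglongrightarrow> l" unfolding g0 using X(2,3) by (rule bexI)
    fix \<tau> :: real assume \<tau>: "\<tau> \<in> {0..1}"
    have "\<exists>l\<in>M. (\<lambda>i. g i b) \<longlonglongrightarrow> l" if ab: "a \<in> T \<tau>" "b \<in> T \<tau>" "\<exists>l\<in>M. (\<lambda>i. g i a) \<longlonglongrightarrow> l" for a b
    proof -
      from ab(3) obtain l where "l \<in> M" "(\<lambda>i. g i a) \<longlonglongrightarrow> l" ..
      then have "(\<lambda>i. g i b) \<longlonglongrightarrow> h \<tau> b" by (rule Th(5)[OF \<tau> ab(1) _ _ ab(2)])
      moreover have "h \<tau> b \<in> M" using Th(4)[OF \<tau>] ab(2) by (rule subsetD[OF _ imageI])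
      ultimately show ?thesis ..
    qed
    then show "\<exists>T. openin (top_of_set {0..1}) T \<and> \<tau> \<in> T \<and>
        (\<forall>x\<in>T. \<forall>y\<in>T. (\<exists>l\<in>M. (\<lambda>i. g i x) \<longlonglongrightarrow> l) \<longrightarrow> (\<exists>l\<in>M. (\<lambda>i. g i y) \<longlonglongrightarrow> l))"
      using Th(1,2)[OF \<tau>] by blast
  qed (use t in auto)
  then obtain L where L: "\<And>t. t \<in> {0..1} \<Longrightarrow> L t \<in> M" "\<And>t. t \<in> {0..1} \<Longrightarrow> (\<lambda>i. g i t) \<longlonglongrightarrow> L t"
    by metis
  have cL: "continuous_on {0..1} L"
    unfolding continuous_on_eq_continuous_within
  proof
    fix \<tau> :: real assume \<tau>: "\<tau> \<in> {0..1}"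
    obtain V where V: "open V" "T \<tau> = {0..1} \<inter> V" using Th(1)[OF \<tau>] by (auto simp: openin_open)
    have "continuous_on (T \<tau>) L"
      using Th(3)[OF \<tau>]
    proof (rule continuous_on_eq)
      fix t assume t: "t \<in> T \<tau>"
      then have "t \<in> {0..1}" using V by auto
      then show "h \<tau> t = L t"
        by (intro LIMSEQ_unique[OF Th(5)[OF \<tau> t L(1) L(2) t] L(2)])
    qed
    then have "continuous (at \<tau> within T \<tau>) L"
      using Th(2)[OF \<tau>] by (simp add: continuous_on_eq_continuous_within)
    moreover have "at \<tau> within T \<tau> = at \<tau> within {0..1}"
      by (rule at_within_nhd[of _ V]) (use V Th(2)[OF \<tau>] in auto)
    ultimately show "continuous (at \<tau> within {0..1}) L" by simp
  qed
  have fL: "f (L t) = f x + t *\<^sub>R v" if t: "t \<in> {0..1}" for t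
  proof (rule LIMSEQ_unique)
    show "(\<lambda>i. f (g i t)) \<longlonglongrightarrow> f (L t)" by (rule f_tendsto) (use g(1)[OF t] L[OF t] in auto)
    show "(\<lambda>i. f (g i t)) \<longlonglongrightarrow> f x + t *\<^sub>R v"
      unfolding g(2)[OF t] by (intro tendsto_intros f_tendsto[OF X(1,3,2)] w)
  qed
  have nL: "n (L t) = n x" if t: "t \<in> {0..1}" for t
  proof (rule LIMSEQ_unique)
    show "(\<lambda>i. n (g i t)) \<longlonglongrightarrow> n (L t)" by (rule n_tendsto) (use g(1)[OF t] L[OF t] in auto)
    show "(\<lambda>i. n (g i t)) \<longlonglongrightarrow> n x"
      unfolding g(3)[OF t] by (rule n_tendsto[OF X(1,3,2)])
  qed
  have "(\<lambda>i. g i 0) \<longlonglongrightarrow> L 0" by (rule L(2)) simp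
  then have "L 0 = x" unfolding g0 by (rule LIMSEQ_unique) (rule X(2))
  then have "nlift L x v" using cL L(1) fL nL by (auto simp: nlift_def)
  from nlift_ex[OF this] show "nseg x v" "(\<lambda>i. ex (X i) (w i)) \<longlonglongrightarrow> ex x v"
    using L(2)[of 1] by (auto simp: g_def)
qed

definition nline :: "'m \<Rightarrow> real^3 \<Rightarrow> bool" where
  "nline x w \<longleftrightarrow> (\<forall>s. nseg x (s *\<^sub>R w))"

lemma nlineD:
  assumes "nline x w"
  shows "nseg x (s *\<^sub>R w)" "x \<in> M" "ex x (s *\<^sub>R w) \<in> M" "f (ex x (s *\<^sub>R w)) = f x + s *\<^sub>R w"
    "n (ex x (s *\<^sub>R w)) = n x"
  using assms nseg_ex[of x "s *\<^sub>R w"] nseg_in_M unfolding nline_def by blast+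

lemma nline_limit:
  assumes "\<And>i::nat. X i \<in> M" "X \<longlonglongrightarrow> x" "x \<in> M" "w \<longlonglongrightarrow> v" "\<And>i. nline (X i) (w i)"
  shows "nline x v"
  unfolding nline_def
proof
  fix s
  have "(\<lambda>i. s *\<^sub>R w i) \<longlonglongrightarrow> s *\<^sub>R v" by (intro tendsto_intros assms(4))
  moreover have "nseg (X i) (s *\<^sub>R w i)" for i using assms(5)[of i] by (simp add: nline_def)
  ultimately show "nseg x (s *\<^sub>R v)" by (rule ex_limit(1)[OF assms(1-3)])
qed

lemma nline_continuous:
  assumes "nline x w" shows "continuous_on S (\<lambda>t. ex x (t *\<^sub>R w))"
proof (rule continuous_on_sequentiallyI)
  fix u a assume u: "\<forall>i. u i \<in> S" "a \<in> S" "u \<longlonglongrightarrow> a"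
  show "(\<lambda>i. ex x (u i *\<^sub>R w)) \<longlonglongrightarrow> ex x (a *\<^sub>R w)"
    by (rule ex_limit(2)[OF _ tendsto_const _ tendsto_scaleR[OF u(3) tendsto_const]])
      (rule nlineD[OF assms])+
qed

lemma nline_shift:
  assumes "nline x w"
  shows "nline (ex x (s *\<^sub>R w)) w" "ex (ex x (s *\<^sub>R w)) (t *\<^sub>R w) = ex x ((s + t) *\<^sub>R w)"
proof -
  have *: "nseg (ex x (s *\<^sub>R w)) (t *\<^sub>R w) \<and> ex (ex x (s *\<^sub>R w)) (t *\<^sub>R w) = ex x ((s + t) *\<^sub>R w)" for t
  proof -
    define b where "b = \<bar>s\<bar> + \<bar>t\<bar>"
    have z: "s \<in> {-b..b}" "s + t \<in> {-b..b}" by (auto simp: b_def)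
    have "s + t - s = t" by simp
    then show ?thesis
      using curve_ex[OF nline_continuous[OF assms] nlineD(3)[OF assms] nlineD(4)[OF assms]
          nlineD(5)[OF assms] z] by metis
  qed
  show "nline (ex x (s *\<^sub>R w)) w" unfolding nline_def using * by blast
  show "ex (ex x (s *\<^sub>R w)) (t *\<^sub>R w) = ex x ((s + t) *\<^sub>R w)" using * by blast
qed

lemma nline_scale: "nline x w \<Longrightarrow> nline x (c *\<^sub>R w)"
  by (simp add: nline_def)

text \<open>Compare the tangency condition at points \<open>g t\<close> with \<open>t\<close> tending to \<open>0\<close>.\<close>

lemma curve_tangent:
  assumes "continuous_on {0..1} g" "\<And>t. t \<in> {0..1} \<Longrightarrow> g t \<in> M"
    "\<And>t. t \<in> {0..1} \<Longrightarrow> f (g t) = f (g 0) + t *\<^sub>R w"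
  shows "n (g 0) \<bullet> w = 0"
proof (rule ccontr)
  assume ne: "n (g 0) \<bullet> w \<noteq> 0"
  define \<epsilon> where "\<epsilon> = \<bar>n (g 0) \<bullet> w\<bar> / (norm w + 1)"
  have nw: "0 < norm w + 1" using norm_ge_zero[of w] by linarith
  have \<epsilon>: "0 < \<epsilon>" using ne nw by (simp add: \<epsilon>_def)
  have g0: "g 0 \<in> M" using assms(2) by simp
  from tangency[OF g0 \<epsilon>] obtain U where U: "openin (top_of_set M) U" "g 0 \<in> U"
    "\<And>y. y \<in> U \<Longrightarrow> \<bar>n (g 0) \<bullet> (f y - f (g 0))\<bar> \<le> \<epsilon> * norm (f y - f (g 0))" by blast
  define t where "t i = 1 / (real i + 1)" for i
  have t01: "t i \<in> {0..1}" "0 < t i" for i by (auto simp: t_def)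
  have "t \<longlonglongrightarrow> 0" unfolding t_def using LIMSEQ_inverse_real_of_nat by (simp add: inverse_eq_divide add.commute)
  then have "(\<lambda>i. g (t i)) \<longlonglongrightarrow> g 0"
    using continuous_on_tendsto_compose[OF assms(1), of t 0] t01 by simp
  then have "\<forall>\<^sub>F i in sequentially. g (t i) \<in> U"
    by (intro eventually_in_openin[OF U(1,2)] assms(2) t01)
  then obtain i where i: "g (t i) \<in> U" by (meson eventually_happens sequentially_bot)
  have "\<bar>n (g 0) \<bullet> (t i *\<^sub>R w)\<bar> \<le> \<epsilon> * norm (t i *\<^sub>R w)"
    using U(3)[OF i] assms(3)[OF t01(1)] by (metis add_diff_cancel_left')
  then have "t i * \<bar>n (g 0) \<bullet> w\<bar> \<le> t i * (\<epsilon> * norm w)" using t01(2)[of i] by (simp add: abs_mult mult_ac)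
  then have "\<bar>n (g 0) \<bullet> w\<bar> \<le> \<epsilon> * norm w" using t01(2)[of i] by simp
  also have "\<dots> < \<epsilon> * (norm w + 1)" using \<epsilon> by simp
  also have "\<dots> = \<bar>n (g 0) \<bullet> w\<bar>" using nw by (simp add: \<epsilon>_def)
  finally show False by simp
qed

lemma nseg_tangent: assumes "nseg x w" shows "n x \<bullet> w = 0"
proof -
  have 0: "ex x (0 *\<^sub>R w) = x" using nseg_0(2)[OF nseg_in_M[OF assms]] by simp
  show ?thesis using curve_tangent[OF nseg_curve(1,2)[OF assms]] nseg_curve(3)[OF assms] unfolding 0 by blast
qed

lemma nline_tangent: "nline x w \<Longrightarrow> n x \<bullet> w = 0"
  using nlineD(1)[of x w 1] nseg_tangent by simp

end

section \<open>Continuation along an interval\<close>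

text \<open>Induction along the half-line: consider the infimum of the parameters
  where the property fails.\<close>

lemma real_continuation:
  fixes P :: "real \<Rightarrow> bool"
  assumes "P 0"
    and step: "\<And>t. 0 \<le> t \<Longrightarrow> (\<And>s. 0 \<le> s \<Longrightarrow> s \<le> t \<Longrightarrow> P s) \<Longrightarrow> \<exists>\<epsilon>>0. \<forall>s. t < s \<and> s < t + \<epsilon> \<longrightarrow> P s"
    and limit: "\<And>t. 0 < t \<Longrightarrow> (\<And>s. 0 \<le> s \<Longrightarrow> s < t \<Longrightarrow> P s) \<Longrightarrow> P t"
    and "0 \<le> t"
  shows "P t"
proof (rule ccontr)
  assume nP: "\<not> P t"
  define S where "S = {s. 0 \<le> s \<and> \<not> P s}"
  have S: "t \<in> S" "bdd_below S" using nP \<open>0 \<le> t\<close> by (auto simp: S_def intro: bdd_belowI[of _ 0])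
  define m where "m = Inf S"
  have m0: "0 \<le> m" unfolding m_def by (rule cInf_greatest) (use S in \<open>auto simp: S_def\<close>)
  have below: "P s" if "0 \<le> s" "s < m" for s
    using that cInf_lower[OF _ S(2), of s] by (force simp: S_def m_def)
  have "P m" using limit[of m] below \<open>P 0\<close> m0 by (cases "m = 0") auto
  then have "P s" if "0 \<le> s" "s \<le> m" for s using below that by (cases "s = m") auto
  from step[OF m0 this] obtain \<epsilon> where \<epsilon>: "\<epsilon> > 0" "\<And>s. m < s \<Longrightarrow> s < m + \<epsilon> \<Longrightarrow> P s" by blast
  have "Inf S < m + \<epsilon>" using \<epsilon> by (simp add: m_def)
  then obtain s where "s \<in> S" "s < m + \<epsilon>" using cInf_lessD[of S] S(1) by blast
  moreover have "m \<le> s" unfolding m_def by (rule cInf_lower) (use \<open>s \<in> S\<close> S(2) in auto)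
  ultimately show False using \<epsilon>(2)[of s] \<open>P m\<close> by (cases "s = m") (auto simp: S_def)
qed

lemma right_neighbourhood_by_sequences:
  fixes t :: real
  assumes "\<And>X. (\<And>i. t < X i) \<Longrightarrow> (\<And>i. \<not> Q (X i)) \<Longrightarrow> X \<longlonglongrightarrow> t \<Longrightarrow> False"
  shows "\<exists>\<epsilon>>0. \<forall>s. t < s \<and> s < t + \<epsilon> \<longrightarrow> Q s"
proof (rule ccontr)
  assume "\<not> ?thesis"
  then have "\<exists>s. t < s \<and> s < t + inverse (real (Suc i)) \<and> \<not> Q s" for i
    by (metis inverse_positive_iff_positive of_nat_0_less_iff zero_less_Suc)
  then obtain X where X: "\<And>i. t < X i" "\<And>i. X i < t + inverse (real (Suc i))" "\<And>i. \<not> Q (X i)"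
    by metis
  have "X \<longlonglongrightarrow> t"
  proof (rule tendsto_sandwich[OF _ _ tendsto_const])
    show "(\<lambda>i. t + inverse (real (Suc i))) \<longlonglongrightarrow> t"
      using tendsto_add[OF tendsto_const[of t] LIMSEQ_inverse_real_of_nat] by simp
    show "\<forall>\<^sub>F i in sequentially. t \<le> X i" using X(1) by (simp add: less_imp_le)
    show "\<forall>\<^sub>F i in sequentially. X i \<le> t + inverse (real (Suc i))"
      using X(2) by (intro always_eventually allI less_imp_le)
  qed
  with assms X show False by blast
qed

lemma unit_vector_subsequence:
  fixes w :: "nat \<Rightarrow> real^3"
  assumes "\<And>i. norm (w i) = 1"
  obtains l r where "norm l = 1" "strict_mono (r :: nat \<Rightarrow> nat)" "(\<lambda>i. w (r i)) \<longlonglongrightarrow> l"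
proof -
  have "\<forall>i. w i \<in> sphere 0 1" using assms by simp
  then show ?thesis
    using compact_sphere[of "0 :: real^3" 1] that unfolding compact_def by (fastforce simp: o_def)
qed

section \<open>Flat lines and flat pieces of a surface\<close>

context proper_surface
begin

lemma ex_tendsto_0:
  assumes "\<And>i::nat. X i \<in> M" "X \<longlonglongrightarrow> x" "x \<in> M" "w \<longlonglongrightarrow> 0" "\<And>i. nseg (X i) (w i)"
  shows "(\<lambda>i. ex (X i) (w i)) \<longlonglongrightarrow> x"
  using ex_limit(2)[OF assms] nseg_0(2)[OF assms(3)] by simp

lemma n_inner: "x \<in> M \<Longrightarrow> n x \<bullet> n x = 1"
  using norm_n[of x] by (simp add: dot_square_norm)

text \<open>In space two neighbouring lines need not meet, but their projections along the normal at \<open>x\<close>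
  do, if the limit direction is transversal to \<open>a\<close>. The points over the crossing tend to \<open>x\<close>; by local
  injectivity modulo the normal they coincide.\<close>

lemma transversal_lines_meet:
  assumes X: "\<And>i::nat. X i \<in> M" "X \<longlonglongrightarrow> x" and w: "w \<longlonglongrightarrow> v" and line: "\<And>i. nline (X i) (w i)"
    and a: "nline x a" "a \<noteq> 0" and ne: "v \<bullet> (n x \<times> a) \<noteq> 0"
  shows "\<forall>\<^sub>F i in sequentially. \<exists>s \<mu>. ex (X i) (s *\<^sub>R w i) = ex x (\<mu> *\<^sub>R a)"
proof -
  have x: "x \<in> M" using nlineD(2)[OF a(1)] .
  let ?\<tau> = "n x \<times> a"
  define D where "D i = f (X i) - f x" for i
  define s where "s i = - (D i \<bullet> ?\<tau>) / (w i \<bullet> ?\<tau>)" for i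
  \<comment> \<open>\<open>s\<close> and \<open>\<mu>\<close> are the parameters on the two lines of the crossing of the projections\<close>
  define \<mu> where "\<mu> i = (D i + s i *\<^sub>R w i) \<bullet> a / (a \<bullet> a)" for i
  have D: "D \<longlonglongrightarrow> 0"
    using tendsto_diff[OF f_tendsto[OF X(1) x X(2)] tendsto_const[of "f x"]] by (simp add: D_def[abs_def])
  have wt: "(\<lambda>i. w i \<bullet> ?\<tau>) \<longlonglongrightarrow> v \<bullet> ?\<tau>" by (intro tendsto_intros w)
  have s: "s \<longlonglongrightarrow> 0"
    using tendsto_divide[OF tendsto_minus[OF tendsto_inner[OF D tendsto_const[of ?\<tau>]]] wt ne]
    by (simp add: s_def[abs_def])
  have "(\<lambda>i. D i + s i *\<^sub>R w i) \<longlonglongrightarrow> 0 + 0 *\<^sub>R v" by (intro tendsto_intros D s w)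
  from tendsto_divide[OF tendsto_inner[OF this tendsto_const[of a]] tendsto_const[of "a \<bullet> a"]]
  have \<mu>: "\<mu> \<longlonglongrightarrow> 0" using a(2) by (simp add: \<mu>_def[abs_def])
  have Y: "(\<lambda>i. ex (X i) (s i *\<^sub>R w i)) \<longlonglongrightarrow> x"
    by (rule ex_tendsto_0[OF X x]) (use tendsto_scaleR[OF s w] nlineD(1)[OF line] in auto)
  have Z: "(\<lambda>i. ex x (\<mu> i *\<^sub>R a)) \<longlonglongrightarrow> x"
    by (rule ex_tendsto_0[OF x tendsto_const x]) (use tendsto_scaleR[OF \<mu> tendsto_const[of a]] nlineD(1)[OF a(1)] in auto)
  have nz: "\<forall>\<^sub>F i in sequentially. w i \<bullet> ?\<tau> \<noteq> 0"
    using tendsto_imp_eventually_ne[OF wt ne] .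
  from locally_injective_mod_normal[OF x nlineD(3)[OF line] Y nlineD(3)[OF a(1)] Z] nz
  show ?thesis
  proof eventually_elim
    case (elim i)
    define y where "y = D i + s i *\<^sub>R w i"
    have "y \<bullet> ?\<tau> = 0" using elim(2) by (simp add: y_def s_def inner_diff_left)
    then have "y = \<mu> i *\<^sub>R a + (y \<bullet> n x) *\<^sub>R n x"
      using frame_expansion[OF norm_n[OF x] nline_tangent[OF a(1)] a(2), of y] by (simp add: \<mu>_def y_def)
    moreover have "f (ex (X i) (s i *\<^sub>R w i)) - f (ex x (\<mu> i *\<^sub>R a)) = y - \<mu> i *\<^sub>R a"
      using nlineD(4)[OF line] nlineD(4)[OF a(1)] by (simp add: y_def D_def)
    ultimately have "f (ex (X i) (s i *\<^sub>R w i)) - f (ex x (\<mu> i *\<^sub>R a)) = (y \<bullet> n x) *\<^sub>R n x"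
      by (metis add_diff_cancel_left')
    with elim(1) show ?case by blast
  qed
qed

text \<open>A curve with constant normal \<open>\<nu>\<close> has velocity orthogonal to \<open>\<nu>\<close> by tangency, so \<open>\<nu> \<bullet> f\<close> has derivative
  zero along it. A Lipschitz bound suffices, because the tangency error is
  relative to the displacement.\<close>

lemma n_const_curve_flat:
  assumes g: "\<And>t. t \<in> {a..b} \<Longrightarrow> g t \<in> M" "continuous_on {a..b} g"
    and lip: "\<And>s t. s \<in> {a..b} \<Longrightarrow> t \<in> {a..b} \<Longrightarrow> norm (f (g s) - f (g t)) \<le> K * \<bar>s - t\<bar>"
    and ng: "\<And>t. t \<in> {a..b} \<Longrightarrow> n (g t) = \<nu>" and st: "s \<in> {a..b}" "t \<in> {a..b}"
  shows "\<nu> \<bullet> f (g s) = \<nu> \<bullet> f (g t)"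
proof -
  have der: "((\<lambda>t. \<nu> \<bullet> f (g t)) has_vector_derivative 0) (at t within {a..b})" if t: "t \<in> {a..b}" for t
    unfolding has_vector_derivative_def has_derivative_within_alt
  proof (intro conjI allI impI)
    fix e :: real assume e: "0 < e"
    define \<epsilon> where "\<epsilon> = e / (\<bar>K\<bar> + 1)"
    have \<epsilon>: "0 < \<epsilon>" using e by (simp add: \<epsilon>_def)
    obtain U where U: "openin (top_of_set M) U" "g t \<in> U"
      "\<And>y. y \<in> U \<Longrightarrow> \<bar>n (g t) \<bullet> (f y - f (g t))\<bar> \<le> \<epsilon> * norm (f y - f (g t))"
      using tangency[OF g(1)[OF t] \<epsilon>] by blast
    have "openin (top_of_set {a..b}) ({a..b} \<inter> g -` U)"
      by (rule continuous_openin_preimage[OF g(2) _ U(1)]) (use g(1) in auto)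
    moreover have "t \<in> {a..b} \<inter> g -` U" using t U(2) by simp
    ultimately obtain d where d: "0 < d" "\<And>y. y \<in> {a..b} \<Longrightarrow> dist y t < d \<Longrightarrow> y \<in> {a..b} \<inter> g -` U"
      unfolding openin_euclidean_subtopology_iff by blast
    show "\<exists>d>0. \<forall>y\<in>{a..b}. norm (y - t) < d \<longrightarrow>
        norm (\<nu> \<bullet> f (g y) - \<nu> \<bullet> f (g t) - (y - t) *\<^sub>R 0) \<le> e * norm (y - t)"
    proof (intro exI[of _ d] conjI ballI impI d(1))
      fix y assume y: "y \<in> {a..b}" "norm (y - t) < d"
      then have "g y \<in> U" using d(2)[of y] by (simp add: dist_norm)
      from U(3)[OF this] have "\<bar>\<nu> \<bullet> (f (g y) - f (g t))\<bar> \<le> \<epsilon> * norm (f (g y) - f (g t))"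
        using ng[OF t] by simp
      also have "\<dots> \<le> \<epsilon> * ((\<bar>K\<bar> + 1) * \<bar>y - t\<bar>)"
      proof (rule mult_left_mono)
        have "norm (f (g y) - f (g t)) \<le> K * \<bar>y - t\<bar>" by (rule lip[OF y(1) t])
        also have "\<dots> \<le> (\<bar>K\<bar> + 1) * \<bar>y - t\<bar>" by (rule mult_right_mono) auto
        finally show "norm (f (g y) - f (g t)) \<le> (\<bar>K\<bar> + 1) * \<bar>y - t\<bar>" .
      qed (use \<epsilon> in simp)
      also have "\<dots> = e * \<bar>y - t\<bar>"
        using abs_ge_zero[of K] by (simp add: \<epsilon>_def del: abs_ge_zero)
      finally show "norm (\<nu> \<bullet> f (g y) - \<nu> \<bullet> f (g t) - (y - t) *\<^sub>R 0) \<le> e * norm (y - t)"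
        by (simp add: inner_diff_right)
    qed
  qed (simp add: bounded_linear_zero)
  obtain c where "\<And>t. t \<in> {a..b} \<Longrightarrow> \<nu> \<bullet> f (g t) = c"
    using has_vector_derivative_zero_constant[OF convex_real_interval(5), of a b "\<lambda>t. \<nu> \<bullet> f (g t)"] der by blast
  then show ?thesis using st by simp
qed

text \<open>Where the normal is constant along the lift of a plane segment, the lift lies both in a plane
  through the normal \<open>n p\<close> and in a plane orthogonal to \<open>\<nu>\<close>; these are transversal, and the lift is
  straight.\<close>

lemma graph_segment:
  assumes gcc: "graph_chart M f p (n p) P r G K" and pM: "p \<in> M"
    and ball: "\<And>t. t \<in> {0..1} \<Longrightarrow> z + t *\<^sub>R d \<in> ball (P (f p)) r"
    and nG: "\<And>t. t \<in> {0..1} \<Longrightarrow> n (G (z + t *\<^sub>R d)) = \<nu>" and tr: "\<nu> \<bullet> n p \<noteq> 0"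
    and w: "w = f (G (z + d)) - f (G z)"
  shows "nseg (G z) w" "\<And>t. t \<in> {0..1} \<Longrightarrow> ex (G z) (t *\<^sub>R w) = G (z + t *\<^sub>R d)"
proof -
  note gc = graph_chartD[OF gcc]
  define g where "g t = G (z + t *\<^sub>R d)" for t
  have gM: "g t \<in> M" if "t \<in> {0..1}" for t using gc(8) ball[OF that] by (simp add: g_def)
  have cg: "continuous_on {0..1} g" unfolding g_def
    by (rule continuous_on_compose2[OF gc(6)]) (use ball in \<open>auto intro!: continuous_intros\<close>)
  have Pg: "P (f (g t)) = z + t *\<^sub>R d" if "t \<in> {0..1}" for t using gc(7) ball[OF that] by (simp add: g_def)
  have flat: "\<nu> \<bullet> f (g s) = \<nu> \<bullet> f (g t)" if "s \<in> {0..1}" "t \<in> {0..1}" for s t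
  proof (rule n_const_curve_flat[OF gM cg _ _ that])
    fix s t :: real assume st: "s \<in> {0..1}" "t \<in> {0..1}"
    have "norm (f (g s) - f (g t)) \<le> K * norm ((z + s *\<^sub>R d) - (z + t *\<^sub>R d))"
      unfolding g_def by (rule gc(13)[OF ball[OF st(1)] ball[OF st(2)]])
    also have "(z + s *\<^sub>R d) - (z + t *\<^sub>R d) = (s - t) *\<^sub>R d" by (simp add: algebra_simps)
    finally show "norm (f (g s) - f (g t)) \<le> (K * norm d) * \<bar>s - t\<bar>" by (simp add: mult_ac)
  qed (use nG in \<open>auto simp: g_def\<close>)
  have w': "w = f (g 1) - f (g 0)" using w by (simp add: g_def)
  have fg: "f (g t) = f (g 0) + t *\<^sub>R w" if t: "t \<in> {0..1}" for t
  proof -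
    let ?y = "f (g t) - f (g 0) - t *\<^sub>R w"
    have "P ?y = 0"
      using Pg[OF t] Pg[of 0] Pg[of 1] unfolding w'
      by (simp add: linear_diff[OF gc(1)] linear_scale[OF gc(1)])
    then obtain c where c: "?y = c *\<^sub>R n p" using gc(12) by blast
    have "\<nu> \<bullet> ?y = 0"
      unfolding w' using flat[OF t, of 0] flat[of 1 0] by (simp add: inner_diff_right inner_add_right)
    then have "c = 0" using tr unfolding c by simp
    then show ?thesis using c by (simp add: algebra_simps)
  qed
  have "nlift g (G z) w"
    unfolding nlift_def using cg gM fg nG[of 0] nG by (auto simp: g_def)
  from nlift_ex(1)[OF this] show ns: "nseg (G z) w" .
  fix t :: real assume t: "t \<in> {0..1}"
  have "ex (g 0) ((t - 0) *\<^sub>R w) = g t"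
    using curve_ex(2)[OF cg gM fg, of \<nu> 0 t] nG t by (auto simp: g_def)
  then show "ex (G z) (t *\<^sub>R w) = G (z + t *\<^sub>R d)" by (simp add: g_def)
qed

end

section \<open>Surfaces ruled over a closed set and flat elsewhere\<close>

text \<open>In the application \<open>C\<close> is the closure of the set where the differential of the Gauss map is not zero.
  The last assumption says that every point of \<open>C\<close> is a limit of points on lines that carry a
  different value of \<open>n\<close>.\<close>

locale developable_surface = proper_surface M f n
  for M :: "'m::{t2_space,second_countable_topology} set" and f n :: "'m \<Rightarrow> real^3" +
  fixes C :: "'m set"
  assumes C_closedin: "closedin (top_of_set M) C"
    and locally_const_off_C: "x \<in> M \<Longrightarrow> x \<notin> C \<Longrightarrow>
        \<exists>U. openin (top_of_set M) U \<and> x \<in> U \<and> (\<forall>y\<in>U. n y = n x)"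
    and C_approx: "x \<in> C \<Longrightarrow> \<exists>(X :: nat \<Rightarrow> 'm) w. X \<longlonglongrightarrow> x \<and>
        (\<forall>i. X i \<in> C \<and> n (X i) \<noteq> n x \<and> norm (w i) = 1 \<and> nline (X i) (w i) \<and>
             (\<forall>t. ex (X i) (t *\<^sub>R w i) \<in> C))"
begin

lemma C_subset: "x \<in> C \<Longrightarrow> x \<in> M"
  using C_closedin closedin_imp_subset by blast

lemma C_limit:
  assumes "\<And>i::nat. X i \<in> C" "X \<longlonglongrightarrow> x" "x \<in> M" shows "x \<in> C"
proof (rule ccontr)
  assume "x \<notin> C"
  moreover have "openin (top_of_set M) (M - C)" using C_closedin by (simp add: openin_diff)
  ultimately have "\<forall>\<^sub>F i in sequentially. X i \<in> M - C"
    using assms by (intro eventually_in_openin[of M]) (auto simp: C_subset)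
  then show False using assms(1) by (auto dest: eventually_happens)
qed

lemma C_line:
  assumes x: "x \<in> C"
  obtains w where "norm w = 1" "nline x w" "\<And>t. ex x (t *\<^sub>R w) \<in> C"
proof -
  obtain X w where X: "X \<longlonglongrightarrow> x" and
    Xi: "\<And>i::nat. X i \<in> C \<and> n (X i) \<noteq> n x \<and> norm (w i) = 1 \<and> nline (X i) (w i) \<and>
             (\<forall>t. ex (X i) (t *\<^sub>R w i) \<in> C)"
    using C_approx[OF x] by blast
  obtain v r where v: "norm v = 1" "strict_mono (r :: nat \<Rightarrow> nat)" "(\<lambda>i. w (r i)) \<longlonglongrightarrow> v"
    using unit_vector_subsequence[of w] Xi by blast
  have Xr: "(\<lambda>i. X (r i)) \<longlonglongrightarrow> x" using LIMSEQ_subseq_LIMSEQ[OF X v(2)] by (simp add: o_def)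
  have M: "X (r i) \<in> M" for i using Xi C_subset by blast
  have line: "nline (X (r i)) (w (r i))" for i using Xi by blast
  have nx: "nline x v" by (rule nline_limit[OF M Xr C_subset[OF x] v(3) line])
  have "ex x (t *\<^sub>R v) \<in> C" for t
  proof (rule C_limit)
    show "(\<lambda>i. ex (X (r i)) (t *\<^sub>R w (r i))) \<longlonglongrightarrow> ex x (t *\<^sub>R v)"
      by (rule ex_limit(2)[OF M Xr C_subset[OF x] tendsto_scaleR[OF tendsto_const v(3)] nlineD(1)[OF line]])
    show "ex (X (r i)) (t *\<^sub>R w (r i)) \<in> C" for i using Xi by blast
  qed (rule nlineD(3)[OF nx])
  then show ?thesis using that v(1) nx by blast
qed

text \<open>Lines near \<open>x\<close> on which \<open>n\<close> has values other than \<open>n x\<close> cannot meet a line through \<open>x\<close>, where \<open>n\<close> is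
  constant. As transversal lines would meet, every line through \<open>x\<close> is parallel to a limit \<open>v\<close> of
  their directions.\<close>

theorem C_line_unique:
  assumes x: "x \<in> C" and a: "nline x a" "a \<noteq> 0" and b: "nline x b"
  shows "\<exists>c. b = c *\<^sub>R a"
proof (cases "b = 0")
  case True then show ?thesis by (metis scaleR_zero_left)
next
  case b0: False
  obtain X w where X: "X \<longlonglongrightarrow> x" and
    Xi: "\<And>i::nat. X i \<in> C \<and> n (X i) \<noteq> n x \<and> norm (w i) = 1 \<and> nline (X i) (w i) \<and>
             (\<forall>t. ex (X i) (t *\<^sub>R w i) \<in> C)"
    using C_approx[OF x] by blast
  obtain v r where v: "norm v = 1" "strict_mono (r :: nat \<Rightarrow> nat)" "(\<lambda>i. w (r i)) \<longlonglongrightarrow> v"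
    using unit_vector_subsequence[of w] Xi by blast
  have Xr: "(\<lambda>i. X (r i)) \<longlonglongrightarrow> x" using LIMSEQ_subseq_LIMSEQ[OF X v(2)] by (simp add: o_def)
  have M: "X (r i) \<in> M" for i using Xi C_subset by blast
  have line: "nline (X (r i)) (w (r i))" for i using Xi by blast
  have nx: "nline x v" by (rule nline_limit[OF M Xr C_subset[OF x] v(3) line])
  have par: "\<exists>c. v = c *\<^sub>R u" if u: "nline x u" "u \<noteq> 0" for u
  proof (rule ccontr)
    assume "\<not> ?thesis"
    then have "v \<bullet> (n x \<times> u) \<noteq> 0"
      using parallel_in_plane[OF norm_n[OF C_subset[OF x]] nline_tangent[OF u(1)] nline_tangent[OF nx] u(2)] by blast
    from transversal_lines_meet[OF M Xr v(3) line u this]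
    obtain i s \<mu> where "ex (X (r i)) (s *\<^sub>R w (r i)) = ex x (\<mu> *\<^sub>R u)"
      by (auto dest: eventually_happens)
    moreover have "n (ex (X (r i)) (s *\<^sub>R w (r i))) = n (X (r i))" by (rule nlineD(5)[OF line])
    moreover have "n (ex x (\<mu> *\<^sub>R u)) = n x" by (rule nlineD(5)[OF u(1)])
    ultimately have "n (X (r i)) = n x" by simp
    then show False using Xi by blast
  qed
  obtain c where c: "v = c *\<^sub>R a" using par[OF a] by blast
  obtain d where d: "v = d *\<^sub>R b" using par[OF b b0] by blast
  have "d \<noteq> 0" using d v(1) by auto
  moreover have "(1 / d) *\<^sub>R (d *\<^sub>R b) = (1 / d) *\<^sub>R (c *\<^sub>R a)" using c d by simp
  ultimately have "b = (c / d) *\<^sub>R a" by simp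
  then show ?thesis by blast
qed

lemma C_line_in_C:
  assumes "x \<in> C" "nline x a" shows "ex x (t *\<^sub>R a) \<in> C"
proof -
  obtain w where w: "norm w = 1" "nline x w" "\<And>t. ex x (t *\<^sub>R w) \<in> C" using C_line[OF assms(1)] by blast
  have "w \<noteq> 0" using w(1) by auto
  from C_line_unique[OF assms(1) w(2) this assms(2)] obtain c where "a = c *\<^sub>R w" ..
  then show ?thesis using w(3)[of "t * c"] by simp
qed

lemma n_const_off_C:
  fixes g :: "real \<Rightarrow> 'm"
  assumes S: "connected S" "continuous_on S g" "\<And>t. t \<in> S \<Longrightarrow> g t \<in> M \<and> g t \<notin> C" and ab: "a \<in> S" "b \<in> S"
  shows "n (g b) = n (g a)"
proof (rule connected_induction_simple[of S a b "\<lambda>t. n (g t) = n (g a)"])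
  fix t assume t: "t \<in> S"
  then obtain U where U: "openin (top_of_set M) U" "g t \<in> U" "\<And>y. y \<in> U \<Longrightarrow> n y = n (g t)"
    using locally_const_off_C S(3) by metis
  have "openin (top_of_set S) (S \<inter> g -` U)"
    by (rule continuous_openin_preimage[OF S(2) _ U(1)]) (use S(3) in auto)
  moreover have "t \<in> S \<inter> g -` U" using t U(2) by simp
  moreover have "\<forall>x\<in>S \<inter> g -` U. \<forall>y\<in>S \<inter> g -` U. n (g x) = n (g a) \<longrightarrow> n (g y) = n (g a)"
    using U(3) by (metis IntE vimageE)
  ultimately show "\<exists>T. openin (top_of_set S) T \<and> t \<in> T \<and>
      (\<forall>x\<in>T. \<forall>y\<in>T. n (g x) = n (g a) \<longrightarrow> n (g y) = n (g a))" by blast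
qed (use S ab in auto)

text \<open>Off \<open>C\<close> the normal is locally constant, so a piece of the local graph is planar and
  contains short segments in all tangent directions.\<close>

lemma planar_extension:
  assumes x: "x \<in> M" "x \<notin> C" and w: "n x \<bullet> w = 0"
  shows "\<exists>\<epsilon>>0. \<forall>s. 0 \<le> s \<and> s \<le> \<epsilon> \<longrightarrow> nseg x (s *\<^sub>R w) \<and> ex x (s *\<^sub>R w) \<notin> C"
proof -
  obtain P r G K where gcc: "graph_chart M f x (n x) P r G K" using local_graph[OF x(1)] by metis
  note gc = graph_chartD[OF gcc]
  let ?B = "ball (P (f x)) r"
  obtain U where U: "openin (top_of_set M) U" "x \<in> U" "\<And>y. y \<in> U \<Longrightarrow> n y = n x"
    using locally_const_off_C[OF x] by blast
  have "openin (top_of_set M) (U \<inter> (M - C))" using U(1) C_closedin by (intro openin_Int) (auto simp: openin_diff)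
  then have "openin (top_of_set ?B) (?B \<inter> G -` (U \<inter> (M - C)))"
    using gc(8) by (intro continuous_openin_preimage[OF gc(6)]) auto
  then have "open (?B \<inter> G -` (U \<inter> (M - C)))" using openin_open_eq[OF open_ball] by blast
  moreover have "P (f x) \<in> ?B \<inter> G -` (U \<inter> (M - C))" using gc(2,5) U(2) x by simp
  ultimately obtain \<delta> where \<delta>: "0 < \<delta>" "ball (P (f x)) \<delta> \<subseteq> ?B \<inter> G -` (U \<inter> (M - C))"
    using open_contains_ball by blast
  define \<epsilon> where "\<epsilon> = \<delta> / (norm (P w) + 1)"
  have np: "0 < norm (P w) + 1" using norm_ge_zero[of "P w"] by linarith
  have \<epsilon>: "0 < \<epsilon>" using \<delta>(1) np by (simp add: \<epsilon>_def)
  have in_ball: "P (f x) + t *\<^sub>R P w \<in> ball (P (f x)) \<delta>" if "0 \<le> t" "t \<le> \<epsilon>" for t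
  proof -
    have "t * norm (P w) \<le> \<epsilon> * norm (P w)" using that by (simp add: mult_right_mono)
    also have "\<dots> < \<epsilon> * (norm (P w) + 1)" using \<epsilon> by simp
    also have "\<dots> = \<delta>" using np by (simp add: \<epsilon>_def)
    finally show ?thesis using that by (simp add: dist_norm)
  qed
  have "nseg x (s *\<^sub>R w) \<and> ex x (s *\<^sub>R w) \<notin> C" if s: "0 \<le> s" "s \<le> \<epsilon>" for s
  proof -
    define d where "d = s *\<^sub>R P w"
    define u where "u = f (G (P (f x) + d)) - f (G (P (f x)))"
    have st: "P (f x) + t *\<^sub>R d \<in> ball (P (f x)) \<delta>" if "t \<in> {0..1}" for t
      using in_ball[of "t * s"] that s mult_le_one[of t s] mult_left_le_one_le[of s t] by (auto simp: d_def)
    have b: "P (f x) + t *\<^sub>R d \<in> ?B" "G (P (f x) + t *\<^sub>R d) \<in> U \<inter> (M - C)" if "t \<in> {0..1}" for t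
      using st[OF that] \<delta>(2) by blast+
    have nG: "n (G (P (f x) + t *\<^sub>R d)) = n x" if "t \<in> {0..1}" for t
      using b(2)[OF that] U(3) by blast
    have ne: "n x \<bullet> n x \<noteq> 0" using n_inner[OF x(1)] by simp
    note seg = graph_segment[OF gcc x(1) b(1) nG ne u_def, unfolded gc(5)]
    have "n x \<bullet> (u - s *\<^sub>R w) = 0" using nseg_tangent[OF seg(1)] w by (simp add: inner_diff_right)
    moreover have "P (u - s *\<^sub>R w) = 0"
      using gc(7)[OF b(1)[of 1]] gc(7)[OF b(1)[of 0]]
      by (simp add: u_def d_def linear_diff[OF gc(1)] linear_scale[OF gc(1)])
    then obtain c where "u - s *\<^sub>R w = c *\<^sub>R n x" using gc(12) by blast
    ultimately have "u = s *\<^sub>R w" using ne by auto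
    moreover have "ex x u = G (P (f x) + d)" using seg(2)[of 1] by simp
    ultimately show ?thesis using seg(1) b(2)[of 1] by simp
  qed
  then show ?thesis using \<epsilon> by blast
qed

end

section \<open>Translating a ruling across a planar piece\<close>

lemma tendsto_from_below:
  fixes t :: real
  assumes "0 < t"
  obtains X :: "nat \<Rightarrow> real" where "\<And>i. 0 \<le> X i" "\<And>i. X i < t" "X \<longlonglongrightarrow> t"
proof
  define X where "X i = t * (1 - inverse (real (Suc i)))" for i
  show "0 \<le> X i" "X i < t" for i using assms by (auto simp: X_def field_simps)
  have "X \<longlonglongrightarrow> t * (1 - 0)" unfolding X_def[abs_def]
    by (intro tendsto_intros LIMSEQ_inverse_real_of_nat)
  then show "X \<longlonglongrightarrow> t" by simp
qed

lemma bounded_bilinear_cross: "bounded_bilinear (\<times>)"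
  using bilinear_cross bilinear_conv_bounded_bilinear by blast

context developable_surface
begin

text \<open>Continue the segment by planar extension; it can only be stopped by \<open>C\<close>.\<close>

lemma ray_first_hit:
  assumes q: "q \<in> M" "q \<notin> C" and u: "n q \<bullet> u = 0" and b: "0 \<le> b"
  shows "(nseg q (b *\<^sub>R u) \<and> (\<forall>\<mu>. 0 \<le> \<mu> \<and> \<mu> < b \<longrightarrow> ex q (\<mu> *\<^sub>R u) \<notin> C)) \<or>
    (\<exists>l. 0 < l \<and> l < b \<and> nseg q (l *\<^sub>R u) \<and> ex q (l *\<^sub>R u) \<in> C \<and>
       (\<forall>\<mu>. 0 \<le> \<mu> \<and> \<mu> < l \<longrightarrow> ex q (\<mu> *\<^sub>R u) \<notin> C))"
proof (rule disjCI)
  assume no: "\<not> (\<exists>l. 0 < l \<and> l < b \<and> nseg q (l *\<^sub>R u) \<and> ex q (l *\<^sub>R u) \<in> C \<and>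
       (\<forall>\<mu>. 0 \<le> \<mu> \<and> \<mu> < l \<longrightarrow> ex q (\<mu> *\<^sub>R u) \<notin> C))"
  have *: "t \<le> b \<longrightarrow> nseg q (t *\<^sub>R u) \<and> (t < b \<longrightarrow> ex q (t *\<^sub>R u) \<notin> C)" if "0 \<le> t" for t
  proof (rule real_continuation[OF _ _ _ that])
    show "0 \<le> b \<longrightarrow> nseg q (0 *\<^sub>R u) \<and> (0 < b \<longrightarrow> ex q (0 *\<^sub>R u) \<notin> C)"
      using nseg_0[OF q(1)] q(2) by simp
  next
    fix t :: real
    assume t: "0 \<le> t" "\<And>s. 0 \<le> s \<Longrightarrow> s \<le> t \<Longrightarrow> s \<le> b \<longrightarrow> nseg q (s *\<^sub>R u) \<and> (s < b \<longrightarrow> ex q (s *\<^sub>R u) \<notin> C)"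
    show "\<exists>\<epsilon>>0. \<forall>s. t < s \<and> s < t + \<epsilon> \<longrightarrow> s \<le> b \<longrightarrow> nseg q (s *\<^sub>R u) \<and> (s < b \<longrightarrow> ex q (s *\<^sub>R u) \<notin> C)"
    proof (cases "t < b")
      case False
      then show ?thesis by (intro exI[of _ 1]) auto
    next
      case True
      then have x: "nseg q (t *\<^sub>R u)" "ex q (t *\<^sub>R u) \<notin> C" using t(2)[of t] t(1) by auto
      have "n (ex q (t *\<^sub>R u)) \<bullet> u = 0" using nseg_ex(3)[OF x(1)] u by simp
      from planar_extension[OF nseg_ex(1)[OF x(1)] x(2) this]
      obtain \<epsilon> where \<epsilon>: "0 < \<epsilon>" "\<And>s. 0 \<le> s \<Longrightarrow> s \<le> \<epsilon> \<Longrightarrow> nseg (ex q (t *\<^sub>R u)) (s *\<^sub>R u)"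
        "\<And>s. 0 \<le> s \<Longrightarrow> s \<le> \<epsilon> \<Longrightarrow> ex (ex q (t *\<^sub>R u)) (s *\<^sub>R u) \<notin> C" by blast
      have "nseg q (s *\<^sub>R u) \<and> ex q (s *\<^sub>R u) \<notin> C" if "t < s" "s < t + \<epsilon>" for s
        using nseg_append[OF x(1) \<epsilon>(2)[of "s - t"] t(1)] \<epsilon>(3)[of "s - t"] that by simp
      then show ?thesis using \<epsilon>(1) by blast
    qed
  next
    fix t :: real
    assume t: "0 < t" "\<And>s. 0 \<le> s \<Longrightarrow> s < t \<Longrightarrow> s \<le> b \<longrightarrow> nseg q (s *\<^sub>R u) \<and> (s < b \<longrightarrow> ex q (s *\<^sub>R u) \<notin> C)"
    show "t \<le> b \<longrightarrow> nseg q (t *\<^sub>R u) \<and> (t < b \<longrightarrow> ex q (t *\<^sub>R u) \<notin> C)"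
    proof
      assume tb: "t \<le> b"
      obtain X where X: "\<And>i::nat. 0 \<le> X i" "\<And>i. X i < t" "X \<longlonglongrightarrow> t"
        using tendsto_from_below[OF t(1)] by blast
      have "nseg q (X i *\<^sub>R u)" for i using t(2)[OF X(1,2)] X(2)[of i] tb by simp
      then have ns: "nseg q (t *\<^sub>R u)"
        by (rule ex_limit(1)[OF q(1) tendsto_const q(1) tendsto_scaleR[OF X(3) tendsto_const]])
      moreover have "ex q (t *\<^sub>R u) \<notin> C" if "t < b"
        using no t ns that by force
      ultimately show "nseg q (t *\<^sub>R u) \<and> (t < b \<longrightarrow> ex q (t *\<^sub>R u) \<notin> C)" by blast
    qed
  qed
  show "nseg q (b *\<^sub>R u) \<and> (\<forall>\<mu>. 0 \<le> \<mu> \<and> \<mu> < b \<longrightarrow> ex q (\<mu> *\<^sub>R u) \<notin> C)"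
    using *[OF b] * by (auto dest: less_imp_le)
qed

text \<open>Segments that reach their endpoint without having met \<open>C\<close>. The endpoint
  may belong to \<open>C\<close>.\<close>

definition clear_chord :: "'m \<Rightarrow> real^3 \<Rightarrow> 'm \<Rightarrow> bool" where
  "clear_chord q u e \<longleftrightarrow> nseg q u \<and> ex q u = e \<and> (\<forall>l. 0 \<le> l \<and> l < 1 \<longrightarrow> ex q (l *\<^sub>R u) \<notin> C)"

text \<open>A point \<open>q\<close> off \<open>C\<close> sees a point \<open>b\<close> of a line in direction \<open>m\<close>. It is shown that \<open>q\<close> sees
  the whole half-line; \<open>u t\<close> is the vector from \<open>q\<close> to the point with parameter \<open>t\<close>, and \<open>\<kappa> \<noteq> 0\<close> says
  that the line does not pass through \<open>q\<close>.\<close>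

context
  fixes q b :: 'm and m u0 :: "real^3" and \<kappa> :: real and u :: "real \<Rightarrow> real^3"
  assumes q: "q \<in> M" "q \<notin> C"
    and line: "nline b m"
    and ch0: "clear_chord q u0 b"
    and \<kappa>: "u0 \<bullet> (n q \<times> m) = \<kappa>" "\<kappa> \<noteq> 0"
    and u: "\<And>t. u t = u0 + t *\<^sub>R m"
begin

lemma fan_facts:
  shows "n b = n q" "n q \<bullet> m = 0" "n q \<bullet> u t = 0" "u t \<bullet> (n q \<times> m) = \<kappa>" "f b = f q + u0"
    "f (ex b (t *\<^sub>R m)) = f q + u t" "m \<noteq> 0"
proof -
  have ch: "nseg q u0" "ex q u0 = b" using ch0 by (auto simp: clear_chord_def)
  show nb: "n b = n q" using nseg_ex(3)[OF ch(1)] ch(2) by simp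
  show nm: "n q \<bullet> m = 0" using nline_tangent[OF line] nb by simp
  show "n q \<bullet> u t = 0" using nseg_tangent[OF ch(1)] nm by (simp add: u inner_add_right)
  show "u t \<bullet> (n q \<times> m) = \<kappa>" using \<kappa> by (simp add: u inner_add_left inner_cross_self)
  show fb: "f b = f q + u0" using nseg_ex(2)[OF ch(1)] ch(2) by simp
  show "f (ex b (t *\<^sub>R m)) = f q + u t" using nlineD(4)[OF line] fb by (simp add: u)
  show "m \<noteq> 0" using \<kappa> by auto
qed

lemma u_tendsto: "X \<longlonglongrightarrow> t \<Longrightarrow> (\<lambda>i. u (X i)) \<longlonglongrightarrow> u t" for X :: "nat \<Rightarrow> real"
  unfolding u by (intro tendsto_intros)

text \<open>If the limit of the chords met \<open>C\<close>, the line through the point of contact would either cross the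
  earlier chords, whose interior avoids \<open>C\<close>, or contain the limit chord and with it \<open>q\<close>.\<close>

lemma fan_limit:
  assumes t: "0 < t" and ch: "\<And>s. 0 \<le> s \<Longrightarrow> s < t \<Longrightarrow> clear_chord q (u s) (ex b (s *\<^sub>R m))"
  shows "clear_chord q (u t) (ex b (t *\<^sub>R m))"
proof -
  obtain X where X: "\<And>i::nat. 0 \<le> X i" "\<And>i. X i < t" "X \<longlonglongrightarrow> t"
    using tendsto_from_below[OF t] by blast
  have chX: "nseg q (u (X i))" "ex q (u (X i)) = ex b (X i *\<^sub>R m)"
    "\<And>l. 0 \<le> l \<Longrightarrow> l < 1 \<Longrightarrow> ex q (l *\<^sub>R u (X i)) \<notin> C" for i
    using ch[OF X(1,2), of i] by (auto simp: clear_chord_def)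
  note lim = ex_limit[OF q(1) tendsto_const q(1) u_tendsto[OF X(3)] chX(1)]
  have "(\<lambda>i. ex b (X i *\<^sub>R m)) \<longlonglongrightarrow> ex b (t *\<^sub>R m)"
    by (rule ex_limit(2)[OF _ tendsto_const _ tendsto_scaleR[OF X(3) tendsto_const]])
      (rule nlineD[OF line])+
  with lim(2) have end_eq: "ex q (u t) = ex b (t *\<^sub>R m)" unfolding chX(2) by (rule LIMSEQ_unique)
  have "ex q (l *\<^sub>R u t) \<notin> C" if l: "0 \<le> l" "l < 1" for l
  proof
    define y where "y = ex q (l *\<^sub>R u t)"
    assume "ex q (l *\<^sub>R u t) \<in> C"
    then have yC: "y \<in> C" by (simp add: y_def)
    have "l \<noteq> 0" using yC nseg_0(2)[OF q(1)] q(2) by (auto simp: y_def)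
    have nsl: "nseg q (l *\<^sub>R u t)" using nseg_curve(5)[OF lim(1), of l] l by simp
    have y: "y \<in> M" "f y = f q + l *\<^sub>R u t" "n y = n q" using nseg_ex[OF nsl] by (auto simp: y_def)
    obtain w where w: "norm w = 1" "nline y w" "\<And>t. ex y (t *\<^sub>R w) \<in> C" using C_line[OF yC] by blast
    have nw: "n q \<bullet> w = 0" using nline_tangent[OF w(2)] y(3) by simp
    have ut: "u t \<noteq> 0" using fan_facts(4)[of t] \<kappa>(2) by auto
    show False
    proof (cases "w \<bullet> (n q \<times> u t) = 0")
      case True
      then obtain c where c: "w = c *\<^sub>R u t"
        using parallel_in_plane[OF norm_n[OF q(1)] fan_facts(3) nw ut] by blast
      have "c \<noteq> 0" using c w(1) by auto
      have "ex y ((- l / c) *\<^sub>R w) = q"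
        using nseg_reverse(2)[OF nsl] \<open>c \<noteq> 0\<close> by (simp add: c y_def)
      then show False using w(3)[of "- l / c"] q(2) by simp
    next
      case False
      define \<tau> where "\<tau> i = n q \<times> u (X i)" for i
      have \<tau>: "\<tau> \<longlonglongrightarrow> n q \<times> u t" unfolding \<tau>_def[abs_def]
        by (intro bounded_bilinear.tendsto[OF bounded_bilinear_cross] tendsto_const u_tendsto X(3))
      define s where "s i = - (l * (u t \<bullet> \<tau> i)) / (w \<bullet> \<tau> i)" for i
      have wt: "(\<lambda>i. w \<bullet> \<tau> i) \<longlonglongrightarrow> w \<bullet> (n q \<times> u t)" by (intro tendsto_intros \<tau>)
      have "s \<longlonglongrightarrow> - (l * (u t \<bullet> (n q \<times> u t))) / (w \<bullet> (n q \<times> u t))"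
        unfolding s_def[abs_def] by (intro tendsto_intros \<tau> False)
      then have s: "s \<longlonglongrightarrow> 0" by (simp add: inner_cross_self)
      define \<mu> where "\<mu> i = (l *\<^sub>R u t + s i *\<^sub>R w) \<bullet> u (X i) / (u (X i) \<bullet> u (X i))" for i
      have "\<mu> \<longlonglongrightarrow> (l *\<^sub>R u t + 0 *\<^sub>R w) \<bullet> u t / (u t \<bullet> u t)"
        unfolding \<mu>_def[abs_def] by (intro tendsto_intros s u_tendsto[OF X(3)]) (use ut in simp)
      then have \<mu>: "\<mu> \<longlonglongrightarrow> l" using ut by simp
      \<comment> \<open>clipping ensures that the segments exist also for the finitely many irrelevant indices\<close>
      define \<mu>' where "\<mu>' i = max 0 (min 1 (\<mu> i))" for i
      have \<mu>'01: "\<mu>' i \<in> {0..1}" for i by (auto simp: \<mu>'_def)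
      have "\<mu>' \<longlonglongrightarrow> max 0 (min 1 l)" unfolding \<mu>'_def[abs_def] by (intro tendsto_intros \<mu>)
      then have \<mu>': "\<mu>' \<longlonglongrightarrow> l" using l by simp
      have Y: "(\<lambda>i. ex y (s i *\<^sub>R w)) \<longlonglongrightarrow> y"
        by (rule ex_tendsto_0[OF y(1) tendsto_const y(1)])
          (use tendsto_scaleR[OF s tendsto_const[of w]] nlineD(1)[OF w(2)] in auto)
      have nsZ: "nseg q (\<mu>' i *\<^sub>R u (X i))" for i by (rule nseg_curve(5)[OF chX(1) \<mu>'01])
      have Z: "(\<lambda>i. ex q (\<mu>' i *\<^sub>R u (X i))) \<longlonglongrightarrow> y" unfolding y_def
        by (rule ex_limit(2)[OF q(1) tendsto_const q(1) tendsto_scaleR[OF \<mu>' u_tendsto[OF X(3)]] nsZ])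
      have ev: "\<forall>\<^sub>F i in sequentially. 0 < \<mu> i" "\<forall>\<^sub>F i in sequentially. \<mu> i < 1"
        using order_tendstoD[OF \<mu>] l \<open>l \<noteq> 0\<close> by auto
      have "\<forall>\<^sub>F i in sequentially. False"
        using locally_injective_mod_normal[OF y(1) nlineD(3)[OF w(2)] Y nseg_ex(1)[OF nsZ] Z]
          tendsto_imp_eventually_ne[OF wt False] ev
      proof eventually_elim
        case (elim i)
        define d where "d = l *\<^sub>R u t + s i *\<^sub>R w"
        have \<mu>i: "\<mu>' i = \<mu> i" using elim by (simp add: \<mu>'_def)
        have "u (X i) \<noteq> 0" using fan_facts(4)[of "X i"] \<kappa>(2) by auto
        moreover have "n q \<bullet> d = 0" using fan_facts(3)[of t] nw by (simp add: d_def inner_add_right)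
        moreover have "d \<bullet> \<tau> i = 0" using elim(2) by (simp add: d_def s_def inner_diff_left)
        ultimately have "d = (d \<bullet> u (X i) / (u (X i) \<bullet> u (X i))) *\<^sub>R u (X i)"
          using frame_expansion[OF norm_n[OF q(1)] fan_facts(3), of "X i" d]
          by (simp add: \<tau>_def inner_commute)
        then have "d = \<mu> i *\<^sub>R u (X i)" by (simp add: \<mu>_def d_def)
        then have "f (ex y (s i *\<^sub>R w)) - f (ex q (\<mu>' i *\<^sub>R u (X i))) = 0 *\<^sub>R n y"
          using nlineD(4)[OF w(2), of "s i"] nseg_ex(2)[OF nsZ, of i] y(2) unfolding \<mu>i
          by (simp add: d_def algebra_simps)
        then have "ex y (s i *\<^sub>R w) = ex q (\<mu>' i *\<^sub>R u (X i))" using elim(1) by blast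
        then show False using w(3)[of "s i"] chX(3)[of "\<mu> i" i] elim \<mu>i by simp
      qed
      then show False by simp
    qed
  qed
  then show ?thesis using lim(1) end_eq by (simp add: clear_chord_def)
qed

text \<open>Suppose that chords arbitrarily close to a clear one are blocked by points \<open>y i\<close> of \<open>C\<close>. These points tend
  to the endpoint \<open>e\<close>, as the clear chord avoids \<open>C\<close> elsewhere, and the lines \<open>W i\<close> through them tend
  to the line through \<open>e\<close>. The line through \<open>y i\<close> leaves the triangle spanned by \<open>q\<close> and the line through
  \<open>e\<close> either through the clear chord, which avoids \<open>C\<close>, or through the line through \<open>e\<close>, which
  contradicts uniqueness of lines in \<open>C\<close>.\<close>

lemma fan_reach:
  assumes ch: "clear_chord q (u t) (ex b (t *\<^sub>R m))"
  shows "\<exists>\<epsilon>>0. \<forall>s. t < s \<and> s < t + \<epsilon> \<longrightarrow>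
    nseg q (u s) \<and> (\<forall>l. 0 \<le> l \<and> l < 1 \<longrightarrow> ex q (l *\<^sub>R u s) \<notin> C)"
proof (rule right_neighbourhood_by_sequences)
  fix X :: "nat \<Rightarrow> real"
  assume X: "\<And>i. t < X i" "X \<longlonglongrightarrow> t" and
    bad: "\<And>i. \<not> (nseg q (u (X i)) \<and> (\<forall>l. 0 \<le> l \<and> l < 1 \<longrightarrow> ex q (l *\<^sub>R u (X i)) \<notin> C))"
  define e where "e = ex q (u t)"
  have cht: "nseg q (u t)" "ex b (t *\<^sub>R m) = e" "\<And>l. 0 \<le> l \<Longrightarrow> l < 1 \<Longrightarrow> ex q (l *\<^sub>R u t) \<notin> C"
    using ch by (auto simp: clear_chord_def e_def)
  have "\<exists>l. 0 < l \<and> l < 1 \<and> nseg q (l *\<^sub>R u (X i)) \<and> ex q (l *\<^sub>R u (X i)) \<in> C" for i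
    using ray_first_hit[OF q fan_facts(3)[of "X i"], of 1] bad[of i] by auto
  then obtain lam where lam: "\<And>i. 0 < lam i" "\<And>i. lam i < 1" "\<And>i. nseg q (lam i *\<^sub>R u (X i))"
    "\<And>i. ex q (lam i *\<^sub>R u (X i)) \<in> C" by metis
  have "\<exists>w. norm w = 1 \<and> nline (ex q (lam i *\<^sub>R u (X i))) w" for i
    using C_line[OF lam(4)[of i]] by blast
  then obtain w where w: "\<And>i. norm (w i) = 1" "\<And>i. nline (ex q (lam i *\<^sub>R u (X i))) (w i)" by metis
  have "compact (Sigma {0..1::real} (\<lambda>_. sphere (0::real^3) 1))" by (intro compact_Times compact_Icc compact_sphere)
  moreover have "\<forall>i. (lam i, w i) \<in> Sigma {0..1::real} (\<lambda>_. sphere (0::real^3) 1)"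
    using lam(1,2) w(1) by (auto intro: less_imp_le)
  ultimately obtain p r where p: "p \<in> Sigma {0..1::real} (\<lambda>_. sphere (0::real^3) 1)" and r: "strict_mono (r :: nat \<Rightarrow> nat)"
    "((\<lambda>i. (lam i, w i)) \<circ> r) \<longlonglongrightarrow> p" unfolding compact_def by meson
  obtain L v where pLv: "p = (L, v)" by (cases p)
  define l where "l i = lam (r i)" for i
  define W where "W i = w (r i)" for i
  define U where "U i = u (X (r i))" for i
  define y where "y i = ex q (l i *\<^sub>R U i)" for i
  have L: "0 \<le> L" "L \<le> 1" and v: "norm v = 1" using p by (auto simp: pLv)
  have lL: "l \<longlonglongrightarrow> L" and Wv: "W \<longlonglongrightarrow> v"
    using tendsto_fst[OF r(2)] tendsto_snd[OF r(2)] by (simp_all add: pLv o_def l_def[abs_def] W_def[abs_def])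
  have Ut: "U \<longlonglongrightarrow> u t"
    using u_tendsto[OF LIMSEQ_subseq_LIMSEQ[OF X(2) r(1)]] by (simp add: U_def[abs_def] o_def)
  have l: "0 < l i" "l i < 1" for i using lam by (auto simp: l_def)
  have nsy: "nseg q (l i *\<^sub>R U i)" for i using lam(3) by (simp add: l_def U_def)
  have yC: "y i \<in> C" for i using lam(4) by (simp add: y_def l_def U_def)
  have yM: "y i \<in> M" "f (y i) = f q + l i *\<^sub>R U i" "n (y i) = n q" for i
    using nseg_ex[OF nsy] by (auto simp: y_def)
  have Wline: "nline (y i) (W i)" for i using w(2) by (simp add: y_def l_def U_def W_def)
  have ylim: "y \<longlonglongrightarrow> ex q (L *\<^sub>R u t)" unfolding y_def[abs_def]
    by (rule ex_limit(2)[OF q(1) tendsto_const q(1) tendsto_scaleR[OF lL Ut] nsy])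
  have nsL: "nseg q (L *\<^sub>R u t)" using nseg_curve(5)[OF cht(1)] L by simp
  have "ex q (L *\<^sub>R u t) \<in> C" by (rule C_limit[OF yC ylim nseg_ex(1)[OF nsL]])
  then have L1: "L = 1" using cht(3)[of L] L by force
  have ye: "y \<longlonglongrightarrow> e" and eC: "e \<in> C"
    using ylim \<open>ex q (L *\<^sub>R u t) \<in> C\<close> by (simp_all add: L1 e_def)
  have eM: "e \<in> M" by (rule C_subset[OF eC])
  have fe: "f e = f q + u t" "n e = n q" using nseg_ex[OF cht(1)] by (auto simp: e_def)
  have le: "nline e m" using nline_shift(1)[OF line, of t] cht(2) by simp
  have lv: "nline e v" by (rule nline_limit[OF yM(1) ye eM Wv Wline])
  obtain c where c: "v = c *\<^sub>R m" using C_line_unique[OF eC le fan_facts(7) lv] by blast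
  have c0: "c \<noteq> 0" using c v by auto
  have nW: "n q \<bullet> W i = 0" for i using nline_tangent[OF Wline] yM(3) by simp
  have nU: "n q \<bullet> U i = 0" for i using fan_facts(3) by (simp add: U_def)
  have UK: "U i \<bullet> (n q \<times> m) = \<kappa>" for i using fan_facts(4) by (simp add: U_def)
  define a where "a i = W i \<bullet> (n q \<times> u t)" for i
  define k where "k i = W i \<bullet> (n q \<times> m)" for i
  have "m \<bullet> (n q \<times> u t) = - \<kappa>" using inner_cross_swap[of m "n q" "u t"] fan_facts(4) by simp
  then have vne: "v \<bullet> (n q \<times> u t) \<noteq> 0" using c c0 \<kappa>(2) by simp
  have alim: "a \<longlonglongrightarrow> v \<bullet> (n q \<times> u t)" unfolding a_def[abs_def] by (intro tendsto_intros Wv)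
  define s where "s i = - (l i * (U i \<bullet> (n q \<times> u t))) / a i" for i
  have "s \<longlonglongrightarrow> - (L * (u t \<bullet> (n q \<times> u t))) / (v \<bullet> (n q \<times> u t))"
    unfolding s_def[abs_def] by (intro tendsto_intros lL Ut alim vne)
  then have s: "s \<longlonglongrightarrow> 0" by (simp add: inner_cross_self)
  \<comment> \<open>the line through \<open>y i\<close> reaches the ray of the clear chord at the parameter \<open>s i\<close>, in the position \<open>\<mu> i\<close> on the ray\<close>
  define \<mu> where "\<mu> i = l i + s i * k i / \<kappa>" for i
  have "\<mu> \<longlonglongrightarrow> L + 0 * (v \<bullet> (n q \<times> m)) / \<kappa>"
    unfolding \<mu>_def[abs_def] k_def[abs_def] by (intro tendsto_intros lL s Wv \<kappa>(2))
  then have \<mu>: "\<mu> \<longlonglongrightarrow> 1" by (simp add: L1)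
  have coords: "z = (z \<bullet> (n q \<times> m) / \<kappa>) *\<^sub>R u t - (z \<bullet> (n q \<times> u t) / \<kappa>) *\<^sub>R m" if "n q \<bullet> z = 0" for z
    using plane_coords[OF norm_n[OF q(1)] fan_facts(3)[of t] fan_facts(2) that] fan_facts(4)[of t] \<kappa>(2) by simp
  have near_e: "(\<lambda>i. ex (y i) (h i *\<^sub>R W i)) \<longlonglongrightarrow> e" if "h \<longlonglongrightarrow> 0" for h
    by (rule ex_tendsto_0[OF yM(1) ye eM])
      (use tendsto_scaleR[OF that Wv] nlineD(1)[OF Wline] in auto)
  define \<mu>' where "\<mu>' i = max 0 (min 1 (\<mu> i))" for i
  have "\<mu>' \<longlonglongrightarrow> max 0 (min 1 1)" unfolding \<mu>'_def[abs_def] by (intro tendsto_intros \<mu>)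
  then have \<mu>': "\<mu>' \<longlonglongrightarrow> 1" by simp
  have nsZ: "nseg q (\<mu>' i *\<^sub>R u t)" for i by (rule nseg_curve(5)[OF cht(1)]) (auto simp: \<mu>'_def)
  have Z: "(\<lambda>i. ex q (\<mu>' i *\<^sub>R u t)) \<longlonglongrightarrow> e"
    using ex_limit(2)[OF q(1) tendsto_const q(1) tendsto_scaleR[OF \<mu>' tendsto_const] nsZ]
    by (simp add: e_def)
  have "\<forall>\<^sub>F i in sequentially. 1 \<le> \<mu> i"
    using locally_injective_mod_normal[OF eM nlineD(3)[OF Wline] near_e[OF s] nseg_ex(1)[OF nsZ] Z]
      tendsto_imp_eventually_ne[OF alim vne] order_tendstoD(1)[OF \<mu>, of 0, simplified]
  proof eventually_elim
    case (elim i)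
    show ?case
    proof (rule ccontr)
      assume "\<not> 1 \<le> \<mu> i"
      then have \<mu>i: "\<mu>' i = \<mu> i" "\<mu> i < 1" using elim by (auto simp: \<mu>'_def)
      define d where "d = l i *\<^sub>R U i + s i *\<^sub>R W i"
      have "n q \<bullet> d = 0" using nU nW by (simp add: d_def inner_add_right)
      moreover have "d \<bullet> (n q \<times> u t) = 0" using elim(2) by (simp add: d_def s_def a_def inner_diff_left)
      moreover have "d \<bullet> (n q \<times> m) / \<kappa> = \<mu> i"
        using UK \<kappa>(2) by (simp add: d_def \<mu>_def k_def inner_add_left add_divide_distrib)
      ultimately have "d = \<mu> i *\<^sub>R u t" using coords[of d] by simp
      then have "f (ex (y i) (s i *\<^sub>R W i)) - f (ex q (\<mu>' i *\<^sub>R u t)) = 0 *\<^sub>R n e"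
        using nlineD(4)[OF Wline, of i "s i"] nseg_ex(2)[OF nsZ, of i] yM(2)[of i] unfolding \<mu>i(1)
        by (simp add: d_def algebra_simps)
      then have "ex (y i) (s i *\<^sub>R W i) = ex q (\<mu>' i *\<^sub>R u t)" using elim(1) by blast
      then show False using C_line_in_C[OF yC Wline, of i "s i"] cht(3)[of "\<mu> i"] elim(3) \<mu>i by simp
    qed
  qed
  moreover
  \<comment> \<open>since \<open>l i < 1 \<le> \<mu> i\<close>, the line crosses the line through \<open>e\<close> before it reaches the ray\<close>
  define s' where "s' i = (if 1 \<le> \<mu> i then s i * ((1 - l i) / (\<mu> i - l i)) else 0)" for i
  have s'_le: "norm (s' i) \<le> norm (s i)" for i
  proof -
    have "\<bar>(1 - l i) / (\<mu> i - l i)\<bar> \<le> 1" if "1 \<le> \<mu> i" using l(2)[of i] that by simp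
    then have "norm (s i * ((1 - l i) / (\<mu> i - l i))) \<le> norm (s i)" if "1 \<le> \<mu> i"
      using that unfolding real_norm_def abs_mult by (intro mult_left_le) auto
    then show ?thesis by (simp only: s'_def split: if_splits) simp
  qed
  have s': "s' \<longlonglongrightarrow> 0"
    by (rule Lim_null_comparison[OF _ tendsto_norm_zero[OF s]]) (simp add: s'_le[simplified])
  define d where "d i = l i *\<^sub>R U i + s' i *\<^sub>R W i" for i
  define h where "h i = - (d i \<bullet> (n q \<times> u t)) / \<kappa>" for i
  have "h \<longlonglongrightarrow> - ((L *\<^sub>R u t + 0 *\<^sub>R v) \<bullet> (n q \<times> u t)) / \<kappa>"
    unfolding h_def[abs_def] d_def[abs_def] by (intro tendsto_intros lL Ut s' Wv \<kappa>(2))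
  then have h: "h \<longlonglongrightarrow> 0" by (simp add: inner_cross_self)
  have H: "(\<lambda>i. ex e (h i *\<^sub>R m)) \<longlonglongrightarrow> e"
    by (rule ex_tendsto_0[OF eM tendsto_const eM])
      (use tendsto_scaleR[OF h tendsto_const[of m]] nlineD(1)[OF le] in auto)
  have ev2: "\<forall>\<^sub>F i in sequentially. (\<exists>c. f (ex (y i) (s' i *\<^sub>R W i)) - f (ex e (h i *\<^sub>R m)) = c *\<^sub>R n e) \<longrightarrow>
      ex (y i) (s' i *\<^sub>R W i) = ex e (h i *\<^sub>R m)"
    by (rule locally_injective_mod_normal[OF eM nlineD(3)[OF Wline] near_e[OF s'] nlineD(3)[OF le] H])
  ultimately have "\<forall>\<^sub>F i in sequentially. False" using ev2
  proof eventually_elim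
    case (elim i)
    have sk: "s i * k i = \<kappa> * (\<mu> i - l i)" using \<kappa>(2) by (simp add: \<mu>_def)
    have "s' i * k i = \<kappa> * (1 - l i)"
    proof -
      have "s' i * k i = (s i * k i) * ((1 - l i) / (\<mu> i - l i))" using elim(1) by (simp add: s'_def)
      then show ?thesis unfolding sk using elim(1) l(2)[of i] by simp
    qed
    then have "d i \<bullet> (n q \<times> m) = \<kappa>"
      using UK[of i] by (simp add: d_def k_def[symmetric] inner_add_left algebra_simps)
    moreover have "n q \<bullet> d i = 0" using nU nW by (simp add: d_def inner_add_right)
    ultimately have "d i = u t + h i *\<^sub>R m" using coords[of "d i"] \<kappa>(2) by (simp add: h_def)
    then have "f (ex (y i) (s' i *\<^sub>R W i)) - f (ex e (h i *\<^sub>R m)) = 0 *\<^sub>R n e"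
      using nlineD(4)[OF Wline, of i "s' i"] nlineD(4)[OF le, of "h i"] yM(2)[of i] fe(1)
      by (simp add: d_def algebra_simps)
    then have meet: "ex (y i) (s' i *\<^sub>R W i) = ex e (h i *\<^sub>R m)" using elim(2) by blast
    have "nline (ex e (h i *\<^sub>R m)) (W i)"
      unfolding meet[symmetric] by (rule nline_shift(1)[OF Wline])
    then obtain c' where "W i = c' *\<^sub>R m"
      using C_line_unique[OF C_line_in_C[OF eC le] nline_shift(1)[OF le] fan_facts(7)] by blast
    then have "k i = 0" by (simp add: k_def inner_cross_self)
    then show False using elim(1) l(2)[of i] by (simp add: \<mu>_def)
  qed
  then show False by simp
qed

lemma fan_step:
  assumes ch: "clear_chord q (u t) (ex b (t *\<^sub>R m))"
  shows "\<exists>\<epsilon>>0. \<forall>s. t < s \<and> s < t + \<epsilon> \<longrightarrow> clear_chord q (u s) (ex b (s *\<^sub>R m))"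
proof -
  have "\<exists>\<epsilon>>0. \<forall>s. t < s \<and> s < t + \<epsilon> \<longrightarrow> (nseg q (u s) \<longrightarrow> ex q (u s) = ex b (s *\<^sub>R m))"
  proof (rule right_neighbourhood_by_sequences)
    fix X :: "nat \<Rightarrow> real"
    assume X: "X \<longlonglongrightarrow> t" and bad: "\<And>i. \<not> (nseg q (u (X i)) \<longrightarrow> ex q (u (X i)) = ex b (X i *\<^sub>R m))"
    then have ns: "nseg q (u (X i))" for i by blast
    define e where "e = ex b (t *\<^sub>R m)"
    have eM: "e \<in> M" unfolding e_def by (rule nlineD(3)[OF line])
    have "(\<lambda>i. ex q (u (X i))) \<longlonglongrightarrow> ex q (u t)"
      by (rule ex_limit(2)[OF q(1) tendsto_const q(1) u_tendsto[OF X] ns])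
    then have 1: "(\<lambda>i. ex q (u (X i))) \<longlonglongrightarrow> e" using ch by (simp add: clear_chord_def e_def)
    have 2: "(\<lambda>i. ex b (X i *\<^sub>R m)) \<longlonglongrightarrow> e" unfolding e_def
      by (rule ex_limit(2)[OF _ tendsto_const _ tendsto_scaleR[OF X tendsto_const]])
        (rule nlineD[OF line])+
    have "f (ex q (u (X i))) - f (ex b (X i *\<^sub>R m)) = 0 *\<^sub>R n e" for i
      using nseg_ex(2)[OF ns] fan_facts(6) by simp
    then have "\<forall>\<^sub>F i in sequentially. ex q (u (X i)) = ex b (X i *\<^sub>R m)"
      using locally_injective_mod_normal[OF eM nseg_ex(1)[OF ns] 1 nlineD(3)[OF line] 2]
      by (elim eventually_mono) blast
    then show False using bad by (auto dest: eventually_happens)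
  qed
  then obtain \<epsilon>1 where \<epsilon>1: "\<epsilon>1 > 0" "\<And>s. t < s \<Longrightarrow> s < t + \<epsilon>1 \<Longrightarrow> nseg q (u s) \<Longrightarrow> ex q (u s) = ex b (s *\<^sub>R m)"
    by blast
  obtain \<epsilon>2 where \<epsilon>2: "\<epsilon>2 > 0" "\<And>s. t < s \<Longrightarrow> s < t + \<epsilon>2 \<Longrightarrow>
    nseg q (u s) \<and> (\<forall>l. 0 \<le> l \<and> l < 1 \<longrightarrow> ex q (l *\<^sub>R u s) \<notin> C)" using fan_reach[OF ch] by blast
  show ?thesis
    by (rule exI[of _ "min \<epsilon>1 \<epsilon>2"], unfold clear_chord_def) (use \<epsilon>1 \<epsilon>2 in auto)
qed

theorem fan:
  assumes "0 \<le> t" shows "clear_chord q (u t) (ex b (t *\<^sub>R m))"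
proof (rule real_continuation[OF _ _ _ assms])
  show "clear_chord q (u 0) (ex b (0 *\<^sub>R m))"
    using ch0 nseg_0(2)[OF nlineD(2)[OF line]] by (simp add: u)
next
  fix t :: real assume "0 \<le> t" "\<And>s. 0 \<le> s \<Longrightarrow> s \<le> t \<Longrightarrow> clear_chord q (u s) (ex b (s *\<^sub>R m))"
  then show "\<exists>\<epsilon>>0. \<forall>s. t < s \<and> s < t + \<epsilon> \<longrightarrow> clear_chord q (u s) (ex b (s *\<^sub>R m))"
    by (intro fan_step) simp
next
  fix t :: real assume "0 < t" "\<And>s. 0 \<le> s \<Longrightarrow> s < t \<Longrightarrow> clear_chord q (u s) (ex b (s *\<^sub>R m))"
  then show "clear_chord q (u t) (ex b (t *\<^sub>R m))" by (rule fan_limit)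
qed

end

text \<open>Suppose that the translate through \<open>q\<close>, the endpoint of \<open>u\<close>, of the line in direction \<open>v\<close> meets \<open>C\<close> in a first
  point \<open>p\<close>. The line \<open>w\<close> of \<open>C\<close> through \<open>p\<close> is transversal to \<open>v\<close>, as it would contain \<open>q\<close> otherwise. Hence the
  lines through \<open>a\<close> and \<open>p\<close> cross in the plane. The crossing is visible from \<open>q\<close> through the
  fans over both lines, so the lines cross in the surface, against uniqueness.\<close>

lemma planar_fan_ray:
  assumes a: "nline a v" and ns: "nseg a u" and clear: "\<And>l. 0 < l \<Longrightarrow> l \<le> 1 \<Longrightarrow> ex a (l *\<^sub>R u) \<notin> C"
    and tr: "u \<bullet> (n a \<times> v) \<noteq> 0" and s: "0 \<le> s"
  shows "nseg (ex a u) (s *\<^sub>R v)"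
proof -
  define q where "q = ex a u"
  have q: "q \<in> M" "f q = f a + u" "n q = n a" using nseg_ex[OF ns] by (auto simp: q_def)
  have qC: "q \<notin> C" using clear[of 1] by (simp add: q_def)
  have v: "n q \<bullet> v = 0" "v \<noteq> 0" using nline_tangent[OF a] q(3) tr by auto
  have nu: "n q \<bullet> u = 0" using nseg_tangent[OF ns] q(3) by simp
  define k where "k = u \<bullet> (n q \<times> v)"
  have k: "k \<noteq> 0" using tr q(3) by (simp add: k_def)
  show ?thesis unfolding q_def[symmetric]
  proof (rule ccontr)
    assume "\<not> nseg q (s *\<^sub>R v)"
    with ray_first_hit[OF q(1) qC v(1) s]
    obtain l where l: "0 < l" "nseg q (l *\<^sub>R v)" "ex q (l *\<^sub>R v) \<in> C"
      "\<And>\<mu>. 0 \<le> \<mu> \<Longrightarrow> \<mu> < l \<Longrightarrow> ex q (\<mu> *\<^sub>R v) \<notin> C" by blast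
    define p where "p = ex q (l *\<^sub>R v)"
    have p: "p \<in> C" "p \<in> M" "f p = f q + l *\<^sub>R v" "n p = n q"
      using l(3) nseg_ex[OF l(2)] by (auto simp: p_def)
    obtain w where w: "norm w = 1" "nline p w" using C_line[OF p(1)] by blast
    have nw: "n q \<bullet> w = 0" using nline_tangent[OF w(2)] p(4) by simp
    define j where "j = w \<bullet> (n q \<times> v)"
    have j: "j \<noteq> 0"
    proof
      assume "j = 0"
      then obtain c where c: "w = c *\<^sub>R v"
        using parallel_in_plane[OF norm_n[OF q(1)] v(1) nw v(2)] by (auto simp: j_def)
      then have "c \<noteq> 0" using w(1) by auto
      then have "ex p ((- l / c) *\<^sub>R w) = q" using nseg_reverse(2)[OF l(2)] by (simp add: c p_def)
      then show False using C_line_in_C[OF p(1) w(2), of "- l / c"] qC by simp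
    qed
    have swap: "v \<bullet> (n q \<times> w) = - j" "v \<bullet> (n q \<times> u) = - k"
      using inner_cross_swap[of v "n q" w] inner_cross_swap[of v "n q" u] by (simp_all add: j_def k_def)
    \<comment> \<open>\<open>\<beta>\<close> is the parameter, on the line through \<open>p\<close>, of the crossing with the line through \<open>a\<close>\<close>
    define \<beta> where "\<beta> = - k / j"
    have \<beta>: "\<beta> \<noteq> 0" using k j by (simp add: \<beta>_def)
    define d where "d = u + l *\<^sub>R v + \<beta> *\<^sub>R w"
    have "n q \<bullet> d = 0" using nu v nw by (simp add: d_def inner_add_right)
    moreover have "d \<bullet> (n q \<times> v) = 0"
      using j by (simp add: d_def \<beta>_def inner_diff_left inner_add_left inner_cross_self k_def[symmetric] j_def[symmetric])
    ultimately obtain \<alpha> where \<alpha>: "d = \<alpha> *\<^sub>R v"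
      using parallel_in_plane[OF norm_n[OF q(1)] v(1) _ v(2), of d] by blast
    have "clear_chord q (l *\<^sub>R v + 1 *\<^sub>R (\<beta> *\<^sub>R w)) (ex p (1 *\<^sub>R (\<beta> *\<^sub>R w)))"
    proof (rule fan[OF q(1) qC nline_scale[OF w(2)] _ refl])
      show "clear_chord q (l *\<^sub>R v) p"
        unfolding clear_chord_def using l(1,2) l(4)[of "\<mu> * l" for \<mu>] by (auto simp: p_def)
      show "(l *\<^sub>R v) \<bullet> (n q \<times> (\<beta> *\<^sub>R w)) \<noteq> 0" using l(1) \<beta> j swap by (simp add: cross_mult_right)
    qed auto
    then have 1: "ex q (l *\<^sub>R v + \<beta> *\<^sub>R w) = ex p (\<beta> *\<^sub>R w)" by (simp add: clear_chord_def)
    have bwd: "nseg q (- u)" "ex q (- u) = a" using nseg_reverse[OF ns] by (auto simp: q_def)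
    have bwd2: "ex q (t *\<^sub>R (- u)) = ex a ((1 - t) *\<^sub>R u)" if "0 \<le> t" "t \<le> 1" for t
    proof -
      have z: "1 \<in> {0..1::real}" "1 - t \<in> {0..1}" using that by auto
      show ?thesis using curve_ex(2)[OF nseg_curve(1-4)[OF ns] z] by (simp add: q_def)
    qed
    have 2: "ex q (- u + \<alpha> *\<^sub>R v) = ex a (\<alpha> *\<^sub>R v)"
    proof (cases "\<alpha> = 0")
      case True then show ?thesis using bwd nseg_0(2)[OF nlineD(2)[OF a]] by simp
    next
      case False
      have "clear_chord q (- u + 1 *\<^sub>R (\<alpha> *\<^sub>R v)) (ex a (1 *\<^sub>R (\<alpha> *\<^sub>R v)))"
      proof (rule fan[OF q(1) qC nline_scale[OF a] _ refl])
        show "clear_chord q (- u) a"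
          unfolding clear_chord_def
        proof (intro conjI allI impI bwd)
          fix t :: real assume t: "0 \<le> t \<and> t < 1"
          show "ex q (t *\<^sub>R - u) \<notin> C" using bwd2[of t] clear[of "1 - t"] t by simp
        qed
        show "(- u) \<bullet> (n q \<times> (\<alpha> *\<^sub>R v)) \<noteq> 0" using False k by (simp add: cross_mult_right k_def)
      qed auto
      then show ?thesis by (simp add: clear_chord_def)
    qed
    have "l *\<^sub>R v + \<beta> *\<^sub>R w = - u + \<alpha> *\<^sub>R v" using \<alpha> by (simp add: d_def algebra_simps)
    then have meet: "ex p (\<beta> *\<^sub>R w) = ex a (\<alpha> *\<^sub>R v)" using 1 2 by simp
    have "nline (ex p (\<beta> *\<^sub>R w)) v" unfolding meet by (rule nline_shift(1)[OF a])
    then obtain c where "w = c *\<^sub>R v"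
      using C_line_unique[OF C_line_in_C[OF p(1) w(2)] _ v(2) nline_shift(1)[OF w(2)]] by blast
    then show False using j by (simp add: j_def inner_cross_self)
  qed
qed

text \<open>The two half-lines of the translate are treated separately by \<open>planar_fan_ray\<close>.\<close>

theorem planar_fan:
  assumes a: "nline a v" and ns: "nseg a u" and clear: "\<And>l. 0 < l \<Longrightarrow> l \<le> 1 \<Longrightarrow> ex a (l *\<^sub>R u) \<notin> C"
  shows "nline (ex a u) v"
proof (cases "u \<bullet> (n a \<times> v) = 0")
  case True
  show ?thesis
  proof (cases "v = 0")
    case True
    then show ?thesis using nseg_0(1)[OF nseg_ex(1)[OF ns]] by (simp add: nline_def)
  next
    case False
    obtain c where "u = c *\<^sub>R v"
      using parallel_in_plane[OF norm_n[OF nlineD(2)[OF a]] nline_tangent[OF a] nseg_tangent[OF ns] False True]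
      by blast
    then show ?thesis using nline_shift(1)[OF a] by simp
  qed
next
  case False
  have "nseg (ex a u) (s *\<^sub>R v)" for s
  proof (cases "0 \<le> s")
    case True
    show ?thesis by (rule planar_fan_ray[OF a ns clear False True])
  next
    case neg: False
    have "u \<bullet> (n a \<times> (- v)) \<noteq> 0" using False by (simp add: cross_minus_right)
    moreover have "nline a (- v)" using nline_scale[OF a, of "-1"] by simp
    ultimately have "nseg (ex a u) ((- s) *\<^sub>R (- v))" using neg by (intro planar_fan_ray[OF _ ns clear]) auto
    then show ?thesis by simp
  qed
  then show ?thesis by (simp add: nline_def)
qed

end

section \<open>The rulings are parallel\<close>

context developable_surface
begin

text \<open>Displacements between the lines through \<open>p\<close> and \<open>Y i\<close>, divided by the difference \<open>\<delta> i\<close> of their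
  directions, converge to \<open>D + s E\<close> at the parameter \<open>s\<close>. If the part of \<open>E\<close> tangent to the surface and transversal to
  the line were not zero, the lines would cross when viewed along the normal, and hence
  meet. The normal part of \<open>D + s E\<close> vanishes by tangency, for the normal is constant along
  the line. So \<open>E\<close> is a multiple of \<open>a\<close>, and it is zero because the directions are normalised
  by \<open>e\<close>. But \<open>E\<close> is a unit vector.\<close>

lemma ruling_variation_limit:
  assumes p: "p \<in> C" and Y: "\<And>i::nat. Y i \<in> C" "Y \<longlonglongrightarrow> p" and v: "v \<longlonglongrightarrow> a"
    and line: "\<And>i. nline (Y i) (v i)" and a: "nline p a" and e: "e \<bullet> a = 1" "\<And>i. e \<bullet> v i = 1"
    and \<delta>: "\<And>i. \<delta> i = norm (v i - a)" "\<And>i. 0 < \<delta> i"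
    and E: "(\<lambda>i. (1 / \<delta> i) *\<^sub>R (v i - a)) \<longlonglongrightarrow> E"
    and D: "(\<lambda>i. (1 / \<delta> i) *\<^sub>R (f (Y i) - f p)) \<longlonglongrightarrow> D"
  shows False
proof -
  have pM: "p \<in> M" by (rule C_subset[OF p])
  have YM: "Y i \<in> M" for i by (rule C_subset[OF Y(1)])
  define \<nu> where "\<nu> = n p"
  define \<tau> where "\<tau> = \<nu> \<times> a"
  have \<nu>: "norm \<nu> = 1" "\<nu> \<bullet> a = 0" using norm_n[OF pM] nline_tangent[OF a] by (auto simp: \<nu>_def)
  have a0: "a \<noteq> 0" using e(1) by auto
  have aa: "a \<bullet> a \<noteq> 0" using a0 by simp
  have a\<tau>: "a \<bullet> \<tau> = 0" by (simp add: \<tau>_def inner_cross_self)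
  have frame: "y = (y \<bullet> a / (a \<bullet> a)) *\<^sub>R a + (y \<bullet> \<tau> / (a \<bullet> a)) *\<^sub>R \<tau> + (y \<bullet> \<nu>) *\<^sub>R \<nu>" for y
    unfolding \<tau>_def by (rule frame_expansion[OF \<nu> a0])
  define Q where "Q i s = (1 / \<delta> i) *\<^sub>R (f (Y i) - f p) + s *\<^sub>R ((1 / \<delta> i) *\<^sub>R (v i - a))" for i s
  have Q: "f (ex (Y i) (s *\<^sub>R v i)) = f p + s *\<^sub>R a + \<delta> i *\<^sub>R Q i s" for i s
    using nlineD(4)[OF line] \<delta>(2)[of i] by (simp add: Q_def algebra_simps)
  have Qlim: "(\<lambda>i. Q i (s i)) \<longlonglongrightarrow> D + t *\<^sub>R E" if "s \<longlonglongrightarrow> t" for s t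
    unfolding Q_def by (intro tendsto_intros D that E)
  have lim: "(\<lambda>i. ex (Y i) (s i *\<^sub>R v i)) \<longlonglongrightarrow> ex p (t *\<^sub>R a)" if "s \<longlonglongrightarrow> t" for s t
    by (rule ex_limit(2)[OF YM Y(2) pM tendsto_scaleR[OF that v] nlineD(1)[OF line]])
  have no_meet: "ex (Y i) (s *\<^sub>R v i) \<noteq> ex p (t *\<^sub>R a)" for i s t
  proof
    assume meet: "ex (Y i) (s *\<^sub>R v i) = ex p (t *\<^sub>R a)"
    have "nline (ex p (t *\<^sub>R a)) (v i)" unfolding meet[symmetric] by (rule nline_shift(1)[OF line])
    then obtain c where c: "v i = c *\<^sub>R a"
      using C_line_unique[OF C_line_in_C[OF p a] nline_shift(1)[OF a] a0] by blast
    then have "c = 1" using e(1) e(2)[of i] by simp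
    then show False using \<delta>[of i] c by simp
  qed
  have vi: "v i = a + \<delta> i *\<^sub>R ((1 / \<delta> i) *\<^sub>R (v i - a))" for i
    using \<delta>(2)[of i] by simp
  have dlim: "\<delta> \<longlonglongrightarrow> 0"
    unfolding \<delta>(1)[abs_def] using tendsto_norm_zero[OF LIM_zero[OF v]] by simp
  have E\<tau>: "E \<bullet> \<tau> = 0"
  proof (rule ccontr)
    assume ne: "E \<bullet> \<tau> \<noteq> 0"
    \<comment> \<open>the parameters where the projections of the two lines to the plane of \<open>a\<close> and \<open>\<tau>\<close> cross\<close>
    define s where "s i = - (((1 / \<delta> i) *\<^sub>R (f (Y i) - f p)) \<bullet> \<tau>) / (((1 / \<delta> i) *\<^sub>R (v i - a)) \<bullet> \<tau>)" for i
    define s0 where "s0 = - (D \<bullet> \<tau>) / (E \<bullet> \<tau>)"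
    have s: "s \<longlonglongrightarrow> s0" unfolding s_def[abs_def] s0_def by (intro tendsto_intros D E ne)
    define t where "t i = s i + \<delta> i * (Q i (s i) \<bullet> a / (a \<bullet> a))" for i
    have "t \<longlonglongrightarrow> s0 + 0 * ((D + s0 *\<^sub>R E) \<bullet> a / (a \<bullet> a))"
      unfolding t_def[abs_def] by (intro tendsto_intros s dlim Qlim aa)
    then have t: "t \<longlonglongrightarrow> s0" by simp
    have "(\<lambda>i. ((1 / \<delta> i) *\<^sub>R (v i - a)) \<bullet> \<tau>) \<longlonglongrightarrow> E \<bullet> \<tau>" by (intro tendsto_intros E)
    from tendsto_imp_eventually_ne[OF this ne]
    have ev: "\<forall>\<^sub>F i in sequentially. ((1 / \<delta> i) *\<^sub>R (v i - a)) \<bullet> \<tau> \<noteq> 0" .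
    have T: "(\<lambda>i. ex p (t i *\<^sub>R a)) \<longlonglongrightarrow> ex p (s0 *\<^sub>R a)"
      by (rule ex_limit(2)[OF pM tendsto_const pM tendsto_scaleR[OF t tendsto_const] nlineD(1)[OF a]])
    have "\<forall>\<^sub>F i in sequentially. False"
      using locally_injective_mod_normal[OF nlineD(3)[OF a] nlineD(3)[OF line] lim[OF s] nlineD(3)[OF a] T] ev
    proof eventually_elim
      case (elim i)
      have "(y + (- (y \<bullet> \<tau>) / (z \<bullet> \<tau>)) *\<^sub>R z) \<bullet> \<tau> = 0" if "z \<bullet> \<tau> \<noteq> 0" for y z
        using that by (simp add: inner_diff_left)
      then have "Q i (s i) \<bullet> \<tau> = 0" using elim(2) unfolding Q_def s_def by blast
      then have "Q i (s i) = (Q i (s i) \<bullet> a / (a \<bullet> a)) *\<^sub>R a + (Q i (s i) \<bullet> \<nu>) *\<^sub>R \<nu>"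
        using frame[of "Q i (s i)"] by simp
      then have "\<delta> i *\<^sub>R Q i (s i) = \<delta> i *\<^sub>R ((Q i (s i) \<bullet> a / (a \<bullet> a)) *\<^sub>R a + (Q i (s i) \<bullet> \<nu>) *\<^sub>R \<nu>)"
        by (rule arg_cong)
      then have "f (ex (Y i) (s i *\<^sub>R v i)) - f (ex p (t i *\<^sub>R a)) = (\<delta> i * (Q i (s i) \<bullet> \<nu>)) *\<^sub>R n (ex p (s0 *\<^sub>R a))"
        unfolding Q nlineD(4)[OF a] nlineD(5)[OF a] by (simp add: t_def \<nu>_def algebra_simps)
      then show False using elim(1) no_meet by blast
    qed
    then show False by simp
  qed
  have flat: "(D + s0 *\<^sub>R E) \<bullet> \<nu> = 0" for s0
  proof (rule ccontr)
    assume ne: "(D + s0 *\<^sub>R E) \<bullet> \<nu> \<noteq> 0"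
    \<comment> \<open>displacements are compared orthogonally to \<open>a\<close>; otherwise sliding along the line, which is not small on the scale \<open>\<delta> i\<close>, would spoil the tangency estimate\<close>
    define proj where "proj y = (y \<bullet> \<tau> / (a \<bullet> a)) *\<^sub>R \<tau> + (y \<bullet> \<nu>) *\<^sub>R \<nu>" for y
    define al where "al i = v i \<bullet> a / (a \<bullet> a)" for i
    have "al \<longlonglongrightarrow> a \<bullet> a / (a \<bullet> a)" unfolding al_def[abs_def] by (intro tendsto_intros v aa)
    then have al: "al \<longlonglongrightarrow> 1" using aa by simp
    define s where "s i = (s0 - (f (Y i) - f p) \<bullet> a / (a \<bullet> a)) / al i" for i
    have "s \<longlonglongrightarrow> (s0 - (f p - f p) \<bullet> a / (a \<bullet> a)) / 1"
      unfolding s_def[abs_def] by (intro tendsto_intros al aa f_tendsto[OF YM pM Y(2)]) simp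
    then have s: "s \<longlonglongrightarrow> s0" by simp
    have ev1: "\<forall>\<^sub>F i in sequentially. al i \<noteq> 0" by (rule tendsto_imp_eventually_ne[OF al]) simp
    define g where "g = \<bar>(D + s0 *\<^sub>R E) \<bullet> \<nu>\<bar>"
    define \<epsilon> where "\<epsilon> = g / (2 * (norm (proj (D + s0 *\<^sub>R E)) + 1))"
    have np: "0 < norm (proj (D + s0 *\<^sub>R E)) + 1" using norm_ge_zero[of "proj (D + s0 *\<^sub>R E)"] by linarith
    have g: "0 < g" using ne by (simp add: g_def)
    have \<epsilon>: "0 < \<epsilon>" unfolding \<epsilon>_def using g np by (intro divide_pos_pos mult_pos_pos) auto
    define z where "z = ex p (s0 *\<^sub>R a)"
    obtain U where U: "openin (top_of_set M) U" "z \<in> U"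
      "\<And>y. y \<in> U \<Longrightarrow> \<bar>n z \<bullet> (f y - f z)\<bar> \<le> \<epsilon> * norm (f y - f z)"
      using tangency[OF nlineD(3)[OF a] \<epsilon>, of s0] unfolding z_def by blast
    have "\<forall>\<^sub>F i in sequentially. ex (Y i) (s i *\<^sub>R v i) \<in> U"
      by (rule eventually_in_openin[OF U(1,2) nlineD(3)[OF line]]) (unfold z_def, rule lim[OF s])
    with ev1 have "\<forall>\<^sub>F i in sequentially. \<bar>Q i (s i) \<bullet> \<nu>\<bar> \<le> \<epsilon> * norm (proj (Q i (s i)))"
    proof eventually_elim
      case (elim i)
      have nz: "n z = \<nu>" "f z = f p + s0 *\<^sub>R a" using nlineD(4,5)[OF a] by (auto simp: z_def \<nu>_def)
      define ov where "ov = f (ex (Y i) (s i *\<^sub>R v i)) - f z"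
      have oQ: "ov = (s i - s0) *\<^sub>R a + \<delta> i *\<^sub>R Q i (s i)" unfolding ov_def Q nz by (simp add: algebra_simps)
      have "ov = (f (Y i) - f p) + s i *\<^sub>R v i - s0 *\<^sub>R a"
        unfolding ov_def nz nlineD(4)[OF line] by simp
      then have "ov \<bullet> a / (a \<bullet> a) = (f (Y i) - f p) \<bullet> a / (a \<bullet> a) + s i * al i - s0"
        using aa by (simp add: al_def inner_add_left inner_diff_left add_divide_distrib diff_divide_distrib)
      also have "\<dots> = 0" using elim(1) by (simp add: s_def)
      finally have "ov = proj ov" using frame[of ov] aa by (simp add: proj_def)
      also have "proj ov = \<delta> i *\<^sub>R proj (Q i (s i))"
        unfolding oQ proj_def using a\<tau> \<nu>(2)[unfolded inner_commute[of \<nu>]]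
        by (simp add: inner_add_left scaleR_add_right)
      finally have o1: "ov = \<delta> i *\<^sub>R proj (Q i (s i))" .
      have "\<nu> \<bullet> ov = \<delta> i * (Q i (s i) \<bullet> \<nu>)" unfolding oQ using \<nu>(2) by (simp add: inner_add_right inner_commute)
      then have "\<delta> i * \<bar>Q i (s i) \<bullet> \<nu>\<bar> = \<bar>n z \<bullet> ov\<bar>" using nz \<delta>(2)[of i] by (simp add: abs_mult)
      also have "\<dots> \<le> \<epsilon> * norm ov" using U(3)[OF elim(2)] by (simp add: ov_def)
      also have "\<dots> = \<delta> i * (\<epsilon> * norm (proj (Q i (s i))))" using \<delta>(2)[of i] unfolding o1 by simp
      finally show ?case using \<delta>(2)[of i] by simp
    qed
    moreover have "(\<lambda>i. \<bar>Q i (s i) \<bullet> \<nu>\<bar>) \<longlonglongrightarrow> g" unfolding g_def by (intro tendsto_intros Qlim s)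
    moreover have "(\<lambda>i. \<epsilon> * norm (proj (Q i (s i)))) \<longlonglongrightarrow> \<epsilon> * norm (proj (D + s0 *\<^sub>R E))"
      unfolding proj_def by (intro tendsto_intros Qlim s aa)
    ultimately have "g \<le> \<epsilon> * norm (proj (D + s0 *\<^sub>R E))"
      by (intro tendsto_le[OF sequentially_bot])
    also have "\<dots> \<le> \<epsilon> * (norm (proj (D + s0 *\<^sub>R E)) + 1)" using \<epsilon> by simp
    also have "\<dots> = g / 2"
    proof -
      have "g / (2 * X) * X = g / 2" if "0 < X" for X :: real using that by simp
      from this[OF np] show ?thesis unfolding \<epsilon>_def .
    qed
    finally show False using g by simp
  qed
  have E\<nu>: "E \<bullet> \<nu> = 0" using flat[of 0] flat[of 1] by (simp add: inner_add_left)
  have "(\<lambda>i. e \<bullet> ((1 / \<delta> i) *\<^sub>R (v i - a))) \<longlonglongrightarrow> e \<bullet> E" by (intro tendsto_intros E)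
  then have eE: "e \<bullet> E = 0" using e by (simp add: inner_diff_right LIMSEQ_const_iff)
  have Ea: "E = (E \<bullet> a / (a \<bullet> a)) *\<^sub>R a" using frame[of E] E\<tau> E\<nu> by simp
  have "e \<bullet> E = (E \<bullet> a / (a \<bullet> a)) * (e \<bullet> a)" by (subst Ea) simp
  then have "E \<bullet> a / (a \<bullet> a) = 0" using eE e(1) by simp
  then have "E = 0" using Ea by (metis scaleR_zero_left)
  moreover have "norm ((1 / \<delta> i) *\<^sub>R (v i - a)) = 1" for i using \<delta>[of i] by simp
  then have "(\<lambda>i. norm ((1 / \<delta> i) *\<^sub>R (v i - a))) \<longlonglongrightarrow> 1" by (simp only: tendsto_const)
  then have "norm E = 1" using tendsto_norm[OF E] LIMSEQ_unique by blast
  ultimately show False by simp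
qed

text \<open>The directions of the lines, normalised by the linear form \<open>e\<close>, differ by \<open>o\<close> of the distance of the base
  points. If not, the quotients by the difference of the directions are bounded and have
  convergent subsequences, to which \<open>ruling_variation_limit\<close> applies.\<close>

theorem ruling_variation:
  assumes p: "p \<in> C" and Y: "\<And>i::nat. Y i \<in> C" "Y \<longlonglongrightarrow> p"
    and a: "nline p a" and e: "e \<bullet> a = 1" and \<epsilon>: "0 < \<epsilon>"
  shows "\<exists>i v. nline (Y i) v \<and> e \<bullet> v = 1 \<and> norm (v - a) \<le> \<epsilon> * norm (f (Y i) - f p)"
proof (rule ccontr)
  assume no: "\<not> ?thesis"
  have pM: "p \<in> M" by (rule C_subset[OF p])
  have YM: "Y i \<in> M" for i by (rule C_subset[OF Y(1)])
  have a0: "a \<noteq> 0" using e by auto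
  have "\<exists>w. norm w = 1 \<and> nline (Y i) w" for i using C_line[OF Y(1)[of i]] by blast
  then obtain w where w: "\<And>i. norm (w i) = 1" "\<And>i. nline (Y i) (w i)" by metis
  obtain w0 r where w0: "norm w0 = 1" and r: "strict_mono (r :: nat \<Rightarrow> nat)" "(\<lambda>i. w (r i)) \<longlonglongrightarrow> w0"
    using unit_vector_subsequence[of w] w(1) by blast
  have Yr: "(\<lambda>i. Y (r i)) \<longlonglongrightarrow> p" using LIMSEQ_subseq_LIMSEQ[OF Y(2) r(1)] by (simp add: o_def)
  have "nline p w0" by (rule nline_limit[OF YM Yr pM r(2) w(2)])
  then obtain c where c: "w0 = c *\<^sub>R a" using C_line_unique[OF p a a0] by blast
  have c0: "c \<noteq> 0" using c w0 by auto
  have ew: "(\<lambda>i. e \<bullet> w (r i)) \<longlonglongrightarrow> c" using tendsto_inner[OF tendsto_const r(2), of e] c e by simp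
  obtain k where k: "\<And>i. k \<le> i \<Longrightarrow> e \<bullet> w (r i) \<noteq> 0"
    using tendsto_imp_eventually_ne[OF ew c0] by (auto simp: eventually_sequentially)
  define Z where "Z i = Y (r (i + k))" for i
  define v where "v i = (1 / (e \<bullet> w (r (i + k)))) *\<^sub>R w (r (i + k))" for i
  have Z: "Z \<longlonglongrightarrow> p" unfolding Z_def by (rule LIMSEQ_ignore_initial_segment[OF Yr])
  have ZC: "Z i \<in> C" for i using Y(1) by (simp add: Z_def)
  have ev: "e \<bullet> v i = 1" for i using k[of "i + k"] by (simp add: v_def)
  have line: "nline (Z i) (v i)" for i unfolding Z_def v_def by (rule nline_scale[OF w(2)])
  have "v \<longlonglongrightarrow> (1 / c) *\<^sub>R w0" unfolding v_def[abs_def]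
    by (intro tendsto_intros LIMSEQ_ignore_initial_segment[OF r(2)] LIMSEQ_ignore_initial_segment[OF ew] c0)
  then have va: "v \<longlonglongrightarrow> a" using c c0 by simp
  define \<delta> where "\<delta> i = norm (v i - a)" for i
  have big: "\<epsilon> * norm (f (Z i) - f p) < \<delta> i" for i
    using no line[of i] ev[of i] unfolding \<delta>_def Z_def by (meson linorder_not_le)
  have \<delta>0: "0 < \<delta> i" for i
    using big[of i] \<epsilon> by (meson le_less_trans mult_nonneg_nonneg less_imp_le norm_ge_zero)
  define EE where "EE i = (1 / \<delta> i) *\<^sub>R (v i - a)" for i
  define DD where "DD i = (1 / \<delta> i) *\<^sub>R (f (Z i) - f p)" for i
  have "norm (DD i) = norm (f (Z i) - f p) / \<delta> i" for i using \<delta>0[of i] by (simp add: DD_def)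
  then have "norm (DD i) \<le> 1 / \<epsilon>" for i
    using big[of i] \<delta>0[of i] \<epsilon> by (simp add: field_simps)
  moreover have "norm (EE i) = 1" for i using \<delta>0[of i] by (simp add: EE_def \<delta>_def)
  ultimately have "\<forall>i. (EE i, DD i) \<in> Sigma (sphere 0 1) (\<lambda>_. cball 0 (1 / \<epsilon>))" by simp
  moreover have "compact (Sigma (sphere (0::real^3) 1) (\<lambda>_. cball (0::real^3) (1 / \<epsilon>)))"
    by (intro compact_Times compact_sphere compact_cball)
  ultimately obtain l h where h: "strict_mono (h :: nat \<Rightarrow> nat)" "((\<lambda>i. (EE i, DD i)) \<circ> h) \<longlonglongrightarrow> l"
    unfolding compact_def by meson
  show False
  proof (rule ruling_variation_limit[where Y = "\<lambda>i. Z (h i)" and v = "\<lambda>i. v (h i)" and \<delta> = "\<lambda>i. \<delta> (h i)"])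
    show "(\<lambda>i. Z (h i)) \<longlonglongrightarrow> p" using LIMSEQ_subseq_LIMSEQ[OF Z h(1)] by (simp add: o_def)
    show "(\<lambda>i. v (h i)) \<longlonglongrightarrow> a" using LIMSEQ_subseq_LIMSEQ[OF va h(1)] by (simp add: o_def)
    show "(\<lambda>i. (1 / \<delta> (h i)) *\<^sub>R (v (h i) - a)) \<longlonglongrightarrow> fst l"
      using tendsto_fst[OF h(2)] by (simp add: o_def EE_def)
    show "(\<lambda>i. (1 / \<delta> (h i)) *\<^sub>R (f (Z (h i)) - f p)) \<longlonglongrightarrow> snd l"
      using tendsto_snd[OF h(2)] by (simp add: o_def DD_def)
  qed (use p ZC line a e ev \<delta>0 in \<open>auto simp: \<delta>_def\<close>)
qed

end

context developable_surface
begin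

text \<open>Join \<open>p\<close> to \<open>q\<close> by a curve \<open>x\<close> over a segment of the chart. For fixed \<open>\<epsilon>\<close>, it is shown by continuation
  in \<open>s\<close> that \<open>x s\<close> lies on a line whose direction differs from \<open>a\<close> by at most \<open>\<epsilon> s\<close>, as in a proof of the
  mean value theorem. A parameter \<open>s\<close> slightly to the right of \<open>t\<close> with \<open>x s\<close> in \<open>C\<close> is covered by the
  estimate of the variation. If \<open>x s\<close> is not in \<open>C\<close>, let \<open>m\<close> be the last parameter before \<open>s\<close> at which the
  curve is in \<open>C\<close>, or \<open>t\<close>; the curve between \<open>m\<close> and \<open>s\<close> is a straight segment in a planar piece,
  through which the line is translated without change of direction. Letting \<open>\<epsilon>\<close> tend to \<open>0\<close> gives the
  direction \<open>a\<close> itself.\<close>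

lemma ruling_direction_near:
  assumes p: "p \<in> M" and a: "nline p a" "a \<noteq> 0"
  shows "\<exists>U. openin (top_of_set M) U \<and> p \<in> U \<and> (\<forall>q\<in>U. nline q a)"
proof -
  obtain P r G K where gcc: "graph_chart M f p (n p) P r G K" using local_graph[OF p] by metis
  note gc = graph_chartD[OF gcc]
  let ?B = "ball (P (f p)) r"
  have cnG: "continuous_on ?B (\<lambda>z. n (G z) \<bullet> n p)"
    by (intro continuous_intros continuous_on_compose2[OF continuous_n gc(6)]) (use gc(8) in auto)
  have "open (?B \<inter> (\<lambda>z. n (G z) \<bullet> n p) -` {0<..})"
    by (rule continuous_open_preimage[OF cnG open_ball open_greaterThan])
  moreover have "P (f p) \<in> ?B \<inter> (\<lambda>z. n (G z) \<bullet> n p) -` {0<..}"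
    using gc(2,5) n_inner[OF p] by simp
  ultimately obtain \<rho> where \<rho>: "0 < \<rho>" "ball (P (f p)) \<rho> \<subseteq> ?B \<inter> (\<lambda>z. n (G z) \<bullet> n p) -` {0<..}"
    using open_contains_ball by blast
  define B where "B = ball (P (f p)) \<rho>"
  have B: "B \<subseteq> ?B" "\<And>z. z \<in> B \<Longrightarrow> 0 < n (G z) \<bullet> n p" using \<rho>(2) by (auto simp: B_def)
  define U where "U = G ` ?B \<inter> {q \<in> M. P (f q) \<in> B}"
  have lP: "continuous_on UNIV P" using gc(1) by (simp add: linear_continuous_on linear_linear)
  have "continuous_on M (\<lambda>q. P (f q))" by (rule continuous_on_compose2[OF lP continuous_f]) auto
  then have "openin (top_of_set M) (M \<inter> (\<lambda>q. P (f q)) -` B)"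
    by (rule continuous_openin_preimage_gen) (simp add: B_def)
  moreover have "M \<inter> (\<lambda>q. P (f q)) -` B = {q \<in> M. P (f q) \<in> B}" by auto
  ultimately have "openin (top_of_set M) U" unfolding U_def using gc(3) by (simp add: openin_Int)
  moreover have "p \<in> U" using p gc(4) \<rho>(1) by (simp add: U_def B_def)
  moreover have "nline q a" if qU: "q \<in> U" for q
  proof -
    define z where "z = P (f p)"
    define d where "d = P (f q) - P (f p)"
    define x where "x \<sigma> = G (z + \<sigma> *\<^sub>R d)" for \<sigma>
    have zB: "z + \<sigma> *\<^sub>R d \<in> B" if "0 \<le> \<sigma>" "\<sigma> \<le> 1" for \<sigma>
    proof -
      have "z \<in> B" "P (f q) \<in> B" using \<rho>(1) qU by (auto simp: z_def B_def U_def)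
      then have "(1 - \<sigma>) *\<^sub>R z + \<sigma> *\<^sub>R P (f q) \<in> B"
        using that convexD_alt[of B z "P (f q)" \<sigma>] by (simp add: B_def)
      then show ?thesis by (simp add: d_def z_def algebra_simps)
    qed
    have x0: "x 0 = p" using gc(5) by (simp add: x_def z_def)
    have x1: "x 1 = q" using gc(9)[of q] qU by (simp add: x_def z_def d_def U_def)
    have xM: "x \<sigma> \<in> M" if "0 \<le> \<sigma>" "\<sigma> \<le> 1" for \<sigma> using gc(8) zB[OF that] B(1) by (auto simp: x_def)
    have xt: "(\<lambda>i. x (S i)) \<longlonglongrightarrow> x s" if "\<And>i::nat. 0 \<le> S i" "S \<longlonglongrightarrow> s" "0 \<le> s" "s \<le> 1" for S s
    proof -
      have "isCont G (z + s *\<^sub>R d)"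
        using gc(6) zB[OF that(3,4)] B(1) by (meson continuous_on_eq_continuous_at open_ball subsetD)
      moreover have "(\<lambda>i. z + S i *\<^sub>R d) \<longlonglongrightarrow> z + s *\<^sub>R d" by (intro tendsto_intros that(2))
      ultimately show ?thesis unfolding x_def by (rule isCont_tendsto_compose)
    qed
    have cx: "continuous_on {0..1} x" unfolding x_def
      by (rule continuous_on_compose2[OF gc(6)]) (use zB B(1) in \<open>auto intro!: continuous_intros\<close>)
    define L where "L = \<bar>K\<bar> * norm d + 1"
    have L: "0 < L" by (simp add: L_def add_nonneg_pos)
    have lip: "norm (f (x s) - f (x t)) \<le> L * \<bar>s - t\<bar>" if "0 \<le> s" "s \<le> 1" "0 \<le> t" "t \<le> 1" for s t
    proof -
      have "norm (f (x s) - f (x t)) \<le> K * norm ((z + s *\<^sub>R d) - (z + t *\<^sub>R d))"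
        unfolding x_def by (rule gc(13)) (use zB that B(1) in blast)+
      also have "(z + s *\<^sub>R d) - (z + t *\<^sub>R d) = (s - t) *\<^sub>R d" by (simp add: algebra_simps)
      also have "K * norm ((s - t) *\<^sub>R d) = (K * norm d) * \<bar>s - t\<bar>" by simp
      also have "\<dots> \<le> L * \<bar>s - t\<bar>"
      proof (rule mult_right_mono)
        have "K * norm d \<le> \<bar>K\<bar> * norm d" by (rule mult_right_mono) auto
        then show "K * norm d \<le> L" by (simp add: L_def)
      qed simp
      finally show ?thesis .
    qed
    define e where "e = (1 / (a \<bullet> a)) *\<^sub>R a"
    have ea: "e \<bullet> a = 1" using a(2) by (simp add: e_def)
    have close: "\<exists>v. nline q v \<and> norm (v - a) \<le> \<epsilon>" if \<epsilon>: "0 < \<epsilon>" for \<epsilon>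
    proof -
      define Q where "Q s \<longleftrightarrow> (\<exists>v. nline (x s) v \<and> e \<bullet> v = 1 \<and> norm (v - a) \<le> \<epsilon> * s)" for s
      have "(1::real) \<le> 1 \<longrightarrow> Q 1"
      proof (rule real_continuation[where P = "\<lambda>s. s \<le> 1 \<longrightarrow> Q s"])
        show "0 \<le> 1 \<longrightarrow> Q 0" using a ea x0 by (auto simp: Q_def)
      next
        fix t :: real assume t0: "0 \<le> t" and Qt: "\<And>s. 0 \<le> s \<Longrightarrow> s \<le> t \<Longrightarrow> s \<le> 1 \<longrightarrow> Q s"
        show "\<exists>\<epsilon>'>0. \<forall>s. t < s \<and> s < t + \<epsilon>' \<longrightarrow> s \<le> 1 \<longrightarrow> Q s"
        proof (cases "t < 1")
          case False
          then show ?thesis by (intro exI[of _ 1]) auto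
        next
          case t1: True
          then obtain v where v: "nline (x t) v" "e \<bullet> v = 1" "norm (v - a) \<le> \<epsilon> * t"
            using Qt[of t] t0 by (auto simp: Q_def)
          have "\<exists>\<epsilon>'>0. \<forall>s. t < s \<and> s < t + \<epsilon>' \<longrightarrow> (s \<le> 1 \<longrightarrow> x s \<in> C \<longrightarrow> Q s)"
          proof (rule right_neighbourhood_by_sequences)
            fix S :: "nat \<Rightarrow> real"
            assume S: "\<And>i. t < S i" "S \<longlonglongrightarrow> t" and bad: "\<And>i. \<not> (S i \<le> 1 \<longrightarrow> x (S i) \<in> C \<longrightarrow> Q (S i))"
            have S1: "S i \<le> 1" "x (S i) \<in> C" "0 \<le> S i" for i using bad[of i] S(1)[of i] t0 by auto
            have lim: "(\<lambda>i. x (S i)) \<longlonglongrightarrow> x t" by (rule xt[OF S1(3) S(2)]) (use t0 t1 in auto)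
            have xtC: "x t \<in> C" by (rule C_limit[OF S1(2) lim xM]) (use t0 t1 in auto)
            have "0 < \<epsilon> / L" using \<epsilon> L by simp
            from ruling_variation[OF xtC S1(2) lim v(1,2) this]
            obtain i v' where v': "nline (x (S i)) v'" "e \<bullet> v' = 1"
              "norm (v' - v) \<le> \<epsilon> / L * norm (f (x (S i)) - f (x t))" by blast
            note v'(3)
            also have "\<epsilon> / L * norm (f (x (S i)) - f (x t)) \<le> \<epsilon> / L * (L * \<bar>S i - t\<bar>)"
              by (rule mult_left_mono[OF lip]) (use S1[of i] t0 t1 \<epsilon> L in auto)
            also have "\<dots> = \<epsilon> * (S i - t)" using L S(1)[of i] by simp
            finally have "norm (v' - a) \<le> \<epsilon> * (S i - t) + \<epsilon> * t"
              using v(3) norm_triangle_ineq[of "v' - v" "v - a"] by simp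
            then have "Q (S i)" using v' by (auto simp: Q_def algebra_simps)
            then show False using bad by blast
          qed
          then obtain \<epsilon>' where \<epsilon>': "\<epsilon>' > 0" "\<And>s. t < s \<Longrightarrow> s < t + \<epsilon>' \<Longrightarrow> s \<le> 1 \<Longrightarrow> x s \<in> C \<Longrightarrow> Q s"
            by blast
          have "Q s" if s: "t < s" "s < t + \<epsilon>'" "s \<le> 1" for s
          proof (cases "x s \<in> C")
            case True
            then show ?thesis using \<epsilon>'(2) s by blast
          next
            case sC: False
            define S where "S = {\<sigma> \<in> {t..s}. \<sigma> = t \<or> x \<sigma> \<in> C}"
            define m where "m = Sup S"
            have "closed S"
              unfolding closed_sequential_limits
            proof (intro allI impI, elim conjE)
              fix X l assume X: "\<forall>i. X i \<in> S" "X \<longlonglongrightarrow> l"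
              have Xts: "X i \<in> {t..s}" for i using X(1) by (auto simp: S_def)
              have lts: "l \<in> {t..s}" by (rule closed_sequentially[OF closed_atLeastAtMost _ X(2)]) (use Xts in blast)
              show "l \<in> S"
              proof (cases "l = t")
                case True then show ?thesis using lts by (simp add: S_def)
              next
                case False
                have "\<forall>\<^sub>F i in sequentially. X i > t" using order_tendstoD(1)[OF X(2), of t] lts False by simp
                then obtain k where k: "\<And>i. k \<le> i \<Longrightarrow> X i > t" by (auto simp: eventually_sequentially)
                have "x l \<in> C"
                proof (rule C_limit)
                  show "x (X (i + k)) \<in> C" for i using k[of "i + k"] X(1) by (force simp: S_def)
                  show "(\<lambda>i. x (X (i + k))) \<longlonglongrightarrow> x l"
                    by (rule xt[OF _ LIMSEQ_ignore_initial_segment[OF X(2)]])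
                      (use lts t0 s Xts in \<open>auto intro: order_trans\<close>)
                  show "x l \<in> M" by (rule xM) (use lts t0 s in auto)
                qed
                then show ?thesis using lts by (simp add: S_def)
              qed
            qed
            moreover have tS: "t \<in> S" "bdd_above S" using s by (auto simp: S_def intro: bdd_aboveI[of _ s])
            ultimately have mS: "m \<in> S" unfolding m_def using closed_contains_Sup[of S] by blast
            have off: "x \<sigma> \<notin> C" if "m < \<sigma>" "\<sigma> \<le> s" for \<sigma>
            proof
              assume "x \<sigma> \<in> C"
              then have "\<sigma> \<in> S" using that mS by (auto simp: S_def)
              then have "\<sigma> \<le> m" unfolding m_def using tS(2) by (rule cSup_upper)
              then show False using that by simp
            qed
            have ms: "t \<le> m" "m < s" "m = t \<or> x m \<in> C"
              using mS sC s by (auto simp: S_def) (metis order_less_le)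
            have "Q m"
            proof (cases "m = t")
              case True then show ?thesis using Qt[of t] t0 t1 by simp
            next
              case False then show ?thesis using \<epsilon>'(2)[of m] ms s by auto
            qed
            then obtain v' where v': "nline (x m) v'" "e \<bullet> v' = 1" "norm (v' - a) \<le> \<epsilon> * m" by (auto simp: Q_def)
            define d' where "d' = (s - m) *\<^sub>R d"
            have par: "(z + m *\<^sub>R d) + \<sigma> *\<^sub>R d' = z + (m + \<sigma> * (s - m)) *\<^sub>R d" for \<sigma>
              by (simp add: d'_def algebra_simps)
            have rng: "0 \<le> m + \<sigma> * (s - m)" "m + \<sigma> * (s - m) \<le> s" if "\<sigma> \<in> {0..1}" for \<sigma>
            proof -
              have "\<sigma> * (s - m) \<le> s - m" using that ms by (intro mult_left_le_one_le) auto
              moreover have "0 \<le> \<sigma> * (s - m)" using that ms by simp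
              ultimately show "0 \<le> m + \<sigma> * (s - m)" "m + \<sigma> * (s - m) \<le> s" using ms t0 by linarith+
            qed
            have n_off: "n (x \<sigma>) = n (x s)" if "m < \<sigma>" "\<sigma> \<le> s" for \<sigma>
            proof (rule n_const_off_C[of "{m<..s}"])
              show "continuous_on {m<..s} x" using cx by (rule continuous_on_subset) (use ms t0 s in auto)
            qed (use that ms off xM t0 s in auto)
            have nm: "n (x m) = n (x s)"
            proof (rule LIMSEQ_unique)
              define S' where "S' i = m + (s - m) * inverse (real (Suc i))" for i
              have S': "m < S' i" "S' i \<le> s" for i
              proof -
                show "m < S' i" using ms by (simp add: S'_def)
                have "(s - m) * inverse (real (Suc i)) \<le> (s - m) * 1"
                  using ms by (intro mult_left_mono) (auto simp: inverse_le_1_iff)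
                then show "S' i \<le> s" by (simp add: S'_def)
              qed
              have "S' \<longlonglongrightarrow> m + (s - m) * 0" unfolding S'_def[abs_def]
                by (intro tendsto_intros LIMSEQ_inverse_real_of_nat)
              moreover have S'0: "0 \<le> S' i" for i using S'(1)[of i] ms(1) t0 by linarith
              ultimately have "(\<lambda>i. x (S' i)) \<longlonglongrightarrow> x m"
                using ms t0 s by (intro xt) auto
              moreover have "x (S' i) \<in> M" for i using xM S'[of i] ms t0 s by auto
              ultimately show "(\<lambda>i. n (x (S' i))) \<longlonglongrightarrow> n (x m)"
                using xM[of m] ms t0 s by (intro n_tendsto) auto
              show "(\<lambda>i. n (x (S' i))) \<longlonglongrightarrow> n (x s)" using n_off[OF S'] by simp
            qed
            have ball: "(z + m *\<^sub>R d) + \<sigma> *\<^sub>R d' \<in> ?B" if "\<sigma> \<in> {0..1}" for \<sigma>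
              unfolding par using zB[of "m + \<sigma> * (s - m)"] rng[OF that] s B(1) by auto
            have nconst: "n (G ((z + m *\<^sub>R d) + \<sigma> *\<^sub>R d')) = n (x s)" if "\<sigma> \<in> {0..1}" for \<sigma>
              unfolding par x_def[symmetric]
            proof (cases "\<sigma> = 0")
              case False
              then have "m < m + \<sigma> * (s - m)" using that ms by simp
              then show "n (x (m + \<sigma> * (s - m))) = n (x s)" using n_off rng[OF that] by blast
            qed (simp add: nm)
            have tr: "n (x s) \<bullet> n p \<noteq> 0" using B(2)[OF zB[of s]] ms s t0 by (simp add: x_def)
            define w where "w = f (G ((z + m *\<^sub>R d) + d')) - f (G (z + m *\<^sub>R d))"
            note seg = graph_segment[OF gcc p ball nconst tr w_def, unfolded par, folded x_def]
            have "nline (ex (x m) w) v'"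
            proof (rule planar_fan[OF v'(1) seg(1)])
              fix l :: real assume l: "0 < l" "l \<le> 1"
              have "m < m + l * (s - m)" using l ms by simp
              then show "ex (x m) (l *\<^sub>R w) \<notin> C" using seg(2)[of l] l off rng(2)[of l] by simp
            qed
            moreover have "ex (x m) w = x s" using seg(2)[of 1] by simp
            moreover have "\<epsilon> * m \<le> \<epsilon> * s" using ms \<epsilon> by simp
            ultimately have "nline (x s) v' \<and> e \<bullet> v' = 1 \<and> norm (v' - a) \<le> \<epsilon> * s" using v'(2,3) by simp
            then show ?thesis unfolding Q_def by blast
          qed
          then show ?thesis using \<epsilon>'(1) by blast
        qed
      next
        fix t :: real assume t0: "0 < t" and Qt: "\<And>s. 0 \<le> s \<Longrightarrow> s < t \<Longrightarrow> s \<le> 1 \<longrightarrow> Q s"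
        show "t \<le> 1 \<longrightarrow> Q t"
        proof
          assume t1: "t \<le> 1"
          obtain X where X: "\<And>i::nat. 0 \<le> X i" "\<And>i. X i < t" "X \<longlonglongrightarrow> t"
            using tendsto_from_below[OF t0] by blast
          have "Q (X i)" for i using Qt[OF X(1,2), of i] X(2)[of i] t1 by simp
          then obtain v where v: "\<And>i. nline (x (X i)) (v i)" "\<And>i. e \<bullet> v i = 1" "\<And>i. norm (v i - a) \<le> \<epsilon> * X i"
            unfolding Q_def by metis
          have "v i \<in> cball a \<epsilon>" for i
          proof -
            have "\<epsilon> * X i \<le> \<epsilon> * 1" using X(2)[of i] t1 \<epsilon> by (intro mult_left_mono) auto
            then show ?thesis using v(3)[of i] by (simp add: dist_norm norm_minus_commute)
          qed
          then obtain l h where h: "strict_mono (h :: nat \<Rightarrow> nat)" "(v \<circ> h) \<longlonglongrightarrow> l"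
            using compact_cball[of a \<epsilon>] unfolding compact_def by meson
          have Xh: "(\<lambda>i. X (h i)) \<longlonglongrightarrow> t" using LIMSEQ_subseq_LIMSEQ[OF X(3) h(1)] by (simp add: o_def)
          have vl: "(\<lambda>i. v (h i)) \<longlonglongrightarrow> l" using h(2) by (simp add: o_def)
          have "nline (x t) l"
          proof (rule nline_limit[OF _ _ _ vl v(1)])
            show "(\<lambda>i. x (X (h i))) \<longlonglongrightarrow> x t" by (rule xt[OF X(1) Xh]) (use t0 t1 in auto)
            show "x (X (h i)) \<in> M" for i using xM[OF X(1), of "h i"] X(2)[of "h i"] t1 by simp
            show "x t \<in> M" using xM t0 t1 by simp
          qed
          moreover have "(\<lambda>i. e \<bullet> v (h i)) \<longlonglongrightarrow> e \<bullet> l" by (intro tendsto_intros vl)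
          then have "e \<bullet> l = 1" using v(2) by (simp add: LIMSEQ_const_iff)
          moreover have "norm (l - a) \<le> \<epsilon> * t"
          proof (rule tendsto_le[OF sequentially_bot])
            show "(\<lambda>i. \<epsilon> * X (h i)) \<longlonglongrightarrow> \<epsilon> * t" by (intro tendsto_intros Xh)
            show "(\<lambda>i. norm (v (h i) - a)) \<longlonglongrightarrow> norm (l - a)" by (intro tendsto_intros vl)
          qed (use v(3) in simp)
          ultimately show "Q t" by (auto simp: Q_def)
        qed
      qed simp
      then show ?thesis using x1 by (auto simp: Q_def)
    qed
    then have "\<exists>v. nline q v \<and> norm (v - a) \<le> inverse (real (Suc i))" for i by simp
    then obtain v where v: "\<And>i. nline q (v i)" "\<And>i. norm (v i - a) \<le> inverse (real (Suc i))" by metis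
    have "(\<lambda>i. v i - a) \<longlonglongrightarrow> 0"
      by (rule Lim_null_comparison[OF always_eventually[OF allI[OF v(2)]] LIMSEQ_inverse_real_of_nat])
    then have "v \<longlonglongrightarrow> a" by (rule LIM_zero_cancel)
    moreover have "q \<in> M" using qU by (simp add: U_def)
    ultimately show "nline q a" by (intro nline_limit[OF _ tendsto_const _ _ v(1)])
  qed
  ultimately show ?thesis by blast
qed

theorem parallel_rulings:
  assumes "connected M" and p: "p \<in> M" "nline p a" "a \<noteq> 0" and q: "q \<in> M"
  shows "nline q a"
proof -
  let ?Z = "{x \<in> M. nline x a}"
  have "openin (top_of_set M) ?Z"
  proof (subst openin_subopen, intro ballI)
    fix x assume "x \<in> ?Z"
    then have "x \<in> M" "nline x a" by auto
    from ruling_direction_near[OF this p(3)] obtain U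
      where U: "openin (top_of_set M) U" "x \<in> U" "\<forall>q\<in>U. nline q a" by blast
    moreover have "U \<subseteq> ?Z" using U(3) openin_imp_subset[OF U(1)] by blast
    ultimately show "\<exists>T. openin (top_of_set M) T \<and> x \<in> T \<and> T \<subseteq> ?Z" by blast
  qed
  moreover have "closedin (top_of_set M) ?Z"
  proof -
    have "x \<in> ?Z" if xM: "x \<in> M" and xc: "x \<in> closure ?Z" for x
    proof -
      obtain X where X: "\<forall>i. X i \<in> ?Z" "X \<longlonglongrightarrow> x" using xc[unfolded closure_sequential] by blast
      have "nline x a" by (rule nline_limit[OF _ X(2) xM tendsto_const]) (use X(1) in auto)
      then show ?thesis using xM by simp
    qed
    then have "M \<inter> closure ?Z = ?Z" using closure_subset[of ?Z] by auto
    then show ?thesis using closedin_closed_Int[OF closed_closure, of M ?Z] by simp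
  qed
  ultimately have "?Z = {} \<or> ?Z = M" using assms(1)[unfolded connected_clopen] by meson
  then show ?thesis using p q by blast
qed

end

section \<open>Surfaces with parallel lines are cylinders or planes\<close>

context proper_surface
begin

text \<open>The translates in direction \<open>v\<close> of the curve \<open>g\<close>, which lies over a line in a direction \<open>w\<close> not parallel
  to \<open>v\<close>, form a subset that \<open>f\<close> maps onto a plane. It is closed by continuity of coordinates, and
  open by local injectivity modulo the normal; so it is all of \<open>M\<close>.\<close>

lemma plane_of_crossing_lines:
  assumes conn: "connected M" and v: "\<And>p. p \<in> M \<Longrightarrow> nline p v" "v \<noteq> 0"
    and g: "continuous_on UNIV g" "\<And>s. g s \<in> M" "\<And>s. f (g s) = c + s *\<^sub>R w"
    and w: "\<And>k. w \<noteq> k *\<^sub>R v"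
  shows "is_plane M f"
proof -
  let ?S = "range (\<lambda>(s, t). ex (g s) (t *\<^sub>R v))"
  have fS: "f (ex (g s) (t *\<^sub>R v)) = c + s *\<^sub>R w + t *\<^sub>R v" for s t
    using nlineD(4)[OF v(1)[OF g(2)]] g(3) by simp
  have w_tan: "n (g s) \<bullet> w = 0" for s
  proof -
    have "n (g (s + 0)) \<bullet> w = 0"
    proof (rule curve_tangent[where g = "\<lambda>t. g (s + t)"])
      show "continuous_on {0..1} (\<lambda>t. g (s + t))"
        by (rule continuous_on_compose2[OF g(1)]) (auto intro!: continuous_intros)
    qed (use g(2,3) in \<open>auto simp: algebra_simps\<close>)
    then show ?thesis by simp
  qed
  have v_tan: "n (g s) \<bullet> v = 0" for s using nline_tangent[OF v(1)[OF g(2)]] .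
  have ne: "w \<bullet> (n (g s) \<times> v) \<noteq> 0" for s
    using parallel_in_plane[OF norm_n[OF g(2)] v_tan w_tan v(2)] w by blast
  have lim: "(\<lambda>i. ex (g (S i)) (T i *\<^sub>R v)) \<longlonglongrightarrow> ex (g s) (t *\<^sub>R v)" if "S \<longlonglongrightarrow> s" "T \<longlonglongrightarrow> t" for S T s t
  proof (rule ex_limit(2)[OF g(2) _ g(2)])
    show "(\<lambda>i. g (S i)) \<longlonglongrightarrow> g s" using continuous_on_tendsto_compose[OF g(1) that(1)] by simp
    show "(\<lambda>i. T i *\<^sub>R v) \<longlonglongrightarrow> t *\<^sub>R v" by (intro tendsto_intros that(2))
    show "nseg (g (S i)) (T i *\<^sub>R v)" for i by (rule nlineD(1)[OF v(1)[OF g(2)]])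
  qed
  have SM: "?S \<subseteq> M" using nlineD(3)[OF v(1)[OF g(2)]] by auto
  define \<nu> where "\<nu> = n (g 0)"
  define \<kappa> where "\<kappa> = w \<bullet> (\<nu> \<times> v)"
  have \<kappa>: "\<kappa> \<noteq> 0" using ne by (simp add: \<kappa>_def \<nu>_def)
  have swap: "v \<bullet> (\<nu> \<times> w) = - \<kappa>" using inner_cross_swap[of v \<nu> w] by (simp add: \<kappa>_def)
  have swap': "v \<bullet> (n (g s) \<times> w) = - (w \<bullet> (n (g s) \<times> v))" for s by (rule inner_cross_swap)
  have coord: "(f (ex (g s) (t *\<^sub>R v)) - c) \<bullet> (\<nu> \<times> v) / \<kappa> = s"
    "(f (ex (g s) (t *\<^sub>R v)) - c) \<bullet> (\<nu> \<times> w) / - \<kappa> = t" for s t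
    using \<kappa> swap by (simp_all add: fS inner_add_left inner_cross_self \<kappa>_def[symmetric])
  have closed: "x \<in> ?S" if x: "x \<in> M" and X: "\<And>i::nat. X i \<in> ?S" "X \<longlonglongrightarrow> x" for x X
  proof -
    have "\<exists>st. X i = ex (g (fst st)) (snd st *\<^sub>R v)" for i using X(1)[of i] by auto
    then obtain st where st: "\<And>i. X i = ex (g (fst (st i))) (snd (st i) *\<^sub>R v)" by metis
    define S where "S i = fst (st i)" for i
    define T where "T i = snd (st i)" for i
    have ST: "X i = ex (g (S i)) (T i *\<^sub>R v)" for i unfolding S_def T_def by (rule st)
    have XM: "X i \<in> M" for i using X(1) SM by blast
    have fX: "(\<lambda>i. f (X i)) \<longlonglongrightarrow> f x" by (rule f_tendsto[OF XM x X(2)])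
    have S: "S = (\<lambda>i. (f (X i) - c) \<bullet> (\<nu> \<times> v) / \<kappa>)" "T = (\<lambda>i. (f (X i) - c) \<bullet> (\<nu> \<times> w) / - \<kappa>)"
      by (auto simp: ST coord simp del: divide_minus_right)
    define \<alpha> where "\<alpha> = (f x - c) \<bullet> (\<nu> \<times> v) / \<kappa>"
    define \<beta> where "\<beta> = (f x - c) \<bullet> (\<nu> \<times> w) / - \<kappa>"
    have "S \<longlonglongrightarrow> \<alpha>" unfolding S \<alpha>_def by (intro tendsto_intros fX \<kappa>)
    moreover have "T \<longlonglongrightarrow> \<beta>" unfolding S(2) \<beta>_def
      by (intro tendsto_intros fX) (use \<kappa> in simp)
    ultimately have "X \<longlonglongrightarrow> ex (g \<alpha>) (\<beta> *\<^sub>R v)" unfolding ST[abs_def] by (rule lim)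
    then have "x = ex (g \<alpha>) (\<beta> *\<^sub>R v)" by (rule LIMSEQ_unique[OF X(2)])
    then have "x = (\<lambda>(s, t). ex (g s) (t *\<^sub>R v)) (\<alpha>, \<beta>)" by simp
    then show ?thesis by (rule range_eqI)
  qed
  have open': "x \<in> M - ?S" if x: "x \<in> M" and X: "\<And>i::nat. X i \<in> M - ?S" "X \<longlonglongrightarrow> x" for x X
  proof (rule ccontr)
    assume "x \<notin> M - ?S"
    then obtain s t where xst: "x = ex (g s) (t *\<^sub>R v)" using x by auto
    have nx: "n x = n (g s)" unfolding xst by (rule nlineD(5)[OF v(1)[OF g(2)]])
    define D where "D i = f (X i) - f x" for i
    have XM: "X i \<in> M" for i using X(1) by blast
    have D: "D \<longlonglongrightarrow> 0"
      using tendsto_diff[OF f_tendsto[OF XM x X(2)] tendsto_const[of "f x"]] by (simp add: D_def[abs_def])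
    define k where "k = w \<bullet> (n x \<times> v)"
    have k: "k \<noteq> 0" using ne nx by (simp add: k_def)
    define S where "S i = s + D i \<bullet> (n x \<times> v) / k" for i
    define T where "T i = t + D i \<bullet> (n x \<times> w) / - k" for i
    have "S \<longlonglongrightarrow> s + 0 \<bullet> (n x \<times> v) / k" unfolding S_def[abs_def] by (intro tendsto_intros D k)
    moreover have "T \<longlonglongrightarrow> t + 0 \<bullet> (n x \<times> w) / - k" unfolding T_def[abs_def]
      by (intro tendsto_intros D) (use k in simp)
    ultimately have Y: "(\<lambda>i. ex (g (S i)) (T i *\<^sub>R v)) \<longlonglongrightarrow> x" unfolding xst by (intro lim) simp_all
    have YM: "ex (g (S i)) (T i *\<^sub>R v) \<in> M" for i by (rule nlineD(3)[OF v(1)[OF g(2)]])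
    have "\<exists>c'. f (X i) - f (ex (g (S i)) (T i *\<^sub>R v)) = c' *\<^sub>R n x" for i
    proof -
      define y where "y = D i - (D i \<bullet> n x) *\<^sub>R n x"
      have ny: "n x \<bullet> y = 0" using n_inner[OF x] by (simp add: y_def inner_diff_right inner_commute)
      have "n x \<bullet> w = 0" "n x \<bullet> v = 0" using w_tan v_tan nx by auto
      from plane_coords[OF norm_n[OF x] this ny] k
      have "y = (y \<bullet> (n x \<times> v) / k) *\<^sub>R w - (y \<bullet> (n x \<times> w) / k) *\<^sub>R v" by (simp add: k_def)
      moreover have "y \<bullet> (n x \<times> v) = D i \<bullet> (n x \<times> v)" "y \<bullet> (n x \<times> w) = D i \<bullet> (n x \<times> w)"
        by (simp_all add: y_def inner_diff_left inner_cross_self)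
      ultimately have "y = (D i \<bullet> (n x \<times> v) / k) *\<^sub>R w - (D i \<bullet> (n x \<times> w) / k) *\<^sub>R v" by simp
      then have "D i = (D i \<bullet> (n x \<times> v) / k) *\<^sub>R w - (D i \<bullet> (n x \<times> w) / k) *\<^sub>R v + (D i \<bullet> n x) *\<^sub>R n x"
        by (simp add: y_def algebra_simps)
      moreover have fXi: "f (X i) = c + s *\<^sub>R w + t *\<^sub>R v + D i"
        unfolding D_def xst fS by simp
      have "f (X i) - f (ex (g (S i)) (T i *\<^sub>R v)) =
        D i - ((D i \<bullet> (n x \<times> v) / k) *\<^sub>R w - (D i \<bullet> (n x \<times> w) / k) *\<^sub>R v)"
        unfolding fXi fS S_def T_def by (simp add: scaleR_add_left scaleR_diff_left)
      ultimately show ?thesis by (metis add_diff_cancel_left')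
    qed
    then have "\<forall>\<^sub>F i in sequentially. X i = ex (g (S i)) (T i *\<^sub>R v)"
      using locally_injective_mod_normal[OF x XM X(2) YM Y] by simp
    then obtain i where "X i = ex (g (S i)) (T i *\<^sub>R v)" by (auto dest: eventually_happens)
    then show False using X(1)[of i] by auto
  qed
  have cl: "closedin (top_of_set M) A" if A: "A \<subseteq> M" "\<And>x X. x \<in> M \<Longrightarrow> (\<And>i::nat. X i \<in> A) \<Longrightarrow> X \<longlonglongrightarrow> x \<Longrightarrow> x \<in> A" for A
  proof -
    have "x \<in> A" if xM: "x \<in> M" and xA: "x \<in> closure A" for x
    proof -
      obtain X where X: "\<forall>i. X i \<in> A" "X \<longlonglongrightarrow> x" using xA[unfolded closure_sequential] by blast
      from A(2)[OF xM _ X(2)] X(1) show ?thesis by blast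
    qed
    then have "M \<inter> closure A = A" using A(1) closure_subset[of A] by auto
    then show ?thesis using closedin_closed_Int[OF closed_closure, of M A] by simp
  qed
  have 1: "closedin (top_of_set M) ?S" by (rule cl[OF SM closed])
  have "closedin (top_of_set M) (M - ?S)" by (rule cl[OF Diff_subset open'])
  then have 2: "openin (top_of_set M) ?S" using SM by (simp add: closedin_def double_diff)
  have "?S = {} \<or> ?S = M" using conn[unfolded connected_clopen] 1 2 by meson
  then have MS: "M = ?S" by auto
  have fM: "f ` M = (+) c ` span {w, v}"
  proof -
    have sp: "span {w, v} = range (\<lambda>(s, t). s *\<^sub>R w + t *\<^sub>R v)"
      by (force simp: span_insert span_singleton algebra_simps)
    have "f ` ?S = range (\<lambda>(s, t). c + (s *\<^sub>R w + t *\<^sub>R v))"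
      unfolding image_image by (intro image_cong) (auto simp: fS)
    also have "\<dots> = (+) c ` span {w, v}" unfolding sp image_image by (intro image_cong) auto
    finally show ?thesis using MS by simp
  qed
  have "independent {w, v}"
    using v(2) w by (auto simp: independent_insert span_singleton)
  moreover have "w \<noteq> v" using w[of 1] by simp
  ultimately have "dim (span {w, v}) = 2" by (simp add: dim_span dim_eq_card_independent)
  then show ?thesis
    unfolding is_plane_def fM
    by (simp add: affine_translation[symmetric] subspace_imp_affine aff_dim_translation_eq aff_dim_subspace)
qed

lemma line_lift:
  assumes L: "line_in_surface M f L" and p: "p \<in> L"
  obtains g w where "continuous_on UNIV g" "\<And>s. g s \<in> M" "\<And>s. f (g s) = f p + s *\<^sub>R w" "g 0 = p"
    "w \<noteq> 0" "L = range g"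
proof -
  obtain h where L': "L \<subseteq> M" "affine (f ` L)" "aff_dim (f ` L) = 1" "homeomorphism L (f ` L) f h"
    using L unfolding line_in_surface_def by blast
  obtain a b where ab: "a \<noteq> b" "f ` L = affine hull {a, b}"
  proof -
    obtain B where B: "\<not> affine_dependent B" "affine hull B = affine hull (f ` L)" "int (card B) = aff_dim (f ` L) + 1"
      using aff_dim_inner_basis_exists[of "f ` L"] by blast
    then have "card B = 2" using L'(3) by simp
    then obtain a b where "B = {a, b}" "a \<noteq> b" by (meson card_2_iff)
    moreover have "f ` L = affine hull B" using B(2) hull_same[of affine, OF L'(2)] by simp
    ultimately show ?thesis using that by blast
  qed
  define w where "w = b - a"
  have w: "w \<noteq> 0" using ab(1) by (simp add: w_def)
  have line: "affine hull {a, b} = range (\<lambda>s. a + s *\<^sub>R w)"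
    by (simp only: affine_hull_2_alt w_def)
  have "f p \<in> range (\<lambda>s. a + s *\<^sub>R w)" using p unfolding ab(2)[unfolded line, symmetric] by (rule imageI)
  then obtain s0 where s0: "f p = a + s0 *\<^sub>R w" by (elim rangeE)
  have fL: "f ` L = range (\<lambda>s. f p + s *\<^sub>R w)"
  proof -
    have "range (\<lambda>s. a + s *\<^sub>R w) = range (\<lambda>s. f p + s *\<^sub>R w)"
    proof (intro equalityI subsetI; elim rangeE)
      fix x s assume "x = a + s *\<^sub>R w"
      then have "x = f p + (s - s0) *\<^sub>R w" by (simp add: s0 algebra_simps)
      then show "x \<in> range (\<lambda>s. f p + s *\<^sub>R w)" by blast
    next
      fix x s assume "x = f p + s *\<^sub>R w"
      then have "x = a + (s + s0) *\<^sub>R w" by (simp add: s0 algebra_simps)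
      then show "x \<in> range (\<lambda>s. a + s *\<^sub>R w)" by blast
    qed
    then show ?thesis using ab(2) line by simp
  qed
  define g where "g s = h (f p + s *\<^sub>R w)" for s
  have mem: "f p + s *\<^sub>R w \<in> f ` L" for s unfolding fL by (rule rangeI)
  show ?thesis
  proof (rule that)
    show "continuous_on UNIV g" unfolding g_def
      by (rule continuous_on_compose2[OF homeomorphism_cont2[OF L'(4)]])
        (intro continuous_intros, rule image_subsetI, rule mem)
    have gL: "g s \<in> L" for s
      using imageI[OF mem, of h] homeomorphism_image2[OF L'(4)] unfolding g_def by blast
    then show "g s \<in> M" for s using L'(1) by blast
    show "f (g s) = f p + s *\<^sub>R w" for s unfolding g_def by (rule homeomorphism_apply2[OF L'(4) mem])
    show "g 0 = p" using homeomorphism_apply1[OF L'(4) p] by (simp add: g_def)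
    show "L = range g"
    proof
      show "L \<subseteq> range g"
      proof
        fix y assume y: "y \<in> L"
        have "f y \<in> range (\<lambda>s. f p + s *\<^sub>R w)" unfolding fL[symmetric] using y by (rule imageI)
        then obtain s where "f y = f p + s *\<^sub>R w" by (elim rangeE)
        then have "y = g s" using homeomorphism_apply1[OF L'(4) y] by (simp add: g_def)
        then show "y \<in> range g" by (rule range_eqI)
      qed
    qed (use gL in blast)
  qed (rule w)
qed

lemma nline_line_in_surface:
  assumes v: "nline p v" "v \<noteq> 0"
  shows "line_in_surface M f (range (\<lambda>t. ex p (t *\<^sub>R v)))" "f ` range (\<lambda>t. ex p (t *\<^sub>R v)) = (+) (f p) ` span {v}"
proof -
  let ?r = "range (\<lambda>t. ex p (t *\<^sub>R v))"
  note nl = nlineD[OF v(1)]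
  show fr: "f ` ?r = (+) (f p) ` span {v}" by (auto simp: nl(4) span_singleton image_image)
  define h where "h y = ex p (((y - f p) \<bullet> v / (v \<bullet> v)) *\<^sub>R v)" for y
  have hf: "h (f (ex p (t *\<^sub>R v))) = ex p (t *\<^sub>R v)" for t using v(2) by (simp add: h_def nl(4))
  have "homeomorphism ?r (f ` ?r) f h"
  proof (rule homeomorphismI)
    show "continuous_on ?r f" by (rule continuous_on_subset[OF continuous_f]) (use nl(3) in auto)
    show "continuous_on (f ` ?r) h" unfolding h_def
      by (rule continuous_on_compose2[OF nline_continuous[OF v(1), of UNIV]])
        (use v(2) in \<open>auto intro!: continuous_intros\<close>)
  qed (use hf in auto)
  moreover have "aff_dim (f ` ?r) = 1"
    unfolding fr aff_dim_translation_eq using v(2) by (simp add: aff_dim_subspace dim_span)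
  moreover have "affine (f ` ?r)" unfolding fr
    by (simp add: affine_translation[symmetric] subspace_imp_affine)
  ultimately show "line_in_surface M f ?r" unfolding line_in_surface_def using nl(3) by blast
qed

text \<open>If the surface is not a plane, a further line through a point is excluded by
  \<open>plane_of_crossing_lines\<close>.\<close>

theorem cylinder_or_plane_if_parallel:
  assumes conn: "connected M" and v: "\<And>p. p \<in> M \<Longrightarrow> nline p v" "v \<noteq> 0"
  shows "is_cylinder M f \<or> is_plane M f"
proof (rule disjCI)
  assume np: "\<not> is_plane M f"
  define r where "r p = range (\<lambda>t. ex p (t *\<^sub>R v))" for p
  have uniq: "L = r p" if L: "line_in_surface M f L" and p: "p \<in> M" "p \<in> L" for L p
  proof -
    obtain g w where g: "continuous_on UNIV g" "\<And>s. g s \<in> M" "\<And>s. f (g s) = f p + s *\<^sub>R w" "g 0 = p"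
      and w: "w \<noteq> 0" and Lg: "L = range g" using line_lift[OF L p(2)] by metis
    obtain k where k: "w = k *\<^sub>R v"
      using plane_of_crossing_lines[OF conn v g(1-3)] np by blast
    have k0: "k \<noteq> 0" using w k by auto
    note nl = nlineD[OF v(1)[OF p(1)]]
    have ge: "g s = ex p ((s * k) *\<^sub>R v)" for s
    proof (rule lift_unique[of UNIV g _ 0])
      show "continuous_on UNIV (\<lambda>s. ex p ((s * k) *\<^sub>R v))"
        by (rule continuous_on_compose2[OF nline_continuous[OF v(1)[OF p(1)], of UNIV]])
          (auto intro!: continuous_intros)
      show "g 0 = ex p ((0 * k) *\<^sub>R v)" using g(4) nseg_0(2)[OF p(1)] by simp
    qed (use g nl k in auto)
    show ?thesis unfolding Lg r_def
    proof (intro equalityI subsetI; elim rangeE)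
      fix x s assume "x = g s"
      then show "x \<in> range (\<lambda>t. ex p (t *\<^sub>R v))" unfolding ge by (rule range_eqI)
    next
      fix x t assume "x = ex p (t *\<^sub>R v)"
      then have "x = g (t / k)" using k0 by (simp add: ge)
      then show "x \<in> range g" by (rule range_eqI)
    qed
  qed
  show "is_cylinder M f"
    unfolding is_cylinder_def
  proof (intro exI[of _ r] conjI ballI impI allI)
    fix p assume p: "p \<in> M"
    show "line_in_surface M f (r p)" unfolding r_def by (rule nline_line_in_surface(1)[OF v(1)[OF p] v(2)])
    have "ex p (0 *\<^sub>R v) = p" using nseg_0(2)[OF p] by simp
    then show "p \<in> r p" unfolding r_def by (metis rangeI)
    show "L = r p" if "line_in_surface M f L \<and> p \<in> L" for L using uniq p that by blast
  next
    fix p q assume pq: "p \<in> M" "q \<in> M"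
    have "f ` r q = (+) (f q - f p) ` (f ` r p)"
      unfolding r_def nline_line_in_surface(2)[OF v(1)[OF pq(1)] v(2)]
        nline_line_in_surface(2)[OF v(1)[OF pq(2)] v(2)] by (simp add: image_image)
    then show "affine_parallel (f ` r p) (f ` r q)" unfolding affine_parallel_def by blast
  qed
qed

end

text \<open>If \<open>C\<close> is empty, the normal is constant and all tangent directions are directions of
  lines; any of them can be used in place of a ruling.\<close>

theorem (in developable_surface) cylinder_or_plane:
  assumes conn: "connected M"
  shows "is_cylinder M f \<or> is_plane M f"
proof (cases "M = {}")
  case True
  then show ?thesis by (simp add: is_cylinder_def)
next
  case False
  then obtain p0 where p0: "p0 \<in> M" by blast
  show ?thesis
  proof (cases "C = {}")
    case C: False
    then obtain p where p: "p \<in> C" by blast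
    obtain w where w: "norm w = 1" "nline p w" using C_line[OF p] by blast
    have w0: "w \<noteq> 0" using w by auto
    show ?thesis
      by (rule cylinder_or_plane_if_parallel[OF conn parallel_rulings[OF conn C_subset[OF p] w(2) w0] w0])
  next
    case C: True
    have nconst: "n p = n p0" if p: "p \<in> M" for p
    proof (rule connected_induction_simple[OF conn p0 p])
      fix x assume "x \<in> M"
      then obtain U where U: "openin (top_of_set M) U" "x \<in> U" "\<forall>y\<in>U. n y = n x"
        using locally_const_off_C[of x] C by auto
      then show "\<exists>T. openin (top_of_set M) T \<and> x \<in> T \<and> (\<forall>x\<in>T. \<forall>y\<in>T. n x = n p0 \<longrightarrow> n y = n p0)"
        by metis
    qed simp
    have all: "nline p u" if p: "p \<in> M" and u: "n p0 \<bullet> u = 0" for p u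
      unfolding nline_def
    proof
      fix s :: real
      have 1: "n p \<bullet> (s *\<^sub>R u) = 0" using nconst[OF p] u by simp
      show "nseg p (s *\<^sub>R u)" using ray_first_hit[OF p _ 1, of 1] C by auto
    qed
    obtain v where v: "v \<noteq> 0" "orthogonal (n p0) v"
      using orthogonal_to_vector_exists[of "n p0"] by auto
    have nv: "n p0 \<bullet> v = 0" using v(2) by (simp add: orthogonal_def)
    show ?thesis
      by (rule cylinder_or_plane_if_parallel[OF conn all[OF _ nv] v(1)])
  qed
qed

section \<open>Local graphs of immersions\<close>

lemma tangency_at:
  fixes F :: "real^2 \<Rightarrow> real^3" and \<nu> :: "real^3"
  assumes der: "(F has_derivative L) (at x0)" and inj: "inj L" and \<nu>: "\<And>u. \<nu> \<bullet> L u = 0" and \<epsilon>: "0 < \<epsilon>"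
  shows "\<exists>\<delta>>0. \<forall>x. norm (x - x0) < \<delta> \<longrightarrow> \<bar>\<nu> \<bullet> (F x - F x0)\<bar> \<le> \<epsilon> * norm (F x - F x0)"
proof -
  have lin: "linear L" using der has_derivative_linear by blast
  obtain c where c: "0 < c" "\<And>u. c * norm u \<le> norm (L u)"
    using linear_inj_bounded_below_pos[OF lin inj] by metis
  define e where "e = min (c / 2) (\<epsilon> * c / (2 * (norm \<nu> + 1)))"
  have nn: "0 < norm \<nu> + 1" using norm_ge_zero[of \<nu>] by linarith
  have e0: "0 < e" unfolding e_def using c(1) \<epsilon> nn by simp
  have e1: "e \<le> c / 2" unfolding e_def by (rule min.cobounded1)
  have "e \<le> \<epsilon> * c / (2 * (norm \<nu> + 1))" unfolding e_def by (rule min.cobounded2)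
  then have e2: "(norm \<nu> + 1) * e \<le> \<epsilon> * (c / 2)" using nn by (simp add: field_simps)
  obtain d where d: "0 < d" "\<And>x. norm (x - x0) < d \<Longrightarrow> norm (F x - F x0 - L (x - x0)) \<le> e * norm (x - x0)"
    using der e0 unfolding has_derivative_at_alt by blast
  have "\<bar>\<nu> \<bullet> (F x - F x0)\<bar> \<le> \<epsilon> * norm (F x - F x0)" if x: "norm (x - x0) < d" for x
  proof -
    define R where "R = F x - F x0 - L (x - x0)"
    have R: "norm R \<le> e * norm (x - x0)" using d(2)[OF x] by (simp add: R_def)
    have "norm (L (x - x0)) \<le> norm (F x - F x0) + norm R"
      using norm_triangle_ineq4[of "F x - F x0" R] by (simp add: R_def)
    then have "c * norm (x - x0) \<le> norm (F x - F x0) + e * norm (x - x0)" using c(2)[of "x - x0"] R by linarith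
    moreover have "e * norm (x - x0) \<le> c / 2 * norm (x - x0)" by (rule mult_right_mono[OF e1]) simp
    ultimately have low: "c / 2 * norm (x - x0) \<le> norm (F x - F x0)" by simp
    have "\<nu> \<bullet> (F x - F x0) = \<nu> \<bullet> R" using \<nu> by (simp add: R_def inner_diff_right)
    then have "\<bar>\<nu> \<bullet> (F x - F x0)\<bar> \<le> norm \<nu> * norm R" using Cauchy_Schwarz_ineq2 by simp
    also have "\<dots> \<le> (norm \<nu> + 1) * (e * norm (x - x0))" by (rule mult_mono[OF _ R]) (use nn in auto)
    also have "\<dots> \<le> \<epsilon> * (c / 2 * norm (x - x0))"
      using mult_right_mono[OF e2, of "norm (x - x0)"] by (simp add: mult_ac)
    also have "\<dots> \<le> \<epsilon> * norm (F x - F x0)" using low \<epsilon> by (intro mult_left_mono) auto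
    finally show ?thesis .
  qed
  then show ?thesis using d(1) by blast
qed

lemma normal_space:
  fixes L :: "real^2 \<Rightarrow> real^3" and \<nu> :: "real^3"
  assumes lin: "linear L" and inj: "inj L" and n1: "norm \<nu> = 1" and \<nu>: "\<And>u. \<nu> \<bullet> L u = 0"
  shows "(\<And>u. y \<bullet> L u = 0) \<Longrightarrow> \<exists>c. y = c *\<^sub>R \<nu>" "\<nu> \<bullet> y = 0 \<Longrightarrow> \<exists>u. y = L u"
proof -
  define a where "a = L (axis 1 1)"
  define b where "b = L (axis 2 1)"
  have a0: "a \<noteq> 0" using linear_injective_0[OF lin] inj unfolding a_def by (metis axis_eq_0_iff zero_neq_one)
  have nab: "\<nu> \<bullet> a = 0" "\<nu> \<bullet> b = 0" using \<nu> by (auto simp: a_def b_def)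
  have ne: "b \<bullet> (\<nu> \<times> a) \<noteq> 0"
  proof
    assume "b \<bullet> (\<nu> \<times> a) = 0"
    then obtain c where "b = c *\<^sub>R a" using parallel_in_plane[OF n1 nab a0] by blast
    then have "L (axis 2 1 - c *\<^sub>R axis 1 1) = 0"
      by (simp add: linear_diff[OF lin] linear_scale[OF lin] a_def b_def)
    then have "axis 2 1 - c *\<^sub>R axis 1 1 = (0 :: real^2)" using linear_injective_0[OF lin] inj by blast
    then have "(axis 2 1 - c *\<^sub>R axis 1 1 :: real^2) $ 2 = 0" by (simp only: zero_index)
    then show False by (simp add: axis_def)
  qed
  have surj: "\<exists>u. z = L u" if z: "\<nu> \<bullet> z = 0" for z
  proof -
    obtain \<beta> \<alpha> where "z = \<beta> *\<^sub>R b - \<alpha> *\<^sub>R a"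
      using plane_coords[OF n1 nab(2,1) z ne] by blast
    then have "z = L (\<beta> *\<^sub>R axis 2 1 - \<alpha> *\<^sub>R axis 1 1)"
      by (simp add: linear_diff[OF lin] linear_scale[OF lin] a_def b_def)
    then show ?thesis by blast
  qed
  then show "\<nu> \<bullet> y = 0 \<Longrightarrow> \<exists>u. y = L u" .
  show "\<exists>c. y = c *\<^sub>R \<nu>" if y: "\<And>u. y \<bullet> L u = 0"
  proof -
    define d where "d = y - (y \<bullet> \<nu>) *\<^sub>R \<nu>"
    have n11: "\<nu> \<bullet> \<nu> = 1" using n1 by (simp add: dot_square_norm)
    have "\<nu> \<bullet> d = 0" using n11 by (simp add: d_def inner_diff_right inner_commute)
    then obtain u where "d = L u" using surj by blast
    moreover have "d \<bullet> L u = 0" using y \<nu> by (simp add: d_def inner_diff_left)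
    ultimately have "d \<bullet> d = 0" by simp
    then show ?thesis by (auto simp: d_def)
  qed
qed

lemma adjoint_kernel:
  fixes L :: "real^2 \<Rightarrow> real^3" and \<nu> :: "real^3"
  assumes lin: "linear L" and inj: "inj L" and n1: "norm \<nu> = 1" and \<nu>: "\<And>u. \<nu> \<bullet> L u = 0"
  shows "adjoint L y = 0 \<longleftrightarrow> (\<exists>c. y = c *\<^sub>R \<nu>)"
proof
  assume "adjoint L y = 0"
  then have "y \<bullet> L u = 0" for u using adjoint_works[OF lin, of u y] by (simp add: inner_commute)
  then show "\<exists>c. y = c *\<^sub>R \<nu>" by (rule normal_space(1)[OF assms])
next
  assume "\<exists>c. y = c *\<^sub>R \<nu>"
  then have "adjoint L y \<bullet> adjoint L y = 0"
    using adjoint_works[OF lin, of "adjoint L y" y] \<nu> by (auto simp: inner_commute)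
  then show "adjoint L y = 0" by simp
qed

lemma adjoint_comp_inj:
  fixes L :: "real^2 \<Rightarrow> real^3"
  assumes "linear L" "inj L" shows "inj (\<lambda>u. adjoint L (L u))" "linear (\<lambda>u. adjoint L (L u))"
proof -
  show l: "linear (\<lambda>u. adjoint L (L u))"
    using linear_compose[OF assms(1) adjoint_linear[OF assms(1)]] by (simp add: o_def)
  have "u = 0" if "adjoint L (L u) = 0" for u
  proof -
    have "L u \<bullet> L u = 0" using adjoint_works[OF assms(1), of u "L u"] that by simp
    then show ?thesis using linear_injective_0[OF assms(1)] assms(2) by simp
  qed
  then show "inj (\<lambda>u. adjoint L (L u))" using linear_injective_0[OF l] by blast
qed

text \<open>Composed with the adjoint of the derivative at \<open>x0\<close>, which is a projection along the normal followed by
  an isomorphism, the immersion becomes a local diffeomorphism of the plane; \<open>G\<close> is its inverse. Using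
  the adjoint avoids a choice of coordinates in the tangent plane.\<close>

lemma local_graph_at:
  fixes F :: "real^2 \<Rightarrow> real^3" and F' :: "real^2 \<Rightarrow> ((real^2) \<Rightarrow>\<^sub>L (real^3))"
  assumes V: "open V" "x0 \<in> V" and der: "\<And>x. x \<in> V \<Longrightarrow> (F has_derivative F' x) (at x)"
    and cont: "continuous_on V F'" and inj: "inj (F' x0)"
  shows "\<exists>r G K. 0 < r \<and> open (G ` ball (adjoint (F' x0) (F x0)) r) \<and>
    G ` ball (adjoint (F' x0) (F x0)) r \<subseteq> V \<and> G (adjoint (F' x0) (F x0)) = x0 \<and>
    continuous_on (ball (adjoint (F' x0) (F x0)) r) G \<and>
    (\<forall>z\<in>ball (adjoint (F' x0) (F x0)) r. adjoint (F' x0) (F (G z)) = z) \<and>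
    (\<forall>z\<in>ball (adjoint (F' x0) (F x0)) r. \<forall>z'\<in>ball (adjoint (F' x0) (F x0)) r.
        norm (F (G z) - F (G z')) \<le> K * norm (z - z'))"
proof -
  define P where "P = adjoint (F' x0)"
  have linL: "linear (F' x0)" by (rule bounded_linear.linear[OF blinfun.bounded_linear_right])
  have linP: "linear P" unfolding P_def by (rule adjoint_linear[OF linL])
  have blP: "bounded_linear P" using linP linear_conv_bounded_linear by blast
  note comp = adjoint_comp_inj[OF linL inj, folded P_def]
  obtain c where c: "0 < c" "\<And>u. c * norm u \<le> norm (P (F' x0 u))"
    using linear_inj_bounded_below_pos[OF comp(2,1)] by metis
  obtain B where B: "0 < B" "\<And>y. norm (P y) \<le> B * norm y" using linear_bounded_pos[OF linP] by blast
  define e where "e = c / (2 * B)"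
  have e: "0 < e" using c B by (simp add: e_def)
  obtain d1 where d1: "0 < d1" "\<And>x. x \<in> V \<Longrightarrow> dist x x0 < d1 \<Longrightarrow> dist (F' x) (F' x0) < e"
    using cont[unfolded continuous_on_iff, rule_format, OF V(2) e] by metis
  obtain d2 where d2: "0 < d2" "ball x0 d2 \<subseteq> V" using V open_contains_ball by blast
  define \<rho> where "\<rho> = min d1 d2"
  have \<rho>: "0 < \<rho>" "ball x0 \<rho> \<subseteq> V" using d1(1) d2 by (auto simp: \<rho>_def)
  have \<rho>3: "norm (F' x - F' x0) \<le> e" if "x \<in> ball x0 \<rho>" for x
  proof -
    have "dist x x0 < d1" using that by (simp add: \<rho>_def dist_commute)
    then show ?thesis using d1(2)[of x] \<rho>(2) that by (auto simp: dist_norm)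
  qed
  have lin_est: "norm (F y - F x - F' x0 (y - x)) \<le> norm (y - x) * e" if "x \<in> ball x0 \<rho>" "y \<in> ball x0 \<rho>" for x y
  proof (rule differentiable_bound_linearization[where S = "ball x0 \<rho>" and f' = F'])
    fix t :: real assume "t \<in> {0..1}"
    then show "x + t *\<^sub>R (y - x) \<in> ball x0 \<rho>"
      using convexD_alt[OF convex_ball that, of t] by (simp add: algebra_simps)
  next
    fix z assume z: "z \<in> ball x0 \<rho>"
    then show "(F has_derivative F' z) (at z within ball x0 \<rho>)"
      using der \<rho>(2) has_derivative_at_withinI by blast
    have "blinfun_apply (F' z) - blinfun_apply (F' x0) = blinfun_apply (F' z - F' x0)"
      by (rule ext) (simp add: blinfun.diff_left)
    then show "onorm (blinfun_apply (F' z) - blinfun_apply (F' x0)) \<le> e"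
      using \<rho>3[OF z] by (simp add: norm_blinfun.rep_eq)
  qed (use \<rho>(1) in simp)
  have lower: "c / 2 * norm (y - x) \<le> norm (P (F y) - P (F x))" if "x \<in> ball x0 \<rho>" "y \<in> ball x0 \<rho>" for x y
  proof -
    have "norm (P (F y - F x - F' x0 (y - x))) \<le> B * (norm (y - x) * e)"
      using B(2) lin_est[OF that] B(1) by (meson mult_left_mono order_trans less_imp_le)
    also have "\<dots> = c / 2 * norm (y - x)" using B(1) by (simp add: e_def)
    finally have "norm (P (F y) - P (F x) - P (F' x0 (y - x))) \<le> c / 2 * norm (y - x)"
      by (simp add: linear_diff[OF linP])
    moreover have "norm (P (F' x0 (y - x))) \<le> norm (P (F y) - P (F x)) + norm (P (F y) - P (F x) - P (F' x0 (y - x)))"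
      using norm_triangle_ineq4[of "P (F y) - P (F x)" "P (F y) - P (F x) - P (F' x0 (y - x))"] by simp
    ultimately show ?thesis using c(2)[of "y - x"] by linarith
  qed
  define K where "K = (norm (F' x0) + e) * (2 / c)"
  have lip: "norm (F y - F x) \<le> K * norm (P (F y) - P (F x))" if "x \<in> ball x0 \<rho>" "y \<in> ball x0 \<rho>" for x y
  proof -
    have "norm (F y - F x) \<le> norm (F' x0 (y - x)) + norm (F y - F x - F' x0 (y - x))"
      using norm_triangle_ineq[of "F' x0 (y - x)" "F y - F x - F' x0 (y - x)"] by simp
    also have "\<dots> \<le> (norm (F' x0) + e) * norm (y - x)"
      using norm_blinfun[of "F' x0" "y - x"] lin_est[OF that] by (simp add: algebra_simps)
    also have "\<dots> \<le> (norm (F' x0) + e) * (2 / c * norm (P (F y) - P (F x)))"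
    proof (rule mult_left_mono)
      show "norm (y - x) \<le> 2 / c * norm (P (F y) - P (F x))" using lower[OF that] c(1) by (simp add: field_simps)
    qed (use e in simp)
    finally show ?thesis unfolding K_def by (simp only: mult.assoc)
  qed
  define f' where "f' x = Blinfun P o\<^sub>L F' x" for x
  have f'_app: "blinfun_apply (f' x) = (\<lambda>u. P (F' x u))" for x
    by (rule ext) (simp add: f'_def bounded_linear_Blinfun_apply[OF blP])
  obtain k where k: "linear k" "k \<circ> (\<lambda>u. P (F' x0 u)) = id"
    using linear_injective_left_inverse[OF comp(2,1)] by blast
  have blk: "bounded_linear k" using k(1) linear_conv_bounded_linear by blast
  have inv: "Blinfun k o\<^sub>L f' x0 = id_blinfun"
  proof (rule blinfun_eqI)
    fix u have "k (P (F' x0 u)) = u" using fun_cong[OF k(2), of u] by simp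
    then show "(Blinfun k o\<^sub>L f' x0) u = id_blinfun u"
      by (simp add: f'_app bounded_linear_Blinfun_apply[OF blk])
  qed
  have derPF: "((\<lambda>x. P (F x)) has_derivative f' x) (at x)" if "x \<in> ball x0 \<rho>" for x
    unfolding f'_app using \<rho>(2) that by (intro bounded_linear.has_derivative[OF blP der]) blast
  have contf': "continuous_on (ball x0 \<rho>) f'"
    unfolding f'_def by (intro continuous_intros continuous_on_subset[OF cont \<rho>(2)])
  have x0b: "x0 \<in> ball x0 \<rho>" using \<rho>(1) by simp
  obtain U' V' g g' where ift: "open U'" "U' \<subseteq> ball x0 \<rho>" "x0 \<in> U'" "open V'" "P (F x0) \<in> V'"
    "homeomorphism U' V' (\<lambda>x. P (F x)) g"
    by (rule inverse_function_theorem[where f = "\<lambda>x. P (F x)" and f' = f' and invf = "Blinfun k",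
          OF open_ball derPF contf' x0b inv])
  obtain r where r: "0 < r" "ball (P (F x0)) r \<subseteq> V'" using ift(4,5) open_contains_ball by blast
  have gU: "g z \<in> U'" "P (F (g z)) = z" if "z \<in> V'" for z
    using imageI[OF that, of g] homeomorphism_image2[OF ift(6)] homeomorphism_apply2[OF ift(6) that] by auto
  have "openin (top_of_set U') (g ` ball (P (F x0)) r)"
    by (rule homeomorphism_imp_open_map[OF homeomorphism_symD[OF ift(6)]])
      (use r(2) in \<open>simp add: openin_open_eq[OF ift(4)]\<close>)
  then have "open (g ` ball (P (F x0)) r)" using openin_open_eq[OF ift(1)] by blast
  moreover have "g ` ball (P (F x0)) r \<subseteq> V" using gU(1) r(2) ift(2) \<rho>(2) by blast
  moreover have "g (P (F x0)) = x0" by (rule homeomorphism_apply1[OF ift(6,3)])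
  moreover have "continuous_on (ball (P (F x0)) r) g"
    by (rule continuous_on_subset[OF homeomorphism_cont2[OF ift(6)] r(2)])
  moreover have "\<forall>z\<in>ball (P (F x0)) r. P (F (g z)) = z" using gU(2) r(2) by blast
  moreover have "\<forall>z\<in>ball (P (F x0)) r. \<forall>z'\<in>ball (P (F x0)) r. norm (F (g z) - F (g z')) \<le> K * norm (z - z')"
  proof (intro ballI)
    fix z z' assume "z \<in> ball (P (F x0)) r" "z' \<in> ball (P (F x0)) r"
    then have z: "z \<in> V'" "z' \<in> V'" using r(2) by auto
    have "norm (F (g z) - F (g z')) \<le> K * norm (P (F (g z)) - P (F (g z')))"
      by (rule lip) (use gU(1) z ift(2) in blast)+
    then show "norm (F (g z) - F (g z')) \<le> K * norm (z - z')" using gU(2) z by simp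
  qed
  ultimately show ?thesis unfolding P_def[symmetric]
    by (intro exI[of _ r] exI[of _ g] exI[of _ K] conjI r(1))
qed

section \<open>The flow box of a Gauss map of rank one\<close>

lemma plane_frame:
  fixes k u y :: "real^2"
  assumes "k \<noteq> 0" "u \<noteq> 0" "k \<bullet> u = 0"
  shows "y = (y \<bullet> k / (k \<bullet> k)) *\<^sub>R k + (y \<bullet> u / (u \<bullet> u)) *\<^sub>R u"
proof -
  define d where "d = y - ((y \<bullet> k / (k \<bullet> k)) *\<^sub>R k + (y \<bullet> u / (u \<bullet> u)) *\<^sub>R u)"
  have "u \<bullet> k = 0" using assms(3) by (simp add: inner_commute)
  then have dk: "d \<bullet> k = 0" "d \<bullet> u = 0"
    using assms by (simp_all add: d_def inner_diff_left inner_add_left)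
  define j where "j = k$1 * u$2 - k$2 * u$1"
  have "j * j = (k \<bullet> k) * (u \<bullet> u) - (k \<bullet> u) * (k \<bullet> u)"
    by (simp add: j_def inner_vec_def sum_2 algebra_simps)
  then have j: "j \<noteq> 0" using assms by auto
  have "d$1 * j = u$2 * (d \<bullet> k) - k$2 * (d \<bullet> u)" "d$2 * j = k$1 * (d \<bullet> u) - u$1 * (d \<bullet> k)"
    by (simp_all add: j_def inner_vec_def sum_2 algebra_simps)
  then have "d$1 = 0" "d$2 = 0" using j dk by auto
  then have "d = 0" by (simp add: vec_eq_iff forall_2)
  then show ?thesis by (simp add: d_def)
qed

text \<open>Coordinates \<open>(s, \<eta>)\<close> near a point where the derivative of \<open>N\<close> is not zero: \<open>s = N \<bullet> e\<close>, and \<open>\<eta>\<close> is a linear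
  coordinate along the kernel \<open>k0\<close> of the derivative at \<open>x0\<close>. As the derivative of \<open>N\<close> has rank one, \<open>N\<close> depends on \<open>s\<close>
  only, \<open>N = \<nu>0 s\<close>. Since \<open>F\<close> moves orthogonally to \<open>N\<close>, also \<open>F \<bullet> N\<close> depends on \<open>s\<close> only, and its
  derivative in \<open>s\<close> is \<open>F \<bullet> \<nu>1 s\<close>, which again depends on \<open>s\<close> only. The conclusion records that
  \<open>\<nu>1\<close> and \<open>\<kappa>1\<close> are differentiable once more.\<close>

lemma flow_box:
  fixes F N :: "real^2 \<Rightarrow> real^3" and F' N' :: "real^2 \<Rightarrow> ((real^2) \<Rightarrow>\<^sub>L (real^3))"
  assumes V: "open V" "x0 \<in> V" and derF: "\<And>x. x \<in> V \<Longrightarrow> (F has_derivative F' x) (at x)"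
    and derN: "\<And>x. x \<in> V \<Longrightarrow> (N has_derivative N' x) (at x)" and contN: "continuous_on V N'"
    and diffN: "\<And>x u. x \<in> V \<Longrightarrow> (\<lambda>x. N' x u) differentiable (at x)"
    and orth: "\<And>x u. x \<in> V \<Longrightarrow> N x \<bullet> F' x u = 0"
    and rank: "\<And>x. x \<in> V \<Longrightarrow> \<exists>u. u \<noteq> 0 \<and> N' x u = 0"
    and inj: "inj (F' x0)" and u1: "N' x0 u1 \<bullet> e \<noteq> 0" and s0: "s0 = N x0 \<bullet> e"
  obtains \<delta> U h \<nu>0 \<nu>1 \<kappa>1 \<nu>2 \<kappa>2 k where "0 < \<delta>" "open U" "x0 \<in> U" "U \<subseteq> V" "h s0 0 = x0"
    "\<And>s \<eta>. \<bar>s - s0\<bar> < \<delta> \<Longrightarrow> \<bar>\<eta>\<bar> < \<delta> \<Longrightarrow> h s \<eta> \<in> U"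
    "\<And>s \<eta>. \<bar>s - s0\<bar> < \<delta> \<Longrightarrow> \<bar>\<eta>\<bar> < \<delta> \<Longrightarrow> N (h s \<eta>) \<bullet> e = s"
    "\<And>x. x \<in> U \<Longrightarrow> \<exists>\<eta>. \<bar>\<eta>\<bar> < \<delta> \<and> x = h (N x \<bullet> e) \<eta>"
    "\<And>\<eta>. \<bar>\<eta>\<bar> < \<delta> \<Longrightarrow> isCont (\<lambda>s. h s \<eta>) s0"
    "\<And>x. x \<in> U \<Longrightarrow> \<bar>N x \<bullet> e - s0\<bar> < \<delta>"
    "\<And>x. x \<in> U \<Longrightarrow> N x = \<nu>0 (N x \<bullet> e)" "\<And>x. x \<in> U \<Longrightarrow> F x \<bullet> \<nu>1 (N x \<bullet> e) = \<kappa>1 (N x \<bullet> e)"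
    "\<And>s. \<bar>s - s0\<bar> < \<delta> \<Longrightarrow> (\<nu>0 has_vector_derivative \<nu>1 s) (at s)"
    "(\<nu>1 has_vector_derivative \<nu>2) (at s0)" "(\<kappa>1 has_vector_derivative \<kappa>2) (at s0)"
    "continuous_on {-\<delta><..<\<delta>} (h s0)" "\<And>\<eta>. \<bar>\<eta>\<bar> < \<delta> \<Longrightarrow> F (h s0 \<eta>) \<bullet> N x0 = F x0 \<bullet> N x0"
    "((\<lambda>\<eta>. F (h s0 \<eta>)) has_vector_derivative k) (at 0)" "k \<noteq> 0"
proof -
  define E1 E2 :: "real^2" where "E1 = axis 1 1" and "E2 = axis 2 1"
  have EE: "E1 \<bullet> E1 = 1" "E2 \<bullet> E2 = 1" "E1 \<bullet> E2 = 0" "E2 \<bullet> E1 = 0"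
    by (simp_all add: E1_def E2_def inner_axis_axis)
  have nE: "norm E1 = 1" "norm E2 = 1" by (simp_all add: E1_def E2_def)
  obtain k0 where k0: "k0 \<noteq> 0" "N' x0 k0 = 0" using rank[OF V(2)] by blast
  define V1 where "V1 = V \<inter> (\<lambda>x. N' x u1 \<bullet> e) -` (- {0})"
  have cont1: "continuous_on V (\<lambda>x. N' x u1 \<bullet> e)" by (intro continuous_intros contN)
  have V1: "open V1" "x0 \<in> V1" "V1 \<subseteq> V"
    using continuous_open_preimage[OF cont1 V(1) open_delete[OF open_UNIV, of 0]] u1 V(2)
    by (auto simp: V1_def Compl_eq_Diff_UNIV)
  define \<Phi> where "\<Phi> x = (N x \<bullet> e) *\<^sub>R E1 + (k0 \<bullet> x) *\<^sub>R E2" for x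
  define bA where "bA = Blinfun (\<lambda>y :: real^3. (y \<bullet> e) *\<^sub>R E1)"
  define bB where "bB = Blinfun (\<lambda>u. (k0 \<bullet> u) *\<^sub>R E2)"
  have bA: "blinfun_apply bA = (\<lambda>y. (y \<bullet> e) *\<^sub>R E1)" unfolding bA_def
    by (rule bounded_linear_Blinfun_apply)
      (intro bounded_linear_compose[OF bounded_linear_scaleR_left bounded_linear_inner_left])
  have bB: "blinfun_apply bB = (\<lambda>u. (k0 \<bullet> u) *\<^sub>R E2)" unfolding bB_def
    by (rule bounded_linear_Blinfun_apply)
      (intro bounded_linear_compose[OF bounded_linear_scaleR_left bounded_linear_inner_right])
  define \<Phi>' where "\<Phi>' x = (bA o\<^sub>L N' x) + bB" for x
  have \<Phi>': "\<Phi>' x u = (N' x u \<bullet> e) *\<^sub>R E1 + (k0 \<bullet> u) *\<^sub>R E2" for x u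
    by (simp add: \<Phi>'_def bA bB blinfun.add_left)
  have \<Phi>'_0: "N' x u \<bullet> e = 0" "k0 \<bullet> u = 0" if "\<Phi>' x u = 0" for x u
  proof -
    have "\<Phi>' x u \<bullet> E1 = 0" "\<Phi>' x u \<bullet> E2 = 0" using that by auto
    then show "N' x u \<bullet> e = 0" "k0 \<bullet> u = 0" by (simp_all add: \<Phi>' EE inner_add_left)
  qed
  have linN: "N' x (c *\<^sub>R u + d *\<^sub>R v) = c *\<^sub>R N' x u + d *\<^sub>R N' x v" for x c d u v
    by (simp add: blinfun.add_right blinfun.scaleR_right)
  have der\<Phi>: "(\<Phi> has_derivative \<Phi>' x) (at x)" if "x \<in> V1" for x
  proof -
    have "(N has_derivative N' x) (at x)" using derN V1(3) that by blast
    then show ?thesis unfolding \<Phi>_def[abs_def] \<Phi>' by (auto intro!: derivative_eq_intros)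
  qed
  have cont\<Phi>': "continuous_on V1 \<Phi>'" unfolding \<Phi>'_def[abs_def]
    by (intro continuous_intros continuous_on_subset[OF contN V1(3)])
  have inj0: "u = 0" if u: "\<Phi>' x0 u = 0" for u
  proof (rule ccontr)
    assume "u \<noteq> 0"
    from plane_frame[OF k0(1) this \<Phi>'_0(2)[OF u], of u1]
    have "N' x0 u1 = (u1 \<bullet> u / (u \<bullet> u)) *\<^sub>R N' x0 u" using linN k0(2) by (metis add_0 scaleR_zero_right)
    then show False using u1 \<Phi>'_0(1)[OF u] by simp
  qed
  have lin0: "linear (\<Phi>' x0)" by (rule bounded_linear.linear[OF blinfun.bounded_linear_right])
  have "inj (\<Phi>' x0)" using linear_injective_0[OF lin0] inj0 by blast
  then obtain iv where iv: "linear iv" "iv \<circ> \<Phi>' x0 = id" using linear_injective_left_inverse[OF lin0] by blast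
  have bliv: "bounded_linear iv" using iv(1) linear_conv_bounded_linear by blast
  have inv: "Blinfun iv o\<^sub>L \<Phi>' x0 = id_blinfun"
  proof (rule blinfun_eqI)
    fix u have "iv (\<Phi>' x0 u) = u" using fun_cong[OF iv(2), of u] by simp
    then show "(Blinfun iv o\<^sub>L \<Phi>' x0) u = id_blinfun u" by (simp add: bounded_linear_Blinfun_apply[OF bliv])
  qed
  obtain U' V' g g' where ift: "open U'" "U' \<subseteq> V1" "x0 \<in> U'" "open V'" "\<Phi> x0 \<in> V'" "homeomorphism U' V' \<Phi> g"
    and dg: "\<And>z. z \<in> V' \<Longrightarrow> (g has_derivative g' z) (at z)"
    "\<And>z. z \<in> V' \<Longrightarrow> g' z = inv (blinfun_apply (\<Phi>' (g z)))" "\<And>z. z \<in> V' \<Longrightarrow> bij (blinfun_apply (\<Phi>' (g z)))"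
    using inverse_function_theorem[OF V1(1) der\<Phi> cont\<Phi>' V1(2) inv] by blast
  have gU: "g z \<in> U'" "g z \<in> V1" "g z \<in> V" "\<Phi> (g z) = z" if "z \<in> V'" for z
    using homeomorphism_image2[OF ift(6)] homeomorphism_apply2[OF ift(6) that] that ift(2) V1(3) by blast+
  have g'a: "\<Phi>' (g z) (g' z v) = v" if "z \<in> V'" for z v
    unfolding dg(2)[OF that] by (rule surj_f_inv_f[OF bij_is_surj[OF dg(3)[OF that]]])
  have inj': "u = v" if "z \<in> V'" "\<Phi>' (g z) u = \<Phi>' (g z) v" for z u v
    using bij_is_inj[OF dg(3)[OF that(1)]] that(2) by (rule injD)
  have Ng: "N (g z) \<bullet> e = z \<bullet> E1" "k0 \<bullet> g z = z \<bullet> E2" if "z \<in> V'" for z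
  proof -
    have "\<Phi> (g z) \<bullet> E1 = z \<bullet> E1" "\<Phi> (g z) \<bullet> E2 = z \<bullet> E2" using gU(4)[OF that] by auto
    then show "N (g z) \<bullet> e = z \<bullet> E1" "k0 \<bullet> g z = z \<bullet> E2" by (simp_all add: \<Phi>_def EE inner_add_left)
  qed
  \<comment> \<open>the derivative of \<open>N\<close> with respect to \<open>s\<close>, written without the coordinates so that its differentiability is evident\<close>
  define \<mu> where "\<mu> x = (1 / (N' x u1 \<bullet> e)) *\<^sub>R N' x u1" for x
  have E2k: "N' (g z) (g' z E2) = 0" if z: "z \<in> V'" for z
  proof -
    obtain u where u: "u \<noteq> 0" "N' (g z) u = 0" using rank[OF gU(3)[OF z]] by blast
    have "\<Phi>' (g z) u = \<Phi>' (g z) ((k0 \<bullet> u) *\<^sub>R g' z E2)"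
      using g'a[OF z, of E2] u(2) by (simp add: \<Phi>'[of _ u] blinfun.scaleR_right)
    then have uk: "u = (k0 \<bullet> u) *\<^sub>R g' z E2" by (rule inj'[OF z])
    then have ne: "k0 \<bullet> u \<noteq> 0" using u(1) by auto
    have "N' (g z) ((k0 \<bullet> u) *\<^sub>R g' z E2) = 0" using uk u(2) by simp
    then show ?thesis using ne by (simp add: blinfun.scaleR_right)
  qed
  have E1a: "N' (g z) (g' z E1) = \<mu> (g z)" if z: "z \<in> V'" for z
  proof -
    let ?\<alpha> = "N' (g z) u1 \<bullet> e" and ?\<beta> = "k0 \<bullet> u1"
    have "\<Phi>' (g z) u1 = \<Phi>' (g z) (?\<alpha> *\<^sub>R g' z E1 + ?\<beta> *\<^sub>R g' z E2)"
      using g'a[OF z, of E2] g'a[OF z, of E1] by (simp add: \<Phi>'[of _ u1] blinfun.scaleR_right blinfun.add_right)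
    then have "u1 = ?\<alpha> *\<^sub>R g' z E1 + ?\<beta> *\<^sub>R g' z E2" by (rule inj'[OF z])
    then have "N' (g z) u1 = ?\<alpha> *\<^sub>R N' (g z) (g' z E1)" using linN E2k[OF z] by (metis add.right_neutral scaleR_zero_right)
    moreover have "?\<alpha> \<noteq> 0" using gU(2)[OF z] by (simp add: V1_def)
    moreover have "c = (1 / b) *\<^sub>R a" if "a = b *\<^sub>R c" "b \<noteq> 0" for a c :: "real^3" and b
      using that by simp
    ultimately show ?thesis unfolding \<mu>_def by metis
  qed
  obtain \<rho> where \<rho>: "0 < \<rho>" "ball (\<Phi> x0) \<rho> \<subseteq> V'" using ift(4,5) open_contains_ball by blast
  define \<delta> where "\<delta> = \<rho> / 2"
  have \<delta>: "0 < \<delta>" using \<rho> by (simp add: \<delta>_def)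
  define z where "z s \<eta> = s *\<^sub>R E1 + (k0 \<bullet> x0 + \<eta>) *\<^sub>R E2" for s \<eta>
  have zV: "z s \<eta> \<in> V'" if "\<bar>s - s0\<bar> < \<delta>" "\<bar>\<eta>\<bar> < \<delta>" for s \<eta>
  proof -
    have "z s \<eta> - \<Phi> x0 = (s - s0) *\<^sub>R E1 + \<eta> *\<^sub>R E2" by (simp add: z_def \<Phi>_def s0 algebra_simps)
    then have "norm (z s \<eta> - \<Phi> x0) \<le> \<bar>s - s0\<bar> + \<bar>\<eta>\<bar>"
      using norm_triangle_ineq[of "(s - s0) *\<^sub>R E1" "\<eta> *\<^sub>R E2"] nE by simp
    then have "z s \<eta> \<in> ball (\<Phi> x0) \<rho>" using that by (simp add: \<delta>_def dist_norm norm_minus_commute)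
    then show ?thesis using \<rho>(2) by blast
  qed
  define h where "h s \<eta> = g (z s \<eta>)" for s \<eta>
  have hs: "((\<lambda>s. h s \<eta>) has_vector_derivative g' (z s \<eta>) E1) (at s)" if "\<bar>s - s0\<bar> < \<delta>" "\<bar>\<eta>\<bar> < \<delta>" for s \<eta>
  proof -
    have "((\<lambda>s. z s \<eta>) has_vector_derivative E1) (at s)" unfolding z_def
      by (auto intro!: derivative_eq_intros simp: has_vector_derivative_def)
    then have "((\<lambda>s. z s \<eta>) has_derivative (\<lambda>x. x *\<^sub>R E1)) (at s)" by (simp add: has_vector_derivative_def)
    from diff_chain_at[OF this dg(1)[OF zV[OF that]]]
    show ?thesis using dg(1)[OF zV[OF that]]
      by (simp add: has_vector_derivative_def h_def[abs_def] o_def linear_scale[OF has_derivative_linear])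
  qed
  have h\<eta>: "((\<lambda>\<eta>. h s \<eta>) has_vector_derivative g' (z s \<eta>) E2) (at \<eta>)" if "\<bar>s - s0\<bar> < \<delta>" "\<bar>\<eta>\<bar> < \<delta>" for s \<eta>
  proof -
    have "((\<lambda>\<eta>. z s \<eta>) has_derivative (\<lambda>x. x *\<^sub>R E2)) (at \<eta>)" unfolding z_def
      by (auto intro!: derivative_eq_intros)
    from diff_chain_at[OF this dg(1)[OF zV[OF that]]]
    show ?thesis using dg(1)[OF zV[OF that]]
      by (simp add: has_vector_derivative_def h_def[abs_def] o_def linear_scale[OF has_derivative_linear])
  qed
  have comp_der: "((\<lambda>t. G (c t)) has_vector_derivative G' (c t) v) (at t)"
    if "(G has_derivative blinfun_apply (G' (c t))) (at (c t))" "(c has_vector_derivative v) (at t)"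
    for G :: "real^2 \<Rightarrow> real^3" and G' :: "real^2 \<Rightarrow> ((real^2) \<Rightarrow>\<^sub>L (real^3))" and c t v
    using diff_chain_at[OF that(2)[unfolded has_vector_derivative_def] that(1)]
    by (simp add: has_vector_derivative_def o_def blinfun.scaleR_right)
  have hV: "h s \<eta> \<in> V" if "\<bar>s - s0\<bar> < \<delta>" "\<bar>\<eta>\<bar> < \<delta>" for s \<eta>
    using gU(3)[OF zV[OF that]] by (simp add: h_def)
  have N\<eta>: "((\<lambda>\<eta>. N (h s \<eta>)) has_vector_derivative 0) (at \<eta>)" if "\<bar>s - s0\<bar> < \<delta>" "\<bar>\<eta>\<bar> < \<delta>" for s \<eta>
    using comp_der[of N N' "\<lambda>\<eta>. h s \<eta>" \<eta>, OF derN[OF hV[OF that]] h\<eta>[OF that]] E2k[OF zV[OF that]] by (simp add: h_def)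
  have Ns: "((\<lambda>s. N (h s \<eta>)) has_vector_derivative \<mu> (h s \<eta>)) (at s)" if "\<bar>s - s0\<bar> < \<delta>" "\<bar>\<eta>\<bar> < \<delta>" for s \<eta>
    using comp_der[of N N' "\<lambda>s. h s \<eta>" s, OF derN[OF hV[OF that]] hs[OF that]] E1a[OF zV[OF that]] by (simp add: h_def)
  have F\<eta>: "((\<lambda>\<eta>. F (h s \<eta>)) has_vector_derivative F' (h s \<eta>) (g' (z s \<eta>) E2)) (at \<eta>)"
    and Fs: "((\<lambda>s. F (h s \<eta>)) has_vector_derivative F' (h s \<eta>) (g' (z s \<eta>) E1)) (at s)"
    if "\<bar>s - s0\<bar> < \<delta>" "\<bar>\<eta>\<bar> < \<delta>" for s \<eta>
    using comp_der[of F F' "\<lambda>\<eta>. h s \<eta>" \<eta>, OF derF[OF hV[OF that]] h\<eta>[OF that]] comp_der[of F F' "\<lambda>s. h s \<eta>" s, OF derF[OF hV[OF that]] hs[OF that]] by auto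
  have const: "G \<eta> = G 0" if G: "\<And>\<eta>. \<bar>\<eta>\<bar> < \<delta> \<Longrightarrow> (G has_vector_derivative 0) (at \<eta>)" and "\<bar>\<eta>\<bar> < \<delta>"
    for G :: "real \<Rightarrow> 'b::real_normed_vector" and \<eta>
  proof -
    have "\<exists>c. \<forall>x\<in>{-\<delta><..<\<delta>}. G x = c"
      by (rule has_vector_derivative_zero_constant[OF convex_real_interval(8), of "-\<delta>" \<delta> G])
        (use G in \<open>auto intro: has_vector_derivative_at_within simp: abs_less_iff\<close>)
    then obtain c where "\<forall>x\<in>{-\<delta><..<\<delta>}. G x = c" ..
    moreover have "\<eta> \<in> {-\<delta><..<\<delta>}" "0 \<in> {-\<delta><..<\<delta>}" using that(2) \<delta> by auto
    ultimately show ?thesis by metis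
  qed
  have Nc: "N (h s \<eta>) = N (h s 0)" if "\<bar>s - s0\<bar> < \<delta>" "\<bar>\<eta>\<bar> < \<delta>" for s \<eta>
    using const[OF N\<eta>[OF that(1)] that(2)] by simp
  have ip: "((\<lambda>t. F1 t \<bullet> N1 t) has_vector_derivative (F1 t \<bullet> N2 + F2 \<bullet> N1 t)) (at t)"
    if "(F1 has_vector_derivative F2) (at t)" "(N1 has_vector_derivative N2) (at t)"
    for F1 N1 :: "real \<Rightarrow> real^3" and F2 N2 t
    using bounded_bilinear.has_vector_derivative[OF bounded_bilinear_inner that] .
  have \<kappa>c: "F (h s \<eta>) \<bullet> N (h s \<eta>) = F (h s 0) \<bullet> N (h s 0)" if s: "\<bar>s - s0\<bar> < \<delta>" and \<eta>: "\<bar>\<eta>\<bar> < \<delta>" for s \<eta>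
  proof (rule const[OF _ \<eta>])
    fix \<eta> assume \<eta>: "\<bar>\<eta>\<bar> < \<delta>"
    show "((\<lambda>\<eta>. F (h s \<eta>) \<bullet> N (h s \<eta>)) has_vector_derivative 0) (at \<eta>)"
      using ip[OF F\<eta>[OF s \<eta>] N\<eta>[OF s \<eta>]] orth[OF hV[OF s \<eta>]] by (simp add: inner_commute)
  qed
  have nb: "open {s. \<bar>s - s0\<bar> < \<delta>}" by (intro open_Collect_less continuous_intros)
  define \<nu>0 where "\<nu>0 s = N (h s 0)" for s
  define \<nu>1 where "\<nu>1 s = \<mu> (h s 0)" for s
  define \<kappa>1 where "\<kappa>1 s = F (h s 0) \<bullet> \<nu>1 s" for s
  have \<mu>c: "\<mu> (h s \<eta>) = \<nu>1 s" if s: "\<bar>s - s0\<bar> < \<delta>" and \<eta>: "\<bar>\<eta>\<bar> < \<delta>" for s \<eta>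
  proof (rule vector_derivative_unique_at)
    show "((\<lambda>s. N (h s \<eta>)) has_vector_derivative \<mu> (h s \<eta>)) (at s)" by (rule Ns[OF s \<eta>])
    show "((\<lambda>s. N (h s \<eta>)) has_vector_derivative \<nu>1 s) (at s)"
      by (rule has_vector_derivative_transform_within_open[OF Ns[OF s, of 0, folded \<nu>1_def] nb])
        (use Nc[OF _ \<eta>] s \<delta> in auto)
  qed
  have \<kappa>1c: "F (h s \<eta>) \<bullet> \<nu>1 s = \<kappa>1 s" if s: "\<bar>s - s0\<bar> < \<delta>" and \<eta>: "\<bar>\<eta>\<bar> < \<delta>" for s \<eta>
  proof (rule vector_derivative_unique_at)
    have *: "((\<lambda>s. F (h s \<eta>) \<bullet> N (h s \<eta>)) has_vector_derivative F (h s \<eta>) \<bullet> \<nu>1 s) (at s)" if \<eta>: "\<bar>\<eta>\<bar> < \<delta>" for \<eta>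
      using ip[OF Fs[OF s \<eta>] Ns[OF s \<eta>]] orth[OF hV[OF s \<eta>]] \<mu>c[OF s \<eta>] by (simp add: inner_commute)
    show "((\<lambda>s. F (h s \<eta>) \<bullet> N (h s \<eta>)) has_vector_derivative F (h s \<eta>) \<bullet> \<nu>1 s) (at s)" by (rule *[OF \<eta>])
    show "((\<lambda>s. F (h s \<eta>) \<bullet> N (h s \<eta>)) has_vector_derivative \<kappa>1 s) (at s)"
      by (rule has_vector_derivative_transform_within_open[OF *[of 0, folded \<kappa>1_def] nb])
        (use \<kappa>c[OF _ \<eta>] s \<delta> in auto)
  qed
  have s00: "\<bar>s0 - s0\<bar> < \<delta>" "\<bar>0\<bar> < \<delta>" using \<delta> by auto
  have z0: "z s0 0 = \<Phi> x0" by (simp add: z_def \<Phi>_def s0)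
  have hx0: "h s0 0 = x0" unfolding h_def z0 by (rule homeomorphism_apply1[OF ift(6,3)])
  obtain D where D: "((\<lambda>x. N' x u1) has_derivative D) (at x0)" using diffN[OF V(2)] differentiable_def by blast
  have \<nu>1_diff: "\<exists>\<nu>2. (\<nu>1 has_vector_derivative \<nu>2) (at s0)"
  proof -
    define G where "G x = N' x u1" for x
    have DG: "(G has_derivative D) (at x0)" using D by (simp add: G_def[abs_def])
    have "G x0 \<bullet> e \<noteq> 0" using u1 by (simp add: G_def)
    then have "((\<lambda>x. (1 / (G x \<bullet> e)) *\<^sub>R G x) has_derivative
        (\<lambda>w. (1 / (G x0 \<bullet> e)) *\<^sub>R D w + (- (D w \<bullet> e) / ((G x0 \<bullet> e) * (G x0 \<bullet> e))) *\<^sub>R G x0)) (at x0)"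
      by (auto intro!: derivative_eq_intros DG simp: divide_inverse mult_ac)
    then have "\<mu> differentiable (at x0)" unfolding \<mu>_def[abs_def] G_def differentiable_def by blast
    then have "\<mu> differentiable (at (h s0 0))" by (simp add: hx0)
    moreover have "(\<lambda>s. h s 0) differentiable (at s0)"
      using hs[OF s00] unfolding has_vector_derivative_def differentiable_def by blast
    ultimately have "(\<mu> \<circ> (\<lambda>s. h s 0)) differentiable (at s0)" by (intro differentiable_chain_at)
    then have "\<nu>1 differentiable (at s0)" by (simp add: o_def \<nu>1_def[abs_def])
    then show ?thesis using vector_derivative_works by blast
  qed
  then obtain \<nu>2 where \<nu>2: "(\<nu>1 has_vector_derivative \<nu>2) (at s0)" by blast
  have \<kappa>2: "(\<kappa>1 has_vector_derivative (F (h s0 0) \<bullet> \<nu>2 + F' (h s0 0) (g' (z s0 0) E1) \<bullet> \<nu>1 s0)) (at s0)"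
    unfolding \<kappa>1_def[abs_def] by (rule ip[OF Fs[OF s00] \<nu>2])
  define U where "U = U' \<inter> {x. \<bar>N x \<bullet> e - s0\<bar> < \<delta> \<and> \<bar>k0 \<bullet> x - k0 \<bullet> x0\<bar> < \<delta>}"
  have cN: "continuous_on U' N"
    using derN ift(2) V1(3) by (meson continuous_at_imp_continuous_on has_derivative_continuous subsetD)
  have "open (U' \<inter> (\<lambda>x. \<bar>N x \<bullet> e - s0\<bar>) -` {..<\<delta>})"
    by (intro continuous_open_preimage ift(1) open_lessThan continuous_intros cN)
  moreover have "open (U' \<inter> (\<lambda>x. \<bar>k0 \<bullet> x - k0 \<bullet> x0\<bar>) -` {..<\<delta>})"
    by (intro continuous_open_preimage ift(1) open_lessThan continuous_intros)
  ultimately have "open ((U' \<inter> (\<lambda>x. \<bar>N x \<bullet> e - s0\<bar>) -` {..<\<delta>}) \<inter> (U' \<inter> (\<lambda>x. \<bar>k0 \<bullet> x - k0 \<bullet> x0\<bar>) -` {..<\<delta>}))"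
    by (rule open_Int)
  also have "(U' \<inter> (\<lambda>x. \<bar>N x \<bullet> e - s0\<bar>) -` {..<\<delta>}) \<inter> (U' \<inter> (\<lambda>x. \<bar>k0 \<bullet> x - k0 \<bullet> x0\<bar>) -` {..<\<delta>}) = U"
    by (auto simp: U_def)
  finally have oU: "open U" .
  have hN: "N (h s \<eta>) \<bullet> e = s" "k0 \<bullet> h s \<eta> = k0 \<bullet> x0 + \<eta>" if "\<bar>s - s0\<bar> < \<delta>" "\<bar>\<eta>\<bar> < \<delta>" for s \<eta>
    using Ng[OF zV[OF that]] by (simp_all add: h_def z_def inner_add_left EE)
  have hU: "h s \<eta> \<in> U" if "\<bar>s - s0\<bar> < \<delta>" "\<bar>\<eta>\<bar> < \<delta>" for s \<eta>
    using hN[OF that] that gU(1)[OF zV[OF that]] by (simp add: U_def h_def[symmetric])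
  have Uh: "\<exists>\<eta>. \<bar>\<eta>\<bar> < \<delta> \<and> x = h (N x \<bullet> e) \<eta>" if x: "x \<in> U" for x
  proof (intro exI conjI)
    show "\<bar>k0 \<bullet> x - k0 \<bullet> x0\<bar> < \<delta>" using x by (simp add: U_def)
    have "z (N x \<bullet> e) (k0 \<bullet> x - k0 \<bullet> x0) = \<Phi> x" by (simp add: z_def \<Phi>_def)
    then show "x = h (N x \<bullet> e) (k0 \<bullet> x - k0 \<bullet> x0)"
      using homeomorphism_apply1[OF ift(6), of x] x by (simp add: h_def U_def)
  qed
  have US: "\<bar>N x \<bullet> e - s0\<bar> < \<delta>" if "x \<in> U" for x using that by (simp add: U_def)
  show ?thesis
  proof (rule that[OF \<delta> oU _ _ hx0 hU hN(1) Uh _ US])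
    show "x0 \<in> U" using ift(3) \<delta> by (simp add: U_def s0)
    show "U \<subseteq> V" using ift(2) V1(3) by (auto simp: U_def)
    show "isCont (\<lambda>s. h s \<eta>) s0" if "\<bar>\<eta>\<bar> < \<delta>" for \<eta>
      using hs[OF s00(1) that] by (rule has_vector_derivative_continuous)
    show "N x = \<nu>0 (N x \<bullet> e)" if "x \<in> U" for x
      using Uh[OF that] Nc[OF US[OF that]] unfolding \<nu>0_def by metis
    show "F x \<bullet> \<nu>1 (N x \<bullet> e) = \<kappa>1 (N x \<bullet> e)" if "x \<in> U" for x
      using Uh[OF that] \<kappa>1c[OF US[OF that]] by metis
    show "(\<nu>0 has_vector_derivative \<nu>1 s) (at s)" if "\<bar>s - s0\<bar> < \<delta>" for s
      using Ns[OF that s00(2)] by (simp add: \<nu>0_def[abs_def] \<nu>1_def)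
    show "(\<nu>1 has_vector_derivative \<nu>2) (at s0)" by (rule \<nu>2)
    show "(\<kappa>1 has_vector_derivative (F (h s0 0) \<bullet> \<nu>2 + F' (h s0 0) (g' (z s0 0) E1) \<bullet> \<nu>1 s0)) (at s0)" by (rule \<kappa>2)
    show "continuous_on {-\<delta><..<\<delta>} (h s0)"
    proof (intro continuous_at_imp_continuous_on ballI)
      fix \<eta> :: real assume "\<eta> \<in> {-\<delta><..<\<delta>}"
      then have "\<bar>\<eta>\<bar> < \<delta>" by auto
      from h\<eta>[OF s00(1) this] show "isCont (h s0) \<eta>" by (rule has_vector_derivative_continuous)
    qed
    show "F (h s0 \<eta>) \<bullet> N x0 = F x0 \<bullet> N x0" if "\<bar>\<eta>\<bar> < \<delta>" for \<eta>
      using \<kappa>c[OF s00(1) that] Nc[OF s00(1) that] hx0 by simp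
    show "((\<lambda>\<eta>. F (h s0 \<eta>)) has_vector_derivative F' (h s0 0) (g' (z s0 0) E2)) (at 0)" by (rule F\<eta>[OF s00])
    show "F' (h s0 0) (g' (z s0 0) E2) \<noteq> 0"
    proof
      assume "F' (h s0 0) (g' (z s0 0) E2) = 0"
      then have "F' x0 (g' (z s0 0) E2) = F' x0 0" by (simp add: hx0)
      then have "g' (z s0 0) E2 = 0" using inj by (rule injD[rotated])
      then have "E2 = 0" using g'a[OF zV[OF s00], of E2] by simp
      then show False using EE(2) by simp
    qed
  qed
qed

section \<open>Immersed surfaces with singular Gauss map\<close>

lemma continuous_on_if_locally:
  fixes f :: "'a::t2_space \<Rightarrow> 'b::topological_space"
  assumes "\<And>x. x \<in> S \<Longrightarrow> \<exists>T. openin (top_of_set S) T \<and> x \<in> T \<and> continuous_on T f"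
  shows "continuous_on S f"
  unfolding continuous_on_eq_continuous_within
proof
  fix x assume "x \<in> S"
  then obtain T where T: "openin (top_of_set S) T" "x \<in> T" "continuous_on T f" using assms by blast
  obtain V where V: "open V" "T = S \<inter> V" using T(1) by (auto simp: openin_open)
  have "continuous (at x within T) f" using T by (simp add: continuous_on_eq_continuous_within)
  moreover have "at x within T = at x within S"
    by (rule at_within_nhd[of _ V]) (use V T(2) in auto)
  ultimately show "continuous (at x within S) f" by simp
qed

text \<open>A chart in which the immersion is \<open>C\<^sup>1\<close>, with derivative \<open>F'\<close>, the normal is twice differentiable, with first
  derivative \<open>N'\<close>, and the derivative of the normal is singular everywhere.\<close>

definition flat_chart :: "'m::topological_space set \<Rightarrow> ('m \<Rightarrow> real^3) \<Rightarrow> ('m \<Rightarrow> real^3) \<Rightarrow>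
    (real^2) set \<Rightarrow> (real^2 \<Rightarrow> 'm) \<Rightarrow> (real^2 \<Rightarrow> ((real^2) \<Rightarrow>\<^sub>L (real^3))) \<Rightarrow>
    (real^2 \<Rightarrow> ((real^2) \<Rightarrow>\<^sub>L (real^3))) \<Rightarrow> bool" where
  "flat_chart M f n V \<psi> F' N' \<longleftrightarrow>
     open V \<and> openin (top_of_set M) (\<psi> ` V) \<and> (\<exists>g. homeomorphism V (\<psi> ` V) \<psi> g) \<and>
     continuous_on V F' \<and> continuous_on V N' \<and>
     (\<forall>x\<in>V. ((\<lambda>x. f (\<psi> x)) has_derivative F' x) (at x) \<and> inj (F' x) \<and>
        ((\<lambda>x. n (\<psi> x)) has_derivative N' x) (at x) \<and> (\<forall>u. (\<lambda>x. N' x u) differentiable (at x)) \<and>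
        norm (n (\<psi> x)) = 1 \<and> (\<forall>u. n (\<psi> x) \<bullet> F' x u = 0) \<and> (\<exists>u. u \<noteq> 0 \<and> N' x u = 0))"

locale flat_surface =
  fixes M :: "'m::{t2_space,second_countable_topology} set"
    and f n :: "'m \<Rightarrow> real^3"
  assumes proper_seq: "(\<And>i::nat. X i \<in> M) \<Longrightarrow> (\<lambda>i. f (X i)) \<longlonglongrightarrow> y \<Longrightarrow>
        \<exists>l\<in>M. \<exists>r. strict_mono r \<and> (X \<circ> r) \<longlonglongrightarrow> l"
    and charts: "p \<in> M \<Longrightarrow> \<exists>V \<psi> F' N' x. flat_chart M f n V \<psi> F' N' \<and> x \<in> V \<and> \<psi> x = p"
begin

lemma chartD:
  assumes "flat_chart M f n V \<psi> F' N'"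
  shows "open V" "openin (top_of_set M) (\<psi> ` V)" "continuous_on V F'" "continuous_on V N'" "continuous_on V \<psi>"
    and "\<And>x. x \<in> V \<Longrightarrow> \<psi> x \<in> M"
    and "\<And>x. x \<in> V \<Longrightarrow> ((\<lambda>x. f (\<psi> x)) has_derivative F' x) (at x)" "\<And>x. x \<in> V \<Longrightarrow> inj (F' x)"
    and "\<And>x. x \<in> V \<Longrightarrow> ((\<lambda>x. n (\<psi> x)) has_derivative N' x) (at x)"
    and "\<And>x u. x \<in> V \<Longrightarrow> (\<lambda>x. N' x u) differentiable (at x)"
    and "\<And>x. x \<in> V \<Longrightarrow> norm (n (\<psi> x)) = 1" "\<And>x u. x \<in> V \<Longrightarrow> n (\<psi> x) \<bullet> F' x u = 0"
    and "\<And>x. x \<in> V \<Longrightarrow> \<exists>u. u \<noteq> 0 \<and> N' x u = 0"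
    and "\<And>U. open U \<Longrightarrow> U \<subseteq> V \<Longrightarrow> openin (top_of_set M) (\<psi> ` U)"
    and "\<And>O'. open O' \<Longrightarrow> open (V \<inter> \<psi> -` O')"
proof -
  note * = assms[unfolded flat_chart_def]
  obtain g where g: "homeomorphism V (\<psi> ` V) \<psi> g" using * by blast
  show V: "open V" and op: "openin (top_of_set M) (\<psi> ` V)" and "continuous_on V F'" "continuous_on V N'"
    using * by auto
  show c: "continuous_on V \<psi>" using homeomorphism_cont1[OF g] .
  show "\<And>x. x \<in> V \<Longrightarrow> \<psi> x \<in> M" using openin_imp_subset[OF op] by blast
  show "\<And>x. x \<in> V \<Longrightarrow> ((\<lambda>x. f (\<psi> x)) has_derivative F' x) (at x)" "\<And>x. x \<in> V \<Longrightarrow> inj (F' x)"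
    "\<And>x. x \<in> V \<Longrightarrow> ((\<lambda>x. n (\<psi> x)) has_derivative N' x) (at x)"
    "\<And>x u. x \<in> V \<Longrightarrow> (\<lambda>x. N' x u) differentiable (at x)"
    "\<And>x. x \<in> V \<Longrightarrow> norm (n (\<psi> x)) = 1" "\<And>x u. x \<in> V \<Longrightarrow> n (\<psi> x) \<bullet> F' x u = 0"
    "\<And>x. x \<in> V \<Longrightarrow> \<exists>u. u \<noteq> 0 \<and> N' x u = 0" using * by blast+
  show "openin (top_of_set M) (\<psi> ` U)" if "open U" "U \<subseteq> V" for U
  proof -
    have "openin (top_of_set V) U" using that openin_open_eq[OF V] by blast
    from homeomorphism_imp_open_map[OF g this] show ?thesis using op by (rule openin_trans)
  qed
  show "open (V \<inter> \<psi> -` O')" if "open O'" for O'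
    by (rule continuous_open_preimage[OF c V that])
qed

lemma chart_inverse:
  assumes "flat_chart M f n V \<psi> F' N'"
  obtains g where "\<And>x. x \<in> V \<Longrightarrow> g (\<psi> x) = x" "\<And>y. y \<in> \<psi> ` V \<Longrightarrow> g y \<in> V" "\<And>y. y \<in> \<psi> ` V \<Longrightarrow> \<psi> (g y) = y"
    "continuous_on (\<psi> ` V) g"
proof -
  obtain g where g: "homeomorphism V (\<psi> ` V) \<psi> g" using assms unfolding flat_chart_def by blast
  show ?thesis
    by (rule that[of g]) (use g in \<open>auto simp: homeomorphism_def\<close>)
qed

lemma continuous_from_charts:
  fixes k :: "'m \<Rightarrow> real^3"
  assumes "\<And>V \<psi> F' N' x. flat_chart M f n V \<psi> F' N' \<Longrightarrow> x \<in> V \<Longrightarrow> isCont (\<lambda>x. k (\<psi> x)) x"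
  shows "continuous_on M k"
proof (rule continuous_on_if_locally)
  fix p assume "p \<in> M"
  then obtain V \<psi> F' N' x where ch: "flat_chart M f n V \<psi> F' N'" "x \<in> V" "\<psi> x = p" using charts by blast
  obtain g where g: "\<And>y. y \<in> \<psi> ` V \<Longrightarrow> g y \<in> V" "\<And>y. y \<in> \<psi> ` V \<Longrightarrow> \<psi> (g y) = y"
    "continuous_on (\<psi> ` V) g" using chart_inverse[OF ch(1)] by metis
  have "continuous_on V (\<lambda>x. k (\<psi> x))" using assms[OF ch(1)] by (intro continuous_at_imp_continuous_on) blast
  then have "continuous_on (\<psi> ` V) (\<lambda>y. k (\<psi> (g y)))"
    by (rule continuous_on_compose2[OF _ g(3)]) (use g(1) in blast)
  then have "continuous_on (\<psi> ` V) k" by (rule continuous_on_eq) (simp add: g(2))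
  then show "\<exists>T. openin (top_of_set M) T \<and> p \<in> T \<and> continuous_on T k"
    using chartD(2)[OF ch(1)] ch(2,3) by blast
qed

sublocale proper_surface M f n
proof
  show "continuous_on M f"
    by (rule continuous_from_charts) (rule has_derivative_continuous[OF chartD(7)])
  show "continuous_on M n"
    by (rule continuous_from_charts) (rule has_derivative_continuous[OF chartD(9)])
  show "norm (n p) = 1" if "p \<in> M" for p using charts[OF that] chartD(11) by blast
  show "\<exists>l\<in>M. \<exists>r. strict_mono r \<and> (X \<circ> r) \<longlonglongrightarrow> l" if "\<And>i::nat. X i \<in> M" "(\<lambda>i. f (X i)) \<longlonglongrightarrow> y" for X y
    by (rule proper_seq[OF that])
next
  fix p assume "p \<in> M"
  then obtain V \<psi> F' N' x where ch: "flat_chart M f n V \<psi> F' N'" "x \<in> V" "\<psi> x = p" using charts by blast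
  note cd = chartD[OF ch(1)]
  define P where "P = adjoint (F' x)"
  have linL: "linear (F' x)" by (rule bounded_linear.linear[OF blinfun.bounded_linear_right])
  obtain r G K where G: "0 < r" "open (G ` ball (P (f p)) r)" "G ` ball (P (f p)) r \<subseteq> V" "G (P (f p)) = x"
    "continuous_on (ball (P (f p)) r) G" "\<forall>z\<in>ball (P (f p)) r. P (f (\<psi> (G z))) = z"
    "\<forall>z\<in>ball (P (f p)) r. \<forall>z'\<in>ball (P (f p)) r. norm (f (\<psi> (G z)) - f (\<psi> (G z'))) \<le> K * norm (z - z')"
    using local_graph_at[OF cd(1) ch(2) cd(7) cd(3) cd(8)[OF ch(2)]] unfolding P_def ch(3)[symmetric] by metis
  have "graph_chart M f p (n p) P r (\<lambda>z. \<psi> (G z)) K"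
    unfolding graph_chart_def
  proof (intro conjI allI)
    show "linear P" unfolding P_def by (rule adjoint_linear[OF linL])
    show "P y = 0 \<longleftrightarrow> (\<exists>c. y = c *\<^sub>R n p)" for y
      unfolding P_def using adjoint_kernel[OF linL cd(8)[OF ch(2)] cd(11)[OF ch(2)] cd(12)[OF ch(2)]] ch(3) by simp
    show "openin (top_of_set M) ((\<lambda>z. \<psi> (G z)) ` ball (P (f p)) r)"
      using cd(14)[OF G(2,3)] by (simp add: image_image)
    show "continuous_on (ball (P (f p)) r) (\<lambda>z. \<psi> (G z))"
      by (rule continuous_on_compose2[OF cd(5) G(5,3)])
  qed (use G ch(3) in auto)
  then show "\<exists>P r G K. graph_chart M f p (n p) P r G K" by blast
  fix \<epsilon> :: real assume \<epsilon>: "0 < \<epsilon>"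
  obtain \<delta> where \<delta>: "\<delta> > 0" "\<And>z. norm (z - x) < \<delta> \<Longrightarrow>
      \<bar>n (\<psi> x) \<bullet> (f (\<psi> z) - f (\<psi> x))\<bar> \<le> \<epsilon> * norm (f (\<psi> z) - f (\<psi> x))"
    using tangency_at[OF cd(7)[OF ch(2)] cd(8)[OF ch(2)] cd(12)[OF ch(2)] \<epsilon>] by blast
  show "\<exists>U. openin (top_of_set M) U \<and> p \<in> U \<and> (\<forall>y\<in>U. \<bar>n p \<bullet> (f y - f p)\<bar> \<le> \<epsilon> * norm (f y - f p))"
  proof (intro exI[of _ "\<psi> ` (V \<inter> ball x \<delta>)"] conjI ballI)
    show "openin (top_of_set M) (\<psi> ` (V \<inter> ball x \<delta>))" by (rule cd(14)) (use cd(1) in auto)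
    show "p \<in> \<psi> ` (V \<inter> ball x \<delta>)" using ch \<delta>(1) by auto
    fix y assume "y \<in> \<psi> ` (V \<inter> ball x \<delta>)"
    then obtain z where "y = \<psi> z" "norm (z - x) < \<delta>" by (auto simp: dist_norm norm_minus_commute)
    then show "\<bar>n p \<bullet> (f y - f p)\<bar> \<le> \<epsilon> * norm (f y - f p)" using \<delta>(2) ch(3) by simp
  qed
qed

text \<open>Near \<open>y\<close> the surface satisfies the equations of the flow box. Both the flow box and the local equations are
  attached to points and not to images, as different sheets satisfy different equations.\<close>

definition germ :: "real^3 \<Rightarrow> (real \<Rightarrow> real^3) \<Rightarrow> (real \<Rightarrow> real^3) \<Rightarrow> (real \<Rightarrow> real) \<Rightarrow> 'm \<Rightarrow> bool" where
  "germ e \<nu>0 \<nu>1 \<kappa>1 y \<longleftrightarrow> (\<exists>U. openin (top_of_set M) U \<and> y \<in> U \<and>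
     (\<forall>y'\<in>U. n y' = \<nu>0 (n y' \<bullet> e) \<and> f y' \<bullet> \<nu>1 (n y' \<bullet> e) = \<kappa>1 (n y' \<bullet> e)))"

text \<open>The flow box transferred to the surface, with the normalisations \<open>\<nu>1 s0 \<bullet> e = 1\<close> and \<open>\<nu>1 s0\<close>
  orthogonal to the normal, obtained by differentiating \<open>\<nu>0 s \<bullet> e = s\<close> and \<open>\<nu>0 s \<bullet> \<nu>0 s = 1\<close>.\<close>

lemma flow_box_surface:
  assumes ch: "flat_chart M f n V \<psi> F' N'" "x0 \<in> V" and u1: "N' x0 u1 \<bullet> e \<noteq> 0"
    and p: "p = \<psi> x0" and s0: "s0 = n p \<bullet> e"
  obtains \<delta> U h \<nu>0 \<nu>1 \<kappa>1 \<nu>2 \<kappa>2 k where "0 < \<delta>" "openin (top_of_set M) U" "p \<in> U" "h s0 0 = p"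
    "\<And>s \<eta>. \<bar>s - s0\<bar> < \<delta> \<Longrightarrow> \<bar>\<eta>\<bar> < \<delta> \<Longrightarrow> h s \<eta> \<in> U \<and> n (h s \<eta>) \<bullet> e = s"
    "\<And>y. y \<in> U \<Longrightarrow> \<exists>\<eta>. \<bar>\<eta>\<bar> < \<delta> \<and> y = h (n y \<bullet> e) \<eta>"
    "\<And>\<eta>. \<bar>\<eta>\<bar> < \<delta> \<Longrightarrow> isCont (\<lambda>s. h s \<eta>) s0"
    "\<And>y. y \<in> U \<Longrightarrow> \<bar>n y \<bullet> e - s0\<bar> < \<delta> \<and> n y = \<nu>0 (n y \<bullet> e) \<and> f y \<bullet> \<nu>1 (n y \<bullet> e) = \<kappa>1 (n y \<bullet> e)"
    "\<And>s. \<bar>s - s0\<bar> < \<delta> \<Longrightarrow> (\<nu>0 has_vector_derivative \<nu>1 s) (at s)"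
    "(\<nu>1 has_vector_derivative \<nu>2) (at s0)" "(\<kappa>1 has_vector_derivative \<kappa>2) (at s0)"
    "continuous_on {-\<delta><..<\<delta>} (h s0)" "\<And>\<eta>. \<bar>\<eta>\<bar> < \<delta> \<Longrightarrow> f (h s0 \<eta>) \<bullet> n p = f p \<bullet> n p"
    "((\<lambda>\<eta>. f (h s0 \<eta>)) has_vector_derivative k) (at 0)" "k \<noteq> 0"
    "\<nu>1 s0 \<bullet> e = 1" "n p \<bullet> \<nu>1 s0 = 0"
proof -
  note cd = chartD[OF ch(1)]
  have s0': "s0 = n (\<psi> x0) \<bullet> e" using s0 p by simp
  obtain \<delta> U h \<nu>0 \<nu>1 \<kappa>1 \<nu>2 \<kappa>2 k where fb: "0 < \<delta>" "open U" "x0 \<in> U" "U \<subseteq> V" "h s0 0 = x0"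
    and hU: "\<And>s \<eta>. \<bar>s - s0\<bar> < \<delta> \<Longrightarrow> \<bar>\<eta>\<bar> < \<delta> \<Longrightarrow> h s \<eta> \<in> U"
    and hN: "\<And>s \<eta>. \<bar>s - s0\<bar> < \<delta> \<Longrightarrow> \<bar>\<eta>\<bar> < \<delta> \<Longrightarrow> n (\<psi> (h s \<eta>)) \<bullet> e = s"
    and Uh: "\<And>x. x \<in> U \<Longrightarrow> \<exists>\<eta>. \<bar>\<eta>\<bar> < \<delta> \<and> x = h (n (\<psi> x) \<bullet> e) \<eta>"
    and ch': "\<And>\<eta>. \<bar>\<eta>\<bar> < \<delta> \<Longrightarrow> isCont (\<lambda>s. h s \<eta>) s0"
    and U1: "\<And>x. x \<in> U \<Longrightarrow> \<bar>n (\<psi> x) \<bullet> e - s0\<bar> < \<delta>"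
    and U2: "\<And>x. x \<in> U \<Longrightarrow> n (\<psi> x) = \<nu>0 (n (\<psi> x) \<bullet> e)"
    and U3: "\<And>x. x \<in> U \<Longrightarrow> f (\<psi> x) \<bullet> \<nu>1 (n (\<psi> x) \<bullet> e) = \<kappa>1 (n (\<psi> x) \<bullet> e)"
    and d\<nu>0: "\<And>s. \<bar>s - s0\<bar> < \<delta> \<Longrightarrow> (\<nu>0 has_vector_derivative \<nu>1 s) (at s)"
    and d\<nu>1: "(\<nu>1 has_vector_derivative \<nu>2) (at s0)" and d\<kappa>1: "(\<kappa>1 has_vector_derivative \<kappa>2) (at s0)"
    and h0: "continuous_on {-\<delta><..<\<delta>} (h s0)" "\<And>\<eta>. \<bar>\<eta>\<bar> < \<delta> \<Longrightarrow> f (\<psi> (h s0 \<eta>)) \<bullet> n (\<psi> x0) = f (\<psi> x0) \<bullet> n (\<psi> x0)"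
    and k: "((\<lambda>\<eta>. f (\<psi> (h s0 \<eta>))) has_vector_derivative k) (at 0)" "k \<noteq> 0"
    apply (rule flow_box[where F = "\<lambda>x. f (\<psi> x)" and N = "\<lambda>x. n (\<psi> x)",
          OF cd(1) ch(2) cd(7) cd(9) cd(4) cd(10) cd(12) cd(13) cd(8)[OF ch(2)] u1 s0'])
         apply assumption+
    apply (rule that)
                      apply assumption+
    done
  have s00: "\<bar>s0 - s0\<bar> < \<delta>" "\<bar>0\<bar> < \<delta>" using fb(1) by auto
  have nb: "open {s. \<bar>s - s0\<bar> < \<delta>}" by (intro open_Collect_less continuous_intros)
  have \<nu>0h: "\<nu>0 s = n (\<psi> (h s 0))" if "\<bar>s - s0\<bar> < \<delta>" for s
    using U2[OF hU[OF that s00(2)]] hN[OF that s00(2)] by simp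
  have "((\<lambda>s. \<nu>0 s \<bullet> e) has_vector_derivative \<nu>1 s0 \<bullet> e) (at s0)"
    by (rule bounded_linear.has_vector_derivative[OF bounded_linear_inner_left d\<nu>0[OF s00(1)]])
  moreover have "((\<lambda>s. \<nu>0 s \<bullet> e) has_vector_derivative 1) (at s0)"
    by (rule has_vector_derivative_transform_within_open[OF has_vector_derivative_id nb])
      (use fb(1) \<nu>0h hN[OF _ s00(2)] in auto)
  ultimately have e1: "\<nu>1 s0 \<bullet> e = 1" by (rule vector_derivative_unique_at)
  have "((\<lambda>s. \<nu>0 s \<bullet> \<nu>0 s) has_vector_derivative (\<nu>0 s0 \<bullet> \<nu>1 s0 + \<nu>1 s0 \<bullet> \<nu>0 s0)) (at s0)"
    by (rule bounded_bilinear.has_vector_derivative[OF bounded_bilinear_inner d\<nu>0[OF s00(1)] d\<nu>0[OF s00(1)]])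
  moreover have "((\<lambda>s. \<nu>0 s \<bullet> \<nu>0 s) has_vector_derivative 0) (at s0)"
  proof (rule has_vector_derivative_transform_within_open[OF has_vector_derivative_const nb])
    fix s assume "s \<in> {s. \<bar>s - s0\<bar> < \<delta>}"
    then have s: "\<bar>s - s0\<bar> < \<delta>" by simp
    have "norm (\<nu>0 s) = 1" unfolding \<nu>0h[OF s] by (rule cd(11)) (use hU[OF s s00(2)] fb(4) in blast)
    then show "1 = \<nu>0 s \<bullet> \<nu>0 s" by (simp add: dot_square_norm)
  qed (use fb(1) in simp)
  ultimately have "\<nu>0 s0 \<bullet> \<nu>1 s0 + \<nu>1 s0 \<bullet> \<nu>0 s0 = 0" by (rule vector_derivative_unique_at)
  then have e2: "n p \<bullet> \<nu>1 s0 = 0" using \<nu>0h[OF s00(1)] fb(5) p by (simp add: inner_commute)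
  have c\<psi>: "isCont \<psi> x" if "x \<in> V" for x using cd(5) cd(1) that by (simp add: continuous_on_eq_continuous_at)
  show ?thesis
  proof (rule that[of \<delta> "\<psi> ` U" "\<lambda>s \<eta>. \<psi> (h s \<eta>)" \<nu>0 \<nu>1 \<kappa>1 \<nu>2 \<kappa>2 k])
    show "openin (top_of_set M) (\<psi> ` U)" by (rule cd(14)[OF fb(2,4)])
    show "\<psi> (h s \<eta>) \<in> \<psi> ` U \<and> n (\<psi> (h s \<eta>)) \<bullet> e = s" if "\<bar>s - s0\<bar> < \<delta>" "\<bar>\<eta>\<bar> < \<delta>" for s \<eta>
      using hU[OF that] hN[OF that] by blast
    show "\<exists>\<eta>. \<bar>\<eta>\<bar> < \<delta> \<and> y = \<psi> (h (n y \<bullet> e) \<eta>)" if y: "y \<in> \<psi> ` U" for y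
    proof -
      obtain x where x: "x \<in> U" "y = \<psi> x" using y by blast
      obtain \<eta> where \<eta>: "\<bar>\<eta>\<bar> < \<delta>" "x = h (n (\<psi> x) \<bullet> e) \<eta>" using Uh[OF x(1)] by blast
      have "\<psi> x = \<psi> (h (n (\<psi> x) \<bullet> e) \<eta>)" by (rule arg_cong[OF \<eta>(2)])
      then show ?thesis unfolding x(2) using \<eta>(1) by blast
    qed
    show "isCont (\<lambda>s. \<psi> (h s \<eta>)) s0" if "\<bar>\<eta>\<bar> < \<delta>" for \<eta>
    proof (rule isCont_o2[OF ch'[OF that]])
      show "isCont \<psi> (h s0 \<eta>)" by (rule c\<psi>) (use hU[OF s00(1) that] fb(4) in blast)
    qed
    show "\<bar>n y \<bullet> e - s0\<bar> < \<delta> \<and> n y = \<nu>0 (n y \<bullet> e) \<and> f y \<bullet> \<nu>1 (n y \<bullet> e) = \<kappa>1 (n y \<bullet> e)" if y: "y \<in> \<psi> ` U" for y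
    proof -
      obtain x where x: "x \<in> U" "y = \<psi> x" using y by blast
      show ?thesis unfolding x(2) using U1[OF x(1)] U2[OF x(1)] U3[OF x(1)] by blast
    qed
    show "continuous_on {-\<delta><..<\<delta>} (\<lambda>\<eta>. \<psi> (h s0 \<eta>))"
    proof (rule continuous_on_compose2[OF cd(5) h0(1)], rule image_subsetI)
      fix \<eta> :: real assume "\<eta> \<in> {-\<delta><..<\<delta>}"
      then have "\<bar>\<eta>\<bar> < \<delta>" by auto
      then show "h s0 \<eta> \<in> V" using hU[OF s00(1)] fb(4) by blast
    qed
  qed (use fb p d\<nu>0 d\<nu>1 d\<kappa>1 h0(2) k e1 e2 in auto)
qed

end

section \<open>Lines through the points where the normal varies\<close>

text \<open>A function with non-zero derivative changes sign; the intermediate value theorem does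
  the rest.\<close>

lemma real_values_near_regular_point:
  fixes \<theta> :: "real \<Rightarrow> real"
  assumes r: "0 < r" and der: "(\<theta> has_real_derivative D) (at 0)" "D \<noteq> 0" and \<theta>0: "\<theta> 0 = 0"
    and cont: "continuous_on {-r<..<r} \<theta>"
  shows "\<exists>\<epsilon>>0. \<forall>t. \<bar>t\<bar> \<le> \<epsilon> \<longrightarrow> (\<exists>\<eta>. \<bar>\<eta>\<bar> < r \<and> \<theta> \<eta> = t)"
proof -
  have pos: "\<exists>h k. 0 < h \<and> h < r \<and> 0 < k \<and> k < r \<and> \<phi> (- h) < 0 \<and> 0 < \<phi> k"
    if \<phi>: "(\<phi> has_real_derivative d) (at 0)" "0 < d" "\<phi> 0 = 0" for \<phi> d
  proof -
    obtain a where a: "a > 0" "\<And>h. h > 0 \<Longrightarrow> h < a \<Longrightarrow> \<phi> 0 < \<phi> (0 + h)"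
      using DERIV_pos_inc_right[OF \<phi>(1,2)] by blast
    obtain b where b: "b > 0" "\<And>h. h > 0 \<Longrightarrow> h < b \<Longrightarrow> \<phi> (0 - h) < \<phi> 0"
      using DERIV_pos_inc_left[OF \<phi>(1,2)] by blast
    define m where "m = min r (min a b) / 2"
    have "0 < m" "m < r" "m < a" "m < b" using r a(1) b(1) by (auto simp: m_def min_def)
    then show ?thesis using a(2)[of m] b(2)[of m] \<phi>(3) by (intro exI[of _ m]) auto
  qed
  have "\<exists>l u. \<bar>l\<bar> < r \<and> \<bar>u\<bar> < r \<and> \<theta> l < 0 \<and> 0 < \<theta> u"
  proof (cases "0 < D")
    case True
    from pos[OF der(1) True \<theta>0] obtain h k where "0 < h" "h < r" "0 < k" "k < r" "\<theta> (- h) < 0" "0 < \<theta> k" by blast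
    then show ?thesis by (intro exI[of _ "-h"] exI[of _ k]) auto
  next
    case False
    have "((\<lambda>t. - \<theta> t) has_real_derivative - D) (at 0)" by (rule DERIV_minus[OF der(1)])
    from pos[OF this] False der(2) \<theta>0 obtain h k
      where "0 < h" "h < r" "0 < k" "k < r" "- \<theta> (- h) < 0" "0 < - \<theta> k" by auto
    then show ?thesis by (intro exI[of _ k] exI[of _ "-h"]) auto
  qed
  then obtain l u where lu: "\<bar>l\<bar> < r" "\<bar>u\<bar> < r" "\<theta> l < 0" "0 < \<theta> u" by blast
  have "connected (\<theta> ` {-r<..<r})" by (rule connected_continuous_image[OF cont]) simp
  then have "{\<theta> l..\<theta> u} \<subseteq> \<theta> ` {-r<..<r}" using lu by (intro connected_contains_Icc imageI) auto
  then have *: "\<exists>\<eta>. \<bar>\<eta>\<bar> < r \<and> \<theta> \<eta> = t" if "\<theta> l \<le> t" "t \<le> \<theta> u" for t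
  proof -
    have "t \<in> \<theta> ` {-r<..<r}" using \<open>{\<theta> l..\<theta> u} \<subseteq> _\<close> that by auto
    then obtain \<eta> where "\<eta> \<in> {-r<..<r}" "t = \<theta> \<eta>" by blast
    then show ?thesis by (intro exI[of _ \<eta>]) auto
  qed
  show ?thesis
    by (rule exI[of _ "min (- \<theta> l) (\<theta> u)"]) (use lu(3,4) in \<open>auto intro!: *\<close>)
qed

context flat_surface
begin

text \<open>The set of the points where the differential of the Gauss map is not zero; \<open>C\<close> is its closure in
  \<open>M\<close>.\<close>

definition W :: "'m set" where
  "W = {y. \<exists>V \<psi> F' N' x u. flat_chart M f n V \<psi> F' N' \<and> x \<in> V \<and> \<psi> x = y \<and> N' x u \<noteq> 0}"

definition C :: "'m set" where "C = M \<inter> closure W"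

lemma W_subset: "W \<subseteq> M"
  using chartD(6) by (auto simp: W_def)

text \<open>The points at which the local equations of one flow box hold with a fixed value \<open>n0\<close> of the normal. The
  ruling through a point of \<open>W\<close> is followed inside this set, which keeps the same functions
  \<open>\<nu>0\<close>, \<open>\<nu>1\<close>, \<open>\<kappa>1\<close> along the whole line.\<close>

definition ruled_points ::
    "real^3 \<Rightarrow> real^3 \<Rightarrow> (real \<Rightarrow> real^3) \<Rightarrow> (real \<Rightarrow> real^3) \<Rightarrow> (real \<Rightarrow> real) \<Rightarrow> 'm set" where
  "ruled_points e n0 \<nu>0 \<nu>1 \<kappa>1 = {y \<in> M. germ e \<nu>0 \<nu>1 \<kappa>1 y \<and> n y = n0}"

context
  fixes e n0 :: "real^3" and \<nu>0 \<nu>1 :: "real \<Rightarrow> real^3" and \<kappa>1 :: "real \<Rightarrow> real" and s0 \<delta> :: real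
    and \<nu>2 :: "real^3" and \<kappa>2 :: real
  assumes \<delta>: "0 < \<delta>" and s0: "s0 = n0 \<bullet> e"
    and d\<nu>0: "\<And>s. \<bar>s - s0\<bar> < \<delta> \<Longrightarrow> (\<nu>0 has_vector_derivative \<nu>1 s) (at s)"
    and d\<nu>1: "(\<nu>1 has_vector_derivative \<nu>2) (at s0)" and d\<kappa>1: "(\<kappa>1 has_vector_derivative \<kappa>2) (at s0)"
    and a: "\<nu>1 s0 \<bullet> e = 1" "n0 \<bullet> \<nu>1 s0 = 0" and n0: "norm n0 = 1"
begin

abbreviation "ruled \<equiv> ruled_points e n0 \<nu>0 \<nu>1 \<kappa>1"

text \<open>Derivative of the equation \<open>f \<bullet> \<nu>1 s = \<kappa>1 s\<close> with \<open>s = n \<bullet> e\<close>. Both sides are continuous in the point, which is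
  why the identity persists at limits of ruled points.\<close>

lemma ruled_identity:
  assumes ch: "flat_chart M f n V \<psi> F' N'" "x \<in> V" and y: "\<psi> x \<in> ruled"
  shows "F' x u \<bullet> \<nu>1 s0 = (\<kappa>2 - f (\<psi> x) \<bullet> \<nu>2) * (N' x u \<bullet> e)"
proof -
  note cd = chartD[OF ch(1)]
  obtain U where U: "openin (top_of_set M) U" "\<psi> x \<in> U"
    "\<And>y. y \<in> U \<Longrightarrow> f y \<bullet> \<nu>1 (n y \<bullet> e) = \<kappa>1 (n y \<bullet> e)"
    using y unfolding ruled_points_def germ_def by blast
  obtain O' where O': "open O'" "U = M \<inter> O'" using U(1) by (auto simp: openin_open)
  have sx: "n (\<psi> x) \<bullet> e = s0" using y by (simp add: ruled_points_def s0)
  have ds: "((\<lambda>x. n (\<psi> x) \<bullet> e) has_derivative (\<lambda>u. N' x u \<bullet> e)) (at x)"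
    using bounded_linear.has_derivative[OF bounded_linear_inner_left cd(9)[OF ch(2)]] .
  have d1: "((\<lambda>x. \<nu>1 (n (\<psi> x) \<bullet> e)) has_derivative (\<lambda>u. (N' x u \<bullet> e) *\<^sub>R \<nu>2)) (at x)"
    using diff_chain_at[OF ds, of \<nu>1] d\<nu>1 by (simp add: sx has_vector_derivative_def o_def)
  have d2: "((\<lambda>x. \<kappa>1 (n (\<psi> x) \<bullet> e)) has_derivative (\<lambda>u. (N' x u \<bullet> e) *\<^sub>R \<kappa>2)) (at x)"
    using diff_chain_at[OF ds, of \<kappa>1] d\<kappa>1 by (simp add: sx has_vector_derivative_def o_def)
  have "((\<lambda>x. f (\<psi> x) \<bullet> \<nu>1 (n (\<psi> x) \<bullet> e)) has_derivative
      (\<lambda>u. f (\<psi> x) \<bullet> ((N' x u \<bullet> e) *\<^sub>R \<nu>2) + F' x u \<bullet> \<nu>1 (n (\<psi> x) \<bullet> e))) (at x)"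
    by (rule has_derivative_inner[OF cd(7)[OF ch(2)] d1])
  moreover have "((\<lambda>x. f (\<psi> x) \<bullet> \<nu>1 (n (\<psi> x) \<bullet> e)) has_derivative (\<lambda>u. (N' x u \<bullet> e) *\<^sub>R \<kappa>2)) (at x)"
    by (rule has_derivative_transform_within_open[OF d2 cd(15)[OF O'(1)]])
      (use ch(2) U O' cd(6) in auto)
  ultimately have "(\<lambda>u. f (\<psi> x) \<bullet> ((N' x u \<bullet> e) *\<^sub>R \<nu>2) + F' x u \<bullet> \<nu>1 (n (\<psi> x) \<bullet> e)) =
     (\<lambda>u. (N' x u \<bullet> e) *\<^sub>R \<kappa>2)" by (rule has_derivative_unique)
  from fun_cong[OF this, of u] show ?thesis by (simp add: sx algebra_simps)
qed

text \<open>The vector \<open>\<nu>1 s0\<close> is tangent and not zero, so the left-hand side of the identity is not zero for some \<open>u\<close>.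
  Together with \<open>ruled_identity\<close> this prevents the differential of the Gauss map from dying out along a
  ruling.\<close>

lemma nondegenerate:
  assumes ch: "flat_chart M f n V \<psi> F' N'" "x \<in> V" and nx: "n (\<psi> x) = n0"
    and id: "\<And>u. F' x u \<bullet> \<nu>1 s0 = c * (N' x u \<bullet> e)"
  shows "\<exists>u. N' x u \<bullet> e \<noteq> 0"
proof -
  note cd = chartD[OF ch(1)]
  have lin: "linear (F' x)" by (rule bounded_linear.linear[OF blinfun.bounded_linear_right])
  have orth: "n0 \<bullet> F' x u = 0" for u using cd(12)[OF ch(2)] nx by simp
  obtain u where u: "\<nu>1 s0 = F' x u"
    using normal_space(2)[OF lin cd(8)[OF ch(2)] n0 orth a(2)] by blast
  have "\<nu>1 s0 \<noteq> 0" using a(1) by auto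
  then have "F' x u \<bullet> \<nu>1 s0 \<noteq> 0" using u by simp
  then show ?thesis using id by (metis mult_zero_right)
qed

lemma ruled_in_W: assumes "y \<in> ruled" shows "y \<in> W"
proof -
  have "y \<in> M" using assms by (simp add: ruled_points_def)
  then obtain V \<psi> F' N' x where ch: "flat_chart M f n V \<psi> F' N'" "x \<in> V" "\<psi> x = y" using charts by blast
  have yR: "\<psi> x \<in> ruled" using assms ch(3) by simp
  have ny: "n (\<psi> x) = n0" using yR by (simp add: ruled_points_def)
  obtain u where "N' x u \<bullet> e \<noteq> 0"
    using nondegenerate[OF ch(1,2) ny ruled_identity[OF ch(1,2) yR]] by blast
  then have "N' x u \<noteq> 0" by auto
  then show ?thesis using ch unfolding W_def by blast
qed

text \<open>In a flow box at \<open>y\<close>, the curve \<open>s = s0\<close> satisfies the two linear equations with normals \<open>n0\<close> and \<open>\<nu>1 s0\<close>,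
  hence lies on the line in direction \<open>w\<close>. It has non-zero speed at \<open>y\<close> and covers a neighbourhood
  on the line.\<close>

lemma ruled_step:
  assumes y: "y \<in> ruled"
  defines "w \<equiv> n0 \<times> \<nu>1 s0"
  shows "\<exists>\<epsilon>>0. \<forall>t. \<bar>t\<bar> \<le> \<epsilon> \<longrightarrow> nseg y (t *\<^sub>R w) \<and> ex y (t *\<^sub>R w) \<in> ruled"
proof -
  have yM: "y \<in> M" and ny: "n y = n0" using y by (auto simp: ruled_points_def)
  obtain V \<psi> F' N' x where ch: "flat_chart M f n V \<psi> F' N'" "x \<in> V" "\<psi> x = y" using charts[OF yM] by blast
  have yR: "\<psi> x \<in> ruled" "n (\<psi> x) = n0" using y ny ch(3) by auto
  obtain u where u: "N' x u \<bullet> e \<noteq> 0"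
    using nondegenerate[OF ch(1,2) yR(2) ruled_identity[OF ch(1,2) yR(1)]] by blast
  have s0y: "s0 = n y \<bullet> e" using s0 ny by simp
  obtain d U h \<mu>0 \<mu>1 \<zeta>1 k where d: "0 < d" "h s0 0 = y"
    and hU: "\<And>s \<eta>. \<bar>s - s0\<bar> < d \<Longrightarrow> \<bar>\<eta>\<bar> < d \<Longrightarrow> h s \<eta> \<in> U \<and> n (h s \<eta>) \<bullet> e = s"
    and oU: "openin (top_of_set M) U"
    and U': "\<And>y. y \<in> U \<Longrightarrow> \<bar>n y \<bullet> e - s0\<bar> < d \<and> n y = \<mu>0 (n y \<bullet> e) \<and> f y \<bullet> \<mu>1 (n y \<bullet> e) = \<zeta>1 (n y \<bullet> e)"
    and ch0: "continuous_on {-d<..<d} (h s0)" and hn: "\<And>\<eta>. \<bar>\<eta>\<bar> < d \<Longrightarrow> f (h s0 \<eta>) \<bullet> n y = f y \<bullet> n y"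
    and k: "((\<lambda>\<eta>. f (h s0 \<eta>)) has_vector_derivative k) (at 0)" "k \<noteq> 0"
    by (rule flow_box_surface[OF ch(1,2) u ch(3)[symmetric] s0y])
      (rule that)
  have U: "n y = \<mu>0 (n y \<bullet> e)" if "y \<in> U" for y using U'[OF that] by blast
  define c where "c = h s0"
  have c0: "c 0 = y" using d by (simp add: c_def)
  have cU: "c \<eta> \<in> U" "n (c \<eta>) \<bullet> e = s0" if "\<bar>\<eta>\<bar> < d" for \<eta> using hU[of s0 \<eta>] that d by (auto simp: c_def)
  have cM: "c \<eta> \<in> M" if "\<bar>\<eta>\<bar> < d" for \<eta> using cU(1)[OF that] openin_imp_subset[OF oU] by blast
  have nc: "n (c \<eta>) = n0" if "\<bar>\<eta>\<bar> < d" for \<eta>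
    using U[OF cU(1)[OF that]] U[OF cU(1)[of 0]] cU(2)[OF that] cU(2)[of 0] d c0 ny by simp
  obtain Ug where Ug: "openin (top_of_set M) Ug" "y \<in> Ug"
    "\<And>y. y \<in> Ug \<Longrightarrow> n y = \<nu>0 (n y \<bullet> e) \<and> f y \<bullet> \<nu>1 (n y \<bullet> e) = \<kappa>1 (n y \<bullet> e)"
    using y unfolding ruled_points_def germ_def by blast
  have gUg: "germ e \<nu>0 \<nu>1 \<kappa>1 y'" if "y' \<in> Ug" for y' using Ug that unfolding germ_def by blast
  obtain P r G K where gcc: "graph_chart M f y (n y) P r G K" using local_graph[OF yM] by metis
  note gc = graph_chartD[OF gcc]
  have "openin (top_of_set {-d<..<d}) ({-d<..<d} \<inter> c -` (Ug \<inter> G ` ball (P (f y)) r))"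
    by (rule continuous_openin_preimage[OF ch0[folded c_def] _ openin_Int[OF Ug(1) gc(3)]])
      (use cM in \<open>auto simp: abs_less_iff\<close>)
  then have "open ({-d<..<d} \<inter> c -` (Ug \<inter> G ` ball (P (f y)) r))"
    using openin_open_eq[OF open_greaterThanLessThan] by blast
  moreover have "0 \<in> {-d<..<d} \<inter> c -` (Ug \<inter> G ` ball (P (f y)) r)" using d(1) c0 Ug(2) gc(4) by simp
  ultimately obtain \<eta>1 where \<eta>1: "0 < \<eta>1" "ball 0 \<eta>1 \<subseteq> {-d<..<d} \<inter> c -` (Ug \<inter> G ` ball (P (f y)) r)"
    using open_contains_ball by blast
  have near: "\<bar>\<eta>\<bar> < d" "c \<eta> \<in> Ug" "c \<eta> \<in> G ` ball (P (f y)) r" if "\<bar>\<eta>\<bar> < \<eta>1" for \<eta>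
  proof -
    have "\<eta> \<in> ball 0 \<eta>1" using that by simp
    then have "\<eta> \<in> {-d<..<d} \<inter> c -` (Ug \<inter> G ` ball (P (f y)) r)" using \<eta>1(2) by blast
    then show "\<bar>\<eta>\<bar> < d" "c \<eta> \<in> Ug" "c \<eta> \<in> G ` ball (P (f y)) r" by auto
  qed
  have a0: "\<nu>1 s0 \<noteq> 0" using a(1) by auto
  have w: "n0 \<bullet> w = 0" by (simp add: w_def inner_cross_self dot_cross_self)
  have n01: "n0 \<bullet> n0 = 1" using n0 by (simp add: dot_square_norm)
  have nw: "n0 \<times> w = - \<nu>1 s0" unfolding w_def using a(2) n01 by (simp add: Lagrange)
  have w0: "w \<noteq> 0" using nw a0 by auto
  define \<theta> where "\<theta> \<eta> = (f (c \<eta>) - f y) \<bullet> w / (w \<bullet> w)" for \<eta>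
  have fc: "f (c \<eta>) = f y + \<theta> \<eta> *\<^sub>R w" if \<eta>: "\<bar>\<eta>\<bar> < \<eta>1" for \<eta>
  proof -
    define b where "b = f (c \<eta>) - f y"
    have "b \<bullet> n0 = 0" using hn[OF near(1)[OF \<eta>]] ny by (simp add: b_def c_def inner_diff_left)
    moreover have "f (c \<eta>) \<bullet> \<nu>1 s0 = \<kappa>1 s0" "f y \<bullet> \<nu>1 s0 = \<kappa>1 s0"
      using Ug(3)[OF near(2)[OF \<eta>]] Ug(3)[OF Ug(2)] cU(2)[OF near(1)[OF \<eta>]] s0y by auto
    then have "b \<bullet> (n0 \<times> w) = 0" unfolding nw by (simp add: b_def inner_diff_left)
    ultimately have "b = (b \<bullet> w / (w \<bullet> w)) *\<^sub>R w" using frame_expansion[OF n0 w w0, of b] by simp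
    then show ?thesis by (simp add: b_def \<theta>_def)
  qed
  have d\<theta>: "(\<theta> has_real_derivative (k \<bullet> w / (w \<bullet> w))) (at 0)"
  proof -
    have "((\<lambda>\<eta>. f (c \<eta>) - f y) has_vector_derivative k) (at 0)"
      using has_vector_derivative_diff[OF k(1) has_vector_derivative_const[of "f y"]] by (simp add: c_def)
    from bounded_linear.has_vector_derivative[OF bounded_linear_inner_left this, of w]
    have "((\<lambda>\<eta>. (f (c \<eta>) - f y) \<bullet> w) has_real_derivative k \<bullet> w) (at 0)"
      by (simp add: has_real_derivative_iff_has_vector_derivative)
    then show ?thesis unfolding \<theta>_def[abs_def] by (rule DERIV_cdivide)
  qed
  have kw: "k \<bullet> w / (w \<bullet> w) \<noteq> 0"
  proof
    assume z: "k \<bullet> w / (w \<bullet> w) = 0"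
    have "((\<lambda>\<eta>. f y + \<theta> \<eta> *\<^sub>R w) has_vector_derivative (k \<bullet> w / (w \<bullet> w)) *\<^sub>R w) (at 0)"
      using d\<theta> by (auto intro!: derivative_eq_intros simp: has_real_derivative_iff_has_vector_derivative)
    then have "((\<lambda>\<eta>. f (h s0 \<eta>)) has_vector_derivative (k \<bullet> w / (w \<bullet> w)) *\<^sub>R w) (at 0)"
      by (rule has_vector_derivative_transform_within_open[of _ _ _ "ball 0 \<eta>1"])
        (use \<eta>1(1) fc in \<open>auto simp: c_def\<close>)
    then have "k = (k \<bullet> w / (w \<bullet> w)) *\<^sub>R w" using k(1) vector_derivative_unique_at by blast
    then show False using z k(2) by simp
  qed
  have cball: "continuous_on {-\<eta>1<..<\<eta>1} c" unfolding c_def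
    using ch0 by (rule continuous_on_subset) (use near(1) in \<open>force simp: abs_less_iff\<close>)
  have c\<theta>: "continuous_on {-\<eta>1<..<\<eta>1} \<theta>"
    unfolding \<theta>_def[abs_def]
    by (intro continuous_intros continuous_on_compose2[OF continuous_f cball] image_subsetI cM near(1))
      (use w0 in auto)
  have \<theta>0: "\<theta> 0 = 0" by (simp add: \<theta>_def c0)
  obtain \<epsilon> where \<epsilon>: "0 < \<epsilon>" "\<And>t. \<bar>t\<bar> \<le> \<epsilon> \<Longrightarrow> \<exists>\<eta>. \<bar>\<eta>\<bar> < \<eta>1 \<and> \<theta> \<eta> = t"
    using real_values_near_regular_point[OF \<eta>1(1) d\<theta> kw \<theta>0 c\<theta>] by blast
  define \<gamma> where "\<gamma> t = G (P (f y) + t *\<^sub>R P w)" for t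
  have pt: "P (f y) + t *\<^sub>R P w \<in> ball (P (f y)) r \<and> \<gamma> t \<in> ruled \<and> f (\<gamma> t) = f y + t *\<^sub>R w" if t: "\<bar>t\<bar> \<le> \<epsilon>" for t
  proof -
    obtain \<eta> where \<eta>: "\<bar>\<eta>\<bar> < \<eta>1" "\<theta> \<eta> = t" using \<epsilon>(2)[OF t] by blast
    have P: "P (f (c \<eta>)) = P (f y) + t *\<^sub>R P w"
      using fc[OF \<eta>(1)] \<eta>(2) by (simp add: linear_add[OF gc(1)] linear_scale[OF gc(1)])
    have "\<gamma> t = c \<eta>" unfolding \<gamma>_def P[symmetric] by (rule gc(9)[OF near(3)[OF \<eta>(1)]])
    moreover have "c \<eta> \<in> ruled"
      using gUg[OF near(2)[OF \<eta>(1)]] cM[OF near(1)[OF \<eta>(1)]] nc[OF near(1)[OF \<eta>(1)]] by (simp add: ruled_points_def)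
    ultimately show ?thesis using gc(10)[OF near(3)[OF \<eta>(1)]] P fc[OF \<eta>(1)] \<eta>(2) by simp
  qed
  have pt': "P (f y) + t *\<^sub>R P w \<in> ball (P (f y)) r" "\<gamma> t \<in> ruled" "f (\<gamma> t) = f y + t *\<^sub>R w"
    "\<gamma> t \<in> M" "n (\<gamma> t) = n0" if "t \<in> {-\<epsilon>..\<epsilon>}" for t
  proof -
    have "\<bar>t\<bar> \<le> \<epsilon>" using that by auto
    from pt[OF this] show "P (f y) + t *\<^sub>R P w \<in> ball (P (f y)) r" "\<gamma> t \<in> ruled" "f (\<gamma> t) = f y + t *\<^sub>R w"
      "\<gamma> t \<in> M" "n (\<gamma> t) = n0" by (auto simp: ruled_points_def)
  qed
  have c\<gamma>: "continuous_on {-\<epsilon>..\<epsilon>} \<gamma>" unfolding \<gamma>_def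
    by (rule continuous_on_compose2[OF gc(6)]) (use pt'(1) in \<open>auto intro!: continuous_intros\<close>)
  have \<gamma>0: "\<gamma> 0 = y" using gc(5) by (simp add: \<gamma>_def)
  have "nseg y (t *\<^sub>R w) \<and> ex y (t *\<^sub>R w) \<in> ruled" if t: "\<bar>t\<bar> \<le> \<epsilon>" for t
  proof -
    have z: "0 \<in> {-\<epsilon>..\<epsilon>}" "t \<in> {-\<epsilon>..\<epsilon>}" using \<epsilon>(1) t by auto
    show ?thesis using curve_ex[OF c\<gamma> pt'(4,3,5) z] pt'(2)[OF z(2)] by (simp add: \<gamma>0)
  qed
  then show ?thesis using \<epsilon>(1) by blast
qed

text \<open>At the limit point the identity still holds, so the differential of the Gauss map is not zero and there is
  a flow box, with functions \<open>\<mu>0\<close>, \<open>\<mu>1\<close>, \<open>\<zeta>1\<close>. It contains some \<open>Z i\<close>, near which both systems of equations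
  hold. A transversal through \<open>Z i\<close> takes all values of \<open>s\<close> near \<open>s0\<close>; hence the functions agree there.\<close>

lemma ruled_limit:
  assumes Y: "\<And>i::nat. Y i \<in> ruled" "Y \<longlonglongrightarrow> y" "y \<in> M"
  shows "y \<in> ruled"
proof -
  have YM: "Y i \<in> M" "n (Y i) = n0" for i using Y(1) by (auto simp: ruled_points_def)
  have ny: "n y = n0" using n_tendsto[OF YM(1) Y(3,2)] YM(2) by (simp add: LIMSEQ_const_iff)
  obtain V \<psi> F' N' x where ch: "flat_chart M f n V \<psi> F' N'" "x \<in> V" "\<psi> x = y" using charts[OF Y(3)] by blast
  note cd = chartD[OF ch(1)]
  obtain g where g: "\<And>x. x \<in> V \<Longrightarrow> g (\<psi> x) = x" "\<And>y. y \<in> \<psi> ` V \<Longrightarrow> g y \<in> V" "\<And>y. y \<in> \<psi> ` V \<Longrightarrow> \<psi> (g y) = y"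
    "continuous_on (\<psi> ` V) g" using chart_inverse[OF ch(1)] by metis
  have y\<psi>: "y \<in> \<psi> ` V" using ch by blast
  obtain k where k: "\<And>i. k \<le> i \<Longrightarrow> Y i \<in> \<psi> ` V"
    using eventually_in_openin[OF cd(2) y\<psi> YM(1) Y(2)] by (auto simp: eventually_sequentially)
  define Z where "Z i = Y (i + k)" for i
  have Z: "Z i \<in> \<psi> ` V" "Z i \<in> ruled" for i using k Y(1) by (auto simp: Z_def)
  have Zy: "Z \<longlonglongrightarrow> y" unfolding Z_def by (rule LIMSEQ_ignore_initial_segment[OF Y(2)])
  have ZM: "Z i \<in> M" "n (Z i) = n0" for i using YM by (auto simp: Z_def)
  define X where "X i = g (Z i)" for i
  have X: "X i \<in> V" "\<psi> (X i) = Z i" for i using g(2,3)[OF Z(1)] by (auto simp: X_def)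
  have "X \<longlonglongrightarrow> g y" unfolding X_def
    by (rule continuous_on_tendsto_compose[OF g(4) Zy y\<psi>]) (use Z(1) in simp)
  then have Xx: "X \<longlonglongrightarrow> x" using g(1)[OF ch(2)] ch(3) by simp
  have Flim: "(\<lambda>i. F' (X i)) \<longlonglongrightarrow> F' x" and Nlim: "(\<lambda>i. N' (X i)) \<longlonglongrightarrow> N' x"
    using continuous_on_tendsto_compose[OF cd(3) Xx ch(2)] continuous_on_tendsto_compose[OF cd(4) Xx ch(2)] X(1) by auto
  have id: "F' x u \<bullet> \<nu>1 s0 = (\<kappa>2 - f y \<bullet> \<nu>2) * (N' x u \<bullet> e)" for u
  proof (rule LIMSEQ_unique)
    show "(\<lambda>i. F' (X i) u \<bullet> \<nu>1 s0) \<longlonglongrightarrow> F' x u \<bullet> \<nu>1 s0" by (intro tendsto_intros Flim)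
    have "F' (X i) u \<bullet> \<nu>1 s0 = (\<kappa>2 - f (Z i) \<bullet> \<nu>2) * (N' (X i) u \<bullet> e)" for i
      using ruled_identity[OF ch(1) X(1), of i u] X(2) Z(2) by simp
    moreover have "(\<lambda>i. (\<kappa>2 - f (Z i) \<bullet> \<nu>2) * (N' (X i) u \<bullet> e)) \<longlonglongrightarrow> (\<kappa>2 - f y \<bullet> \<nu>2) * (N' x u \<bullet> e)"
      by (intro tendsto_intros Nlim f_tendsto[OF ZM(1) Y(3) Zy])
    ultimately show "(\<lambda>i. F' (X i) u \<bullet> \<nu>1 s0) \<longlonglongrightarrow> (\<kappa>2 - f y \<bullet> \<nu>2) * (N' x u \<bullet> e)" by simp
  qed
  have nx: "n (\<psi> x) = n0" using ny ch(3) by simp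
  obtain u where u: "N' x u \<bullet> e \<noteq> 0" using nondegenerate[OF ch(1,2) nx id] by blast
  have s0y: "s0 = n y \<bullet> e" using s0 ny by simp
  obtain d U h \<mu>0 \<mu>1 \<zeta>1 where d: "0 < d" and oU: "openin (top_of_set M) U" "y \<in> U"
    and hU: "\<And>s \<eta>. \<bar>s - s0\<bar> < d \<Longrightarrow> \<bar>\<eta>\<bar> < d \<Longrightarrow> h s \<eta> \<in> U \<and> n (h s \<eta>) \<bullet> e = s"
    and Uh: "\<And>y. y \<in> U \<Longrightarrow> \<exists>\<eta>. \<bar>\<eta>\<bar> < d \<and> y = h (n y \<bullet> e) \<eta>"
    and hc: "\<And>\<eta>. \<bar>\<eta>\<bar> < d \<Longrightarrow> isCont (\<lambda>s. h s \<eta>) s0"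
    and U: "\<And>y. y \<in> U \<Longrightarrow> \<bar>n y \<bullet> e - s0\<bar> < d \<and> n y = \<mu>0 (n y \<bullet> e) \<and> f y \<bullet> \<mu>1 (n y \<bullet> e) = \<zeta>1 (n y \<bullet> e)"
    and d\<mu>: "\<And>s. \<bar>s - s0\<bar> < d \<Longrightarrow> (\<mu>0 has_vector_derivative \<mu>1 s) (at s)"
    by (rule flow_box_surface[OF ch(1,2) u ch(3)[symmetric] s0y])
      (rule that)
  obtain i where i: "Z i \<in> U"
    using eventually_in_openin[OF oU ZM(1) Zy] by (auto dest: eventually_happens)
  obtain \<eta> where \<eta>: "\<bar>\<eta>\<bar> < d" "Z i = h s0 \<eta>" using Uh[OF i] ZM(2)[of i] s0 by auto
  obtain Ug where Ug: "openin (top_of_set M) Ug" "Z i \<in> Ug"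
    "\<And>y. y \<in> Ug \<Longrightarrow> n y = \<nu>0 (n y \<bullet> e) \<and> f y \<bullet> \<nu>1 (n y \<bullet> e) = \<kappa>1 (n y \<bullet> e)"
    using Z(2)[of i] unfolding ruled_points_def germ_def by blast
  obtain O' where O': "open O'" "Ug = M \<inter> O'" using Ug(1) by (auto simp: openin_open)
  have "(\<lambda>s. h s \<eta>) \<midarrow>s0\<rightarrow> Z i" using hc[OF \<eta>(1)] \<eta>(2) by (simp add: isCont_def)
  then have "\<forall>\<^sub>F s in at s0. h s \<eta> \<in> O'" using O' Ug(2) by (intro topological_tendstoD) auto
  then obtain d2 where d2: "0 < d2" "\<And>s. s \<noteq> s0 \<Longrightarrow> dist s s0 < d2 \<Longrightarrow> h s \<eta> \<in> O'"
    unfolding eventually_at by blast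
  define m where "m = min \<delta> (min d d2)"
  have m: "0 < m" using \<delta> d d2(1) by (simp add: m_def)
  have hs: "h s \<eta> \<in> Ug" "h s \<eta> \<in> U" "n (h s \<eta>) \<bullet> e = s" if s: "\<bar>s - s0\<bar> < m" for s
  proof -
    have s': "\<bar>s - s0\<bar> < d" "dist s s0 < d2" using s by (auto simp: m_def dist_real_def)
    show 1: "h s \<eta> \<in> U" "n (h s \<eta>) \<bullet> e = s" using hU[OF s'(1) \<eta>(1)] by auto
    have "h s \<eta> \<in> O'" using d2(2)[OF _ s'(2)] Ug(2) O'(2) \<eta>(2) by (cases "s = s0") auto
    then show "h s \<eta> \<in> Ug" using O'(2) 1 openin_imp_subset[OF oU(1)] by blast
  qed
  have \<nu>\<mu>: "\<mu>0 s = \<nu>0 s" if "\<bar>s - s0\<bar> < m" for s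
    using U[OF hs(2)[OF that]] Ug(3)[OF hs(1)[OF that]] hs(3)[OF that] by simp
  have nb: "open {s. \<bar>s - s0\<bar> < m}" by (intro open_Collect_less continuous_intros)
  have \<nu>\<mu>1: "\<mu>1 s = \<nu>1 s" if s: "\<bar>s - s0\<bar> < m" for s
  proof (rule vector_derivative_unique_at)
    show "(\<mu>0 has_vector_derivative \<mu>1 s) (at s)" by (rule d\<mu>) (use s in \<open>simp add: m_def\<close>)
    have "(\<nu>0 has_vector_derivative \<nu>1 s) (at s)" by (rule d\<nu>0) (use s in \<open>simp add: m_def\<close>)
    then show "(\<mu>0 has_vector_derivative \<nu>1 s) (at s)"
      by (rule has_vector_derivative_transform_within_open[OF _ nb]) (use s \<nu>\<mu> in auto)
  qed
  have \<kappa>\<zeta>: "\<zeta>1 s = \<kappa>1 s" if s: "\<bar>s - s0\<bar> < m" for s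
    using U[OF hs(2)[OF s]] Ug(3)[OF hs(1)[OF s]] hs(3)[OF s] \<nu>\<mu>1[OF s] by simp
  have "germ e \<nu>0 \<nu>1 \<kappa>1 y"
    unfolding germ_def
  proof (intro exI[of _ "U \<inter> (M \<inter> (\<lambda>y. n y \<bullet> e) -` {s0 - m<..<s0 + m})"] conjI ballI)
    have "continuous_on M (\<lambda>y. n y \<bullet> e)" by (intro continuous_intros continuous_n)
    then have "openin (top_of_set M) (M \<inter> (\<lambda>y. n y \<bullet> e) -` {s0 - m<..<s0 + m})"
      by (rule continuous_openin_preimage_gen) simp
    then show "openin (top_of_set M) (U \<inter> (M \<inter> (\<lambda>y. n y \<bullet> e) -` {s0 - m<..<s0 + m}))"
      using oU(1) by (rule openin_Int[rotated])
    show "y \<in> U \<inter> (M \<inter> (\<lambda>y. n y \<bullet> e) -` {s0 - m<..<s0 + m})" using oU(2) Y(3) s0y m by simp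
    fix y' assume y': "y' \<in> U \<inter> (M \<inter> (\<lambda>y. n y \<bullet> e) -` {s0 - m<..<s0 + m})"
    then have s: "\<bar>n y' \<bullet> e - s0\<bar> < m" and "y' \<in> U" by auto
    show "n y' = \<nu>0 (n y' \<bullet> e)" "f y' \<bullet> \<nu>1 (n y' \<bullet> e) = \<kappa>1 (n y' \<bullet> e)"
      using U[OF \<open>y' \<in> U\<close>] \<nu>\<mu>[OF s] \<nu>\<mu>1[OF s] \<kappa>\<zeta>[OF s] by auto
  qed
  then show ?thesis using Y(3) ny by (simp add: ruled_points_def)
qed

text \<open>The set of ruled points on the line is open by \<open>ruled_step\<close> and closed by \<open>ruled_limit\<close>.\<close>

lemma ruled_line:
  assumes p: "p \<in> ruled"
  shows "nline p (n0 \<times> \<nu>1 s0)" "ex p (t *\<^sub>R (n0 \<times> \<nu>1 s0)) \<in> ruled"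
proof -
  define w where "w = n0 \<times> \<nu>1 s0"
  have pM: "p \<in> M" using p by (simp add: ruled_points_def)
  have ray: "nseg p (t *\<^sub>R (c *\<^sub>R w)) \<and> ex p (t *\<^sub>R (c *\<^sub>R w)) \<in> ruled" if c: "\<bar>c\<bar> = 1" and "0 \<le> t" for c t
  proof (rule real_continuation[OF _ _ _ \<open>0 \<le> t\<close>])
    show "nseg p (0 *\<^sub>R c *\<^sub>R w) \<and> ex p (0 *\<^sub>R c *\<^sub>R w) \<in> ruled" using nseg_0[OF pM] p by simp
  next
    fix t :: real assume t: "0 \<le> t" "\<And>s. 0 \<le> s \<Longrightarrow> s \<le> t \<Longrightarrow> nseg p (s *\<^sub>R c *\<^sub>R w) \<and> ex p (s *\<^sub>R c *\<^sub>R w) \<in> ruled"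
    have 1: "nseg p (t *\<^sub>R c *\<^sub>R w)" "ex p (t *\<^sub>R c *\<^sub>R w) \<in> ruled" using t(2)[OF t(1)] by auto
    obtain \<epsilon> where \<epsilon>: "0 < \<epsilon>" "\<And>s. \<bar>s\<bar> \<le> \<epsilon> \<Longrightarrow> nseg (ex p (t *\<^sub>R c *\<^sub>R w)) (s *\<^sub>R w) \<and>
        ex (ex p (t *\<^sub>R c *\<^sub>R w)) (s *\<^sub>R w) \<in> ruled"
      using ruled_step[OF 1(2), folded w_def] by blast
    have "nseg p (s *\<^sub>R c *\<^sub>R w) \<and> ex p (s *\<^sub>R c *\<^sub>R w) \<in> ruled" if s: "t < s" "s < t + \<epsilon>" for s
    proof -
      have "\<bar>(s - t) * c\<bar> \<le> \<epsilon>" using s c by (simp add: abs_mult)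
      from \<epsilon>(2)[OF this] have "nseg (ex p (t *\<^sub>R c *\<^sub>R w)) ((s - t) *\<^sub>R c *\<^sub>R w)"
        "ex (ex p (t *\<^sub>R c *\<^sub>R w)) ((s - t) *\<^sub>R c *\<^sub>R w) \<in> ruled" by auto
      then show ?thesis using nseg_append[OF 1(1) _ t(1), of "s - t"] s by simp
    qed
    then show "\<exists>\<epsilon>>0. \<forall>s. t < s \<and> s < t + \<epsilon> \<longrightarrow> nseg p (s *\<^sub>R c *\<^sub>R w) \<and> ex p (s *\<^sub>R c *\<^sub>R w) \<in> ruled"
      using \<epsilon>(1) by blast
  next
    fix t :: real assume t: "0 < t" "\<And>s. 0 \<le> s \<Longrightarrow> s < t \<Longrightarrow> nseg p (s *\<^sub>R c *\<^sub>R w) \<and> ex p (s *\<^sub>R c *\<^sub>R w) \<in> ruled"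
    obtain X where X: "\<And>i::nat. 0 \<le> X i" "\<And>i. X i < t" "X \<longlonglongrightarrow> t" using tendsto_from_below[OF t(1)] by blast
    have ns: "nseg p (X i *\<^sub>R c *\<^sub>R w)" "ex p (X i *\<^sub>R c *\<^sub>R w) \<in> ruled" for i using t(2)[OF X(1,2)] by auto
    note lim = ex_limit[OF pM tendsto_const pM tendsto_scaleR[OF X(3) tendsto_const] ns(1)]
    show "nseg p (t *\<^sub>R c *\<^sub>R w) \<and> ex p (t *\<^sub>R c *\<^sub>R w) \<in> ruled"
      using lim(1) ruled_limit[OF ns(2) lim(2) nseg_ex(1)[OF lim(1)]] by blast
  qed
  have "nseg p (t *\<^sub>R w) \<and> ex p (t *\<^sub>R w) \<in> ruled" for t
    using ray[of 1 t] ray[of "-1" "-t"] by (cases "0 \<le> t") auto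
  then show "nline p (n0 \<times> \<nu>1 s0)" "ex p (t *\<^sub>R (n0 \<times> \<nu>1 s0)) \<in> ruled" by (auto simp: nline_def w_def)
qed

end

text \<open>With \<open>e\<close> a value of the differential of the Gauss map, a flow box at \<open>p\<close> starts the ruling.\<close>

theorem W_line:
  assumes p: "p \<in> W"
  shows "\<exists>w. norm w = 1 \<and> nline p w \<and> (\<forall>t. ex p (t *\<^sub>R w) \<in> W)"
proof -
  obtain V \<psi> F' N' x u where ch: "flat_chart M f n V \<psi> F' N'" "x \<in> V" "\<psi> x = p" and u: "N' x u \<noteq> 0"
    using p unfolding W_def by blast
  have pM: "p \<in> M" using p W_subset by blast
  define e where "e = blinfun_apply (N' x) u"
  define s0 where "s0 = n p \<bullet> e"
  have ne: "N' x u \<bullet> e \<noteq> 0" using u by (simp add: e_def)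
  obtain \<delta> U \<nu>0 \<nu>1 \<kappa>1 \<nu>2 \<kappa>2 where fb: "0 < \<delta>" "openin (top_of_set M) U" "p \<in> U"
    and U: "\<And>y. y \<in> U \<Longrightarrow> \<bar>n y \<bullet> e - s0\<bar> < \<delta> \<and> n y = \<nu>0 (n y \<bullet> e) \<and> f y \<bullet> \<nu>1 (n y \<bullet> e) = \<kappa>1 (n y \<bullet> e)"
    and d\<nu>0: "\<And>s. \<bar>s - s0\<bar> < \<delta> \<Longrightarrow> (\<nu>0 has_vector_derivative \<nu>1 s) (at s)"
    and d\<nu>1: "(\<nu>1 has_vector_derivative \<nu>2) (at s0)" and d\<kappa>1: "(\<kappa>1 has_vector_derivative \<kappa>2) (at s0)"
    and a: "\<nu>1 s0 \<bullet> e = 1" "n p \<bullet> \<nu>1 s0 = 0"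
    by (rule flow_box_surface[OF ch(1,2) ne ch(3)[symmetric] s0_def])
      (rule that)
  have g: "germ e \<nu>0 \<nu>1 \<kappa>1 p" unfolding germ_def using fb(2,3) U by blast
  note ctx = fb(1) s0_def d\<nu>0 d\<nu>1 d\<kappa>1 a norm_n[OF pM]
  have pR: "p \<in> ruled_points e (n p) \<nu>0 \<nu>1 \<kappa>1" unfolding ruled_points_def using pM g by simp
  define w where "w = n p \<times> \<nu>1 s0"
  have l: "nline p w" and lR: "\<And>t. ex p (t *\<^sub>R w) \<in> ruled_points e (n p) \<nu>0 \<nu>1 \<kappa>1"
    using ruled_line[OF ctx pR] unfolding w_def by auto
  have lW: "ex p (t *\<^sub>R w) \<in> W" for t by (rule ruled_in_W[OF ctx lR])
  have "n p \<times> w = - \<nu>1 s0" unfolding w_def using a(2) n_inner[OF pM] by (simp add: Lagrange)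
  then have w0: "w \<noteq> 0" using a(1) by auto
  show ?thesis
  proof (intro exI[of _ "(1 / norm w) *\<^sub>R w"] conjI allI)
    show "norm ((1 / norm w) *\<^sub>R w) = 1" using w0 by simp
    show "nline p ((1 / norm w) *\<^sub>R w)" by (rule nline_scale[OF l])
    show "ex p (t *\<^sub>R ((1 / norm w) *\<^sub>R w)) \<in> W" for t using lW[of "t * (1 / norm w)"] by simp
  qed
qed

end

context flat_surface
begin

lemma normal_locally_const_off_C:
  assumes x: "x \<in> M" "x \<notin> C"
  shows "\<exists>U. openin (top_of_set M) U \<and> x \<in> U \<and> (\<forall>y\<in>U. n y = n x)"
proof -
  have "x \<notin> closure W" using x by (simp add: C_def)
  then have "open (- closure W)" "x \<in> - closure W" "- closure W \<inter> W = {}"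
    using closure_subset[of W] by auto
  then obtain O' where O': "open O'" "x \<in> O'" "O' \<inter> W = {}" by blast
  obtain V \<psi> F' N' z where ch: "flat_chart M f n V \<psi> F' N'" "z \<in> V" "\<psi> z = x" using charts[OF x(1)] by blast
  note cd = chartD[OF ch(1)]
  have "z \<in> V \<inter> \<psi> -` O'" using ch O'(2) by simp
  then obtain r where r: "0 < r" "ball z r \<subseteq> V \<inter> \<psi> -` O'"
    using cd(15)[OF O'(1)] open_contains_ball by blast
  have N0: "N' y u = 0" if "y \<in> ball z r" for y u
  proof (rule ccontr)
    assume "N' y u \<noteq> 0"
    moreover have y: "y \<in> V" "\<psi> y \<in> O'" using r(2) that by auto
    ultimately have "\<psi> y \<in> W" using ch(1) unfolding W_def by blast
    then show False using y(2) O'(3) by blast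
  qed
  have "\<exists>c. \<forall>y\<in>ball z r. n (\<psi> y) = c"
  proof (rule has_derivative_zero_constant[OF convex_ball])
    fix y assume y: "y \<in> ball z r"
    have "blinfun_apply (N' y) = (\<lambda>h. 0)" using N0[OF y] by (intro ext)
    then show "((\<lambda>y. n (\<psi> y)) has_derivative (\<lambda>h. 0)) (at y within ball z r)"
      using cd(9)[of y] r(2) y has_derivative_at_withinI by fastforce
  qed
  then obtain c where c: "\<And>y. y \<in> ball z r \<Longrightarrow> n (\<psi> y) = c" by blast
  have z: "z \<in> ball z r" using r(1) by simp
  have "n (\<psi> y) = n x" if "y \<in> ball z r" for y using c[OF that] c[OF z] ch(3) by simp
  moreover have "openin (top_of_set M) (\<psi> ` ball z r)" by (rule cd(14)) (use r(2) in auto)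
  ultimately show ?thesis using z ch(3) by (intro exI[of _ "\<psi> ` ball z r"]) blast
qed

text \<open>In a neighbourhood of a point of \<open>W\<close> the normal is not constant, so points of \<open>W\<close> with a normal
  different from \<open>n x\<close> are dense in \<open>W\<close>.\<close>

lemma C_limit_of_lines:
  assumes x: "x \<in> C"
  shows "\<exists>(X :: nat \<Rightarrow> 'm) w. X \<longlonglongrightarrow> x \<and>
        (\<forall>i. X i \<in> C \<and> n (X i) \<noteq> n x \<and> norm (w i) = 1 \<and> nline (X i) (w i) \<and>
             (\<forall>t. ex (X i) (t *\<^sub>R w i) \<in> C))"
proof -
  have WC: "y \<in> C" if "y \<in> W" for y using that W_subset closure_subset by (auto simp: C_def)
  have "x \<in> closure {y \<in> W. n y \<noteq> n x}"
    unfolding closure_iff_nhds_not_empty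
  proof (intro allI impI)
    fix A S' assume A: "S' \<subseteq> A" "open S'" "x \<in> S'"
    have "W \<inter> S' \<noteq> {}"
      using x A(2,3) by (auto simp: C_def closure_iff_nhds_not_empty)
    then obtain y where y: "y \<in> W" "y \<in> S'" by blast
    then obtain V \<psi> F' N' z u where ch: "flat_chart M f n V \<psi> F' N'" "z \<in> V" "\<psi> z = y" and u: "N' z u \<noteq> 0"
      unfolding W_def by blast
    note cd = chartD[OF ch(1)]
    have "continuous_on V (\<lambda>z. N' z u)" by (intro continuous_intros cd(4))
    then have "open (V \<inter> (\<lambda>z. N' z u) -` (- {0}))"
      by (rule continuous_open_preimage[OF _ cd(1)]) (simp add: open_Compl)
    with cd(15)[OF A(2)] have oV: "open ((V \<inter> \<psi> -` S') \<inter> (V \<inter> (\<lambda>z. N' z u) -` (- {0})))" by (rule open_Int)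
    have "\<exists>z1 \<in> (V \<inter> \<psi> -` S') \<inter> (V \<inter> (\<lambda>z. N' z u) -` (- {0})). n (\<psi> z1) \<noteq> n x"
    proof (rule ccontr)
      assume "\<not> ?thesis"
      then have const: "\<And>z1. z1 \<in> (V \<inter> \<psi> -` S') \<inter> (V \<inter> (\<lambda>z. N' z u) -` (- {0})) \<Longrightarrow> n x = n (\<psi> z1)" by auto
      have zz: "z \<in> (V \<inter> \<psi> -` S') \<inter> (V \<inter> (\<lambda>z. N' z u) -` (- {0}))" using ch u y(2) by auto
      have "((\<lambda>z. n (\<psi> z)) has_derivative (\<lambda>h. 0)) (at z)"
        by (rule has_derivative_transform_within_open[OF has_derivative_const oV zz const])
      then have "blinfun_apply (N' z) = (\<lambda>h. 0)" using cd(9)[OF ch(2)] has_derivative_unique by blast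
      then show False using u by simp
    qed
    then obtain z1 where z1: "z1 \<in> V" "\<psi> z1 \<in> S'" "N' z1 u \<noteq> 0" "n (\<psi> z1) \<noteq> n x" by blast
    then have "\<psi> z1 \<in> W" using ch(1) unfolding W_def by blast
    then show "{y \<in> W. n y \<noteq> n x} \<inter> A \<noteq> {}" using z1 A(1) by blast
  qed
  then obtain X where X: "\<forall>i. X i \<in> {y \<in> W. n y \<noteq> n x}" "X \<longlonglongrightarrow> x" unfolding closure_sequential by blast
  have XW: "X i \<in> W" "n (X i) \<noteq> n x" for i using X(1) by auto
  obtain w where w: "\<And>i. norm (w i) = 1 \<and> nline (X i) (w i) \<and> (\<forall>t. ex (X i) (t *\<^sub>R w i) \<in> W)"
    using W_line[OF XW(1)] by metis
  show ?thesis
    by (intro exI[of _ X] exI[of _ w]) (use X(2) XW w WC in blast)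
qed

sublocale developable_surface M f n C
proof
  show "closedin (top_of_set M) C" unfolding C_def by (rule closedin_closed_Int[OF closed_closure])
qed (fact normal_locally_const_off_C C_limit_of_lines)+

end

section \<open>Calculus of smooth maps\<close>

lemma Ck_on_cong:
  assumes "open S" "Ck_on k S f" "\<And>x. x \<in> S \<Longrightarrow> f x = g x"
  shows "Ck_on k S g"
  using assms
proof (induction k arbitrary: f g)
  case 0
  then show ?case using continuous_on_cong[of S S f g] by simp
next
  case (Suc k)
  have d: "f differentiable (at x)" if "x \<in> S" for x using Suc.prems(2) that by simp
  have g: "(g has_derivative frechet_derivative f (at x)) (at x)" if "x \<in> S" for x
    by (rule has_derivative_transform_within_open[OF _ Suc.prems(1) that Suc.prems(3)])
      (use d[OF that] frechet_derivative_works in auto)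
  have eq: "frechet_derivative f (at x) = frechet_derivative g (at x)" if "x \<in> S" for x
    by (rule frechet_derivative_at[OF g[OF that]])
  have "Ck_on k S (\<lambda>x. frechet_derivative g (at x) v)" for v
  proof (rule Suc.IH[OF Suc.prems(1)])
    show "Ck_on k S (\<lambda>x. frechet_derivative f (at x) v)" using Suc.prems(2) by simp
  qed (simp add: eq)
  moreover have "g differentiable (at x)" if "x \<in> S" for x using g[OF that] differentiable_def by blast
  ultimately show ?case by simp
qed

lemma Ck_on_Suc_imp: "Ck_on (Suc k) S f \<Longrightarrow> Ck_on k S f"
proof (induction k arbitrary: f)
  case 0
  then show ?case by (auto intro!: continuous_at_imp_continuous_on differentiable_imp_continuous_within)
next
  case (Suc k)
  have "Ck_on k S (\<lambda>x. frechet_derivative f (at x) v)" for v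
    by (rule Suc.IH) (use Suc.prems in simp)
  then show ?case using Suc.prems by simp
qed

lemma Ck_on_continuous: "Ck_on k S f \<Longrightarrow> continuous_on S f"
proof (induction k)
  case (Suc k)
  show ?case by (rule Suc.IH[OF Ck_on_Suc_imp[OF Suc.prems]])
qed simp

lemma Ck_on_SucI:
  assumes S: "open S" and der: "\<And>x. x \<in> S \<Longrightarrow> (f has_derivative (\<lambda>v. f' v x)) (at x)"
    and C: "\<And>v. Ck_on k S (f' v)"
  shows "Ck_on (Suc k) S f"
proof -
  have "frechet_derivative f (at x) = (\<lambda>v. f' v x)" if "x \<in> S" for x
    using frechet_derivative_at[OF der[OF that]] by simp
  then have "Ck_on k S (\<lambda>x. frechet_derivative f (at x) v)" for v
    by (intro Ck_on_cong[OF S C[of v]]) simp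
  then show ?thesis using der by (auto simp: differentiable_def)
qed

lemma Ck_on_SucD:
  assumes "Ck_on (Suc k) S f"
  shows "\<And>x. x \<in> S \<Longrightarrow> (f has_derivative (\<lambda>v. frechet_derivative f (at x) v)) (at x)"
    "\<And>v. Ck_on k S (\<lambda>x. frechet_derivative f (at x) v)"
  using assms frechet_derivative_works[of f] by auto

lemma Ck_on_const: "Ck_on k S (\<lambda>x. c)"
proof (induction k arbitrary: c)
  case (Suc k)
  have "frechet_derivative (\<lambda>x. c) (at x) = (\<lambda>v. 0)" for x :: 'a
    using frechet_derivative_at[OF has_derivative_const[of c "at x"]] by simp
  then show ?case using Suc by simp
qed (simp add: continuous_on_const)

lemma Ck_on_add:
  assumes S: "open S" and "Ck_on k S f" "Ck_on k S g" shows "Ck_on k S (\<lambda>x. f x + g x)"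
  using assms(2,3)
proof (induction k arbitrary: f g)
  case 0 then show ?case by (simp add: continuous_on_add)
next
  case (Suc k)
  note f = Ck_on_SucD[OF Suc.prems(1)] and g = Ck_on_SucD[OF Suc.prems(2)]
  show ?case
    by (rule Ck_on_SucI[OF S has_derivative_add[OF f(1) g(1)]], assumption, assumption) (rule Suc.IH[OF f(2) g(2)])
qed

lemma Ck_on_bilinear:
  assumes S: "open S" and bb: "bounded_bilinear pr"
  shows "Ck_on k S f \<Longrightarrow> Ck_on k S g \<Longrightarrow> Ck_on k S (\<lambda>x. pr (f x) (g x))"
proof (induction k arbitrary: f g)
  case 0 then show ?case by (simp add: bounded_bilinear.continuous_on[OF bb])
next
  case (Suc k)
  note f = Ck_on_SucD[OF Suc.prems(1)] and g = Ck_on_SucD[OF Suc.prems(2)]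
  show ?case
    by (rule Ck_on_SucI[OF S bounded_bilinear.FDERIV[OF bb f(1) g(1)]], assumption, assumption)
      (rule Ck_on_add[OF S Suc.IH[OF Ck_on_Suc_imp[OF Suc.prems(1)] g(2)]
          Suc.IH[OF f(2) Ck_on_Suc_imp[OF Suc.prems(2)]]])
qed

text \<open>The derivative of \<open>1 / |m|\<close> is \<open>- (m \<bullet> Dm) / |m|\<^sup>3\<close>, a product of \<open>C\<^sup>k\<close> functions by
  induction.\<close>

lemma Ck_on_inverse_norm:
  fixes m :: "'a::euclidean_space \<Rightarrow> 'b::real_inner"
  assumes S: "open S" and nz: "\<And>x. x \<in> S \<Longrightarrow> m x \<noteq> 0"
  shows "Ck_on k S m \<Longrightarrow> Ck_on k S (\<lambda>x. inverse (norm (m x)))"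
proof (induction k)
  case 0 then show ?case using nz by (auto intro!: continuous_intros)
next
  case (Suc k)
  note m = Ck_on_SucD[OF Suc.prems]
  define D where "D v x = frechet_derivative m (at x) v" for v x
  define q where "q x = inverse (norm (m x))" for x
  have der: "(q has_derivative (\<lambda>v. (- (m x \<bullet> D v x)) * (q x * (q x * q x)))) (at x)" if x: "x \<in> S" for x
  proof -
    have "((\<lambda>x. norm (m x)) has_derivative (\<lambda>v. D v x \<bullet> sgn (m x))) (at x)"
      using has_derivative_compose[OF m(1)[OF x] has_derivative_norm[OF nz[OF x]]] by (simp add: D_def)
    from Deriv.has_derivative_inverse[OF _ this] nz[OF x]
    have "(q has_derivative (\<lambda>v. - (inverse (norm (m x)) * (D v x \<bullet> sgn (m x)) * inverse (norm (m x))))) (at x)"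
      by (simp add: q_def[abs_def])
    moreover have "- (inverse (norm (m x)) * (D v x \<bullet> sgn (m x)) * inverse (norm (m x))) =
        (- (m x \<bullet> D v x)) * (q x * (q x * q x))" for v
      by (simp add: q_def sgn_div_norm inner_commute mult_ac)
    ultimately show ?thesis by simp
  qed
  have qk: "Ck_on k S q" using Suc.IH[OF Ck_on_Suc_imp[OF Suc.prems]] by (simp add: q_def[abs_def])
  have "Ck_on k S (\<lambda>x. (- (m x \<bullet> D v x)) * (q x * (q x * q x)))" for v
  proof -
    have "Ck_on k S (\<lambda>x. m x \<bullet> D v x)" unfolding D_def
      by (rule Ck_on_bilinear[OF S bounded_bilinear_inner Ck_on_Suc_imp[OF Suc.prems] m(2)])
    then have "Ck_on k S (\<lambda>x. (-1) * (m x \<bullet> D v x))"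
      by (rule Ck_on_bilinear[OF S bounded_bilinear_mult Ck_on_const])
    then have "Ck_on k S (\<lambda>x. - (m x \<bullet> D v x))" by simp
    then show ?thesis by (intro Ck_on_bilinear[OF S bounded_bilinear_mult] qk)
  qed
  from Ck_on_SucI[where f' = "\<lambda>v x. (- (m x \<bullet> D v x)) * (q x * (q x * q x))", OF S der this]
  have "Ck_on (Suc k) S q" .
  then show ?case by (simp add: q_def[abs_def])
qed

text \<open>Continuity of all directional derivatives gives continuity in the operator norm, as the
  domain has finite dimension.\<close>

lemma frechet_blinfun:
  fixes F :: "real^2 \<Rightarrow> real^3"
  assumes "Ck_on (Suc k) V F"
  obtains F' where "\<And>x. x \<in> V \<Longrightarrow> (F has_derivative blinfun_apply (F' x)) (at x)" "continuous_on V F'"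
    "\<And>x. x \<in> V \<Longrightarrow> blinfun_apply (F' x) = frechet_derivative F (at x)"
proof -
  define F' where "F' x = Blinfun (frechet_derivative F (at x))" for x
  note F = Ck_on_SucD[OF assms]
  have eq: "blinfun_apply (F' x) = frechet_derivative F (at x)" if "x \<in> V" for x
    unfolding F'_def by (rule bounded_linear_Blinfun_apply[OF has_derivative_bounded_linear[OF F(1)[OF that]]])
  show ?thesis
  proof (rule that[of F'])
    show "(F has_derivative blinfun_apply (F' x)) (at x)" if "x \<in> V" for x unfolding eq[OF that] by (rule F(1)[OF that])
    have "continuous_on V (\<lambda>x. frechet_derivative F (at x) v)" for v
      by (rule Ck_on_continuous[OF F(2)])
    then have "continuous_on V (\<lambda>x. blinfun_apply (F' x) i)" for i
      by (rule continuous_on_eq) (simp add: eq)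
    then show "continuous_on V F'" by (rule continuous_on_blinfun_componentwise)
  qed (rule eq)
qed

section \<open>First-order estimates\<close>

lemma derivative_lower_bound:
  fixes F :: "real^2 \<Rightarrow> real^3"
  assumes der: "(F has_derivative L) (at x0)" and inj: "inj L"
  shows "\<exists>c>0. \<exists>\<delta>>0. \<forall>x. norm (x - x0) < \<delta> \<longrightarrow> c * norm (x - x0) \<le> norm (F x - F x0)"
proof -
  have lin: "linear L" using der has_derivative_linear by blast
  obtain c where c: "0 < c" "\<And>u. c * norm u \<le> norm (L u)"
    using linear_inj_bounded_below_pos[OF lin inj] by metis
  then have "0 < c / 2" by simp
  then obtain d where d: "0 < d" "\<And>x. norm (x - x0) < d \<Longrightarrow> norm (F x - F x0 - L (x - x0)) \<le> c / 2 * norm (x - x0)"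
    using der unfolding has_derivative_at_alt by blast
  have "c / 2 * norm (x - x0) \<le> norm (F x - F x0)" if x: "norm (x - x0) < d" for x
  proof -
    have "norm (L (x - x0)) \<le> norm (F x - F x0) + norm (F x - F x0 - L (x - x0))"
      using norm_triangle_ineq4[of "F x - F x0" "F x - F x0 - L (x - x0)"] by simp
    then show ?thesis using c(2)[of "x - x0"] d(2)[OF x] by linarith
  qed
  then show ?thesis using d(1) \<open>0 < c / 2\<close> by blast
qed

lemma derivative_upper_bound:
  fixes F :: "real^2 \<Rightarrow> real^3"
  assumes der: "(F has_derivative L) (at x0)"
  shows "\<exists>C>0. \<exists>\<delta>>0. \<forall>x. norm (x - x0) < \<delta> \<longrightarrow> norm (F x - F x0) \<le> C * norm (x - x0)"
proof -
  have lin: "linear L" using der has_derivative_linear by blast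
  obtain B where B: "0 < B" "\<And>u. norm (L u) \<le> B * norm u" using linear_bounded_pos[OF lin] by blast
  obtain d where d: "0 < d" "\<And>x. norm (x - x0) < d \<Longrightarrow> norm (F x - F x0 - L (x - x0)) \<le> 1 * norm (x - x0)"
    using der zero_less_one unfolding has_derivative_at_alt by blast
  have "norm (F x - F x0) \<le> (B + 1) * norm (x - x0)" if x: "norm (x - x0) < d" for x
  proof -
    have "norm (F x - F x0) \<le> norm (L (x - x0)) + norm (F x - F x0 - L (x - x0))"
      using norm_triangle_ineq[of "L (x - x0)" "F x - F x0 - L (x - x0)"] by simp
    then show ?thesis using B(2)[of "x - x0"] d(2)[OF x] by (simp add: distrib_right)
  qed
  then show ?thesis using d(1) B(1) by (intro exI[of _ "B + 1"]) auto
qed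

text \<open>Along \<open>u\<close> the map \<open>H\<close>, and with it the dominated map \<open>N\<close>, changes by less than
  first order.\<close>

lemma kernel_of_dominated:
  fixes N H :: "real^2 \<Rightarrow> real^3"
  assumes N: "(N has_derivative DN) (at x)" and H: "(H has_derivative DH) (at x)"
    and dom: "0 < d" "\<And>z. norm (z - x) < d \<Longrightarrow> norm (N z - N x) \<le> C * norm (H z - H x)"
    and u: "DH u = 0"
  shows "DN u = 0"
proof -
  have lin: "linear DN" "linear DH" using N H has_derivative_linear by blast+
  have "norm (DN u) \<le> 0 + e" if e: "0 < e" for e
  proof (cases "u = 0")
    case True then show ?thesis using linear_0[OF lin(1)] e by simp
  next
    case u0: False
    define k where "k = e / ((1 + \<bar>C\<bar>) * norm u)"
    have k: "0 < k" using e u0 by (simp add: k_def add_pos_nonneg)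
    obtain d1 where d1: "0 < d1" "\<And>z. norm (z - x) < d1 \<Longrightarrow> norm (N z - N x - DN (z - x)) \<le> k * norm (z - x)"
      using N k unfolding has_derivative_at_alt by blast
    obtain d2 where d2: "0 < d2" "\<And>z. norm (z - x) < d2 \<Longrightarrow> norm (H z - H x - DH (z - x)) \<le> k * norm (z - x)"
      using H k unfolding has_derivative_at_alt by blast
    define m where "m = min d (min d1 d2)"
    define t where "t = m / (2 * norm u)"
    define z where "z = x + t *\<^sub>R u"
    have m: "0 < m" using dom(1) d1(1) d2(1) by (simp add: m_def)
    have t: "0 < t" using m u0 by (simp add: t_def)
    have zx: "norm (z - x) = t * norm u" using t by (simp add: z_def)
    have "t * norm u = m / 2" using u0 by (simp add: t_def)
    then have small: "norm (z - x) < m" using zx m by simp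
    have "norm (H z - H x) \<le> k * (t * norm u)"
      using d2(2)[of z] small u zx t by (simp add: m_def z_def linear_scale[OF lin(2)])
    then have "\<bar>C\<bar> * norm (H z - H x) \<le> \<bar>C\<bar> * (k * (t * norm u))" by (rule mult_left_mono) simp
    moreover have "C * norm (H z - H x) \<le> \<bar>C\<bar> * norm (H z - H x)" by (rule mult_right_mono) auto
    moreover have "norm (N z - N x) \<le> C * norm (H z - H x)" using dom(2)[of z] small by (simp add: m_def)
    ultimately have 1: "norm (N z - N x) \<le> \<bar>C\<bar> * (k * (t * norm u))" by linarith
    have "norm (N z - N x - DN (z - x)) \<le> k * (t * norm u)" using d1(2)[of z] small zx by (simp add: m_def)
    then have "norm (DN (z - x)) \<le> \<bar>C\<bar> * (k * (t * norm u)) + k * (t * norm u)"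
      using 1 norm_triangle_ineq4[of "N z - N x" "N z - N x - DN (z - x)"] by simp
    also have "\<dots> = t * (k * ((1 + \<bar>C\<bar>) * norm u))" by (simp add: algebra_simps)
    also have "k * ((1 + \<bar>C\<bar>) * norm u) = e" using u0 abs_ge_zero[of C] by (simp add: k_def)
    finally have "t * norm (DN u) \<le> t * e" using t by (simp add: z_def linear_scale[OF lin(1)])
    then show ?thesis using t by simp
  qed
  then have "norm (DN u) \<le> 0" by (rule field_le_epsilon)
  then show ?thesis by simp
qed

section \<open>Closed immersions are proper\<close>

text \<open>If \<open>X\<close> has no convergent subsequence, every compact set contains only finitely many of its members. The members
  are moved slightly to points \<open>Y i\<close> with \<open>f (Y i) \<noteq> y\<close>, so that \<open>f (Y i)\<close> still tends to \<open>y\<close>. The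
  range of \<open>Y\<close> remains closed, but its image does not contain the limit \<open>y\<close>.\<close>

lemma closed_map_proper_sequences:
  fixes M :: "'m::{t2_space,second_countable_topology} set" and f :: "'m \<Rightarrow> real^3"
  assumes cl: "closed_map (top_of_set M) euclidean f" and cf: "continuous_on M f"
    and loc: "\<And>x. x \<in> M \<Longrightarrow> \<exists>K U. compact K \<and> K \<subseteq> M \<and> openin (top_of_set M) U \<and> x \<in> U \<and> U \<subseteq> K"
    and nonconst: "\<And>x U y. openin (top_of_set M) U \<Longrightarrow> x \<in> U \<Longrightarrow> \<exists>z\<in>U. f z \<noteq> y"
    and X: "\<And>i::nat. X i \<in> M" and fX: "(\<lambda>i. f (X i)) \<longlonglongrightarrow> y"
  shows "\<exists>l\<in>M. \<exists>r. strict_mono r \<and> (X \<circ> r) \<longlonglongrightarrow> l"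
proof (rule ccontr)
  assume no: "\<not> ?thesis"
  define \<F> where "\<F> = {U. openin (top_of_set M) U \<and> (\<exists>K. compact K \<and> K \<subseteq> M \<and> U \<subseteq> K)}"
  obtain \<F>' where \<F>': "\<F>' \<subseteq> \<F>" "countable \<F>'" "\<Union>\<F>' = \<Union>\<F>"
    by (rule Lindelof_openin[of \<F> M]) (simp only: \<F>_def mem_Collect_eq)
  have cover: "M \<subseteq> \<Union>\<F>'"
  proof
    fix x assume "x \<in> M"
    from loc[OF this] obtain K U where KU: "compact K" "K \<subseteq> M" "openin (top_of_set M) U" "x \<in> U" "U \<subseteq> K"
      by (elim exE conjE)
    then have "U \<in> \<F>" unfolding \<F>_def by blast
    then show "x \<in> \<Union>\<F>'" unfolding \<F>'(3) using KU(4) by (rule UnionI)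
  qed
  have "\<F>' \<noteq> {}" using cover X[of 0] by auto
  then obtain G where G: "range (G :: nat \<Rightarrow> 'm set) = \<F>'" using \<F>'(2) by (metis range_from_nat_into)
  have "\<exists>K. compact K \<and> K \<subseteq> M \<and> G j \<subseteq> K" for j
  proof -
    have "G j \<in> \<F>" using G \<F>'(1) by blast
    then show ?thesis by (simp add: \<F>_def)
  qed
  then obtain K where K: "\<And>j. compact (K j)" "\<And>j. K j \<subseteq> M" "\<And>j. G j \<subseteq> K j" by metis
  have oG: "openin (top_of_set M) (G j)" for j
  proof -
    have "G j \<in> \<F>" using G \<F>'(1) by blast
    then show ?thesis by (simp add: \<F>_def)
  qed
  have fin: "finite {i. X i \<in> K j}" for j
  proof (rule ccontr)
    assume "infinite {i. X i \<in> K j}"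
    then obtain r :: "nat \<Rightarrow> nat" where r: "strict_mono r" "\<And>n. r n \<in> {i. X i \<in> K j}"
      using infinite_enumerate by blast
    have "\<forall>n. (X \<circ> r) n \<in> K j" using r(2) by simp
    then obtain l r' where l: "l \<in> K j" "strict_mono (r' :: nat \<Rightarrow> nat)" "((X \<circ> r) \<circ> r') \<longlonglongrightarrow> l"
      by (rule seq_compactE[OF compact_imp_seq_compact[OF K(1)[of j]]])
    have "strict_mono (r \<circ> r')" using r(1) l(2) by (rule strict_mono_o)
    then have "\<exists>l\<in>M. \<exists>r. strict_mono r \<and> (X \<circ> r) \<longlonglongrightarrow> l"
      by (intro bexI[of _ l] exI[of _ "r \<circ> r'"] conjI) (use l(1,3) K(2)[of j] in \<open>simp_all only: comp_assoc subset_iff\<close>)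
    then show False using no by simp
  qed
  have "\<exists>z. z \<in> M \<and> f z \<noteq> y \<and> dist (f z) (f (X i)) < inverse (real (Suc i)) \<and>
      (\<forall>j<i. X i \<notin> K j \<longrightarrow> z \<notin> K j)" for i
  proof -
    define B where "B = \<Union>(K ` {j. j < i \<and> X i \<notin> K j})"
    have "closed B" unfolding B_def by (intro closed_UN) (auto intro: compact_imp_closed K(1))
    then have "openin (top_of_set M) (M \<inter> - B)" by (intro openin_open_Int open_Compl)
    moreover have "openin (top_of_set M) (M \<inter> f -` ball (f (X i)) (inverse (real (Suc i))))"
      by (rule continuous_openin_preimage_gen[OF cf open_ball])
    ultimately have "openin (top_of_set M) ((M \<inter> - B) \<inter> (M \<inter> f -` ball (f (X i)) (inverse (real (Suc i)))))"
      by (rule openin_Int)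
    moreover have "X i \<in> (M \<inter> - B) \<inter> (M \<inter> f -` ball (f (X i)) (inverse (real (Suc i))))"
      using X by (auto simp: B_def)
    ultimately obtain z where z: "z \<in> (M \<inter> - B) \<inter> (M \<inter> f -` ball (f (X i)) (inverse (real (Suc i))))" "f z \<noteq> y"
      using nonconst by blast
    then have "z \<in> M" "dist (f z) (f (X i)) < inverse (real (Suc i))" "z \<notin> B" by (auto simp: dist_commute)
    moreover have "\<forall>j<i. X i \<notin> K j \<longrightarrow> z \<notin> K j" using \<open>z \<notin> B\<close> unfolding B_def by blast
    ultimately show ?thesis using z(2) by blast
  qed
  then have "\<forall>i. \<exists>z. z \<in> M \<and> f z \<noteq> y \<and> dist (f z) (f (X i)) < inverse (real (Suc i)) \<and>
      (\<forall>j<i. X i \<notin> K j \<longrightarrow> z \<notin> K j)" by (rule allI)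
  from choice[OF this] obtain Y where "\<forall>i. Y i \<in> M \<and> f (Y i) \<noteq> y \<and> dist (f (Y i)) (f (X i)) < inverse (real (Suc i)) \<and>
      (\<forall>j<i. X i \<notin> K j \<longrightarrow> Y i \<notin> K j)" by (rule exE)
  then have Y: "\<And>i. Y i \<in> M" "\<And>i. f (Y i) \<noteq> y" "\<And>i. dist (f (Y i)) (f (X i)) < inverse (real (Suc i))"
    "\<And>i j. j < i \<Longrightarrow> X i \<notin> K j \<Longrightarrow> Y i \<notin> K j" for i j by blast+
  have finY: "finite {i. Y i \<in> K j}" for j
  proof (rule finite_subset)
    show "{i. Y i \<in> K j} \<subseteq> {..j} \<union> {i. X i \<in> K j}" using Y(4) by (force simp: not_le)
    show "finite ({..j} \<union> {i. X i \<in> K j})" using fin by simp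
  qed
  have "closedin (top_of_set M) (range Y)"
  proof -
    have "x \<in> range Y" if xM: "x \<in> M" and xc: "x \<in> closure (range Y)" for x
    proof -
      obtain Z where Z: "\<forall>i. Z i \<in> range Y" "Z \<longlonglongrightarrow> x" using xc[unfolded closure_sequential] by blast
      obtain j where j: "x \<in> G j" using cover xM G by blast
      have ZM: "Z i \<in> M" for i using Z(1)[rule_format, of i] Y(1) by auto
      have fT: "finite (Y ` {i. Y i \<in> K j})" using finY by simp
      have "\<forall>\<^sub>F i in sequentially. Z i \<in> G j" by (rule eventually_in_openin[OF oG j ZM Z(2)])
      then have "\<forall>\<^sub>F i in sequentially. Z i \<in> Y ` {i. Y i \<in> K j}"
      proof (rule eventually_mono)
        fix i assume i: "Z i \<in> G j"
        obtain k where k: "Z i = Y k" using Z(1)[rule_format, of i] by blast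
        then have "Y k \<in> K j" using i K(3)[of j] by (simp only: subset_iff)
        then show "Z i \<in> Y ` {i. Y i \<in> K j}" using k by blast
      qed
      then have "x \<in> Y ` {i. Y i \<in> K j}"
        using Lim_in_closed_set[OF finite_imp_closed[OF fT] _ sequentially_bot Z(2)] by blast
      then show ?thesis by blast
    qed
    then have "M \<inter> closure (range Y) = range Y" using Y(1) closure_subset[of "range Y"] by auto
    then show ?thesis using closedin_closed_Int[OF closed_closure, of M "range Y"] by simp
  qed
  then have "closed (f ` range Y)" using cl unfolding closed_map_def by simp
  moreover have "(\<lambda>i. f (Y i)) \<longlonglongrightarrow> y"
  proof -
    have "(\<lambda>i. dist (f (Y i)) (f (X i))) \<longlonglongrightarrow> 0"
      by (rule tendsto_sandwich[OF _ _ tendsto_const LIMSEQ_inverse_real_of_nat])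
        (auto intro!: always_eventually less_imp_le[OF Y(3)] simp del: of_nat_Suc)
    then have "(\<lambda>i. f (Y i) - f (X i)) \<longlonglongrightarrow> 0" by (simp add: dist_norm tendsto_norm_zero_iff)
    from tendsto_add[OF this fX] show ?thesis by simp
  qed
  ultimately have "y \<in> f ` range Y" using closed_sequentially[of "f ` range Y" "\<lambda>i. f (Y i)" y] by blast
  then show False using Y(2) by auto
qed

section \<open>Charts of an abstract surface\<close>

lemma surface_chartD:
  assumes "smooth_surface M A" "(V, \<psi>) \<in> A"
  shows "open V" "openin (top_of_set M) (\<psi> ` V)" "\<exists>g. homeomorphism V (\<psi> ` V) \<psi> g" "continuous_on V \<psi>"
    "inj_on \<psi> V" "\<And>x. x \<in> V \<Longrightarrow> \<psi> x \<in> M"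
    "\<And>U. open U \<Longrightarrow> U \<subseteq> V \<Longrightarrow> openin (top_of_set M) (\<psi> ` U)"
proof -
  show V: "open V" and op: "openin (top_of_set M) (\<psi> ` V)" and ex: "\<exists>g. homeomorphism V (\<psi> ` V) \<psi> g"
    using assms unfolding smooth_surface_def by auto
  obtain g where g: "homeomorphism V (\<psi> ` V) \<psi> g" using ex by blast
  show "continuous_on V \<psi>" by (rule homeomorphism_cont1[OF g])
  show "inj_on \<psi> V" by (rule inj_on_inverseI) (rule homeomorphism_apply1[OF g])
  show "\<And>x. x \<in> V \<Longrightarrow> \<psi> x \<in> M" using openin_imp_subset[OF op] by blast
  show "openin (top_of_set M) (\<psi> ` U)" if "open U" "U \<subseteq> V" for U
  proof -
    have "openin (top_of_set V) U" using that openin_open_eq[OF V] by blast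
    from homeomorphism_imp_open_map[OF g this] show ?thesis using op by (rule openin_trans)
  qed
qed

lemma surface_chart_at:
  assumes "smooth_surface M A" "p \<in> M"
  obtains V \<psi> x where "(V, \<psi>) \<in> A" "x \<in> V" "\<psi> x = p"
proof -
  have "M = (\<Union>(V, \<psi>)\<in>A. \<psi> ` V)" using assms(1) unfolding smooth_surface_def by (elim conjE)
  then have "p \<in> (\<Union>(V, \<psi>)\<in>A. \<psi> ` V)" using assms(2) by blast
  then obtain c where "c \<in> A" "p \<in> (case c of (V, \<psi>) \<Rightarrow> \<psi> ` V)" by (rule UN_E)
  then show ?thesis by (cases c) (auto intro: that)
qed

lemma smooth_on_derivative:
  assumes "smooth_on V F" "x \<in> V"
  shows "(F has_derivative frechet_derivative F (at x)) (at x)"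
proof -
  have "Ck_on (Suc 0) V F" using assms(1) unfolding smooth_on_def by blast
  from Ck_on_SucD(1)[OF this assms(2)] show ?thesis .
qed

lemma immersion_chart:
  assumes "immersion A f" "(V, \<psi>) \<in> A"
  shows "smooth_on V (f \<circ> \<psi>)" "\<And>x. x \<in> V \<Longrightarrow> inj (frechet_derivative (f \<circ> \<psi>) (at x))"
    "\<And>x. x \<in> V \<Longrightarrow> (f \<circ> \<psi> has_derivative frechet_derivative (f \<circ> \<psi>) (at x)) (at x)"
proof -
  show s: "smooth_on V (f \<circ> \<psi>)" using assms unfolding immersion_def smooth_map_def by auto
  show "\<And>x. x \<in> V \<Longrightarrow> inj (frechet_derivative (f \<circ> \<psi>) (at x))" using assms unfolding immersion_def by auto
  show "\<And>x. x \<in> V \<Longrightarrow> (f \<circ> \<psi> has_derivative frechet_derivative (f \<circ> \<psi>) (at x)) (at x)"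
    by (rule smooth_on_derivative[OF s])
qed

lemma in_tangent_plane:
  assumes "(V, \<psi>) \<in> A" "x \<in> V"
  shows "frechet_derivative (f \<circ> \<psi>) (at x) u \<in> tangent_plane A f (\<psi> x)"
  using assms unfolding tangent_plane_def by blast

text \<open>Up to the sign, a unit normal is the normalised cross product of the partial derivatives; the sign is locally constant
  by continuity.\<close>

lemma normal_smooth:
  fixes F N :: "real^2 \<Rightarrow> real^3"
  assumes V: "open V" "x0 \<in> V" and F: "smooth_on V F" and inj: "\<And>x. x \<in> V \<Longrightarrow> inj (frechet_derivative F (at x))"
    and N: "continuous_on V N" "\<And>x. x \<in> V \<Longrightarrow> norm (N x) = 1"
    "\<And>x u. x \<in> V \<Longrightarrow> N x \<bullet> frechet_derivative F (at x) u = 0"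
  shows "\<exists>r>0. ball x0 r \<subseteq> V \<and> (\<forall>k. Ck_on k (ball x0 r) N)"
proof -
  define a where "a x = frechet_derivative F (at x) (axis 1 1)" for x
  define b where "b x = frechet_derivative F (at x) (axis 2 1)" for x
  define m where "m x = a x \<times> b x" for x
  have Fk: "Ck_on (Suc k) V F" for k using F unfolding smooth_on_def by blast
  have ab: "Ck_on k V a" "Ck_on k V b" for k
    unfolding a_def[abs_def] b_def[abs_def] using Ck_on_SucD(2)[OF Fk] by auto
  have mk: "Ck_on k V m" for k
    unfolding m_def[abs_def] by (rule Ck_on_bilinear[OF V(1) bounded_bilinear_cross ab])
  have lin: "linear (frechet_derivative F (at x))" if "x \<in> V" for x
    using has_derivative_linear[OF smooth_on_derivative[OF F that]] .
  have perp: "N x \<bullet> a x = 0" "N x \<bullet> b x = 0" if "x \<in> V" for x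
    using N(3)[OF that] by (auto simp: a_def b_def)
  have m0: "m x \<noteq> 0" if x: "x \<in> V" for x
  proof
    assume "m x = 0"
    then have "collinear {0, a x, b x}" by (simp add: m_def cross_eq_0)
    moreover have a0: "a x \<noteq> 0"
      using linear_injective_0[OF lin[OF x]] inj[OF x] unfolding a_def by (metis axis_eq_0_iff zero_neq_one)
    ultimately obtain c where "b x = c *\<^sub>R a x" by (auto simp: collinear_lemma)
    then have "frechet_derivative F (at x) (axis 2 1 - c *\<^sub>R axis 1 1) = 0"
      by (simp add: linear_diff[OF lin[OF x]] linear_scale[OF lin[OF x]] a_def b_def)
    then have "axis 2 1 - c *\<^sub>R axis 1 1 = (0 :: real^2)" using linear_injective_0[OF lin[OF x]] inj[OF x] by blast
    then have "(axis 2 1 - c *\<^sub>R axis 1 1 :: real^2) $ 2 = 0" by (simp only: zero_index)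
    then show False by (simp add: axis_def)
  qed
  define q where "q x = inverse (norm (m x)) *\<^sub>R m x" for x
  have qk: "Ck_on k V q" for k unfolding q_def[abs_def]
    by (rule Ck_on_bilinear[OF V(1) bounded_bilinear_scaleR Ck_on_inverse_norm[OF V(1) m0 mk] mk])
  define \<sigma> where "\<sigma> x = N x \<bullet> q x" for x
  have Nq: "N x = \<sigma> x *\<^sub>R q x \<and> (\<sigma> x = 1 \<or> \<sigma> x = -1)" if x: "x \<in> V" for x
  proof -
    have NN: "N x \<bullet> N x = 1" using N(2)[OF x] by (simp add: dot_square_norm)
    have "N x \<times> m x = 0" unfolding m_def using perp[OF x] by (simp add: Lagrange)
    then have "collinear {0, N x, m x}" by (simp add: cross_eq_0)
    moreover have "N x \<noteq> 0" using N(2)[OF x] by auto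
    ultimately obtain c where c: "m x = c *\<^sub>R N x" using m0[OF x] by (auto simp: collinear_lemma)
    have c0: "c \<noteq> 0" using c m0[OF x] by auto
    have "q x = (c / \<bar>c\<bar>) *\<^sub>R N x" using N(2)[OF x] by (simp add: q_def c divide_inverse mult.commute)
    then have "q x = N x \<or> q x = - N x" using c0 by (cases "c > 0") auto
    then show ?thesis using NN by (auto simp: \<sigma>_def)
  qed
  have "continuous_on V \<sigma>" unfolding \<sigma>_def[abs_def]
    by (intro continuous_intros N(1) Ck_on_continuous[OF qk[of 0]])
  then have "open (V \<inter> \<sigma> -` ball (\<sigma> x0) 1)" by (rule continuous_open_preimage[OF _ V(1) open_ball])
  moreover have "x0 \<in> V \<inter> \<sigma> -` ball (\<sigma> x0) 1" using V(2) by simp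
  ultimately obtain r where r: "0 < r" "ball x0 r \<subseteq> V \<inter> \<sigma> -` ball (\<sigma> x0) 1" using open_contains_ball by blast
  have "\<sigma> x0 *\<^sub>R q x = N x" if "x \<in> ball x0 r" for x
  proof -
    have "x \<in> V" "dist (\<sigma> x0) (\<sigma> x) < 1" using r(2) that by auto
    then have "\<sigma> x = \<sigma> x0" using Nq[of x] Nq[OF V(2)] by (auto simp: dist_real_def)
    then show ?thesis using Nq[OF \<open>x \<in> V\<close>] by simp
  qed
  moreover have "Ck_on k (ball x0 r) (\<lambda>x. \<sigma> x0 *\<^sub>R q x)" for k
  proof (rule Ck_on_bilinear[OF open_ball bounded_bilinear_scaleR Ck_on_const])
    have sub: "Ck_on k S g \<Longrightarrow> T \<subseteq> S \<Longrightarrow> Ck_on k T g" for k S T and g :: "real^2 \<Rightarrow> real^3"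
      by (induction k arbitrary: g) (auto intro: continuous_on_subset)
    show "Ck_on k (ball x0 r) q" by (rule sub[OF qk]) (use r(2) in auto)
  qed
  ultimately have "Ck_on k (ball x0 r) N" for k by (metis Ck_on_cong[OF open_ball])
  moreover have "ball x0 r \<subseteq> V" using r(2) by blast
  ultimately show ?thesis using r(1) by (intro exI[of _ r]) simp
qed

section \<open>The normal of the unit sphere\<close>

lemma chart_neighbourhood:
  fixes S :: "(real^3) set"
  assumes S: "smooth_surface S A" "(V, \<psi>) \<in> A" and x0: "x0 \<in> V" "0 < d"
  shows "\<exists>\<delta>>0. \<forall>y\<in>S. norm (y - \<psi> x0) < \<delta> \<longrightarrow> (\<exists>x\<in>V. norm (x - x0) < d \<and> y = \<psi> x)"
proof -
  note cd = surface_chartD[OF S]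
  have "openin (top_of_set S) (\<psi> ` (V \<inter> ball x0 d))" by (rule cd(7)) (use cd(1) in auto)
  moreover have "\<psi> x0 \<in> \<psi> ` (V \<inter> ball x0 d)" using x0 by auto
  ultimately obtain e where e: "0 < e" "ball (\<psi> x0) e \<inter> S \<subseteq> \<psi> ` (V \<inter> ball x0 d)"
    unfolding openin_contains_ball by blast
  have "\<exists>x\<in>V. norm (x - x0) < d \<and> y = \<psi> x" if y: "y \<in> S" "norm (y - \<psi> x0) < e" for y
  proof -
    have "y \<in> ball (\<psi> x0) e" using y(2) by (simp add: dist_norm norm_minus_commute)
    then have "y \<in> \<psi> ` (V \<inter> ball x0 d)" using e(2) y(1) by blast
    then obtain x where "x \<in> V" "dist x0 x < d" "y = \<psi> x" by auto
    then show ?thesis by (intro bexI[of _ x]) (simp_all add: dist_norm norm_minus_commute)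
  qed
  then show ?thesis using e(1) by blast
qed

lemma embedded_surface_tangency:
  fixes S :: "(real^3) set"
  assumes S: "smooth_surface S A" "immersion A (\<lambda>x. x)" "euclidean_gauss_map S A (\<lambda>x. x) n"
    and y0: "y0 \<in> S" and \<epsilon>: "0 < \<epsilon>"
  shows "\<exists>\<delta>>0. \<forall>y\<in>S. norm (y - y0) < \<delta> \<longrightarrow> \<bar>n y0 \<bullet> (y - y0)\<bar> \<le> \<epsilon> * norm (y - y0)"
proof -
  obtain V \<psi> x0 where c: "(V, \<psi>) \<in> A" "x0 \<in> V" "\<psi> x0 = y0" by (rule surface_chart_at[OF S(1) y0])
  have id: "(\<lambda>x. x) \<circ> \<psi> = \<psi>" by (simp add: comp_def)
  note im = immersion_chart[OF S(2) c(1), unfolded id]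
  have "n y0 \<bullet> frechet_derivative \<psi> (at x0) u = 0" for u
    using S(3) y0 in_tangent_plane[OF c(1,2), of "\<lambda>x. x" u] c(3) unfolding euclidean_gauss_map_def id by auto
  from tangency_at[OF im(3)[OF c(2)] im(2)[OF c(2)] this \<epsilon>]
  obtain d where d: "0 < d" "\<And>x. norm (x - x0) < d \<Longrightarrow> \<bar>n y0 \<bullet> (\<psi> x - y0)\<bar> \<le> \<epsilon> * norm (\<psi> x - y0)"
    unfolding c(3) by blast
  from chart_neighbourhood[OF S(1) c(1,2) d(1)] show ?thesis unfolding c(3) using d(2) by blast
qed

text \<open>In a chart the normal is differentiable, and the inverse of the chart is Lipschitz at
  the point because the inclusion is an immersion.\<close>

lemma gauss_map_lipschitz_at:
  fixes S :: "(real^3) set"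
  assumes S: "smooth_surface S A" "immersion A (\<lambda>x. x)" "euclidean_gauss_map S A (\<lambda>x. x) n"
    and y0: "y0 \<in> S"
  shows "\<exists>C>0. \<exists>\<delta>>0. \<forall>y\<in>S. norm (y - y0) < \<delta> \<longrightarrow> norm (n y - n y0) \<le> C * norm (y - y0)"
proof -
  obtain V \<psi> x0 where c: "(V, \<psi>) \<in> A" "x0 \<in> V" "\<psi> x0 = y0" by (rule surface_chart_at[OF S(1) y0])
  have id: "(\<lambda>x. x) \<circ> \<psi> = \<psi>" by (simp add: comp_def)
  note im = immersion_chart[OF S(2) c(1), unfolded id]
  have "smooth_on V (n \<circ> \<psi>)" using S(3) c(1) unfolding euclidean_gauss_map_def smooth_map_def by blast
  from derivative_upper_bound[OF smooth_on_derivative[OF this c(2)]]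
  obtain B d1 where B: "0 < B" "0 < d1" "\<And>x. norm (x - x0) < d1 \<Longrightarrow> norm (n (\<psi> x) - n y0) \<le> B * norm (x - x0)"
    unfolding comp_def c(3) by blast
  from derivative_lower_bound[OF im(3)[OF c(2)] im(2)[OF c(2)]]
  obtain b d2 where b: "0 < b" "0 < d2" "\<And>x. norm (x - x0) < d2 \<Longrightarrow> b * norm (x - x0) \<le> norm (\<psi> x - y0)"
    unfolding c(3) by blast
  have "0 < min d1 d2" using B b by simp
  from chart_neighbourhood[OF S(1) c(1,2) this]
  obtain \<delta> where \<delta>: "0 < \<delta>" "\<And>y. y \<in> S \<Longrightarrow> norm (y - y0) < \<delta> \<Longrightarrow> \<exists>x\<in>V. norm (x - x0) < min d1 d2 \<and> y = \<psi> x"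
    unfolding c(3) by blast
  have "norm (n y - n y0) \<le> B / b * norm (y - y0)" if y: "y \<in> S" "norm (y - y0) < \<delta>" for y
  proof -
    obtain x where x: "norm (x - x0) < min d1 d2" "y = \<psi> x" using \<delta>(2)[OF y] by blast
    then have "norm (n y - n y0) \<le> B * norm (x - x0)" "b * norm (x - x0) \<le> norm (y - y0)" using B(3) b(3) by auto
    moreover have "norm (x - x0) \<le> norm (y - y0) / b" using calculation(2) b(1) by (simp add: field_simps)
    ultimately show ?thesis using mult_left_mono[of "norm (x - x0)" "norm (y - y0) / b" B] B(1) by simp
  qed
  then show ?thesis using \<delta>(1) B(1) b(1) by (intro exI[of _ "B / b"] conjI exI[of _ \<delta>]) auto
qed

text \<open>Move from \<open>y0\<close> by \<open>t w\<close> and rescale to the sphere. By orthogonality the norm \<open>\<phi>\<close> of \<open>y0 + t w\<close> is at least \<open>1\<close>, and it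
  exceeds \<open>1\<close> at most by a multiple of \<open>t\<close>. The displacement from \<open>y0\<close> on the sphere, times \<open>\<phi>\<close>, is
  \<open>(1 - \<phi>) y0 + t w\<close>; its normal component is small relative to \<open>t\<close>. With the right sign of \<open>t\<close>
  the contributions of \<open>y0\<close> and \<open>w\<close> to it do not cancel, so the one of \<open>w\<close> is small on its own.\<close>

lemma birkhoff_orthogonal_perp_gauss_map:
  assumes N: "is_norm N"
    and S: "smooth_surface (unit_sphere N) A" "immersion A (\<lambda>x. x)" "euclidean_gauss_map (unit_sphere N) A (\<lambda>x. x) n"
    and y0: "y0 \<in> unit_sphere N" and P: "birkhoff_orthogonal N y0 P" "w \<in> P"
  shows "n y0 \<bullet> w = 0"
proof -
  have N0: "0 \<le> N x" and Ns: "N (c *\<^sub>R x) = \<bar>c\<bar> * N x" and Nt: "N (x + y) \<le> N x + N y" for x y c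
    using N unfolding is_norm_def by auto
  have N1: "N y0 = 1" using y0 by (simp add: unit_sphere_def)
  define R where "R = N w * norm y0 + norm w"
  have R: "0 \<le> R" using N0 by (simp add: R_def)
  define \<alpha> where "\<alpha> = n y0 \<bullet> y0"
  define \<beta> where "\<beta> = n y0 \<bullet> w"
  have "\<bar>\<beta>\<bar> \<le> 0 + e" if e: "0 < e" for e
  proof -
    define \<epsilon> where "\<epsilon> = e / (R + 1)"
    have \<epsilon>: "0 < \<epsilon>" using e R by (simp add: \<epsilon>_def)
    obtain \<delta> where \<delta>: "0 < \<delta>" "\<And>y. y \<in> unit_sphere N \<Longrightarrow> norm (y - y0) < \<delta> \<Longrightarrow> \<bar>n y0 \<bullet> (y - y0)\<bar> \<le> \<epsilon> * norm (y - y0)"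
      using embedded_surface_tangency[OF S y0 \<epsilon>] by blast
    define s where "s = \<delta> / (R + 1)"
    have s: "0 < s" using \<delta>(1) R by (simp add: s_def)
    \<comment> \<open>as \<open>1 - \<phi> \<le> 0\<close>, this sign makes \<open>(1 - \<phi>) \<alpha>\<close> and \<open>t \<beta>\<close> have the same sign\<close>
    define t where "t = (if 0 \<le> \<alpha> * \<beta> then - s else s)"
    have ts: "\<bar>t\<bar> = s" using s by (simp add: t_def)
    define \<phi> where "\<phi> = N (y0 + t *\<^sub>R w)"
    have \<phi>1: "1 \<le> \<phi>" using P N1 unfolding birkhoff_orthogonal_def \<phi>_def by force
    have \<phi>2: "\<phi> \<le> 1 + s * N w" using Nt[of y0 "t *\<^sub>R w"] Ns[of t w] N1 ts by (simp add: \<phi>_def)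
    define y where "y = (1 / \<phi>) *\<^sub>R (y0 + t *\<^sub>R w)"
    have yS: "y \<in> unit_sphere N" using \<phi>1 Ns[of "1 / \<phi>" "y0 + t *\<^sub>R w"] by (simp add: unit_sphere_def y_def \<phi>_def[symmetric])
    have disp: "\<phi> *\<^sub>R (y - y0) = (1 - \<phi>) *\<^sub>R y0 + t *\<^sub>R w"
      using \<phi>1 by (simp add: y_def algebra_simps)
    have nd: "\<phi> * norm (y - y0) \<le> s * R"
    proof -
      have "\<phi> * norm (y - y0) = norm ((1 - \<phi>) *\<^sub>R y0 + t *\<^sub>R w)" using \<phi>1 by (simp add: disp[symmetric])
      also have "\<dots> \<le> (\<phi> - 1) * norm y0 + s * norm w"
        using norm_triangle_ineq[of "(1 - \<phi>) *\<^sub>R y0" "t *\<^sub>R w"] \<phi>1 ts by simp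
      also have "\<dots> \<le> (s * N w) * norm y0 + s * norm w"
        using \<phi>2 by (intro add_right_mono mult_right_mono) auto
      finally show ?thesis by (simp add: R_def algebra_simps)
    qed
    have "norm (y - y0) \<le> \<phi> * norm (y - y0)" using \<phi>1 mult_right_mono[of 1 \<phi> "norm (y - y0)"] by simp
    moreover have "s * R < \<delta>" using \<delta>(1) R by (simp add: s_def field_simps)
    ultimately have "\<bar>n y0 \<bullet> (y - y0)\<bar> \<le> \<epsilon> * norm (y - y0)" using nd by (intro \<delta>(2)[OF yS]) linarith
    then have "\<phi> * \<bar>n y0 \<bullet> (y - y0)\<bar> \<le> \<phi> * (\<epsilon> * norm (y - y0))" using \<phi>1 by (intro mult_left_mono) auto
    also have "\<dots> = \<epsilon> * (\<phi> * norm (y - y0))" by simp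
    also have "\<dots> \<le> \<epsilon> * (s * R)" using nd \<epsilon> by (intro mult_left_mono) auto
    also have "\<phi> * \<bar>n y0 \<bullet> (y - y0)\<bar> = \<bar>n y0 \<bullet> (\<phi> *\<^sub>R (y - y0))\<bar>" using \<phi>1 by (simp add: abs_mult)
    also have "n y0 \<bullet> (\<phi> *\<^sub>R (y - y0)) = (1 - \<phi>) * \<alpha> + t * \<beta>"
      unfolding disp by (simp add: inner_add_right \<alpha>_def \<beta>_def)
    finally have up: "\<bar>(1 - \<phi>) * \<alpha> + t * \<beta>\<bar> \<le> \<epsilon> * (s * R)" .
    have "0 \<le> ((1 - \<phi>) * \<alpha>) * (t * \<beta>)"
    proof -
      have "t * (\<alpha> * \<beta>) \<le> 0" using s by (auto simp: t_def mult_le_0_iff zero_le_mult_iff)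
      then have "0 \<le> (1 - \<phi>) * (t * (\<alpha> * \<beta>))" using \<phi>1 by (simp add: zero_le_mult_iff)
      then show ?thesis by (simp add: mult_ac)
    qed
    then have "\<bar>t * \<beta>\<bar> \<le> \<bar>(1 - \<phi>) * \<alpha> + t * \<beta>\<bar>" by (auto simp: zero_le_mult_iff)
    then have "s * \<bar>\<beta>\<bar> \<le> s * (\<epsilon> * R)" using up ts by (simp add: abs_mult mult_ac)
    then have "\<bar>\<beta>\<bar> \<le> \<epsilon> * R" using s by simp
    also have "\<dots> \<le> e" using e R by (simp add: \<epsilon>_def field_simps)
    finally show ?thesis by simp
  qed
  then have "\<bar>\<beta>\<bar> \<le> 0" by (rule field_le_epsilon)
  then show ?thesis by (simp add: \<beta>_def)
qed

text \<open>A map into the surface satisfies the tangency estimate at \<open>H x\<close>, whence the normal component of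
  its derivative is zero.\<close>

lemma derivative_into_surface:
  fixes S :: "(real^3) set" and H :: "real^2 \<Rightarrow> real^3"
  assumes S: "smooth_surface S A" "immersion A (\<lambda>x. x)" "euclidean_gauss_map S A (\<lambda>x. x) n"
    and H: "(H has_derivative DH) (at x)" "open V" "x \<in> V" "\<And>z. z \<in> V \<Longrightarrow> H z \<in> S"
  shows "n (H x) \<bullet> DH u = 0"
proof -
  have "((\<lambda>z. n (H x) \<bullet> H z) has_derivative (\<lambda>u. 0)) (at x)"
    unfolding has_derivative_at_alt
  proof (intro conjI allI impI)
    fix e :: real assume e: "0 < e"
    obtain C d1 where C: "0 < C" "0 < d1" "\<And>z. norm (z - x) < d1 \<Longrightarrow> norm (H z - H x) \<le> C * norm (z - x)"
      using derivative_upper_bound[OF H(1)] by blast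
    have "0 < e / C" using e C(1) by simp
    from embedded_surface_tangency[OF S H(4)[OF H(3)] this]
    obtain \<delta> where \<delta>: "0 < \<delta>" "\<And>y. y \<in> S \<Longrightarrow> norm (y - H x) < \<delta> \<Longrightarrow> \<bar>n (H x) \<bullet> (y - H x)\<bar> \<le> e / C * norm (y - H x)"
      by blast
    obtain d2 where d2: "0 < d2" "ball x d2 \<subseteq> V" using H(2,3) open_contains_ball by blast
    define d where "d = min (\<delta> / C) (min d1 d2)"
    have "0 < d" using \<delta> C d2 by (simp add: d_def)
    moreover have "norm (n (H x) \<bullet> H z - n (H x) \<bullet> H x - 0) \<le> e * norm (z - x)" if z: "norm (z - x) < d" for z
    proof -
      have "z \<in> V" using d2(2) z by (auto simp: d_def dist_norm norm_minus_commute)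
      have up: "norm (H z - H x) \<le> C * norm (z - x)" using C(3) z by (simp add: d_def)
      also have "\<dots> < \<delta>" using z C(1) by (simp add: d_def field_simps)
      finally have "\<bar>n (H x) \<bullet> (H z - H x)\<bar> \<le> e / C * norm (H z - H x)" by (rule \<delta>(2)[OF H(4)[OF \<open>z \<in> V\<close>]])
      also have "\<dots> \<le> e / C * (C * norm (z - x))" using up e C(1) by (intro mult_left_mono) auto
      also have "\<dots> = e * norm (z - x)" using C(1) by simp
      finally show ?thesis by (simp add: inner_diff_right)
    qed
    ultimately show "\<exists>d>0. \<forall>z. norm (z - x) < d \<longrightarrow> norm (n (H x) \<bullet> H z - n (H x) \<bullet> H x - 0) \<le> e * norm (z - x)"
      by blast
  qed simp
  moreover have "((\<lambda>z. n (H x) \<bullet> H z) has_derivative (\<lambda>u. n (H x) \<bullet> DH u)) (at x)"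
    by (rule has_derivative_inner_right[OF H(1)])
  ultimately have "(\<lambda>u. n (H x) \<bullet> DH u) = (\<lambda>u. 0)" by (rule has_derivative_unique[rotated])
  then show ?thesis by (rule fun_cong)
qed

section \<open>Vanishing Minkowski curvature\<close>

text \<open>\<open>T\<close> is the derivative of the coordinate change; the chain rule is applied to \<open>g \<circ> \<psi> = (g \<circ> \<psi>') \<circ> \<tau>\<close>.
  That \<open>T\<close> does not depend on \<open>g\<close> makes the differential of one map with respect to another
  well defined.\<close>

lemma chart_transition:
  assumes M: "smooth_surface M A" and c: "(V, \<psi>) \<in> A" "x \<in> V" and c': "(V', \<psi>') \<in> A" "x' \<in> V'"
    and eq: "\<psi> x = \<psi>' x'"
  shows "\<exists>T. \<forall>g. smooth_map A g \<longrightarrow>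
    (\<forall>u. frechet_derivative (g \<circ> \<psi>) (at x) u = frechet_derivative (g \<circ> \<psi>') (at x') (T u))"
proof -
  note cd = surface_chartD[OF M c(1)] and cd' = surface_chartD[OF M c'(1)]
  define D where "D = V \<inter> \<psi> -` (\<psi>' ` V')"
  define \<tau> where "\<tau> = inv_into V' \<psi>' \<circ> \<psi>"
  obtain Q where Q: "open Q" "\<psi>' ` V' = M \<inter> Q" using cd'(2) unfolding openin_open by blast
  have "D = V \<inter> \<psi> -` Q" using cd(6) by (auto simp: D_def Q(2))
  then have oD: "open D" using continuous_open_preimage[OF cd(4,1) Q(1)] by simp
  have xD: "x \<in> D" using c(2) c'(2) eq by (auto simp: D_def)
  have sm: "smooth_on D \<tau>"
    using M c(1) c'(1) unfolding smooth_surface_def D_def \<tau>_def by fast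
  note d\<tau> = smooth_on_derivative[OF sm xD]
  have inv: "\<psi>' (\<tau> y) = \<psi> y" if "y \<in> D" for y
    using f_inv_into_f[of "\<psi> y" \<psi>' V'] that by (simp add: D_def \<tau>_def)
  have \<tau>x: "\<tau> x = x'" by (simp add: \<tau>_def eq inv_into_f_f[OF cd'(5) c'(2)])
  have "frechet_derivative (g \<circ> \<psi>) (at x) u = frechet_derivative (g \<circ> \<psi>') (at x') (frechet_derivative \<tau> (at x) u)"
    if g: "smooth_map A g" for g u
  proof -
    have "smooth_on V (g \<circ> \<psi>)" "smooth_on V' (g \<circ> \<psi>')" using g c(1) c'(1) unfolding smooth_map_def by auto
    note dg = smooth_on_derivative[OF this(1) c(2)] smooth_on_derivative[OF this(2) c'(2)]
    have "((\<lambda>y. (g \<circ> \<psi>') (\<tau> y)) has_derivative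
        (\<lambda>u. frechet_derivative (g \<circ> \<psi>') (at x') (frechet_derivative \<tau> (at x) u))) (at x)"
      by (rule has_derivative_compose[OF d\<tau>]) (use dg(2) in \<open>simp only: \<tau>x\<close>)
    then have "(g \<circ> \<psi> has_derivative
        (\<lambda>u. frechet_derivative (g \<circ> \<psi>') (at x') (frechet_derivative \<tau> (at x) u))) (at x)"
      by (rule has_derivative_transform_within_open[OF _ oD xD]) (simp add: inv)
    from has_derivative_unique[OF dg(1) this] show ?thesis by (rule fun_cong)
  qed
  then show ?thesis by blast
qed

lemma tangent_plane_chart:
  assumes M: "smooth_surface M A" "immersion A f" and c: "(V, \<psi>) \<in> A" "x \<in> V"
  shows "tangent_plane A f (\<psi> x) = range (frechet_derivative (f \<circ> \<psi>) (at x))"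
proof
  have f: "smooth_map A f" using M(2) unfolding immersion_def by blast
  show "tangent_plane A f (\<psi> x) \<subseteq> range (frechet_derivative (f \<circ> \<psi>) (at x))"
  proof
    fix w assume "w \<in> tangent_plane A f (\<psi> x)"
    then obtain V' \<psi>' x' u where c': "(V', \<psi>') \<in> A" "x' \<in> V'" "\<psi>' x' = \<psi> x"
      and w: "w = frechet_derivative (f \<circ> \<psi>') (at x') u" unfolding tangent_plane_def by blast
    obtain T where "\<And>u. frechet_derivative (f \<circ> \<psi>') (at x') u = frechet_derivative (f \<circ> \<psi>) (at x) (T u)"
      using chart_transition[OF M(1) c'(1,2) c c'(3)] f by blast
    then show "w \<in> range (frechet_derivative (f \<circ> \<psi>) (at x))" by (simp add: w)
  qed
  show "range (frechet_derivative (f \<circ> \<psi>) (at x)) \<subseteq> tangent_plane A f (\<psi> x)"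
    using in_tangent_plane[OF c] by blast
qed

lemma surface_differential_chart:
  assumes M: "smooth_surface M A" "immersion A f" and \<nu>: "smooth_map A \<nu>" and c: "(V, \<psi>) \<in> A" "x \<in> V"
  shows "surface_differential A f \<nu> (\<psi> x) (frechet_derivative (f \<circ> \<psi>) (at x) u) = frechet_derivative (\<nu> \<circ> \<psi>) (at x) u"
  unfolding surface_differential_def
proof (rule the_equality)
  show "\<exists>V' \<psi>' x' u'. (V', \<psi>') \<in> A \<and> x' \<in> V' \<and> \<psi>' x' = \<psi> x \<and>
      frechet_derivative (f \<circ> \<psi>) (at x) u = frechet_derivative (f \<circ> \<psi>') (at x') u' \<and>
      frechet_derivative (\<nu> \<circ> \<psi>) (at x) u = frechet_derivative (\<nu> \<circ> \<psi>') (at x') u'"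
    using c by blast
next
  fix z
  assume "\<exists>V' \<psi>' x' u'. (V', \<psi>') \<in> A \<and> x' \<in> V' \<and> \<psi>' x' = \<psi> x \<and>
      frechet_derivative (f \<circ> \<psi>) (at x) u = frechet_derivative (f \<circ> \<psi>') (at x') u' \<and>
      z = frechet_derivative (\<nu> \<circ> \<psi>') (at x') u'"
  then obtain V' \<psi>' x' u' where c': "(V', \<psi>') \<in> A" "x' \<in> V'" "\<psi>' x' = \<psi> x"
    and w: "frechet_derivative (f \<circ> \<psi>) (at x) u = frechet_derivative (f \<circ> \<psi>') (at x') u'"
    and z: "z = frechet_derivative (\<nu> \<circ> \<psi>') (at x') u'" by blast
  have f: "smooth_map A f" using M(2) unfolding immersion_def by blast
  obtain T where T: "\<And>g u. smooth_map A g \<Longrightarrow>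
      frechet_derivative (g \<circ> \<psi>) (at x) u = frechet_derivative (g \<circ> \<psi>') (at x') (T u)"
    using chart_transition[OF M(1) c c'(1,2) c'(3)[symmetric]] by blast
  have "T u = u'" using w unfolding T[OF f] by (rule injD[OF immersion_chart(2)[OF M(2) c'(1,2)]])
  then show "z = frechet_derivative (\<nu> \<circ> \<psi>) (at x) u" unfolding z T[OF \<nu>] by simp
qed

text \<open>The derivative of \<open>\<eta>\<close> takes values orthogonal to \<open>\<nu>\<close>, hence in the tangent plane. So in the chart the differential of \<open>\<eta>\<close>
  is an endomorphism of the plane, and its determinant is the curvature.\<close>

lemma kernel_if_zero_curvature:
  assumes M: "smooth_surface M A" "immersion A f" and \<eta>: "smooth_map A \<eta>" and c: "(V, \<psi>) \<in> A" "x \<in> V"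
    and n1: "norm \<nu> = 1" and perp: "\<And>u. \<nu> \<bullet> frechet_derivative (f \<circ> \<psi>) (at x) u = 0"
    "\<And>u. \<nu> \<bullet> frechet_derivative (\<eta> \<circ> \<psi>) (at x) u = 0"
    and K: "minkowski_gauss_curvature A f \<eta> (\<psi> x) = 0"
  shows "\<exists>u. u \<noteq> 0 \<and> frechet_derivative (\<eta> \<circ> \<psi>) (at x) u = 0"
proof -
  define L where "L = frechet_derivative (f \<circ> \<psi>) (at x)"
  define E where "E = frechet_derivative (\<eta> \<circ> \<psi>) (at x)"
  have "smooth_on V (\<eta> \<circ> \<psi>)" using \<eta> c(1) unfolding smooth_map_def by auto
  then have linE: "linear E" unfolding E_def using smooth_on_derivative c(2) has_derivative_linear by blast
  have linL: "linear L" unfolding L_def by (rule has_derivative_linear[OF immersion_chart(3)[OF M(2) c]])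
  have injL: "inj L" unfolding L_def by (rule immersion_chart(2)[OF M(2) c])
  obtain g where g: "linear g" "g \<circ> L = id" using linear_injective_left_inverse[OF linL injL] by blast
  have gL: "g (L u) = u" for u using fun_cong[OF g(2), of u] by simp
  have lin: "linear (g \<circ> E)" by (rule linear_compose[OF linE g(1)])
  have LgE: "L (g (E u)) = E u" for u
  proof -
    obtain v where "E u = L v"
      using normal_space(2)[OF linL injL n1 perp(1)[folded L_def] perp(2)[folded E_def]] by blast
    then show ?thesis by (simp add: gL)
  qed
  have "surface_differential A f \<eta> (\<psi> x) (L u) = L (matrix (g \<circ> E) *v u)" for u
  proof -
    have "surface_differential A f \<eta> (\<psi> x) (L u) = E u"
      unfolding L_def E_def by (rule surface_differential_chart[OF M \<eta> c])
    moreover have "matrix (g \<circ> E) *v u = g (E u)" using matrix_vector_mul(2)[OF lin] by (metis comp_apply)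
    ultimately show ?thesis by (simp add: LgE)
  qed
  from plane_det_eq[OF linL injL this]
  have "det (matrix (g \<circ> E)) = 0"
    using K unfolding minkowski_gauss_curvature_def tangent_plane_chart[OF M c] L_def by (simp add: comp_def)
  then have "\<not> inj (g \<circ> E)" using det_nz_iff_inj[OF lin] by blast
  then obtain u where u: "u \<noteq> 0" "g (E u) = 0" using linear_injective_0[OF lin] by auto
  have "E u = 0" using LgE[of u] u(2) linear_0[OF linL] by simp
  then show ?thesis using u(1) unfolding E_def by blast
qed

lemma smooth_map_continuous:
  assumes M: "smooth_surface M A" and g: "smooth_map A g"
  shows "continuous_on M g"
proof (rule continuous_on_if_locally)
  fix p assume "p \<in> M"
  then obtain V \<psi> x where c: "(V, \<psi>) \<in> A" "x \<in> V" "\<psi> x = p" by (rule surface_chart_at[OF M])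
  note cd = surface_chartD[OF M c(1)]
  obtain h where h: "homeomorphism V (\<psi> ` V) \<psi> h" using cd(3) by blast
  have "smooth_on V (g \<circ> \<psi>)" using g c(1) unfolding smooth_map_def by auto
  then have "Ck_on 0 V (g \<circ> \<psi>)" unfolding smooth_on_def by blast
  then have "continuous_on V (g \<circ> \<psi>)" by (simp only: Ck_on.simps)
  then have "continuous_on (\<psi> ` V) (\<lambda>y. (g \<circ> \<psi>) (h y))"
    by (intro continuous_on_compose2[OF _ homeomorphism_cont2[OF h]]) (use homeomorphism_image2[OF h] in auto)
  then have "continuous_on (\<psi> ` V) g"
    by (rule continuous_on_eq) (simp add: homeomorphism_apply2[OF h])
  then show "\<exists>T. openin (top_of_set M) T \<and> p \<in> T \<and> continuous_on T g" using cd(2) c(2,3) by blast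
qed

lemma closed_immersion_proper:
  assumes M: "smooth_surface M A" "immersion A f" and cl: "topologically_closed M f"
    and X: "\<And>i::nat. X i \<in> M" "(\<lambda>i. f (X i)) \<longlonglongrightarrow> y"
  shows "\<exists>l\<in>M. \<exists>r. strict_mono r \<and> (X \<circ> r) \<longlonglongrightarrow> l"
proof (rule closed_map_proper_sequences[OF cl[unfolded topologically_closed_def] _ _ _ X])
  show "continuous_on M f" using smooth_map_continuous[OF M(1)] M(2) unfolding immersion_def by blast
next
  fix p assume "p \<in> M"
  then obtain V \<psi> x where c: "(V, \<psi>) \<in> A" "x \<in> V" "\<psi> x = p" by (rule surface_chart_at[OF M(1)])
  note cd = surface_chartD[OF M(1) c(1)]
  obtain r where r: "0 < r" "cball x r \<subseteq> V" using cd(1) c(2) open_contains_cball by blast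
  have "compact (\<psi> ` cball x r)"
    by (rule compact_continuous_image[OF continuous_on_subset[OF cd(4) r(2)] compact_cball])
  moreover have "\<psi> ` cball x r \<subseteq> M" using cd(6) r(2) by blast
  moreover have "openin (top_of_set M) (\<psi> ` ball x r)"
    by (rule cd(7)[OF open_ball]) (use r(2) ball_subset_cball in blast)
  moreover have "p \<in> \<psi> ` ball x r" using c(3) r(1) by (intro image_eqI[of _ _ x]) auto
  moreover have "\<psi> ` ball x r \<subseteq> \<psi> ` cball x r" using ball_subset_cball by blast
  ultimately show "\<exists>K U. compact K \<and> K \<subseteq> M \<and> openin (top_of_set M) U \<and> p \<in> U \<and> U \<subseteq> K" by blast
next
  fix p U y assume U: "openin (top_of_set M) U" "p \<in> U"
  show "\<exists>z\<in>U. f z \<noteq> y"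
  proof (rule ccontr)
    assume "\<not> ?thesis"
    then have const: "f z = y" if "z \<in> U" for z using that by blast
    have "p \<in> M" using U openin_imp_subset by blast
    then obtain V \<psi> x where c: "(V, \<psi>) \<in> A" "x \<in> V" "\<psi> x = p" by (rule surface_chart_at[OF M(1)])
    note cd = surface_chartD[OF M(1) c(1)]
    obtain Q where Q: "open Q" "U = M \<inter> Q" using U(1) unfolding openin_open by blast
    have oQ: "open (V \<inter> \<psi> -` Q)" by (rule continuous_open_preimage[OF cd(4,1) Q(1)])
    have xQ: "x \<in> V \<inter> \<psi> -` Q" using c U(2) Q(2) by auto
    have "(f \<circ> \<psi> has_derivative (\<lambda>h. 0)) (at x)"
    proof (rule has_derivative_transform_within_open[OF has_derivative_const oQ xQ])
      show "y = (f \<circ> \<psi>) z" if "z \<in> V \<inter> \<psi> -` Q" for z using const[of "\<psi> z"] cd(6) that Q(2) by auto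
    qed
    from has_derivative_unique[OF immersion_chart(3)[OF M(2) c(1,2)] this]
    have "inj (\<lambda>h :: real^2. 0 :: real^3)" using immersion_chart(2)[OF M(2) c(1,2)] by simp
    from injD[OF this, of "axis 1 1" 0] show False by (simp add: axis_eq_0_iff)
  qed
qed

section \<open>Surfaces of vanishing Minkowski curvature\<close>

text \<open>The field \<open>nB \<circ> \<eta>\<close> is a unit normal of \<open>M\<close> by \<open>birkhoff_orthogonal_perp_gauss_map\<close>. Its smoothness is read off
  from the immersion by \<open>normal_smooth\<close>, after the chart has been restricted to a ball. A
  kernel vector of the derivative of \<open>\<eta>\<close> lies in the kernel of the derivative of \<open>nB \<circ> \<eta>\<close>, since \<open>nB\<close> is
  Lipschitz at each point.\<close>

lemma flat_chart_of_birkhoff_gauss_map: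
  assumes N: "is_norm N"
    and S: "smooth_surface (unit_sphere N) A'" "immersion A' (\<lambda>x. x)"
      "euclidean_gauss_map (unit_sphere N) A' (\<lambda>x. x) nB"
    and M: "smooth_surface M A" "immersion A f" and \<eta>: "birkhoff_gauss_map N M A f \<eta>"
    and K: "\<And>p. p \<in> M \<Longrightarrow> minkowski_gauss_curvature A f \<eta> p = 0" and p: "p \<in> M"
  shows "\<exists>V \<psi> F' N' x. flat_chart M f (\<lambda>q. nB (\<eta> q)) V \<psi> F' N' \<and> x \<in> V \<and> \<psi> x = p"
proof -
  have \<eta>s: "smooth_map A \<eta>" and \<eta>S: "\<And>q. q \<in> M \<Longrightarrow> \<eta> q \<in> unit_sphere N"
    and \<eta>b: "\<And>q. q \<in> M \<Longrightarrow> birkhoff_orthogonal N (\<eta> q) (tangent_plane A f q)"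
    using \<eta> unfolding birkhoff_gauss_map_def by auto
  have nB1: "norm (nB y) = 1" if "y \<in> unit_sphere N" for y using S(3) that unfolding euclidean_gauss_map_def by blast
  obtain V \<psi> x0 where c: "(V, \<psi>) \<in> A" "x0 \<in> V" "\<psi> x0 = p" by (rule surface_chart_at[OF M(1) p])
  note cd = surface_chartD[OF M(1) c(1)] and im = immersion_chart[OF M(2) c(1)]
  define H where "H = \<eta> \<circ> \<psi>"
  have Hs: "smooth_on V H" using \<eta>s c(1) unfolding smooth_map_def H_def by auto
  have HS: "H x \<in> unit_sphere N" if "x \<in> V" for x using \<eta>S[OF cd(6)[OF that]] by (simp add: H_def)
  have perpF: "nB (H x) \<bullet> frechet_derivative (f \<circ> \<psi>) (at x) u = 0" if x: "x \<in> V" for x u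
    using birkhoff_orthogonal_perp_gauss_map[OF N S \<eta>S[OF cd(6)[OF x]] \<eta>b[OF cd(6)[OF x]] in_tangent_plane[OF c(1) x]]
    by (simp add: H_def)
  have contB: "continuous_on (unit_sphere N) nB"
    by (rule smooth_map_continuous[OF S(1)]) (use S(3) in \<open>simp add: euclidean_gauss_map_def\<close>)
  have "continuous_on V H" using Hs unfolding smooth_on_def by (metis Ck_on.simps(1))
  then have contN: "continuous_on V (\<lambda>x. nB (H x))"
    by (rule continuous_on_compose2[OF contB]) (use HS in auto)
  obtain r where r: "0 < r" "ball x0 r \<subseteq> V" "\<And>k. Ck_on k (ball x0 r) (\<lambda>x. nB (H x))"
    using normal_smooth[OF cd(1) c(2) im(1,2) contN nB1[OF HS] perpF] by blast
  have "Ck_on (Suc 0) V (f \<circ> \<psi>)" using im(1) unfolding smooth_on_def by blast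
  then obtain F' where F': "\<And>x. x \<in> V \<Longrightarrow> (f \<circ> \<psi> has_derivative blinfun_apply (F' x)) (at x)" "continuous_on V F'"
    "\<And>x. x \<in> V \<Longrightarrow> blinfun_apply (F' x) = frechet_derivative (f \<circ> \<psi>) (at x)" using frechet_blinfun by metis
  obtain N' where N': "\<And>x. x \<in> ball x0 r \<Longrightarrow> ((\<lambda>x. nB (H x)) has_derivative blinfun_apply (N' x)) (at x)"
    "continuous_on (ball x0 r) N'"
    "\<And>x. x \<in> ball x0 r \<Longrightarrow> blinfun_apply (N' x) = frechet_derivative (\<lambda>x. nB (H x)) (at x)"
    using frechet_blinfun[OF r(3)[of "Suc (Suc 0)"]] by metis
  have diff: "(\<lambda>x. N' x u) differentiable (at x)" if "x \<in> ball x0 r" for x u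
  proof -
    have "Ck_on (Suc 0) (ball x0 r) (\<lambda>x. frechet_derivative (\<lambda>x. nB (H x)) (at x) u)"
      by (rule Ck_on_SucD(2)[OF r(3)])
    then have "Ck_on (Suc 0) (ball x0 r) (\<lambda>x. N' x u)"
      by (rule Ck_on_cong[OF open_ball]) (simp add: N'(3))
    then show ?thesis using that by simp
  qed
  have ker: "\<exists>u. u \<noteq> 0 \<and> N' x u = 0" if x: "x \<in> ball x0 r" for x
  proof -
    have xV: "x \<in> V" using x r(2) by blast
    note dH = smooth_on_derivative[OF Hs xV]
    have perpH: "nB (H x) \<bullet> frechet_derivative (\<eta> \<circ> \<psi>) (at x) u = 0" for u
      unfolding H_def[symmetric] by (rule derivative_into_surface[OF S dH cd(1) xV HS])
    from kernel_if_zero_curvature[OF M \<eta>s c(1) xV nB1[OF HS[OF xV]] perpF[OF xV] perpH K[OF cd(6)[OF xV]]]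
    obtain u where u: "u \<noteq> 0" "frechet_derivative H (at x) u = 0" unfolding H_def by blast
    obtain C \<delta> where C: "0 < \<delta>" "\<And>y. y \<in> unit_sphere N \<Longrightarrow> norm (y - H x) < \<delta> \<Longrightarrow> norm (nB y - nB (H x)) \<le> C * norm (y - H x)"
      using gauss_map_lipschitz_at[OF S HS[OF xV]] by blast
    have "isCont H x" by (rule has_derivative_continuous[OF dH])
    then obtain d1 where d1: "0 < d1" "\<And>z. norm (z - x) < d1 \<Longrightarrow> norm (H z - H x) < \<delta>"
      using C(1) unfolding continuous_at_eps_delta dist_norm by blast
    obtain d2 where d2: "0 < d2" "ball x d2 \<subseteq> V" using cd(1) xV open_contains_ball by blast
    have dm: "0 < min d1 d2" using d1 d2 by simp
    have "N' x u = 0"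
    proof (rule kernel_of_dominated[OF N'(1)[OF x] dH dm _ u(2)])
      fix z assume z: "norm (z - x) < min d1 d2"
      then have "z \<in> V" using d2(2) by (auto simp: dist_norm norm_minus_commute)
      then show "norm (nB (H z) - nB (H x)) \<le> C * norm (H z - H x)" using z d1(2) by (intro C(2) HS) auto
    qed
    then show ?thesis using u(1) by blast
  qed
  obtain g where g: "homeomorphism V (\<psi> ` V) \<psi> g" using cd(3) by blast
  have gb: "homeomorphism (ball x0 r) (\<psi> ` ball x0 r) \<psi> g"
    by (rule homeomorphism_of_subsets[OF g r(2)]) (use r(2) in auto)
  have "flat_chart M f (\<lambda>q. nB (\<eta> q)) (ball x0 r) \<psi> F' N'"
    unfolding flat_chart_def
  proof (intro conjI ballI allI)
    show "open (ball x0 r)" by (rule open_ball)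
    show "openin (top_of_set M) (\<psi> ` ball x0 r)" by (rule cd(7)[OF open_ball r(2)])
    show "\<exists>g. homeomorphism (ball x0 r) (\<psi> ` ball x0 r) \<psi> g" using gb by blast
    show "continuous_on (ball x0 r) F'" by (rule continuous_on_subset[OF F'(2) r(2)])
    show "continuous_on (ball x0 r) N'" by (rule N'(2))
    fix x assume x: "x \<in> ball x0 r"
    then have xV: "x \<in> V" using r(2) by blast
    show "((\<lambda>x. f (\<psi> x)) has_derivative blinfun_apply (F' x)) (at x)" using F'(1)[OF xV] by (simp add: comp_def)
    show "inj (blinfun_apply (F' x))" unfolding F'(3)[OF xV] by (rule im(2)[OF xV])
    show "((\<lambda>x. nB (\<eta> (\<psi> x))) has_derivative blinfun_apply (N' x)) (at x)"
      using N'(1)[OF x] by (simp add: H_def)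
    show "norm (nB (\<eta> (\<psi> x))) = 1" using nB1[OF HS[OF xV]] by (simp add: H_def)
    show "\<exists>u. u \<noteq> 0 \<and> blinfun_apply (N' x) u = 0" by (rule ker[OF x])
    show "(\<lambda>x. blinfun_apply (N' x) u) differentiable (at x)" for u by (rule diff[OF x])
    show "nB (\<eta> (\<psi> x)) \<bullet> blinfun_apply (F' x) u = 0" for u
      using perpF[OF xV, of u] unfolding F'(3)[OF xV] by (simp add: H_def)
  qed
  moreover have "x0 \<in> ball x0 r" using r(1) by simp
  ultimately show ?thesis using c(3) by blast
qed

theorem theorem3p3:
  fixes N :: "real^3 \<Rightarrow> real"
    and M :: "'m::{t2_space,second_countable_topology} set"
    and A :: "'m atlas"
    and f \<eta> :: "'m \<Rightarrow> real^3"
  assumes "admissible_norm N"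
    and "smooth_surface M A" and "connected M"
    and "immersion A f"
    and "topologically_closed M f"
    and "birkhoff_gauss_map N M A f \<eta>"
    and "\<forall>p\<in>M. minkowski_gauss_curvature A f \<eta> p = 0"
  shows "is_cylinder M f \<or> is_plane M f"
proof -
  obtain A' nB where N: "is_norm N"
    and S: "smooth_surface (unit_sphere N) A'" "immersion A' (\<lambda>x. x)"
      "euclidean_gauss_map (unit_sphere N) A' (\<lambda>x. x) nB"
    using assms(1) unfolding admissible_norm_def by blast
  interpret flat_surface M f "\<lambda>q. nB (\<eta> q)"
  proof
    show "\<exists>l\<in>M. \<exists>r. strict_mono r \<and> (X \<circ> r) \<longlonglongrightarrow> l" if "\<And>i::nat. X i \<in> M" "(\<lambda>i. f (X i)) \<longlonglongrightarrow> y" for X y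
      by (rule closed_immersion_proper[OF assms(2,4,5) that])
    show "\<exists>V \<psi> F' N' x. flat_chart M f (\<lambda>q. nB (\<eta> q)) V \<psi> F' N' \<and> x \<in> V \<and> \<psi> x = p" if "p \<in> M" for p
      by (rule flat_chart_of_birkhoff_gauss_map[OF N S assms(2,4,6) _ that]) (use assms(7) in blast)
  qed
  show ?thesis by (rule cylinder_or_plane[OF assms(3)])
qed

end
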